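(* The problem $[3,4]$-CH is $\Pi_2^p$-complete in the class of 3-colorable, odd hole-free, planar graphs of maximum degree $6$.
   Context: All graphs are finite and simple. A graph $G=(V,E)$ is $[\ell,k]$-choosable (with $k\ge \ell$) if for every assignment of lists $L(v)\subseteq\{1,\dots,k\}$ with $|L(v)|=\ell$ for all $v\in V$, there is a proper coloring $c$ of $G$ with $c(v)\in L(v)$ for all $v\in V$. $[\ell,k]$-CH is the decision problem: given a graph $G$, decide whether $G$ is $[\ell,k]$-choosable. An odd hole in a graph is an induced cycle $C_{2i+1}$ with $i\ge 2$; a graph is odd hole-free if it contains no odd hole. $\Pi_2^p$ is the usual class of the polynomial hierarchy; completeness is with respect to polynomial-time many-one reductions. *)

theory Defs
  imports "HOL-Analysis.Analysis" "HOL-Computational_Algebra.Polynomial"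
begin

section \<open>Finite simple graphs\<close>

text \<open>A graph is a pair of a vertex set and a set of two-element vertex sets (the edges).\<close>

type_synonym 'a graph = "'a set \<times> 'a set set"

abbreviation verts :: "'a graph \<Rightarrow> 'a set" where "verts \<equiv> fst"
abbreviation edges :: "'a graph \<Rightarrow> 'a set set" where "edges \<equiv> snd"

definition simple_graph :: "'a graph \<Rightarrow> bool" where
  "simple_graph G \<longleftrightarrow> finite (verts G) \<and> (\<forall>e\<in>edges G. e \<subseteq> verts G \<and> card e = 2)"

definition proper_coloring :: "'a graph \<Rightarrow> ('a \<Rightarrow> nat) \<Rightarrow> bool" where
  "proper_coloring G c \<longleftrightarrow> (\<forall>u\<in>verts G. \<forall>v\<in>verts G. {u, v} \<in> edges G \<longrightarrow> c u \<noteq> c v)"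

definition colorable :: "nat \<Rightarrow> 'a graph \<Rightarrow> bool" where
  "colorable k G \<longleftrightarrow> (\<exists>c. (\<forall>v\<in>verts G. c v \<in> {1..k}) \<and> proper_coloring G c)"

text \<open>\<open>choosable l k\<close> is $[l,k]$-choosability; it is meant for \<open>l \<le> k\<close>.\<close>

definition choosable :: "nat \<Rightarrow> nat \<Rightarrow> 'a graph \<Rightarrow> bool" where
  "choosable l k G \<longleftrightarrow>
     (\<forall>L :: 'a \<Rightarrow> nat set. (\<forall>v\<in>verts G. L v \<subseteq> {1..k} \<and> card (L v) = l) \<longrightarrow>
        (\<exists>c. (\<forall>v\<in>verts G. c v \<in> L v) \<and> proper_coloring G c))"

definition induced_cycle :: "'a graph \<Rightarrow> 'a list \<Rightarrow> bool" where
  "induced_cycle G vs \<longleftrightarrow>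
     length vs \<ge> 3 \<and> distinct vs \<and> set vs \<subseteq> verts G \<and>
     (\<forall>i<length vs. \<forall>j<length vs. {vs ! i, vs ! j} \<in> edges G \<longleftrightarrow>
        j = (i + 1) mod length vs \<or> i = (j + 1) mod length vs)"

definition odd_hole_free :: "'a graph \<Rightarrow> bool" where
  "odd_hole_free G \<longleftrightarrow> \<not> (\<exists>vs i. i \<ge> 2 \<and> length vs = 2 * i + 1 \<and> induced_cycle G vs)"

definition vertex_degree :: "'a graph \<Rightarrow> 'a \<Rightarrow> nat" where
  "vertex_degree G v = card {e \<in> edges G. v \<in> e}"

text \<open>The inserted 0 only matters for the graph without vertices.\<close>

definition max_degree :: "'a graph \<Rightarrow> nat" where
  "max_degree G = Max (insert 0 (vertex_degree G ` verts G))"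

text \<open>Planarity: there is a drawing in the plane in which vertices are distinct points, every
  edge is an arc joining its ends, arcs contain no vertices other than their ends, and two arcs
  meet only in common ends.\<close>

definition planar :: "'a graph \<Rightarrow> bool" where
  "planar G \<longleftrightarrow>
     (\<exists>(pos :: 'a \<Rightarrow> real \<times> real) (\<gamma> :: 'a set \<Rightarrow> real \<Rightarrow> real \<times> real).
        inj_on pos (verts G) \<and>
        (\<forall>e\<in>edges G. arc (\<gamma> e) \<and> {pathstart (\<gamma> e), pathfinish (\<gamma> e)} = pos ` e \<and>
           path_image (\<gamma> e) \<inter> pos ` verts G = pos ` e) \<and>
        (\<forall>e\<in>edges G. \<forall>e'\<in>edges G. e \<noteq> e' \<longrightarrow>
           path_image (\<gamma> e) \<inter> path_image (\<gamma> e') = pos ` (e \<inter> e')))"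

section \<open>Deterministic multi-tape Turing machines\<close>

datatype dir = MoveL | Stay | MoveR

fun move :: "dir \<Rightarrow> int \<Rightarrow> int" where
  "move MoveL h = h - 1"
| "move Stay h = h"
| "move MoveR h = h + 1"

text \<open>States and tape symbols are numbers. The working states are those below \<open>num_states\<close>;
  state 0 is initial and the state \<open>num_states\<close> is the halting state. The symbols are
  those below \<open>num_syms\<close>, where 0 is the blank and 1, 2 stand for the two bits.\<close>

record tm =
  num_tapes :: nat
  num_syms :: nat
  num_states :: nat
  delta :: "nat \<Rightarrow> nat list \<Rightarrow> nat \<times> (nat \<times> dir) list"

definition wf_tm :: "tm \<Rightarrow> bool" where
  "wf_tm M \<longleftrightarrow> num_tapes M \<ge> 1 \<and> num_syms M \<ge> 3 \<and>
     (\<forall>q<num_states M. \<forall>rs. length rs = num_tapes M \<and> (\<forall>r\<in>set rs. r < num_syms M) \<longrightarrow>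
        (case delta M q rs of (q', acts) \<Rightarrow>
           q' \<le> num_states M \<and> length acts = num_tapes M \<and>
           (\<forall>(w, d)\<in>set acts. w < num_syms M)))"

text \<open>A tape is infinite in both directions; a configuration consists of the state and, for
  each tape, the head position and the contents.\<close>

type_synonym tape = "int \<Rightarrow> nat"
type_synonym config = "nat \<times> (int \<times> tape) list"

definition tm_step :: "tm \<Rightarrow> config \<Rightarrow> config" where
  "tm_step M = (\<lambda>(q, ts).
     if q < num_states M then
       (case delta M q (map (\<lambda>(h, t). t h) ts) of (q', acts) \<Rightarrow>
          (q', map2 (\<lambda>(w, d) (h, t). (move d h, t(h := w))) acts ts))
     else (q, ts))"

definition tape_of :: "bool list \<Rightarrow> tape" where
  "tape_of x = (\<lambda>i. if 0 \<le> i \<and> nat i < length x then (if x ! nat i then 2 else 1) else 0)"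

definition init_config :: "tm \<Rightarrow> bool list \<Rightarrow> config" where
  "init_config M x = (0, (0, tape_of x) # replicate (num_tapes M - 1) (0, tape_of []))"

text \<open>The input is given on the first tape, the output is read off the last one.\<close>

definition computes_within :: "tm \<Rightarrow> bool list \<Rightarrow> bool list \<Rightarrow> nat \<Rightarrow> bool" where
  "computes_within M x y t \<longleftrightarrow>
     (case (tm_step M ^^ t) (init_config M x) of (q, ts) \<Rightarrow>
        q = num_states M \<and> snd (last ts) = tape_of y)"

section \<open>The class $\Pi_2^p$\<close>

definition polytime :: "(bool list \<Rightarrow> bool list) \<Rightarrow> bool" where
  "polytime f \<longleftrightarrow>
     (\<exists>M (p :: nat poly). wf_tm M \<and> (\<forall>x. computes_within M x (f x) (poly p (length x))))"

definition class_P :: "bool list set set" where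
  "class_P = {L. polytime (\<lambda>x. [x \<in> L])}"

definition pair :: "bool list \<Rightarrow> bool list \<Rightarrow> bool list" where
  "pair x y = concat (map (\<lambda>b. [b, b]) x) @ [False, True] @ y"

definition Pi2p :: "bool list set set" where
  "Pi2p = {L. \<exists>R\<in>class_P. \<exists>p :: nat poly. \<forall>x. x \<in> L \<longleftrightarrow>
     (\<forall>u. length u \<le> poly p (length x) \<longrightarrow>
        (\<exists>v. length v \<le> poly p (length x) \<and> pair x (pair u v) \<in> R))}"

text \<open>Completeness of the problem \<open>L\<close> with inputs restricted to \<open>C\<close>, as a promise problem:
  for membership only the inputs in \<open>C\<close> matter, and
  reductions have to produce inputs in \<open>C\<close>, for yes- and no-instances alike.\<close>

definition Pi2p_complete_in :: "bool list set \<Rightarrow> bool list set \<Rightarrow> bool" where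
  "Pi2p_complete_in C L \<longleftrightarrow>
     (\<exists>L'\<in>Pi2p. L' \<inter> C = L \<inter> C) \<and>
     (\<forall>A\<in>Pi2p. \<exists>f. polytime f \<and> (\<forall>x. f x \<in> C \<and> (x \<in> A \<longleftrightarrow> f x \<in> L)))"

section \<open>Graphs as inputs\<close>

text \<open>As inputs, graphs have vertices \<open>0, \<dots>, n - 1\<close> and are given by the rows of their
  adjacency matrix; the $n^2$ bits determine $n$.\<close>

definition encode :: "nat graph \<Rightarrow> bool list" where
  "encode G = (let n = card (verts G) in
     concat (map (\<lambda>i. map (\<lambda>j. {i, j} \<in> edges G) [0..<n]) [0..<n]))"

definition input_graphs :: "nat graph set" where
  "input_graphs = {G. simple_graph G \<and> (\<exists>n. verts G = {..<n})}"

definition graph_lang :: "(nat graph \<Rightarrow> bool) \<Rightarrow> bool list set" where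
  "graph_lang Q = encode ` {G \<in> input_graphs. Q G}"

definition CH :: "nat \<Rightarrow> nat \<Rightarrow> bool list set" where
  "CH l k = graph_lang (choosable l k)"

lemma encode_length: "length (encode G) = card (verts G) * card (verts G)"
  by (simp add: encode_def Let_def length_concat o_def sum_list_triv)

lemma encode_inj: "inj_on encode input_graphs"
proof (rule inj_onI)
  fix G H assume G: "G \<in> input_graphs" and H: "H \<in> input_graphs" and eq: "encode G = encode H"
  obtain n where n: "verts G = {..<n}" using G by (auto simp: input_graphs_def)
  obtain m where m: "verts H = {..<m}" using H by (auto simp: input_graphs_def)
  have "n * n = m * m"
    using encode_length[of G] encode_length[of H] eq n m by simp
  then have "n\<^sup>2 = m\<^sup>2" by (simp only: power2_eq_square)
  then have nm: "m = n" by simp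
  have "map (\<lambda>i. map (\<lambda>j. {i, j} \<in> edges G) [0..<n]) [0..<n]
      = map (\<lambda>i. map (\<lambda>j. {i, j} \<in> edges H) [0..<n]) [0..<n]"
  proof (rule concat_injective)
    show "concat (map (\<lambda>i. map (\<lambda>j. {i, j} \<in> edges G) [0..<n]) [0..<n])
        = concat (map (\<lambda>i. map (\<lambda>j. {i, j} \<in> edges H) [0..<n]) [0..<n])"
      using eq by (simp only: encode_def Let_def n m nm card_lessThan)
  qed (auto simp: set_zip)
  then have adj: "{i, j} \<in> edges G \<longleftrightarrow> {i, j} \<in> edges H" if "i < n" "j < n" for i j
    using that by simp
  have "e \<in> edges G \<longleftrightarrow> e \<in> edges H" for e
  proof -
    have "\<exists>i j. e = {i, j} \<and> i < n \<and> j < n" if "e \<in> edges G \<or> e \<in> edges H"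
    proof -
      have "e \<subseteq> verts G \<and> card e = 2 \<or> e \<subseteq> verts H \<and> card e = 2"
        using that G H unfolding input_graphs_def simple_graph_def by blast
      then have "e \<subseteq> {..<n}" "card e = 2" unfolding n m nm by blast+
      then obtain a b where "e = {a, b}" "{a, b} \<subseteq> {..<n}" by (metis card_2_iff)
      then show ?thesis by blast
    qed
    then show ?thesis using adj by blast
  qed
  then show "G = H" using n m nm by (simp add: prod_eq_iff set_eq_iff)
qed

end

(* Hardness: the computation of a verifier on the input and on both witnesses is written as a
   conjunctive normal form with arithmetically definable clauses, in which the bits of the first
   witness are universal variables. Placing one cell of gadgets for each pair of a clause and a
   literal on a grid makes the incidence graph planar with few occurrences of each variable. Choosing
   lists corresponds to choosing the universal variables: such a variable is a square of vertices with
   two admissible colours each, whose lists can block one of its literals at will, and a wire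
   transmits at most one bad colour of its source. A vertex with lists of size two is simulated by one
   with lists of size three and a helper of seven vertices that can forbid any one colour, but never
   two. All vertices are drawn on a lattice whose arcs change the parity, except for one arc in the
   triangle of each existential variable, which cannot be on a hole.
   Membership: a list of size three in four colours is given by its missing colour, so the first
   witness is a list of missing colours and the second a colouring. *)

theory Submission
  imports Defs
begin

section \<open>Exact running times of programs on unary registers\<close>

section \<open>Counter programs\<close>

text \<open>The two directions of the equivalence make opposite demands. If the quantified formula
  is false, one bad list assignment has to be exhibited; if it is true, every list assignment has to
  be defeated, also those that ignore the intended colour code. So no gadget may rely on a colour
  meaning a truth value. A true literal is rather one whose terminal avoids the bad colours of the
  wires that leave it. Since a wire has at most one bad colour, list sizes and occurrence numbers
  are dictated: a terminal with three colours escapes two wires, hence two occurrences of an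
  existential literal; a square with two colours per vertex can always save one of two opposite
  corners, but the lists decide which, hence one occurrence of a universal literal. Degree 6 arises
  as three network edges and three helper edges at a vertex with a list of size two. The positions
  in a cell are independent of the quantifier: a universal variable only exchanges the diagonal of a
  unit square for its fourth side.\<close>

datatype com = Skip | Inc nat | Dec nat | BitInc nat nat | Out nat | Seq com com | While nat com

type_synonym store = "(nat \<Rightarrow> nat) \<times> bool list"

definition bit_at :: "bool list \<Rightarrow> nat \<Rightarrow> bool" where
  "bit_at x k \<longleftrightarrow> k < length x \<and> x ! k"

text \<open>The costs are those of the compiled code: leaving a loop costs one test, a further round
  costs the test and the jump back. Hence \<open>comp_runs\<close> can identify the time with the
  number of executed instructions.\<close>

inductive runs :: "bool list \<Rightarrow> com \<Rightarrow> store \<Rightarrow> nat \<Rightarrow> store \<Rightarrow> bool" for x where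
  Skip: "runs x Skip s 0 s"
| Inc: "runs x (Inc r) (s, w) 1 (s(r := s r + 1), w)"
| Dec: "runs x (Dec r) (s, w) 1 (s(r := s r - 1), w)"
| BitInc: "runs x (BitInc r d) (s, w) 1 (if bit_at x (s r) then s(d := s d + 1) else s, w)"
| Out: "runs x (Out r) (s, w) 1 (s, w @ [s r \<noteq> 0])"
| Seq: "runs x c s t s' \<Longrightarrow> runs x c' s' t' s'' \<Longrightarrow> runs x (Seq c c') s (t + t') s''"
| WhileZ: "s r = 0 \<Longrightarrow> runs x (While r c) (s, w) 1 (s, w)"
| WhileS: "s r \<noteq> 0 \<Longrightarrow> runs x c (s, w) t s' \<Longrightarrow> runs x (While r c) s' t' s'' \<Longrightarrow>
    runs x (While r c) (s, w) (t + t' + 2) s''"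

lemma runs_eq: "runs x c s t s' \<Longrightarrow> t = t1 \<Longrightarrow> s' = s1 \<Longrightarrow> runs x c s t1 s1"
  by simp

lemma runs_drain: "\<exists>t. t = 3 * s r + 1 \<and> runs x (While r (Dec r)) (s, w) t (s(r := 0), w)"
proof (induction "s r" arbitrary: s)
  case 0
  then show ?case using WhileZ[of s r x "Dec r" w] by (auto simp: fun_upd_idem)
next
  case (Suc n)
  have "runs x (While r (Dec r)) (s(r := s r - 1), w) (3 * (s r - 1) + 1) (s(r := 0), w)"
    using Suc(1)[of "s(r := s r - 1)"] Suc(2) by auto
  from WhileS[OF _ Dec this] show ?case using Suc(2) by (auto intro: runs_eq)
qed

lemma runs_move:
  assumes "r \<noteq> d"
  shows "\<exists>t. t = 4 * s r + 1 \<and>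
    runs x (While r (Seq (Dec r) (Inc d))) (s, w) t (s(r := 0, d := s d + s r), w)"
  using assms
proof (induction "s r" arbitrary: s)
  case 0
  then show ?case using WhileZ[of s r x _ w] by (auto simp: fun_upd_idem)
next
  case (Suc n)
  let ?s = "s(r := s r - 1, d := s d + 1)"
  have *: "runs x (While r (Seq (Dec r) (Inc d))) (?s, w) (4 * (s r - 1) + 1) (?s(r := 0, d := ?s d + ?s r), w)"
    using Suc(1)[of ?s] Suc(2,3) by auto
  have **: "runs x (Seq (Dec r) (Inc d)) (s, w) 2 (?s, w)"
    by (rule runs_eq[OF Seq[OF Dec Inc]]) (use Suc(3) in auto)
  have "?s(r := 0, d := ?s d + ?s r) = s(r := 0, d := s d + s r)"
    using Suc(2,3) by (auto simp: fun_eq_iff)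
  with WhileS[OF _ ** *] show ?case using Suc(2) by (auto intro: runs_eq)
qed

lemma runs_monus:
  assumes "r \<noteq> d"
  shows "\<exists>t. t = 4 * s r + 1 \<and>
    runs x (While r (Seq (Dec r) (Dec d))) (s, w) t (s(r := 0, d := s d - s r), w)"
  using assms
proof (induction "s r" arbitrary: s)
  case 0
  then show ?case using WhileZ[of s r x _ w] by (auto simp: fun_upd_idem)
next
  case (Suc n)
  let ?s = "s(r := s r - 1, d := s d - 1)"
  have *: "runs x (While r (Seq (Dec r) (Dec d))) (?s, w) (4 * (s r - 1) + 1) (?s(r := 0, d := ?s d - ?s r), w)"
    using Suc(1)[of ?s] Suc(2,3) by auto
  have **: "runs x (Seq (Dec r) (Dec d)) (s, w) 2 (?s, w)"
    by (rule runs_eq[OF Seq[OF Dec Dec]]) (use Suc(3) in auto)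
  have "?s(r := 0, d := ?s d - ?s r) = s(r := 0, d := s d - s r)"
    using Suc(2,3) by (auto simp: fun_eq_iff)
  with WhileS[OF _ ** *] show ?case using Suc(2) by (auto intro: runs_eq)
qed

text \<open>Adding to two registers at once makes a non-destructive read possible: a register is
  emptied into a spare one, which then refills it together with the target.\<close>

lemma runs_unload:
  assumes "r \<noteq> d" "r \<noteq> e" "d \<noteq> e"
  shows "\<exists>t. t = 5 * s r + 1 \<and>
    runs x (While r (Seq (Dec r) (Seq (Inc d) (Inc e)))) (s, w) t (s(r := 0, d := s d + s r, e := s e + s r), w)"
  using assms
proof (induction "s r" arbitrary: s)
  case 0
  then show ?case using WhileZ[of s r x _ w] by (auto simp: fun_upd_idem)
next
  case (Suc n)
  let ?s = "s(r := s r - 1, d := s d + 1, e := s e + 1)"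
  have *: "runs x (While r (Seq (Dec r) (Seq (Inc d) (Inc e)))) (?s, w) (5 * (s r - 1) + 1)
      (?s(r := 0, d := ?s d + ?s r, e := ?s e + ?s r), w)"
    using Suc(1)[of ?s] Suc(2-) by auto
  have **: "runs x (Seq (Dec r) (Seq (Inc d) (Inc e))) (s, w) 3 (?s, w)"
    by (rule runs_eq[OF Seq[OF Dec Seq[OF Inc Inc]]]) (use Suc(3-) in auto)
  have "?s(r := 0, d := ?s d + ?s r, e := ?s e + ?s r) = s(r := 0, d := s d + s r, e := s e + s r)"
    using Suc(2-) by (auto simp: fun_eq_iff)
  with WhileS[OF _ ** *] show ?case using Suc(2) by (auto intro: runs_eq)
qed

section \<open>Polynomial-time evaluation of expressions with bounded sums\<close>

section \<open>Arithmetic expressions\<close>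

text \<open>Variables are de Bruijn indices; \<open>Sum a b\<close> binds the index of a bounded sum.\<close>

datatype expr = Const nat | Var nat | Plus expr expr | Minus expr expr | Sum expr expr | Bit expr

primrec eval :: "bool list \<Rightarrow> expr \<Rightarrow> (nat \<Rightarrow> nat) \<Rightarrow> nat" where
  "eval x (Const n) v = n"
| "eval x (Var k) v = v k"
| "eval x (Plus a b) v = eval x a v + eval x b v"
| "eval x (Minus a b) v = eval x a v - eval x b v"
| "eval x (Sum a b) v = (\<Sum>i<eval x a v. eval x b (case_nat i v))"
| "eval x (Bit a) v = of_bool (bit_at x (eval x a v))"

lemma poly_nat_mono: "a \<le> b \<Longrightarrow> poly p a \<le> poly p (b :: nat)"
  by (induction p) (auto intro!: mult_mono)

text \<open>Registers are unary, so time is governed by values. A bounded sum stays in the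
  polynomial range because both the number of its terms and each term are bounded, the index being
  below the bound of the first argument.\<close>

lemma eval_bound:
  "\<exists>q :: nat poly. \<forall>x v N. length x \<le> N \<and> (\<forall>k. v k \<le> N) \<longrightarrow> eval x e v \<le> poly q N"
proof (induction e)
  case (Const n)
  show ?case by (rule exI[of _ "[:n:]"]) simp
next
  case (Var k)
  show ?case by (rule exI[of _ "[:0, 1:]"]) simp
next
  case (Plus a b)
  then obtain p q :: "nat poly" where
    "\<And>x v N. length x \<le> N \<Longrightarrow> (\<And>k. v k \<le> N) \<Longrightarrow> eval x a v \<le> poly p N"
    "\<And>x v N. length x \<le> N \<Longrightarrow> (\<And>k. v k \<le> N) \<Longrightarrow> eval x b v \<le> poly q N" by meson
  then show ?case by (intro exI[of _ "p + q"]) (auto intro: add_mono)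
next
  case (Minus a b)
  then show ?case by simp (meson diff_le_self le_trans)
next
  case (Sum a b)
  then obtain p q :: "nat poly" where
    p: "\<And>x v N. length x \<le> N \<Longrightarrow> (\<And>k. v k \<le> N) \<Longrightarrow> eval x a v \<le> poly p N" and
    q: "\<And>x v N. length x \<le> N \<Longrightarrow> (\<And>k. v k \<le> N) \<Longrightarrow> eval x b v \<le> poly q N" by meson
  show ?case
  proof (intro exI[of _ "p * pcompose q ([:0, 1:] + p)"] allI impI, elim conjE)
    fix x v N assume *: "length (x :: bool list) \<le> N" "\<forall>k. (v :: nat \<Rightarrow> nat) k \<le> N"
    have "eval x (Sum a b) v \<le> (\<Sum>i<eval x a v. poly q (N + poly p N))"
      unfolding eval.simps
    proof (rule sum_mono)
      fix i assume "i \<in> {..<eval x a v}"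
      then have "i \<le> N + poly p N" using p[of x N v] * by fastforce
      then show "eval x b (case_nat i v) \<le> poly q (N + poly p N)"
        using * by (intro q) (auto split: nat.split intro: trans_le_add1)
    qed
    also have "\<dots> \<le> poly p N * poly q (N + poly p N)" using p[of x N v] * by simp
    finally show "eval x (Sum a b) v \<le> poly (p * pcompose q ([:0, 1:] + p)) N"
      by (simp add: poly_pcompose)
  qed
next
  case (Bit a)
  show ?case by (rule exI[of _ "[:1:]"]) simp
qed

text \<open>Stack discipline: variables live below \<open>d\<close>, the value is left in
  \<open>d\<close>, and all registers above are zero before and after. A sum counts down in
  \<open>d\<close>, keeps the index in \<open>d + 1\<close> and the accumulator in
  \<open>d + 2\<close>, and evaluates its terms in \<open>d + 3\<close>.\<close>

primrec compE :: "expr \<Rightarrow> (nat \<Rightarrow> nat) \<Rightarrow> nat \<Rightarrow> com" where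
  "compE (Const n) \<rho> d = (Seq (Inc d) ^^ n) Skip"
| "compE (Var k) \<rho> d = Seq (While (\<rho> k) (Seq (Dec (\<rho> k)) (Inc (Suc d))))
     (While (Suc d) (Seq (Dec (Suc d)) (Seq (Inc d) (Inc (\<rho> k)))))"
| "compE (Plus a b) \<rho> d = Seq (compE a \<rho> d) (Seq (compE b \<rho> (Suc d))
     (While (Suc d) (Seq (Dec (Suc d)) (Inc d))))"
| "compE (Minus a b) \<rho> d = Seq (compE a \<rho> d) (Seq (compE b \<rho> (Suc d))
     (While (Suc d) (Seq (Dec (Suc d)) (Dec d))))"
| "compE (Sum a b) \<rho> d = Seq (compE a \<rho> d)
     (Seq (While d (Seq (Dec d) (Seq (compE b (case_nat (d + 1) \<rho>) (d + 3))
        (Seq (While (d + 3) (Seq (Dec (d + 3)) (Inc (d + 2)))) (Inc (d + 1))))))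
     (Seq (While (d + 1) (Dec (d + 1))) (While (d + 2) (Seq (Dec (d + 2)) (Inc d)))))"
| "compE (Bit a) \<rho> d = Seq (compE a \<rho> d) (Seq (BitInc d (Suc d)) (Seq (While d (Dec d))
     (While (Suc d) (Seq (Dec (Suc d)) (Inc d)))))"

definition computesE :: "expr \<Rightarrow> nat poly \<Rightarrow> bool" where
  "computesE e p \<longleftrightarrow> (\<forall>x \<rho> d s w N. length x \<le> N \<and> (\<forall>k. s (\<rho> k) \<le> N) \<and> (\<forall>k. \<rho> k < d) \<and> (\<forall>r\<ge>d. s r = 0)
     \<longrightarrow> (\<exists>t\<le>poly p N. runs x (compE e \<rho> d) (s, w) t (s(d := eval x e (\<lambda>k. s (\<rho> k))), w)))"

lemma computesED:
  assumes "computesE e p" "length x \<le> N" "\<And>k. s (\<rho> k) \<le> N" "\<And>k. \<rho> k < d" "\<And>r. r \<ge> d \<Longrightarrow> s r = 0"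
  obtains t where "t \<le> poly p N" "runs x (compE e \<rho> d) (s, w) t (s(d := eval x e (\<lambda>k. s (\<rho> k))), w)"
  using assms unfolding computesE_def by (metis (no_types, lifting))

lemma runs_const:
  "runs x ((Seq (Inc d) ^^ n) Skip) (s, w) n (s(d := s d + n), w)"
proof (induction n arbitrary: s)
  case 0
  show ?case using Skip by simp
next
  case (Suc n)
  show ?case
    unfolding funpow.simps o_def by (rule runs_eq[OF Seq[OF Inc Suc.IH]]) auto
qed

text \<open>The start index \<open>i\<close> and the content of the accumulator are general, since
  the induction on the countdown register removes terms at the lower end of the sum. The index
  register is a variable of the body, so \<open>N\<close> has to bound all index values as
  well.\<close>

lemma computesE_Sum_loop:
  assumes q: "computesE b q" and x: "length x \<le> N" and V: "V = (\<lambda>k. s (\<rho> k))" and vN: "\<And>k. V k \<le> N"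
    and \<rho>: "\<And>k. \<rho> k < d" and m: "i + s d \<le> N" "s (d + 1) = i" "\<And>r. r \<ge> d + 3 \<Longrightarrow> s r = 0"
    and vb: "\<And>j. j < N \<Longrightarrow> eval x b (case_nat j V) \<le> B"
  defines "body \<equiv> Seq (Dec d) (Seq (compE b (case_nat (d + 1) \<rho>) (d + 3))
        (Seq (While (d + 3) (Seq (Dec (d + 3)) (Inc (d + 2)))) (Inc (d + 1))))"
  shows "\<exists>t. t \<le> s d * (poly q N + 4 * B + 10) + 1 \<and> runs x (While d body) (s, w) t
    (s(d := 0, d + 1 := i + s d, d + 2 := s (d + 2) + (\<Sum>j = i..<i + s d. eval x b (case_nat j V))), w)"
  using V m
proof (induction "s d" arbitrary: s i)
  case 0
  then show ?case using WhileZ[of s d x body w] by (auto simp: fun_upd_idem intro!: exI[of _ 1])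
next
  case (Suc n)
  let ?s1 = "s(d := s d - 1)"
  let ?v = "eval x b (case_nat i V)"
  have ev: "(\<lambda>k. ?s1 (case_nat (d + 1) \<rho> k)) = case_nat i V"
    using Suc.prems \<rho> by (auto simp: fun_eq_iff less_not_refl2 less_imp_neq split: nat.split)
  have "?s1 (case_nat (d + 1) \<rho> k) \<le> N" for k
    using vN Suc.hyps(2) Suc.prems by (subst fun_cong[OF ev]) (auto split: nat.split)
  moreover have "case_nat (d + 1) \<rho> k < d + 3" for k
    using \<rho> by (auto split: nat.split intro: trans_less_add1)
  moreover have "?s1 r = 0" if "d + 3 \<le> r" for r using that Suc.prems(4)[of r] by auto
  ultimately obtain t1 where t1: "t1 \<le> poly q N" "runs x (compE b (case_nat (d + 1) \<rho>) (d + 3)) (?s1, w) t1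
      (?s1(d + 3 := ?v), w)"
    using computesED[OF q x, of ?s1 "case_nat (d + 1) \<rho>" "d + 3" w] unfolding ev by blast
  let ?s2 = "?s1(d + 3 := ?v)"
  let ?s3 = "s(d := s d - 1, d + 2 := s (d + 2) + ?v)"
  have t2: "runs x (While (d + 3) (Seq (Dec (d + 3)) (Inc (d + 2)))) (?s2, w) (4 * ?v + 1) (?s3, w)"
    using runs_move[of "d + 3" "d + 2" ?s2 x w] Suc.prems(4)
    by (auto elim!: runs_eq simp: fun_eq_iff)
  let ?s4 = "?s3(d + 1 := i + 1)"
  have t3: "runs x (Inc (d + 1)) (?s3, w) 1 (?s4, w)"
    by (rule runs_eq[OF Inc]) (use Suc.prems in auto)
  have body: "runs x body (s, w) (1 + (t1 + (4 * ?v + 1 + 1))) (?s4, w)"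
    unfolding body_def by (rule Seq[OF Dec Seq[OF t1(2) Seq[OF t2 t3]]])
  have ne: "\<rho> k \<noteq> d" "\<rho> k \<noteq> d + 1" "\<rho> k \<noteq> d + 2" for k
    using \<rho>[of k] by auto
  have v4: "V = (\<lambda>k. ?s4 (\<rho> k))"
    unfolding Suc.prems(1) by (rule ext) (simp only: fun_upd_apply ne if_False)
  have h: "n = ?s4 d" "i + 1 + ?s4 d \<le> N" "?s4 (d + 1) = i + 1" "\<And>r. d + 3 \<le> r \<Longrightarrow> ?s4 r = 0"
    using Suc.hyps(2) Suc.prems by auto
  obtain t4 where t4: "t4 \<le> ?s4 d * (poly q N + 4 * B + 10) + 1"
    "runs x (While d body) (?s4, w) t4 (?s4(d := 0, d + 1 := i + 1 + ?s4 d, d + 2 := ?s4 (d + 2) +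
      (\<Sum>j = i + 1..<i + 1 + ?s4 d. eval x b (case_nat j V))), w)"
    using Suc.hyps(1)[OF h(1) v4 h(2-4)] by blast
  have "?v + (\<Sum>j = i + 1..<i + s d. eval x b (case_nat j V)) = (\<Sum>j = i..<i + s d. eval x b (case_nat j V))"
    using Suc.hyps(2) by (subst (2) sum.atLeast_Suc_lessThan) auto
  then have fin: "?s4(d := 0, d + 1 := i + 1 + ?s4 d, d + 2 := ?s4 (d + 2) +
      (\<Sum>j = i + 1..<i + 1 + ?s4 d. eval x b (case_nat j V)))
    = s(d := 0, d + 1 := i + s d, d + 2 := s (d + 2) + (\<Sum>j = i..<i + s d. eval x b (case_nat j V)))"
    using Suc.hyps(2) by (auto simp: fun_eq_iff)
  have "?v \<le> B" using vb[of i] Suc.prems(2) Suc.hyps(2) by simp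
  then have time: "(1 + (t1 + (4 * ?v + 1 + 1))) + t4 + 2 \<le> s d * (poly q N + 4 * B + 10) + 1"
    using t1(1) t4(1) Suc.hyps(2) by (cases "s d") auto
  show ?case
    using WhileS[OF _ body t4(2)] Suc.hyps(2) time unfolding fin by auto
qed

lemma computesE_exists: "\<exists>p. computesE e p"
proof (induction e)
  case (Const n)
  show ?case unfolding computesE_def
    by (rule exI[of _ "[:n:]"]) (auto intro!: exI[of _ n] runs_eq[OF runs_const])
next
  case (Var j)
  show ?case unfolding computesE_def
  proof (rule exI[of _ "[:2, 9:]"], intro allI impI, elim conjE)
    fix x and \<rho> s :: "nat \<Rightarrow> nat" and d N :: nat and w
    assume x: "length (x :: bool list) \<le> N" and sN: "\<forall>k. s (\<rho> k) \<le> N" and \<rho>: "\<forall>k. \<rho> k < d" and z: "\<forall>r\<ge>d. s r = (0 :: nat)"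
    have ne: "\<rho> j \<noteq> Suc d" "\<rho> j \<noteq> d" using \<rho>[rule_format, of j] by auto
    let ?s1 = "s(\<rho> j := 0, Suc d := s (\<rho> j))"
    have 1: "runs x (While (\<rho> j) (Seq (Dec (\<rho> j)) (Inc (Suc d)))) (s, w) (4 * s (\<rho> j) + 1) (?s1, w)"
      using runs_move[of "\<rho> j" "Suc d" s x w] ne z by auto
    have 2: "runs x (While (Suc d) (Seq (Dec (Suc d)) (Seq (Inc d) (Inc (\<rho> j))))) (?s1, w) (5 * s (\<rho> j) + 1)
        (s(d := s (\<rho> j)), w)"
      using runs_unload[of "Suc d" d "\<rho> j" ?s1 x w] ne z
      by (auto elim!: runs_eq simp: fun_eq_iff)
    show "\<exists>t\<le>poly [:2, 9:] N. runs x (compE (Var j) \<rho> d) (s, w) t (s(d := eval x (Var j) (\<lambda>k. s (\<rho> k))), w)"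
      using Seq[OF 1 2] sN[rule_format, of j]
      by (intro exI[of _ "Suc (Suc (9 * s (\<rho> j)))"]) auto
  qed
next
  case (Plus a b)
  then obtain p q where p: "computesE a p" and q: "computesE b q" by blast
  obtain e :: "nat poly" where e: "\<And>x v N. length x \<le> N \<Longrightarrow> (\<And>k. v k \<le> N) \<Longrightarrow> eval x b v \<le> poly e N"
    using eval_bound[of b] by meson
  show ?case unfolding computesE_def
  proof (rule exI[of _ "p + (q + ([:4:] * e + 1))"], intro allI impI, elim conjE)
    fix x and \<rho> s :: "nat \<Rightarrow> nat" and d N :: nat and w
    assume x: "length (x :: bool list) \<le> N" and sN: "\<forall>k. s (\<rho> k) \<le> N" and \<rho>: "\<forall>k. \<rho> k < d" and z: "\<forall>r\<ge>d. s r = (0 :: nat)"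
    let ?va = "eval x a (\<lambda>k. s (\<rho> k))" and ?vb = "eval x b (\<lambda>k. s (\<rho> k))"
    have ne: "\<rho> k \<noteq> d" "\<rho> k < Suc d" for k using \<rho>[rule_format, of k] by auto
    obtain t1 where 1: "t1 \<le> poly p N" "runs x (compE a \<rho> d) (s, w) t1 (s(d := ?va), w)"
      using computesED[OF p x, of s \<rho> d w] sN \<rho> z by auto
    obtain t2 where 2: "t2 \<le> poly q N" "runs x (compE b \<rho> (Suc d)) (s(d := ?va), w) t2 (s(d := ?va, Suc d := ?vb), w)"
      using computesED[OF q x, of "s(d := ?va)" \<rho> "Suc d" w] sN ne z by auto
    have 3: "runs x (While (Suc d) (Seq (Dec (Suc d)) (Inc d))) (s(d := ?va, Suc d := ?vb), w) (4 * ?vb + 1) (s(d := ?va + ?vb), w)"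
      using runs_move[of "Suc d" d "s(d := ?va, Suc d := ?vb)" x w] z by (auto elim!: runs_eq simp: fun_eq_iff)
    have "?vb \<le> poly e N" using e x sN by auto
    then show "\<exists>t\<le>poly (p + (q + ([:4:] * e + 1))) N. runs x (compE (Plus a b) \<rho> d) (s, w) t
        (s(d := eval x (Plus a b) (\<lambda>k. s (\<rho> k))), w)"
      using Seq[OF 1(2) Seq[OF 2(2) 3]] 1(1) 2(1) by (intro exI[of _ "t1 + (t2 + (4 * ?vb + 1))"]) auto
  qed
next
  case (Minus a b)
  then obtain p q where p: "computesE a p" and q: "computesE b q" by blast
  obtain e :: "nat poly" where e: "\<And>x v N. length x \<le> N \<Longrightarrow> (\<And>k. v k \<le> N) \<Longrightarrow> eval x b v \<le> poly e N"
    using eval_bound[of b] by meson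
  show ?case unfolding computesE_def
  proof (rule exI[of _ "p + (q + ([:4:] * e + 1))"], intro allI impI, elim conjE)
    fix x and \<rho> s :: "nat \<Rightarrow> nat" and d N :: nat and w
    assume x: "length (x :: bool list) \<le> N" and sN: "\<forall>k. s (\<rho> k) \<le> N" and \<rho>: "\<forall>k. \<rho> k < d" and z: "\<forall>r\<ge>d. s r = (0 :: nat)"
    let ?va = "eval x a (\<lambda>k. s (\<rho> k))" and ?vb = "eval x b (\<lambda>k. s (\<rho> k))"
    have ne: "\<rho> k \<noteq> d" "\<rho> k < Suc d" for k using \<rho>[rule_format, of k] by auto
    obtain t1 where 1: "t1 \<le> poly p N" "runs x (compE a \<rho> d) (s, w) t1 (s(d := ?va), w)"
      using computesED[OF p x, of s \<rho> d w] sN \<rho> z by auto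
    obtain t2 where 2: "t2 \<le> poly q N" "runs x (compE b \<rho> (Suc d)) (s(d := ?va), w) t2 (s(d := ?va, Suc d := ?vb), w)"
      using computesED[OF q x, of "s(d := ?va)" \<rho> "Suc d" w] sN ne z by auto
    have 3: "runs x (While (Suc d) (Seq (Dec (Suc d)) (Dec d))) (s(d := ?va, Suc d := ?vb), w) (4 * ?vb + 1) (s(d := ?va - ?vb), w)"
      using runs_monus[of "Suc d" d "s(d := ?va, Suc d := ?vb)" x w] z by (auto elim!: runs_eq simp: fun_eq_iff)
    have "?vb \<le> poly e N" using e x sN by auto
    then show "\<exists>t\<le>poly (p + (q + ([:4:] * e + 1))) N. runs x (compE (Minus a b) \<rho> d) (s, w) t
        (s(d := eval x (Minus a b) (\<lambda>k. s (\<rho> k))), w)"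
      using Seq[OF 1(2) Seq[OF 2(2) 3]] 1(1) 2(1) by (intro exI[of _ "t1 + (t2 + (4 * ?vb + 1))"]) auto
  qed
next
  case (Sum a b)
  then obtain p q where p: "computesE a p" and q: "computesE b q" by blast
  obtain ea :: "nat poly" where ea: "\<And>x v N. length x \<le> N \<Longrightarrow> (\<And>k. v k \<le> N) \<Longrightarrow> eval x a v \<le> poly ea N"
    using eval_bound[of a] by meson
  obtain eb :: "nat poly" where eb: "\<And>x v N. length x \<le> N \<Longrightarrow> (\<And>k. v k \<le> N) \<Longrightarrow> eval x b v \<le> poly eb N"
    using eval_bound[of b] by meson
  obtain es :: "nat poly" where es: "\<And>x v N. length x \<le> N \<Longrightarrow> (\<And>k. v k \<le> N) \<Longrightarrow> eval x (Sum a b) v \<le> poly es N"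
    using eval_bound[of "Sum a b"] by meson
  \<comment> \<open>The index can reach the number of terms, so the bounds for the body are taken at
    \<open>N + poly ea N\<close> instead of \<open>N\<close>.\<close>
  let ?M = "[:0, 1:] + ea"
  let ?P = "p + ((ea * (pcompose q ?M + [:4:] * pcompose eb ?M + [:10:]) + [:1:])
    + (([:3:] * ea + [:1:]) + ([:4:] * es + [:1:])))"
  show ?case unfolding computesE_def
  proof (rule exI[of _ ?P], intro allI impI, elim conjE)
    fix x and \<rho> s :: "nat \<Rightarrow> nat" and d N :: nat and w
    assume x: "length (x :: bool list) \<le> N" and sN: "\<forall>k. s (\<rho> k) \<le> N" and \<rho>: "\<forall>k. \<rho> k < d" and z: "\<forall>r\<ge>d. s r = (0 :: nat)"
    let ?v = "\<lambda>k. s (\<rho> k)"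
    let ?n = "eval x a ?v"
    let ?N = "N + poly ea N"
    let ?body = "Seq (Dec d) (Seq (compE b (case_nat (d + 1) \<rho>) (d + 3))
        (Seq (While (d + 3) (Seq (Dec (d + 3)) (Inc (d + 2)))) (Inc (d + 1))))"
    let ?r = "\<Sum>j<?n. eval x b (case_nat j ?v)"
    have ne: "\<rho> k \<noteq> d" for k using \<rho>[rule_format, of k] by auto
    have n: "?n \<le> poly ea N" using ea x sN by auto
    obtain t1 where 1: "t1 \<le> poly p N" "runs x (compE a \<rho> d) (s, w) t1 (s(d := ?n), w)"
      using computesED[OF p x, of s \<rho> d w] sN \<rho> z by auto
    have "\<exists>t. t \<le> (s(d := ?n)) d * (poly q ?N + 4 * poly eb ?N + 10) + 1 \<and> runs x (While d ?body) (s(d := ?n), w) t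
      ((s(d := ?n))(d := 0, d + 1 := 0 + (s(d := ?n)) d, d + 2 := (s(d := ?n)) (d + 2)
        + (\<Sum>j = 0..<0 + (s(d := ?n)) d. eval x b (case_nat j ?v))), w)"
    proof (rule computesE_Sum_loop[OF q, of _ ?N])
      show "length x \<le> ?N" using x by simp
      show "?v = (\<lambda>k. (s(d := ?n)) (\<rho> k))" using ne by simp
      show "s (\<rho> k) \<le> ?N" for k using sN by (simp add: trans_le_add1)
      show "eval x b (case_nat j ?v) \<le> poly eb ?N" if "j < ?N" for j
        using that x sN by (intro eb) (auto split: nat.split intro: trans_le_add1)
    qed (use n \<rho> z in auto)
    then obtain t2 where 2: "t2 \<le> ?n * (poly q ?N + 4 * poly eb ?N + 10) + 1"
      "runs x (While d ?body) (s(d := ?n), w) t2 (s(d := 0, d + 1 := ?n, d + 2 := ?r), w)"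
      using z by (auto simp: lessThan_atLeast0)
    have 3: "runs x (While (d + 1) (Dec (d + 1))) (s(d := 0, d + 1 := ?n, d + 2 := ?r), w) (3 * ?n + 1) (s(d + 2 := ?r), w)"
      using runs_drain[of "s(d := 0, d + 1 := ?n, d + 2 := ?r)" "d + 1" x w] z
      by (auto elim!: runs_eq simp: fun_eq_iff)
    have 4: "runs x (While (d + 2) (Seq (Dec (d + 2)) (Inc d))) (s(d + 2 := ?r), w) (4 * ?r + 1) (s(d := ?r), w)"
      using runs_move[of "d + 2" d "s(d + 2 := ?r)" x w] z by (auto elim!: runs_eq simp: fun_eq_iff)
    have "?r \<le> poly es N" using es[of x N ?v] x sN by auto
    moreover have "?n * (poly q ?N + 4 * poly eb ?N + 10) \<le> poly ea N * (poly q ?N + 4 * poly eb ?N + 10)"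
      using n by (rule mult_right_mono) simp
    moreover have "poly ?P N = poly p N + ((poly ea N * (poly q ?N + 4 * poly eb ?N + 10) + 1)
      + ((3 * poly ea N + 1) + (4 * poly es N + 1)))"
      by (simp add: poly_pcompose)
    ultimately have "t1 + (t2 + ((3 * ?n + 1) + (4 * ?r + 1))) \<le> poly ?P N"
      using 1(1) 2(1) n by linarith
    moreover have "runs x (compE (Sum a b) \<rho> d) (s, w) (t1 + (t2 + ((3 * ?n + 1) + (4 * ?r + 1))))
        (s(d := eval x (Sum a b) ?v), w)"
      unfolding compE.simps eval.simps by (rule Seq[OF 1(2) Seq[OF 2(2) Seq[OF 3 4]]])
    ultimately show "\<exists>t\<le>poly ?P N. runs x (compE (Sum a b) \<rho> d) (s, w) t (s(d := eval x (Sum a b) ?v), w)"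
      by blast
  qed
next
  case (Bit a)
  then obtain p where p: "computesE a p" by blast
  obtain e :: "nat poly" where e: "\<And>x v N. length x \<le> N \<Longrightarrow> (\<And>k. v k \<le> N) \<Longrightarrow> eval x a v \<le> poly e N"
    using eval_bound[of a] by meson
  show ?case unfolding computesE_def
  proof (rule exI[of _ "p + ([:3:] * e + [:7:])"], intro allI impI, elim conjE)
    fix x and \<rho> s :: "nat \<Rightarrow> nat" and d N :: nat and w
    assume x: "length (x :: bool list) \<le> N" and sN: "\<forall>k. s (\<rho> k) \<le> N" and \<rho>: "\<forall>k. \<rho> k < d" and z: "\<forall>r\<ge>d. s r = (0 :: nat)"
    let ?va = "eval x a (\<lambda>k. s (\<rho> k))"
    let ?b = "of_bool (bit_at x ?va) :: nat"
    obtain t1 where 1: "t1 \<le> poly p N" "runs x (compE a \<rho> d) (s, w) t1 (s(d := ?va), w)"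
      using computesED[OF p x, of s \<rho> d w] sN \<rho> z by auto
    have 2: "runs x (BitInc d (Suc d)) (s(d := ?va), w) 1 (s(d := ?va, Suc d := ?b), w)"
      by (rule runs_eq[OF BitInc]) (use z in \<open>auto simp: fun_eq_iff\<close>)
    have 3: "runs x (While d (Dec d)) (s(d := ?va, Suc d := ?b), w) (3 * ?va + 1) (s(Suc d := ?b), w)"
      using runs_drain[of "s(d := ?va, Suc d := ?b)" d x w] z by (auto elim!: runs_eq simp: fun_eq_iff)
    have 4: "runs x (While (Suc d) (Seq (Dec (Suc d)) (Inc d))) (s(Suc d := ?b), w) (4 * ?b + 1) (s(d := ?b), w)"
      using runs_move[of "Suc d" d "s(Suc d := ?b)" x w] z by (auto elim!: runs_eq simp: fun_eq_iff)
    have "?va \<le> poly e N" using e x sN by auto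
    then show "\<exists>t\<le>poly (p + ([:3:] * e + [:7:])) N. runs x (compE (Bit a) \<rho> d) (s, w) t
        (s(d := eval x (Bit a) (\<lambda>k. s (\<rho> k))), w)"
      using Seq[OF 1(2) Seq[OF 2 Seq[OF 3 4]]] 1(1)
      by (intro exI[of _ "t1 + (1 + ((3 * ?va + 1) + (4 * ?b + 1)))"]) auto
  qed
qed

text \<open>The main program: registers 0, 1, 2 hold the input length, the number of output bits still
  to be written and the index of the next one.\<close>

definition out_body :: "expr \<Rightarrow> com" where
  "out_body e = Seq (Dec 1) (Seq (compE e (case_nat 2 (\<lambda>_. 0)) 3) (Seq (Out 3) (Seq (While 3 (Dec 3)) (Inc 2))))"

definition out_prog :: "expr \<Rightarrow> expr \<Rightarrow> com" where
  "out_prog a e = Seq (compE a (\<lambda>_. 0) 1) (While 1 (out_body e))"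

definition out_bits :: "expr \<Rightarrow> expr \<Rightarrow> bool list \<Rightarrow> bool list" where
  "out_bits a e x = map (\<lambda>i. eval x e (case_nat i (\<lambda>_. length x)) \<noteq> 0) [0..<eval x a (\<lambda>_. length x)]"

lemma out_loop:
  assumes q: "computesE e q" and x: "length x \<le> N"
    and vb: "\<And>j. j < N \<Longrightarrow> eval x e (case_nat j (\<lambda>_. length x)) \<le> B"
    and m: "s 0 = length x" "i + s 1 \<le> N" "s 2 = i" "\<And>r. r \<ge> 3 \<Longrightarrow> s r = 0"
  shows "\<exists>t s'. t \<le> s 1 * (poly q N + 3 * B + 10) + 1 \<and> runs x (While 1 (out_body e)) (s, w) t
    (s', w @ map (\<lambda>i. eval x e (case_nat i (\<lambda>_. length x)) \<noteq> 0) [i..<i + s 1])"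
  using m
proof (induction "s 1" arbitrary: s i w)
  case 0
  then show ?case using WhileZ[of s 1 x "out_body e" w] by fastforce
next
  case (Suc n)
  let ?s1 = "s(1 := s 1 - 1)"
  let ?v = "eval x e (case_nat i (\<lambda>_. length x))"
  have ev: "(\<lambda>k. ?s1 (case_nat 2 (\<lambda>_. 0) k)) = case_nat i (\<lambda>_. length x)"
    using Suc.prems by (auto simp: fun_eq_iff split: nat.split)
  have "?s1 (case_nat 2 (\<lambda>_. 0) k) \<le> N" for k
    using Suc.hyps(2) Suc.prems x by (subst fun_cong[OF ev]) (auto split: nat.split)
  moreover have "case_nat 2 (\<lambda>_. 0) k < (3 :: nat)" for k by (auto split: nat.split)
  moreover have "?s1 r = 0" if "3 \<le> r" for r using that Suc.prems(4)[of r] by auto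
  ultimately obtain t1 where t1: "t1 \<le> poly q N" "runs x (compE e (case_nat 2 (\<lambda>_. 0)) 3) (?s1, w) t1 (?s1(3 := ?v), w)"
    using computesED[OF q x, of ?s1 "case_nat 2 (\<lambda>_. 0)" 3 w] unfolding ev by blast
  let ?w = "w @ [?v \<noteq> 0]"
  have t2: "runs x (Out 3) (?s1(3 := ?v), w) 1 (?s1(3 := ?v), ?w)"
    by (rule runs_eq[OF Out]) auto
  have t3: "runs x (While 3 (Dec 3)) (?s1(3 := ?v), ?w) (3 * ?v + 1) (?s1, ?w)"
    using runs_drain[of "?s1(3 := ?v)" 3 x ?w] Suc.prems(4)[of 3] by (auto elim!: runs_eq simp: fun_eq_iff)
  let ?s2 = "?s1(2 := i + 1)"
  have t4: "runs x (Inc 2) (?s1, ?w) 1 (?s2, ?w)"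
    by (rule runs_eq[OF Inc]) (use Suc.prems in auto)
  have body: "runs x (out_body e) (s, w) (1 + (t1 + (1 + (3 * ?v + 1 + 1)))) (?s2, ?w)"
    unfolding out_body_def by (rule Seq[OF Dec Seq[OF t1(2) Seq[OF t2 Seq[OF t3 t4]]]])
  have h: "n = ?s2 1" "?s2 0 = length x" "i + 1 + ?s2 1 \<le> N" "?s2 2 = i + 1" "\<And>r. 3 \<le> r \<Longrightarrow> ?s2 r = 0"
    using Suc.hyps(2) Suc.prems by auto
  obtain t5 s' where t5: "t5 \<le> ?s2 1 * (poly q N + 3 * B + 10) + 1"
    "runs x (While 1 (out_body e)) (?s2, ?w) t5
      (s', ?w @ map (\<lambda>i. eval x e (case_nat i (\<lambda>_. length x)) \<noteq> 0) [i + 1..<i + 1 + ?s2 1])"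
    using Suc.hyps(1)[OF h, of ?w] by blast
  have fin: "?w @ map (\<lambda>i. eval x e (case_nat i (\<lambda>_. length x)) \<noteq> 0) [i + 1..<i + 1 + ?s2 1]
    = w @ map (\<lambda>i. eval x e (case_nat i (\<lambda>_. length x)) \<noteq> 0) [i..<i + s 1]"
    using Suc.hyps(2) by (simp add: upt_conv_Cons)
  have "?v \<le> B" using vb[of i] Suc.prems(2) Suc.hyps(2) by simp
  then have time: "(1 + (t1 + (1 + (3 * ?v + 1 + 1)))) + t5 + 2 \<le> s 1 * (poly q N + 3 * B + 10) + 1"
    using t1(1) t5(1) Suc.hyps(2) by (cases "s 1") auto
  have "s 1 \<noteq> 0" using Suc.hyps(2) by simp
  from WhileS[OF this body t5(2)] time show ?case unfolding fin by blast
qed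

lemma out_prog_runs:
  "\<exists>p. \<forall>x. \<exists>t\<le>poly p (length x). \<exists>s'. runs x (out_prog a e) (\<lambda>r. if r = 0 then length x else 0, []) t (s', out_bits a e x)"
proof -
  obtain p q where p: "computesE a p" and q: "computesE e q" using computesE_exists by meson
  obtain ea :: "nat poly" where ea: "\<And>x v N. length x \<le> N \<Longrightarrow> (\<And>k. v k \<le> N) \<Longrightarrow> eval x a v \<le> poly ea N"
    using eval_bound[of a] by meson
  obtain ee :: "nat poly" where ee: "\<And>x v N. length x \<le> N \<Longrightarrow> (\<And>k. v k \<le> N) \<Longrightarrow> eval x e v \<le> poly ee N"
    using eval_bound[of e] by meson
  let ?M = "[:0, 1:] + ea"
  let ?P = "p + (ea * (pcompose q ?M + [:3:] * pcompose ee ?M + [:10:]) + [:1:])"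
  show ?thesis
  proof (intro exI[of _ ?P] allI)
    fix x :: "bool list"
    let ?s = "\<lambda>r :: nat. if r = 0 then length x else 0"
    let ?N = "length x" let ?K = "?N + poly ea ?N"
    let ?n = "eval x a (\<lambda>_. ?N)"
    obtain t1 where 1: "t1 \<le> poly p ?N" "runs x (compE a (\<lambda>_. 0) 1) (?s, []) t1 (?s(1 := ?n), [])"
      using computesED[OF p, of x ?N ?s "\<lambda>_. 0" 1 "[]"] by auto
    have n: "?n \<le> poly ea ?N" using ea by auto
    have "\<exists>t s'. t \<le> (?s(1 := ?n)) 1 * (poly q ?K + 3 * poly ee ?K + 10) + 1 \<and> runs x (While 1 (out_body e)) (?s(1 := ?n), []) t
      (s', [] @ map (\<lambda>i. eval x e (case_nat i (\<lambda>_. length x)) \<noteq> 0) [0..<0 + (?s(1 := ?n)) 1])"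
      by (rule out_loop[OF q]) (use n in \<open>auto intro!: ee split: nat.split\<close>)
    then obtain t2 s' where 2: "t2 \<le> ?n * (poly q ?K + 3 * poly ee ?K + 10) + 1"
      "runs x (While 1 (out_body e)) (?s(1 := ?n), []) t2 (s', out_bits a e x)"
      by (auto simp: out_bits_def)
    have "?n * (poly q ?K + 3 * poly ee ?K + 10) \<le> poly ea ?N * (poly q ?K + 3 * poly ee ?K + 10)"
      using n by (rule mult_right_mono) simp
    moreover have "poly ?P ?N = poly p ?N + (poly ea ?N * (poly q ?K + 3 * poly ee ?K + 10) + 1)"
      by (simp add: poly_pcompose)
    ultimately have "t1 + t2 \<le> poly ?P ?N" using 1(1) 2(1) by linarith
    moreover have "runs x (out_prog a e) (?s, []) (t1 + t2) (s', out_bits a e x)"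
      unfolding out_prog_def by (rule Seq[OF 1(2) 2(2)])
    ultimately show "\<exists>t\<le>poly ?P ?N. \<exists>s'. runs x (out_prog a e) (?s, []) t (s', out_bits a e x)"
      by blast
  qed
qed

section \<open>Simulation with one Turing machine step per instruction\<close>

section \<open>Compilation to Turing machines\<close>

datatype instr = IInc nat | IDec nat | IBit nat nat | IOut nat | IJz nat nat | IJmp nat

fun istep :: "bool list \<Rightarrow> instr \<Rightarrow> nat \<times> store \<Rightarrow> nat \<times> store" where
  "istep x (IInc r) (pc, s, w) = (pc + 1, s(r := s r + 1), w)"
| "istep x (IDec r) (pc, s, w) = (pc + 1, s(r := s r - 1), w)"
| "istep x (IBit r d) (pc, s, w) = (pc + 1, if bit_at x (s r) then s(d := s d + 1) else s, w)"
| "istep x (IOut r) (pc, s, w) = (pc + 1, s, w @ [s r \<noteq> 0])"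
| "istep x (IJz r j) (pc, s, w) = (if s r = 0 then j else pc + 1, s, w)"
| "istep x (IJmp j) (pc, s, w) = (j, s, w)"

definition cstep :: "bool list \<Rightarrow> instr list \<Rightarrow> nat \<times> store \<Rightarrow> nat \<times> store" where
  "cstep x P = (\<lambda>(pc, s). if pc < length P then istep x (P ! pc) (pc, s) else (pc, s))"

primrec comp :: "nat \<Rightarrow> com \<Rightarrow> instr list" where
  "comp p Skip = []"
| "comp p (Inc r) = [IInc r]"
| "comp p (Dec r) = [IDec r]"
| "comp p (BitInc r d) = [IBit r d]"
| "comp p (Out r) = [IOut r]"
| "comp p (Seq c c') = comp p c @ comp (p + length (comp p c)) c'"
| "comp p (While r c) = IJz r (p + length (comp (p + 1) c) + 2) # comp (p + 1) c @ [IJmp p]"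

text \<open>Jump targets are absolute, so code is compiled for the address at which it stands. The
  surrounding code \<open>P1\<close>, \<open>P2\<close> is arbitrary in order that the induction
  applies to subprograms.\<close>

lemma comp_runs:
  assumes "runs x c s t s'"
  shows "P = P1 @ comp (length P1) c @ P2 \<Longrightarrow>
    (cstep x P ^^ t) (length P1, s) = (length P1 + length (comp (length P1) c), s')"
  using assms
proof (induction arbitrary: P1 P2 rule: runs.induct)
  case (Seq c s t s' c' t' s'')
  let ?C = "comp (length P1) c"
  have 1: "(cstep x P ^^ t) (length P1, s) = (length P1 + length ?C, s')"
    using Seq.prems by (intro Seq.IH(1)) simp
  have 2: "(cstep x P ^^ t') (length (P1 @ ?C), s') =
      (length (P1 @ ?C) + length (comp (length (P1 @ ?C)) c'), s'')"
    using Seq.prems by (intro Seq.IH(2)) simp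
  show ?case using 1 2 by (simp add: funpow_add add.commute[of t] add.assoc)
next
  case (WhileS s r c w t s' t' s'')
  let ?C = "comp (length P1 + 1) c"
  have 0: "cstep x P (length P1, s, w) = (length P1 + 1, s, w)"
    using WhileS.prems WhileS.hyps by (simp add: cstep_def nth_append)
  have "(cstep x P ^^ t) (length (P1 @ [IJz r (length P1 + length ?C + 2)]), s, w) =
      (length (P1 @ [IJz r (length P1 + length ?C + 2)])
        + length (comp (length (P1 @ [IJz r (length P1 + length ?C + 2)])) c), s')"
    using WhileS.prems by (intro WhileS.IH(1)) simp
  then have 1: "(cstep x P ^^ t) (length P1 + 1, s, w) = (length P1 + 1 + length ?C, s')" by simp
  have 2: "cstep x P (length P1 + 1 + length ?C, s') = (length P1, s')"
    using WhileS.prems by (cases s') (simp add: cstep_def nth_append)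
  have 3: "(cstep x P ^^ t') (length P1, s') = (length P1 + length (comp (length P1) (While r c)), s'')"
    using WhileS.prems by (rule WhileS.IH(2))
  have "(cstep x P ^^ (t + Suc 0)) (length P1, s, w) = (length P1 + 1 + length ?C, s')"
    by (simp only: funpow_add o_apply funpow.simps funpow_0 id_apply 0 1)
  then have "(cstep x P ^^ Suc (t + Suc 0)) (length P1, s, w) = (length P1, s')"
    using 2 by simp
  then have "(cstep x P ^^ (t' + Suc (t + Suc 0))) (length P1, s, w) = (length P1 + length (comp (length P1) (While r c)), s'')"
    by (simp only: funpow_add o_apply 3)
  then show ?case by (simp add: add.commute add.left_commute)
qed (auto simp: cstep_def nth_append)

fun iregs :: "instr \<Rightarrow> nat set" where
  "iregs (IInc r) = {r}" | "iregs (IDec r) = {r}" | "iregs (IBit r d) = {r, d}" | "iregs (IOut r) = {r}"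
| "iregs (IJz r j) = {r}" | "iregs (IJmp j) = {}"

fun itgts :: "instr \<Rightarrow> nat set" where
  "itgts (IJz r j) = {j}" | "itgts (IJmp j) = {j}" | "itgts _ = {}"

lemma comp_tgts: "i \<in> set (comp p c) \<Longrightarrow> j \<in> itgts i \<Longrightarrow> j \<le> p + length (comp p c)"
  by (induction c arbitrary: p) (fastforce+)

text \<open>At least two registers are demanded because the rewinding phase recognises its end by
  the mark on tape 2, which belongs to register 1.\<close>

lemma comp_regs: "\<exists>R\<ge>2. \<forall>i\<in>set (comp p c). \<forall>r\<in>iregs i. r < R"
proof -
  have "finite (insert 1 (\<Union>i\<in>set (comp p c). iregs i))"
    by (auto elim: iregs.elims) (metis finite.simps iregs.simps instr.exhaust)
  then obtain R where "\<forall>r\<in>insert 1 (\<Union>i\<in>set (comp p c). iregs i). r < R"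
    using finite_nat_set_iff_bounded by blast
  then show ?thesis by (intro exI[of _ R]) auto
qed

text \<open>Register \<open>r\<close> is the position of the head on tape \<open>r + 1\<close>, which holds a copy of the input
  whose first cell is marked by adding 3 to its symbol; tape 0 is the input and the last tape the output.\<close>

definition idelta :: "nat \<Rightarrow> instr list \<Rightarrow> nat \<Rightarrow> nat list \<Rightarrow> nat \<times> (nat \<Rightarrow> nat \<times> dir)" where
  "idelta R P q rs =
    (if q = 0 then
       if rs ! 0 = 0 then (3, \<lambda>k. (if 1 \<le> k \<and> k \<le> R then 3 else rs ! k, Stay))
       else (1, \<lambda>k. if k = 0 then (rs ! 0, MoveR)
         else if k \<le> R then (if rs ! 0 \<le> 2 then 3 + rs ! 0 else 0, MoveR) else (rs ! k, Stay))
     else if q = 1 then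
       if rs ! 0 = 0 then (2, \<lambda>k. (rs ! k, Stay))
       else (1, \<lambda>k. if k \<le> R then (rs ! 0, MoveR) else (rs ! k, Stay))
     else if q = 2 then
       if rs ! 2 \<ge> 3 then (3, \<lambda>k. (rs ! k, Stay))
       else (2, \<lambda>k. (rs ! k, if 2 \<le> k \<and> k \<le> R then MoveL else Stay))
     else (case P ! (q - 3) of
       IInc r \<Rightarrow> (q + 1, \<lambda>k. (rs ! k, if k = r + 1 then MoveR else Stay))
     | IDec r \<Rightarrow> (q + 1, \<lambda>k. (rs ! k, if k = r + 1 \<and> rs ! (r + 1) < 3 then MoveL else Stay))
     | IBit r d \<Rightarrow> (q + 1, \<lambda>k. (rs ! k, if k = d + 1 \<and> rs ! (r + 1) \<in> {2, 5} then MoveR else Stay))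
     | IOut r \<Rightarrow> (q + 1, \<lambda>k. if k = R + 1 then (if rs ! (r + 1) \<ge> 3 then 1 else 2, MoveR) else (rs ! k, Stay))
     | IJz r j \<Rightarrow> (if rs ! (r + 1) \<ge> 3 then j + 3 else q + 1, \<lambda>k. (rs ! k, Stay))
     | IJmp j \<Rightarrow> (j + 3, \<lambda>k. (rs ! k, Stay))))"

definition itm :: "nat \<Rightarrow> instr list \<Rightarrow> tm" where
  "itm R P = \<lparr>num_tapes = R + 2, num_syms = 6, num_states = length P + 3,
     delta = (\<lambda>q rs. case idelta R P q rs of (q', f) \<Rightarrow> (q', map f [0..<R + 2]))\<rparr>"

lemma itm_sel [simp]:
  "num_tapes (itm R P) = R + 2" "num_syms (itm R P) = 6" "num_states (itm R P) = length P + 3"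
  by (simp_all add: itm_def)

definition good_prog :: "nat \<Rightarrow> instr list \<Rightarrow> bool" where
  "good_prog R P \<longleftrightarrow> R \<ge> 2 \<and> (\<forall>i\<in>set P. (\<forall>r\<in>iregs i. r < R) \<and> (\<forall>j\<in>itgts i. j \<le> length P))"

lemma wf_itm:
  assumes "good_prog R P"
  shows "wf_tm (itm R P)"
proof -
  have "fst (idelta R P q rs) \<le> length P + 3 \<and> (\<forall>k<R + 2. fst (snd (idelta R P q rs) k) < 6)"
    if q: "q < length P + 3" and rs: "length rs = R + 2" "\<forall>r\<in>set rs. r < 6" for q rs
  proof -
    have r6: "rs ! k < 6" if "k < R + 2" for k using rs that by (metis nth_mem)
    show ?thesis
    proof (cases "q < 3")
      case True
      then show ?thesis using r6 by (auto simp: idelta_def)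
    next
      case False
      then have "P ! (q - 3) \<in> set P" using q by auto
      then have "\<forall>j\<in>itgts (P ! (q - 3)). j \<le> length P" using assms by (auto simp: good_prog_def)
      then show ?thesis using r6 q False by (auto simp: idelta_def split: instr.split)
    qed
  qed
  then show ?thesis
    by (auto simp: wf_tm_def itm_def split_beta)
qed

text \<open>With the tapes given as a function of their number, a step of the machine can be checked
  for one tape at a time.\<close>

lemma tm_step_map:
  assumes "q < length P + 3"
    and rs: "rs = map (\<lambda>k. snd (F k) (fst (F k))) [0..<R + 2]"
    and "fst (idelta R P q rs) = q'"
    and "\<And>k. k < R + 2 \<Longrightarrow> (move (snd (snd (idelta R P q rs) k)) (fst (F k)),
      (snd (F k))(fst (F k) := fst (snd (idelta R P q rs) k))) = F' k"
  shows "tm_step (itm R P) (q, map F [0..<R + 2]) = (q', map F' [0..<R + 2])"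
proof -
  define G where "G = snd (idelta R P q rs)"
  have G: "idelta R P q rs = (q', G)" using assms(3) by (auto simp: G_def)
  have eq: "map (\<lambda>(h, t). t h) (map F [0..<R + 2]) = map (\<lambda>k. snd (F k) (fst (F k))) [0..<R + 2]"
    by (simp add: split_beta del: upt_Suc)
  have "tm_step (itm R P) (q, map F [0..<R + 2])
    = (q', map2 (\<lambda>(w, d) (h, t). (move d h, t(h := w))) (map G [0..<R + 2]) (map F [0..<R + 2]))"
    using assms(1) unfolding tm_step_def prod.case eq by (simp add: itm_def rs[symmetric] G del: upt_Suc add_2_eq_Suc')
  also have "map2 (\<lambda>(w, d) (h, t). (move d h, t(h := w))) (map G [0..<R + 2]) (map F [0..<R + 2])
    = map F' [0..<R + 2]"
    unfolding map2_map_map using assms(4) by (intro map_cong) (auto simp: split_beta G_def)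
  finally show ?thesis .
qed

definition xt :: "bool list \<Rightarrow> tape" where
  "xt x = (\<lambda>i. if i = 0 then 3 + tape_of x 0 else tape_of x i)"

definition frame :: "bool list \<Rightarrow> nat \<Rightarrow> store \<Rightarrow> nat \<Rightarrow> int \<times> tape" where
  "frame x R = (\<lambda>(s, w) k. if k = 0 then (int (length x), tape_of x)
     else if k \<le> R then (int (s (k - 1)), xt x) else (int (length w), tape_of w))"

lemma tape_of_le: "tape_of x i \<le> 2"
  by (simp add: tape_of_def)

lemma xt_zero: "3 \<le> xt x (int m) \<longleftrightarrow> m = 0" "xt x (int m) < 3 \<longleftrightarrow> m \<noteq> 0"
  using tape_of_le[of x "int m"] by (auto simp: xt_def)

text \<open>A head beyond the word reads a blank, in agreement with \<open>bit_at\<close> being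
  false there. Symbol 5 is a one in the marked first cell.\<close>

lemma xt_bit: "xt x (int m) = 2 \<or> xt x (int m) = 5 \<longleftrightarrow> bit_at x m"
  by (auto simp: xt_def tape_of_def bit_at_def)

lemma tape_of_snoc: "(tape_of w)(int (length w) := if b then 2 else Suc 0) = tape_of (w @ [b])"
  by (auto simp: tape_of_def fun_eq_iff nth_append)

lemma itm_sim:
  assumes P: "good_prog R P"
  shows "cstep x P (pc, s) = (pc', s') \<Longrightarrow> pc \<le> length P \<Longrightarrow> pc' \<le> length P \<and>
    tm_step (itm R P) (pc + 3, map (frame x R s) [0..<R + 2]) = (pc' + 3, map (frame x R s') [0..<R + 2])"
proof (cases "pc < length P")
  case False
  then show "cstep x P (pc, s) = (pc', s') \<Longrightarrow> pc \<le> length P \<Longrightarrow> pc' \<le> length P \<and>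
    tm_step (itm R P) (pc + 3, map (frame x R s) [0..<R + 2]) = (pc' + 3, map (frame x R s') [0..<R + 2])"
    by (auto simp: cstep_def tm_step_def)
next
  case True
  assume c: "cstep x P (pc, s) = (pc', s')"
  obtain r w where s: "s = (r, w)" by (cases s)
  have i: "istep x (P ! pc) (pc, r, w) = (pc', s')" using c True by (simp add: cstep_def s)
  have "P ! pc \<in> set P" using True by simp
  then have good: "\<forall>r\<in>iregs (P ! pc). r < R" "\<forall>j\<in>itgts (P ! pc). j \<le> length P"
    using P by (auto simp: good_prog_def)
  have "pc' \<le> length P" using i good True by (cases "P ! pc") auto
  moreover have "tm_step (itm R P) (pc + 3, map (frame x R s) [0..<R + 2]) = (pc' + 3, map (frame x R s') [0..<R + 2])"
  proof (rule tm_step_map)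
    let ?rs = "map (\<lambda>k. snd (frame x R s k) (fst (frame x R s k))) [0..<R + 2]"
    have rs: "?rs ! k = snd (frame x R s k) (fst (frame x R s k))" if "k < R + 2" for k
      using that by (simp del: upt_Suc)
    have rs1: "?rs ! Suc k = xt x (int (r k))" if "k < R" for k
      using that by (subst rs) (auto simp: frame_def s)
    have rs2: "snd (frame x R s (Suc k)) (fst (frame x R s (Suc k))) = xt x (int (r k))" if "k < R" for k
      using that by (auto simp: frame_def s)
    show "?rs = ?rs" ..
    show "fst (idelta R P (pc + 3) ?rs) = pc' + 3"
      using i good by (cases "P ! pc") (auto simp: idelta_def rs1 rs2 xt_zero xt_bit simp del: upt_Suc)
    show "(move (snd (snd (idelta R P (pc + 3) ?rs) k)) (fst (frame x R s k)),
        (snd (frame x R s k))(fst (frame x R s k) := fst (snd (idelta R P (pc + 3) ?rs) k))) = frame x R s' k"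
      if "k < R + 2" for k
      using i good that
      by (cases "P ! pc") (auto simp: idelta_def rs1 rs2 xt_zero xt_bit frame_def s tape_of_snoc[where b = True, simplified] tape_of_snoc[where b = False, simplified] simp del: upt_Suc)
  qed (use True in simp)
  ultimately show "pc' \<le> length P \<and> tm_step (itm R P) (pc + 3, map (frame x R s) [0..<R + 2])
    = (pc' + 3, map (frame x R s') [0..<R + 2])" by blast
qed

lemma itm_sim_steps:
  assumes P: "good_prog R P"
  shows "(cstep x P ^^ t) (pc, s) = (pc', s') \<Longrightarrow> pc \<le> length P \<Longrightarrow> pc' \<le> length P \<and>
    (tm_step (itm R P) ^^ t) (pc + 3, map (frame x R s) [0..<R + 2]) = (pc' + 3, map (frame x R s') [0..<R + 2])"
proof (induction t arbitrary: pc' s')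
  case (Suc t)
  obtain pc1 s1 where 1: "(cstep x P ^^ t) (pc, s) = (pc1, s1)" by (meson surj_pair)
  then have "cstep x P (pc1, s1) = (pc', s')" using Suc.prems by simp
  from itm_sim[OF P this] Suc.IH[OF 1] Suc.prems show ?case by simp
qed simp

text \<open>The first three states copy the input to the register tapes and rewind all of them but the
  one of register 0.\<close>

lemma itm_init:
  assumes P: "good_prog R P"
  shows "\<exists>t\<le>2 * length x + 3. (tm_step (itm R P) ^^ t) (init_config (itm R P) x)
    = (3, map (frame x R (\<lambda>r. if r = 0 then length x else 0, [])) [0..<R + 2])"
proof -
  have R: "R \<ge> 2" using P by (simp add: good_prog_def)
  let ?n = "length x"
  define F0 where "F0 = (\<lambda>k :: nat. (0 :: int, if k = 0 then tape_of x else tape_of []))"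
  \<comment> \<open>\<open>F1 i\<close> are the tapes after \<open>i\<close> cells have been copied,
    \<open>F2 i\<close> those with the rewound heads at position \<open>i\<close>. Tape 1 stays at
    the end of the word, since register 0 starts with the input length.\<close>
  define F1 where "F1 = (\<lambda>i k. if k = 0 then (int i, tape_of x)
    else if k \<le> R then (int i, \<lambda>j. if j < int i then xt x j else 0) else (0, tape_of []))"
  define F2 where "F2 = (\<lambda>i k. if k = 0 then (int ?n, tape_of x)
    else if k \<le> R then (if k = 1 then int ?n else int i, xt x) else (0, tape_of []))"
  have init: "init_config (itm R P) x = (0, map F0 [0..<R + 2])"
  proof -
    have "map F0 [0..<R + 2] = F0 0 # map F0 [1..<R + 2]" by (simp add: upt_conv_Cons del: upt_Suc)
    also have "map F0 [1..<R + 2] = replicate (R + 1) (0, tape_of [])"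
      by (rule replicate_eqI) (auto simp: F0_def simp del: upt_Suc)
    finally show ?thesis by (simp add: init_config_def F0_def)
  qed
  have last: "F2 0 k = frame x R (\<lambda>r. if r = 0 then length x else 0, []) k" for k
    by (auto simp: F2_def frame_def)
  have tx: "tape_of x (int i) \<noteq> 0 \<longleftrightarrow> i < ?n" "tape_of x (int i) = 0 \<longleftrightarrow> \<not> i < ?n" for i
    by (auto simp: tape_of_def)
  show ?thesis
  proof (cases "x = []")
    case True
    have "tm_step (itm R P) (0, map F0 [0..<R + 2]) = (3, map (F2 0) [0..<R + 2])"
      by (rule tm_step_map[OF _ refl]) (use R True in \<open>auto simp: idelta_def F0_def F2_def xt_def tape_of_def fun_eq_iff simp del: upt_Suc\<close>)
    then show ?thesis unfolding init last by (intro exI[of _ 1]) simp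
  next
    case False
    have a: "tm_step (itm R P) (0, map F0 [0..<R + 2]) = (1, map (F1 1) [0..<R + 2])"
      by (rule tm_step_map[OF _ refl])
        (use R False tx[of 0] tape_of_le[of x 0] in \<open>auto simp: idelta_def F0_def F1_def xt_def tape_of_def fun_eq_iff simp del: upt_Suc\<close>)
    have b: "(tm_step (itm R P) ^^ i) (1, map (F1 1) [0..<R + 2]) = (1, map (F1 (1 + i)) [0..<R + 2])" if "1 + i \<le> ?n" for i
      using that
    proof (induction i)
      case (Suc i)
      have "tm_step (itm R P) (1, map (F1 (1 + i)) [0..<R + 2]) = (1, map (F1 (1 + Suc i)) [0..<R + 2])"
        by (rule tm_step_map[OF _ refl])
          (use R Suc.prems tx[of "1 + i"] in \<open>auto simp: idelta_def F1_def xt_def fun_eq_iff simp del: upt_Suc\<close>)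
      with Suc show ?case by simp
    qed simp
    have c: "tm_step (itm R P) (1, map (F1 ?n) [0..<R + 2]) = (2, map (F2 ?n) [0..<R + 2])"
      by (rule tm_step_map[OF _ refl])
        (use R False tx[of "?n"] in \<open>auto simp: idelta_def F1_def F2_def xt_def tape_of_def fun_eq_iff simp del: upt_Suc\<close>)
    have d: "(tm_step (itm R P) ^^ i) (2, map (F2 ?n) [0..<R + 2]) = (2, map (F2 (?n - i)) [0..<R + 2])" if "i \<le> ?n" for i
      using that
    proof (induction i)
      case (Suc i)
      have "tm_step (itm R P) (2, map (F2 (?n - i)) [0..<R + 2]) = (2, map (F2 (?n - Suc i)) [0..<R + 2])"
        by (rule tm_step_map[OF _ refl])
          (use R Suc.prems xt_zero[of x "?n - i"] in \<open>auto simp: idelta_def F2_def fun_eq_iff simp del: upt_Suc\<close>)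
      with Suc show ?case by simp
    qed simp
    have e: "tm_step (itm R P) (2, map (F2 0) [0..<R + 2]) = (3, map (F2 0) [0..<R + 2])"
      by (rule tm_step_map[OF _ refl])
        (use R xt_zero[of x 0] in \<open>auto simp: idelta_def F2_def fun_eq_iff simp del: upt_Suc\<close>)
    have b': "(tm_step (itm R P) ^^ (?n - 1)) (1, map (F1 1) [0..<R + 2]) = (1, map (F1 ?n) [0..<R + 2])"
      using b[of "?n - 1"] False by (cases x) auto
    have d': "(tm_step (itm R P) ^^ ?n) (2, map (F2 ?n) [0..<R + 2]) = (2, map (F2 0) [0..<R + 2])"
      using d[of ?n] by simp
    have "(tm_step (itm R P) ^^ (Suc 0 + (?n + (Suc 0 + ((?n - 1) + Suc 0))))) (0, map F0 [0..<R + 2])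
      = (3, map (F2 0) [0..<R + 2])"
      by (simp only: funpow_add o_apply funpow.simps funpow_0 id_apply a b' c d' e)
    moreover have "Suc 0 + (?n + (Suc 0 + ((?n - 1) + Suc 0))) \<le> 2 * ?n + 3" by simp
    ultimately show ?thesis unfolding init last by blast
  qed
qed

text \<open>The result is demanded at one exact time. A mere upper bound suffices because a halted
  configuration does not change any more.\<close>

lemma computes_within_mono:
  assumes "(tm_step M ^^ t) (init_config M x) = (num_states M, ts)" "t \<le> t'" "snd (last ts) = tape_of y"
  shows "computes_within M x y t'"
proof -
  have "(tm_step M ^^ i) (num_states M, ts) = (num_states M, ts)" for i
    by (induction i) (auto simp: tm_step_def)
  then have "(tm_step M ^^ (t' - t + t)) (init_config M x) = (num_states M, ts)"
    by (simp add: funpow_add assms(1))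
  then show ?thesis using assms(2,3) by (simp add: computes_within_def)
qed

theorem polytime_out_bits: "polytime (out_bits a e)"
proof -
  obtain p where p: "\<And>x. \<exists>t\<le>poly p (length x). \<exists>s'. runs x (out_prog a e) (\<lambda>r. if r = 0 then length x else 0, []) t (s', out_bits a e x)"
    using out_prog_runs by blast
  let ?P = "comp 0 (out_prog a e)"
  obtain R where R: "R \<ge> 2" "\<forall>i\<in>set ?P. \<forall>r\<in>iregs i. r < R" using comp_regs by blast
  have good: "good_prog R ?P" using R comp_tgts[of _ 0 "out_prog a e"] by (auto simp: good_prog_def)
  have "computes_within (itm R ?P) x (out_bits a e x) (poly ([:3, 2:] + p) (length x))" for x
  proof -
    let ?s = "\<lambda>r :: nat. if r = 0 then length x else 0"
    obtain t s' where t: "t \<le> poly p (length x)" "runs x (out_prog a e) (?s, []) t (s', out_bits a e x)"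
      using p by blast
    obtain u where u: "u \<le> 2 * length x + 3" "(tm_step (itm R ?P) ^^ u) (init_config (itm R ?P) x)
      = (3, map (frame x R (?s, [])) [0..<R + 2])" using itm_init[OF good] by blast
    have "(cstep x ?P ^^ t) (0, ?s, []) = (length ?P, s', out_bits a e x)"
      using comp_runs[OF t(2), of ?P "[]" "[]"] by simp
    from itm_sim_steps[OF good this]
    have "(tm_step (itm R ?P) ^^ t) (3, map (frame x R (?s, [])) [0..<R + 2])
      = (length ?P + 3, map (frame x R (s', out_bits a e x)) [0..<R + 2])" by simp
    then have "(tm_step (itm R ?P) ^^ (t + u)) (init_config (itm R ?P) x)
      = (num_states (itm R ?P), map (frame x R (s', out_bits a e x)) [0..<R + 2])"
      using u(2) by (simp add: funpow_add)
    then show ?thesis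
      by (rule computes_within_mono) (use t u in \<open>auto simp: frame_def\<close>)
  qed
  then show ?thesis using wf_itm[OF good] unfolding polytime_def by blast
qed

section \<open>A calculus of polynomial-time decidable predicates\<close>

section \<open>Closure properties of arithmetic expressions\<close>

primrec ren :: "(nat \<Rightarrow> nat) \<Rightarrow> expr \<Rightarrow> expr" where
  "ren f (Const n) = Const n"
| "ren f (Var k) = Var (f k)"
| "ren f (Plus a b) = Plus (ren f a) (ren f b)"
| "ren f (Minus a b) = Minus (ren f a) (ren f b)"
| "ren f (Sum a b) = Sum (ren f a) (ren (case_nat 0 (\<lambda>k. Suc (f k))) b)"
| "ren f (Bit a) = Bit (ren f a)"

lemma eval_ren: "eval x (ren f e) v = eval x e (\<lambda>k. v (f k))"
proof (induction e arbitrary: f v)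
  case (Sum a b)
  have "(\<lambda>k. case_nat i v (case_nat 0 (\<lambda>k. Suc (f k)) k)) = case_nat i (\<lambda>k. v (f k))" for i
    by (auto simp: fun_eq_iff split: nat.split)
  then show ?case by (simp add: Sum)
qed auto

text \<open>The input length is an additional variable with index 0.\<close>

definition pexp :: "(bool list \<Rightarrow> (nat \<Rightarrow> nat) \<Rightarrow> nat) \<Rightarrow> bool" where
  "pexp g \<longleftrightarrow> (\<exists>e. \<forall>x v. eval x e (case_nat (length x) v) = g x v)"

definition ppred :: "(bool list \<Rightarrow> (nat \<Rightarrow> nat) \<Rightarrow> bool) \<Rightarrow> bool" where
  "ppred P \<longleftrightarrow> pexp (\<lambda>x v. of_bool (P x v))"

named_theorems pexp_intros

lemma pexpI: "(\<And>x :: bool list. \<And>v. eval x e (case_nat (length x) v) = g x v) \<Longrightarrow> pexp g"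
  by (auto simp: pexp_def)

lemma pexp_const [pexp_intros]: "pexp (\<lambda>x v. c)"
  by (rule pexpI[of "Const c"]) simp

lemma pexp_var [pexp_intros]: "pexp (\<lambda>x v. v k)"
  by (rule pexpI[of "Var (Suc k)"]) simp

lemma pexp_length [pexp_intros]: "pexp (\<lambda>x v. length x)"
  by (rule pexpI[of "Var 0"]) simp

lemma pexp_add [pexp_intros]: "pexp a \<Longrightarrow> pexp b \<Longrightarrow> pexp (\<lambda>x v. a x v + b x v)"
  unfolding pexp_def by (metis eval.simps(3))

lemma pexp_diff [pexp_intros]: "pexp a \<Longrightarrow> pexp b \<Longrightarrow> pexp (\<lambda>x v. a x v - b x v)"
  unfolding pexp_def by (metis eval.simps(4))

lemma pexp_bit: "pexp a \<Longrightarrow> pexp (\<lambda>x v. of_bool (bit_at x (a x v)))"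
  unfolding pexp_def by (metis eval.simps(6))

lemma pexp_shift:
  assumes "pexp a"
  shows "pexp (\<lambda>x v. a x (\<lambda>k. v (Suc k)))"
proof -
  obtain e where e: "\<And>x v. eval x e (case_nat (length x) v) = a x v" using assms by (auto simp: pexp_def)
  show ?thesis
  proof (rule pexpI[of "ren (case_nat 0 (\<lambda>k. Suc (Suc k))) e"])
    fix x :: "bool list" and v
    have "(\<lambda>k. case_nat (length x) v (case_nat 0 (\<lambda>k. Suc (Suc k)) k)) = case_nat (length x) (\<lambda>k. v (Suc k))"
      by (auto simp: fun_eq_iff split: nat.split)
    then show "eval x (ren (case_nat 0 (\<lambda>k. Suc (Suc k))) e) (case_nat (length x) v) = a x (\<lambda>k. v (Suc k))"
      by (simp add: eval_ren e)
  qed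
qed

lemma pexp_sum [pexp_intros]:
  assumes "pexp a" "pexp (\<lambda>x v. b x (v 0) (\<lambda>k. v (Suc k)))"
  shows "pexp (\<lambda>x v. \<Sum>i<a x v. b x i v)"
proof -
  obtain e where e: "\<And>x v. eval x e (case_nat (length x) v) = a x v" using assms by (auto simp: pexp_def)
  obtain f where f: "\<And>x v. eval x f (case_nat (length x) v) = b x (v 0) (\<lambda>k. v (Suc k))"
    using assms by (auto simp: pexp_def)
  \<comment> \<open>The sum binds index 0, where the input length is expected; the renaming
    exchanges the two.\<close>
  let ?s = "case_nat 1 (case_nat 0 (\<lambda>k. Suc (Suc k)))"
  have *: "(\<lambda>k. case_nat i (case_nat (length x) v) (?s k)) = case_nat (length x) (case_nat i v)" for i and x :: "bool list" and v
    by (auto simp: fun_eq_iff split: nat.split)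
  show ?thesis
    by (rule pexpI[of "Sum e (ren ?s f)"]) (simp only: eval.simps eval_ren e * f nat.case)
qed

lemma pexp_mult [pexp_intros]:
  assumes "pexp a" "pexp b"
  shows "pexp (\<lambda>x v. a x v * b x v)"
  using pexp_sum[OF assms(1) pexp_shift[OF assms(2)]] by simp

lemma ppredD: "ppred P \<Longrightarrow> pexp (\<lambda>x v. of_bool (P x v))"
  by (simp add: ppred_def)

lemma ppred_const [pexp_intros]: "ppred (\<lambda>x v. c)"
  unfolding ppred_def by (rule pexp_const)

lemma ppred_not [pexp_intros]: "ppred P \<Longrightarrow> ppred (\<lambda>x v. \<not> P x v)"
proof -
  have eq: "of_bool (\<not> b) = (1 - of_bool b :: nat)" for b by (cases b) auto
  show "ppred P \<Longrightarrow> ppred (\<lambda>x v. \<not> P x v)"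
    unfolding ppred_def eq by (intro pexp_diff pexp_const)
qed

lemma ppred_conj [pexp_intros]: "ppred P \<Longrightarrow> ppred Q \<Longrightarrow> ppred (\<lambda>x v. P x v \<and> Q x v)"
  unfolding ppred_def of_bool_conj by (rule pexp_mult)

lemma ppred_disj [pexp_intros]: "ppred P \<Longrightarrow> ppred Q \<Longrightarrow> ppred (\<lambda>x v. P x v \<or> Q x v)"
  proof -
  have eq: "(a \<or> b) = (\<not> (\<not> a \<and> \<not> b))" for a b by auto
  show "ppred P \<Longrightarrow> ppred Q \<Longrightarrow> ppred (\<lambda>x v. P x v \<or> Q x v)"
    unfolding eq by (intro ppred_not ppred_conj)
qed

lemma ppred_imp [pexp_intros]: "ppred P \<Longrightarrow> ppred Q \<Longrightarrow> ppred (\<lambda>x v. P x v \<longrightarrow> Q x v)"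
  unfolding imp_conv_disj by (intro ppred_not ppred_disj)

lemma ppred_less [pexp_intros]: "pexp a \<Longrightarrow> pexp b \<Longrightarrow> ppred (\<lambda>x v. a x v < b x v)"
proof -
  have eq: "of_bool (n < m) = (1 - (1 - (m - n)) :: nat)" for m n :: nat by auto
  show "pexp a \<Longrightarrow> pexp b \<Longrightarrow> ppred (\<lambda>x v. a x v < b x v)"
    unfolding ppred_def eq by (intro pexp_diff pexp_const)
qed

lemma ppred_le [pexp_intros]: "pexp a \<Longrightarrow> pexp b \<Longrightarrow> ppred (\<lambda>x v. a x v \<le> b x v)"
  by (simp only: not_less[symmetric]) (intro ppred_not ppred_less)

lemma ppred_eq [pexp_intros]: "pexp a \<Longrightarrow> pexp b \<Longrightarrow> ppred (\<lambda>x v. a x v = b x v)"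
  unfolding eq_iff by (intro ppred_conj ppred_le)

lemma ppred_iff [pexp_intros]: "ppred P \<Longrightarrow> ppred Q \<Longrightarrow> ppred (\<lambda>x v. P x v = Q x v)"
  unfolding iff_conv_conj_imp by (intro ppred_conj ppred_imp)

lemma ppred_bit [pexp_intros]: "pexp a \<Longrightarrow> ppred (\<lambda>x v. bit_at x (a x v))"
  unfolding ppred_def by (rule pexp_bit)

lemma ppred_bex [pexp_intros]:
  assumes "pexp a" "ppred (\<lambda>x v. P x (v 0) (\<lambda>k. v (Suc k)))"
  shows "ppred (\<lambda>x v. \<exists>i<a x v. P x i v)"
proof -
  have eq: "(\<exists>i<n. Q i) = (0 < (\<Sum>i<n. of_bool (Q i) :: nat))" for n :: nat and Q
    by (auto simp flip: neq0_conv)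
  show ?thesis unfolding eq
    by (intro ppred_less pexp_const pexp_sum assms(1) assms(2)[THEN ppredD])
qed

lemma ppred_ball [pexp_intros]:
  assumes "pexp a" "ppred (\<lambda>x v. P x (v 0) (\<lambda>k. v (Suc k)))"
  shows "ppred (\<lambda>x v. \<forall>i<a x v. P x i v)"
proof -
  have eq: "(\<forall>i<n. Q i) = (\<not> (\<exists>i<n. \<not> Q i))" for n :: nat and Q by auto
  show ?thesis unfolding eq by (intro ppred_not ppred_bex assms)
qed

lemma ppred_bex_le [pexp_intros]:
  assumes "pexp a" "ppred (\<lambda>x v. P x (v 0) (\<lambda>k. v (Suc k)))"
  shows "ppred (\<lambda>x v. \<exists>i\<le>a x v. P x i v)"
  unfolding less_Suc_eq_le[symmetric] Suc_eq_plus1 by (intro ppred_bex pexp_add pexp_const assms)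

lemma ppred_list_ex [pexp_intros]:
  "(\<And>y. y \<in> set ys \<Longrightarrow> ppred (\<lambda>x v. P y x v)) \<Longrightarrow> ppred (\<lambda>x v. \<exists>y\<in>set ys. P y x v)"
  by (induction ys) (simp_all add: ppred_const ppred_disj ppred_conj)

lemma pexp_if [pexp_intros]:
  assumes "ppred P" "pexp a" "pexp b"
  shows "pexp (\<lambda>x v. if P x v then a x v else b x v)"
proof -
  have eq: "(if b then m else n) = of_bool b * m + of_bool (\<not> b) * (n :: nat)" for b m n by auto
  show ?thesis unfolding eq by (intro pexp_add pexp_mult ppredD ppred_not assms)
qed

lemma ppred_if [pexp_intros]:
  "ppred P \<Longrightarrow> ppred Q \<Longrightarrow> ppred R \<Longrightarrow> ppred (\<lambda>x v. if P x v then Q x v else R x v)"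
  unfolding if_bool_eq_conj by (intro ppred_conj ppred_imp ppred_not)

text \<open>The quotient counts the \<open>i\<close> with \<open>(i + 1) * n \<le> m\<close>. The
  guard \<open>0 < n\<close> reproduces the convention that division by zero gives zero.\<close>

lemma pexp_div [pexp_intros]:
  assumes "pexp a" "pexp b"
  shows "pexp (\<lambda>x v. a x v div b x v)"
proof -
  have min: "(\<Sum>i<m. of_bool (i < k)) = min m k" for m k :: nat
    by (induction m) auto
  have *: "(\<Sum>i<m. of_bool (0 < n \<and> (i + 1) * n \<le> m)) = m div n" for m n :: nat
  proof (cases "n = 0")
    case False
    then have "(i + 1) * n \<le> m \<longleftrightarrow> i < m div n" for i
      using less_eq_div_iff_mult_less_eq[of n "i + 1" m] Suc_le_eq[of i "m div n"] by (simp only: Suc_eq_plus1)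
    then show ?thesis using False by (simp only: min min_absorb2 div_le_dividend neq0_conv simp_thms)
  qed simp
  have "pexp (\<lambda>x v. \<Sum>i<a x v. of_bool (0 < b x v \<and> (i + 1) * b x v \<le> a x v))"
    by (intro pexp_sum ppredD ppred_conj ppred_less ppred_le pexp_mult pexp_add pexp_var pexp_const
      pexp_shift[OF assms(1)] pexp_shift[OF assms(2)] assms)
  then show ?thesis by (simp only: *)
qed

lemma pexp_mod [pexp_intros]: "pexp a \<Longrightarrow> pexp b \<Longrightarrow> pexp (\<lambda>x v. a x v mod b x v)"
  unfolding minus_div_mult_eq_mod[symmetric] by (intro pexp_diff pexp_mult pexp_div)

lemma pexp_poly [pexp_intros]: "pexp a \<Longrightarrow> pexp (\<lambda>x v. poly p (a x v))"
  by (induction p) (simp_all add: pexp_const pexp_add pexp_mult)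

text \<open>All machines that have to be constructed are obtained from here: a function is given by
  its output length and by a predicate for its single bits.\<close>

theorem polytime_bits:
  assumes "pexp (\<lambda>x v. N x)" "ppred (\<lambda>x v. P x (v 0))"
  shows "polytime (\<lambda>x. map (P x) [0..<N x])"
proof -
  obtain a where a: "\<And>x v. eval x a (case_nat (length x) v) = N x" using assms by (auto simp: pexp_def)
  obtain e where e: "\<And>x v. eval x e (case_nat (length x) v) = of_bool (P x (v 0))"
    using assms by (auto simp: ppred_def pexp_def)
  let ?s = "case_nat 1 (case_nat 0 (\<lambda>k. 1))"
  have 1: "eval x a (\<lambda>_. length x) = N x" for x
  proof -
    have "case_nat (length x) (\<lambda>_. length x) = (\<lambda>_. length x)" by (auto simp: fun_eq_iff split: nat.split)
    then show ?thesis using a[of x "\<lambda>_. length x"] by simp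
  qed
  have *: "(\<lambda>k. case_nat i (\<lambda>_. length x) (?s k)) = case_nat (length x) (case_nat i (\<lambda>_. length x))" for i and x :: "bool list"
    by (auto simp: fun_eq_iff split: nat.split)
  have "out_bits a (ren ?s e) = (\<lambda>x. map (P x) [0..<N x])"
    by (simp only: fun_eq_iff out_bits_def 1 eval_ren * e nat.case of_bool_eq_0_iff not_not) simp
  then show ?thesis using polytime_out_bits[of a "ren ?s e"] by simp
qed

lemma class_PI:
  assumes "ppred (\<lambda>x v. x \<in> L)"
  shows "L \<in> class_P"
  using polytime_bits[OF pexp_const[of 1], of "\<lambda>x _. x \<in> L"] assms by (simp add: class_P_def)

section \<open>List colourings of gadget networks and quantified formulas\<close>

section \<open>Networks of list-colouring gadgets\<close>

datatype ('x, 'k) node = Pos 'x | Neg 'x | Mid 'x | Opp 'x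
  | Path 'k nat nat | Side 'k nat bool | Mer 'k nat | Cla 'k

text \<open>A clause \<open>k\<close> has one wire for each of its slots \<open>i \<in> sl k\<close>, from the literal \<open>src k i\<close> along a
  path of \<open>len k i\<close> nodes and through a square of the last path node, two \<open>Side\<close>s and \<open>Mer\<close>.
  Universal variables get a square of nodes, the others a triangle.\<close>

locale network =
  fixes X U :: "'x set" and K :: "'k set" and sl :: "'k \<Rightarrow> nat set"
    and src :: "'k \<Rightarrow> nat \<Rightarrow> 'x \<times> bool" and len :: "'k \<Rightarrow> nat \<Rightarrow> nat"
  assumes U_sub: "U \<subseteq> X"
    and sl: "k \<in> K \<Longrightarrow> sl k \<subseteq> {..<3} \<and> card (sl k) \<in> {2, 3}"
    and src_X: "k \<in> K \<Longrightarrow> i \<in> sl k \<Longrightarrow> fst (src k i) \<in> X"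
    and len: "k \<in> K \<Longrightarrow> i \<in> sl k \<Longrightarrow> len k i \<ge> 1"
    and occ2: "x \<in> X - U \<Longrightarrow> \<exists>w w'. {(k, i). k \<in> K \<and> i \<in> sl k \<and> src k i = (x, b)} \<subseteq> {w, w'}"
    and occ1: "x \<in> U \<Longrightarrow> \<exists>w. {(k, i). k \<in> K \<and> i \<in> sl k \<and> src k i = (x, b)} \<subseteq> {w}"
begin

text \<open>The terminals of a square are the opposite corners \<open>Pos\<close> and
  \<open>Opp\<close>; those of a triangle are \<open>Pos\<close> and \<open>Neg\<close>.\<close>

definition term_node :: "'x \<times> bool \<Rightarrow> ('x, 'k) node" where
  "term_node = (\<lambda>(x, b). if b then Pos x else if x \<in> U then Opp x else Neg x)"

inductive_set nodes :: "('x, 'k) node set" where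
  "x \<in> X \<Longrightarrow> Pos x \<in> nodes"
| "x \<in> X \<Longrightarrow> Neg x \<in> nodes"
| "x \<in> X \<Longrightarrow> Mid x \<in> nodes"
| "x \<in> U \<Longrightarrow> Opp x \<in> nodes"
| "k \<in> K \<Longrightarrow> i \<in> sl k \<Longrightarrow> n < len k i \<Longrightarrow> Path k i n \<in> nodes"
| "k \<in> K \<Longrightarrow> i \<in> sl k \<Longrightarrow> Side k i b \<in> nodes"
| "k \<in> K \<Longrightarrow> i \<in> sl k \<Longrightarrow> Mer k i \<in> nodes"
| "k \<in> K \<Longrightarrow> Cla k \<in> nodes"

inductive_set harc :: "(('x, 'k) node \<times> ('x, 'k) node) set" where
  PosNeg: "x \<in> X \<Longrightarrow> (Pos x, Neg x) \<in> harc"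
| PosMid: "x \<in> X \<Longrightarrow> (Pos x, Mid x) \<in> harc"
| NegMid: "x \<in> X \<Longrightarrow> x \<notin> U \<Longrightarrow> (Neg x, Mid x) \<in> harc"
| NegOpp: "x \<in> U \<Longrightarrow> (Neg x, Opp x) \<in> harc"
| MidOpp: "x \<in> U \<Longrightarrow> (Mid x, Opp x) \<in> harc"
| SrcPath: "k \<in> K \<Longrightarrow> i \<in> sl k \<Longrightarrow> (term_node (src k i), Path k i 0) \<in> harc"
| PathPath: "k \<in> K \<Longrightarrow> i \<in> sl k \<Longrightarrow> Suc n < len k i \<Longrightarrow> (Path k i n, Path k i (Suc n)) \<in> harc"
| PathSide: "k \<in> K \<Longrightarrow> i \<in> sl k \<Longrightarrow> (Path k i (len k i - 1), Side k i b) \<in> harc"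
| SideMer: "k \<in> K \<Longrightarrow> i \<in> sl k \<Longrightarrow> (Side k i b, Mer k i) \<in> harc"
| MerCla: "k \<in> K \<Longrightarrow> i \<in> sl k \<Longrightarrow> (Mer k i, Cla k) \<in> harc"

text \<open>A clause has as many colours as slots, so it is blocked only if all of its wires are
  restricted, each to a different colour of the clause.\<close>

fun hsize :: "('x, 'k) node \<Rightarrow> nat" where
  "hsize (Pos x) = (if x \<in> U then 2 else 3)"
| "hsize (Neg x) = (if x \<in> U then 2 else 3)"
| "hsize (Mid x) = 2"
| "hsize (Opp x) = 2"
| "hsize (Path k i n) = 2"
| "hsize (Side k i b) = 2"
| "hsize (Mer k i) = 3"
| "hsize (Cla k) = card (sl k)"

definition hcolouring :: "(('x, 'k) node \<Rightarrow> nat set) \<Rightarrow> (('x, 'k) node \<Rightarrow> nat) \<Rightarrow> bool" where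
  "hcolouring M c \<longleftrightarrow> (\<forall>v\<in>nodes. c v \<in> M v) \<and> (\<forall>(u, v)\<in>harc. c u \<noteq> c v)"

definition sat :: "('x \<Rightarrow> bool) \<Rightarrow> bool" where
  "sat val \<longleftrightarrow> (\<forall>k\<in>K. \<exists>i\<in>sl k. val (fst (src k i)) = snd (src k i))"

end

lemma ex_notin_card:
  assumes "finite F" "card F < card A"
  shows "\<exists>a\<in>A. a \<notin> F"
  using assms by (metis card_mono linorder_not_less subsetI)

lemma ex_neq1: "card A \<ge> 2 \<Longrightarrow> \<exists>a\<in>A. a \<noteq> (s :: nat)"
  using ex_notin_card[of "{s}" A] by auto

lemma ex_neq2: "card A \<ge> 3 \<Longrightarrow> \<exists>a\<in>A. a \<noteq> s \<and> a \<noteq> (t :: nat)"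
  using ex_notin_card[of "{s, t}" A] by (auto simp: card_insert_if)

text \<open>\<open>wext A B M Ls g m\<close>: if the source of a wire has colour \<open>g\<close>, the wire can be coloured from its
  lists so that \<open>Mer\<close> gets colour \<open>m\<close>.\<close>

fun wext :: "nat set \<Rightarrow> nat set \<Rightarrow> nat set \<Rightarrow> nat set list \<Rightarrow> nat \<Rightarrow> nat \<Rightarrow> bool" where
  "wext A B M [] g m \<longleftrightarrow> m \<in> M \<and> (\<exists>a\<in>A. \<exists>b\<in>B. a \<noteq> g \<and> b \<noteq> g \<and> m \<noteq> a \<and> m \<noteq> b)"
| "wext A B M (L # Ls) g m \<longleftrightarrow> (\<exists>c\<in>L. c \<noteq> g \<and> wext A B M Ls c m)"

text \<open>Only one colour of the source can restrict \<open>Mer\<close> to a single colour. In a square this takes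
  side lists with exactly one common colour, which is then the colour of the last path node.\<close>

lemma wext_bad:
  assumes AB: "card A = 2" "card B = 2" "card M = 3" and "\<forall>L\<in>set Ls. card L = 2"
  shows "\<exists>z. \<forall>g. (\<exists>m. wext A B M Ls g m) \<and> (g \<noteq> z \<longrightarrow> (\<forall>t. \<exists>m. m \<noteq> t \<and> wext A B M Ls g m))"
  using assms(4)
proof (induction Ls)
  case Nil
  \<comment> \<open>If the side lists do not meet in exactly one colour, the choice is arbitrary, as
    no colour of the source is bad then.\<close>
  define z where "z = (SOME s. A \<inter> B = {s})"
  show ?case
  proof (rule exI[of _ z], intro allI conjI impI)
    fix g
    obtain a b where "a \<in> A" "a \<noteq> g" "b \<in> B" "b \<noteq> g" using AB ex_neq1 by (metis order_refl)
    moreover obtain m where "m \<in> M" "m \<noteq> a" "m \<noteq> b" using AB ex_neq2[of M a b] by auto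
    ultimately show "\<exists>m. wext A B M [] g m" by auto
    fix t assume z: "g \<noteq> z"
    \<comment> \<open>A side whose list misses \<open>g\<close> keeps two admissible colours. So
      \<open>Mer\<close> is coloured before it, with only the other side and \<open>t\<close> to
      avoid.\<close>
    have sym: "\<exists>m. m \<noteq> t \<and> m \<in> M \<and> (\<exists>a\<in>A'. \<exists>b\<in>B'. a \<noteq> g \<and> b \<noteq> g \<and> m \<noteq> a \<and> m \<noteq> b)"
      if "card A' = 2" "card B' = 2" "g \<notin> A'" for A' B'
    proof -
      obtain b where b: "b \<in> B'" "b \<noteq> g" using \<open>card B' = 2\<close> ex_neq1[of B' g] by auto
      obtain m where m: "m \<in> M" "m \<noteq> b" "m \<noteq> t" using AB ex_neq2[of M b t] by auto
      obtain a where "a \<in> A'" "a \<noteq> m" using \<open>card A' = 2\<close> ex_neq1[of A' m] by auto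
      with b m that show ?thesis by metis
    qed
    consider "g \<notin> A" | "g \<notin> B" | "g \<in> A" "g \<in> B" by blast
    then show "\<exists>m. m \<noteq> t \<and> wext A B M [] g m"
    proof cases
      case 1
      then show ?thesis using sym[of A B] AB by auto
    next
      case 2
      then show ?thesis using sym[of B A] AB by (metis wext.simps(1))
    next
      case 3
      have "A \<inter> B \<noteq> {g}"
      proof
        assume *: "A \<inter> B = {g}"
        then have "A \<inter> B = {z}" unfolding z_def by (rule someI)
        with * z show False by simp
      qed
      \<comment> \<open>Both sides take the common colour \<open>a\<close>, which leaves
        \<open>Mer\<close> with only \<open>a\<close> and \<open>t\<close> to avoid.\<close>
      then obtain a where a: "a \<in> A" "a \<in> B" "a \<noteq> g" using 3 by blast
      obtain m where "m \<in> M" "m \<noteq> a" "m \<noteq> t" using AB ex_neq2[of M a t] by auto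
      with a show ?thesis by auto
    qed
  qed
next
  case (Cons L Ls)
  then obtain z where z: "\<And>g. \<exists>m. wext A B M Ls g m"
    "\<And>g t. g \<noteq> z \<Longrightarrow> \<exists>m. m \<noteq> t \<and> wext A B M Ls g m" by auto
  have L: "card L = 2" using Cons.prems by simp
  show ?case
  proof (cases "z \<in> L")
    case True
    \<comment> \<open>This node is forced to the bad colour \<open>z\<close> only by the colour
      \<open>w\<close> of its predecessor, so badness moves back by one node and remains
      unique.\<close>
    then obtain w where w: "w \<in> L" "w \<noteq> z" using ex_neq1[of L z] L by auto
    show ?thesis
    proof (rule exI[of _ w], intro allI conjI impI)
      fix g
      obtain c where "c \<in> L" "c \<noteq> g" using ex_neq1[of L g] L by auto
      then show "\<exists>m. wext A B M (L # Ls) g m" using z(1)[of c] by auto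
      show "\<exists>m. m \<noteq> t \<and> wext A B M (L # Ls) g m" if "g \<noteq> w" for t
        using z(2)[OF w(2), of t] w that by auto
    qed
  next
    case False
    show ?thesis
    proof (rule exI, intro allI conjI impI)
      fix g
      obtain c where c: "c \<in> L" "c \<noteq> g" using ex_neq1[of L g] L by auto
      then show "\<exists>m. wext A B M (L # Ls) g m" using z(1)[of c] by auto
      show "\<exists>m. m \<noteq> t \<and> wext A B M (L # Ls) g m" for t
        using z(2)[of c t] c False by auto
    qed
  qed
qed

lemma wextE:
  assumes "wext A B M Ls g m"
  obtains p a b where "\<And>n. n < length Ls \<Longrightarrow> p n \<in> Ls ! n" "Ls \<noteq> [] \<Longrightarrow> p 0 \<noteq> g"
    "\<And>n. Suc n < length Ls \<Longrightarrow> p n \<noteq> p (Suc n)" "a \<in> A" "b \<in> B" "m \<in> M" "m \<noteq> a" "m \<noteq> b"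
    "a \<noteq> (if Ls = [] then g else p (length Ls - 1))" "b \<noteq> (if Ls = [] then g else p (length Ls - 1))"
  using assms
proof (induction Ls arbitrary: g thesis)
  case Nil
  then show ?case by auto
next
  case (Cons L Ls)
  from Cons.prems(2) obtain c where c: "c \<in> L" "c \<noteq> g" "wext A B M Ls c m" by auto
  from c(3) obtain p a b where p: "\<And>n. n < length Ls \<Longrightarrow> p n \<in> Ls ! n" "Ls \<noteq> [] \<Longrightarrow> p 0 \<noteq> c"
    "\<And>n. Suc n < length Ls \<Longrightarrow> p n \<noteq> p (Suc n)" "a \<in> A" "b \<in> B" "m \<in> M" "m \<noteq> a" "m \<noteq> b"
    "a \<noteq> (if Ls = [] then c else p (length Ls - 1))" "b \<noteq> (if Ls = [] then c else p (length Ls - 1))"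
    by (rule Cons.IH[rotated]) blast
  have last: "case_nat c p (length (L # Ls) - 1) = (if Ls = [] then c else p (length Ls - 1))"
    by (cases Ls) auto
  show ?case
  proof (rule Cons.prems(1)[of "case_nat c p" a b])
    show "case_nat c p n \<in> (L # Ls) ! n" if "n < length (L # Ls)" for n
      using that p(1) c(1) by (cases n) auto
    show "case_nat c p n \<noteq> case_nat c p (Suc n)" if "Suc n < length (L # Ls)" for n
      using that p(2) p(3) by (cases n) fastforce+
  qed (use c p last in auto)
qed

text \<open>The terminal that has to avoid \<open>F\<close> comes first, then the vertex with two
  colours, and last the other terminal, which has a third colour left.\<close>

lemma triangle_colouring:
  assumes "card P = 3" "card N = 3" "card M = 2" "card F \<le> 2" "finite F"
  shows "\<exists>p\<in>P. \<exists>n\<in>N. \<exists>m\<in>M. p \<notin> F \<and> p \<noteq> n \<and> p \<noteq> m \<and> n \<noteq> (m :: nat)"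
proof -
  obtain p where p: "p \<in> P" "p \<notin> F" using ex_notin_card[of F P] assms by auto
  obtain m where m: "m \<in> M" "m \<noteq> p" using ex_neq1[of M p] assms by auto
  obtain n where "n \<in> N" "n \<noteq> p" "n \<noteq> m" using ex_neq2[of N p m] assms by auto
  with p m show ?thesis by metis
qed

text \<open>Each of the lists \<open>N\<close>, \<open>M\<close> forbids at most two of the pairs \<open>(p, q)\<close>, and never so that all the
  remaining ones coincide.\<close>

lemma square_colouring:
  assumes "card P = 2" "card N = 2" "card M = 2" "card Q = 2"
  shows "\<exists>p\<in>P. \<exists>n\<in>N. \<exists>m\<in>M. \<exists>q\<in>Q. p \<noteq> n \<and> p \<noteq> m \<and> q \<noteq> n \<and> q \<noteq> m \<and> (p \<noteq> f \<or> q \<noteq> (g :: nat))"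
proof (rule ccontr)
  assume neg: "\<not> ?thesis"
  have ex: "\<exists>n\<in>N'. p \<noteq> n \<and> q \<noteq> n" if "card N' = 2" "N' \<noteq> {p, q}" for N' :: "nat set" and p q
    using that by (auto simp: card_2_iff)
  have bl: "N = {p, q} \<or> M = {p, q}" if "p \<in> P" "q \<in> Q" "p \<noteq> f \<or> q \<noteq> g" for p q
    using ex[of N p q] ex[of M p q] neg that assms by blast
  obtain p where p: "p \<in> P" "p \<noteq> f" using ex_neq1[of P f] assms by auto
  obtain p' where p': "p' \<in> P" "p' \<noteq> p" using ex_neq1[of P p] assms by auto
  obtain q where q: "q \<in> Q" "q \<noteq> g" using ex_neq1[of Q g] assms by auto
  obtain q' where q': "q' \<in> Q" "q' \<noteq> q" using ex_neq1[of Q q] assms by auto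
  have ne: "N \<noteq> {r}" "M \<noteq> {r}" for r using assms by auto
  show False
    using bl[OF p(1) q(1)] bl[OF p(1) q'(1)] bl[OF p'(1) q(1)] p p' q q' ne by (auto simp: doubleton_eq_iff)
qed

context network
begin

lemma wires_finite:
  assumes "x \<in> X"
  shows "finite {(k, i). k \<in> K \<and> i \<in> sl k \<and> src k i = (x, b)}"
    and "card {(k, i). k \<in> K \<and> i \<in> sl k \<and> src k i = (x, b)} \<le> 2"
    and "x \<in> U \<Longrightarrow> card {(k, i). k \<in> K \<and> i \<in> sl k \<and> src k i = (x, b)} \<le> 1"
proof -
  let ?S = "{(k, i). k \<in> K \<and> i \<in> sl k \<and> src k i = (x, b)}"
  obtain w w' where w: "?S \<subseteq> {w, w'}" "x \<in> U \<Longrightarrow> w' = w"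
    using assms occ1[of x b] occ2[of x b] by (cases "x \<in> U") auto
  then show "finite ?S" by (simp add: finite_subset)
  have "card ?S \<le> card {w, w'}" using w by (intro card_mono) auto
  then show "card ?S \<le> 2" "x \<in> U \<Longrightarrow> card ?S \<le> 1" using w(2) by (auto simp: card_insert_if split: if_splits)
qed

lemma sl_finite: "k \<in> K \<Longrightarrow> finite (sl k)"
  using sl finite_subset by blast

text \<open>The lists play the adversary of the formula: they fix the values of the universal
  variables. An assignment that satisfies the formula for these values tells which terminals have to
  stay away from the bad colours of their wires.\<close>

theorem complete:
  assumes M: "\<forall>v\<in>nodes. card (M v) = hsize v"
    and sat: "\<And>a. \<exists>val. (\<forall>x\<in>U. val x = a x) \<and> sat val"
  shows "\<exists>c. hcolouring M c"
proof -
  define Ls where "Ls = (\<lambda>k i. map (\<lambda>n. M (Path k i n)) [0..<len k i])"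
  define W where "W = (\<lambda>k i. wext (M (Side k i False)) (M (Side k i True)) (M (Mer k i)) (Ls k i))"
  have "\<exists>z. \<forall>g. (\<exists>m. W k i g m) \<and> (g \<noteq> z \<longrightarrow> (\<forall>t. \<exists>m. m \<noteq> t \<and> W k i g m))" if "k \<in> K" "i \<in> sl k" for k i
    unfolding W_def by (rule wext_bad) (use M that in \<open>auto simp: Ls_def nodes.intros\<close>)
  then obtain z where z: "\<And>k i g. k \<in> K \<Longrightarrow> i \<in> sl k \<Longrightarrow> \<exists>m. W k i g m"
    "\<And>k i g t. k \<in> K \<Longrightarrow> i \<in> sl k \<Longrightarrow> g \<noteq> z k i \<Longrightarrow> \<exists>m. m \<noteq> t \<and> W k i g m" by metis
  define F where "F = (\<lambda>x b. (\<lambda>(k, i). z k i) ` {(k, i). k \<in> K \<and> i \<in> sl k \<and> src k i = (x, b)})"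
  have F: "finite (F x b)" "card (F x b) \<le> 2" "x \<in> U \<Longrightarrow> card (F x b) \<le> 1" if "x \<in> X" for x b
    unfolding F_def using wires_finite[OF that, of b] by (auto intro: card_image_le[THEN le_trans])
  have F1: "\<exists>f. F x b \<subseteq> {f}" if "x \<in> U" for x b
    using F[of x b] that U_sub by (auto simp: le_Suc_eq card_1_singleton_iff)
  define ok where "ok = (\<lambda>x p n m q. p \<in> M (Pos x) \<and> n \<in> M (Neg x) \<and> m \<in> M (Mid x) \<and> p \<noteq> n \<and> p \<noteq> m
    \<and> (if x \<in> U then q \<in> M (Opp x) \<and> n \<noteq> q \<and> m \<noteq> q else n \<noteq> m))"
  \<comment> \<open>The universal value says whether the lists allow \<open>Pos\<close> to avoid its
    bad colour. If they do not, \<open>square_colouring\<close> yields a colouring in which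
    \<open>Opp\<close> avoids its own.\<close>
  define a where "a = (\<lambda>x. \<exists>p n m q. ok x p n m q \<and> p \<notin> F x True)"
  obtain val where val: "\<And>x. x \<in> U \<Longrightarrow> val x = a x" "sat val" using sat[of a] by blast
  have "\<exists>p n m q. ok x p n m q \<and> (val x \<longrightarrow> p \<notin> F x True) \<and>
      (\<not> val x \<longrightarrow> (if x \<in> U then q else n) \<notin> F x False)" if x: "x \<in> X" for x
  proof (cases "x \<in> U")
    case True
    obtain f g where fg: "F x True \<subseteq> {f}" "F x False \<subseteq> {g}" using F1[OF True] by meson
    have "card (M (Pos x)) = 2" "card (M (Neg x)) = 2" "card (M (Mid x)) = 2" "card (M (Opp x)) = 2"
      using M x True by (auto simp: nodes.intros)
    from square_colouring[OF this, of f g] obtain p n m q where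
      "p \<in> M (Pos x)" "n \<in> M (Neg x)" "m \<in> M (Mid x)" "q \<in> M (Opp x)"
      "p \<noteq> n" "p \<noteq> m" "q \<noteq> n" "q \<noteq> m" "p \<noteq> f \<or> q \<noteq> g" by blast
    then have pq: "ok x p n m q" "p \<notin> F x True \<or> q \<notin> F x False"
      using True fg by (auto simp: ok_def)
    show ?thesis
    proof (cases "val x")
      case True
      then have "a x" using val(1)[OF \<open>x \<in> U\<close>] by simp
      then show ?thesis unfolding a_def using True by blast
    next
      case False
      then have "\<not> a x" using val(1)[OF \<open>x \<in> U\<close>] by simp
      then have "q \<notin> F x False" using pq unfolding a_def by blast
      then show ?thesis using pq(1) True False by auto
    qed
  next
    case False
    have c: "card (M (Pos x)) = 3" "card (M (Neg x)) = 3" "card (M (Mid x)) = 2"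
      using M x False by (auto simp: nodes.intros)
    show ?thesis
    proof (cases "val x")
      case True
      then show ?thesis
        using triangle_colouring[OF c F(2,1)[OF x, of True]] False unfolding ok_def by auto
    next
      case nval: False
      then show ?thesis
        using triangle_colouring[OF c(2,1,3) F(2,1)[OF x, of False]] False unfolding ok_def by auto
    qed
  qed
  then obtain p n m q where pn: "\<And>x. x \<in> X \<Longrightarrow> ok x (p x) (n x) (m x) (q x)"
    "\<And>x. x \<in> X \<Longrightarrow> val x \<Longrightarrow> p x \<notin> F x True"
    "\<And>x. x \<in> X \<Longrightarrow> \<not> val x \<Longrightarrow> (if x \<in> U then q x else n x) \<notin> F x False" by metis
  define sc where "sc = (\<lambda>(x, b). if b then p x else if x \<in> U then q x else n x)"
  have good: "sc (src k i) \<noteq> z k i" if "k \<in> K" "i \<in> sl k" "val (fst (src k i)) = snd (src k i)" for k i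
  proof -
    obtain x b where xb: "src k i = (x, b)" by fastforce
    have "z k i \<in> F x b" unfolding F_def using that xb by force
    then show ?thesis using pn(2,3)[of x] src_X[OF that(1,2)] that(3) by (cases b) (auto simp: xb sc_def)
  qed
  have "\<exists>y t. y \<in> M (Cla k) \<and> (\<forall>i\<in>sl k. t i \<noteq> y \<and> W k i (sc (src k i)) (t i))" if k: "k \<in> K" for k
  proof -
    obtain i0 where i0: "i0 \<in> sl k" "val (fst (src k i0)) = snd (src k i0)" using val(2) k by (auto simp: sat_def)
    have "\<forall>i\<in>sl k. \<exists>m. W k i (sc (src k i)) m" using z(1)[OF k] by blast
    then obtain \<mu> where \<mu>: "\<And>i. i \<in> sl k \<Longrightarrow> W k i (sc (src k i)) (\<mu> i)" by metis
    \<comment> \<open>The wires other than \<open>i0\<close> block fewer colours than the clause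
      has; the wire of the true literal adapts to whichever colour \<open>y\<close> is left.\<close>
    have "card (\<mu> ` (sl k - {i0})) < card (M (Cla k))"
      using M k i0 sl_finite[OF k] card_image_le[of "sl k - {i0}" \<mu>] sl[OF k]
      by (auto simp: nodes.intros card_Diff_singleton)
    then obtain y where y: "y \<in> M (Cla k)" "y \<notin> \<mu> ` (sl k - {i0})"
      using ex_notin_card[of "\<mu> ` (sl k - {i0})"] sl_finite[OF k] by auto
    have "\<exists>t. t \<noteq> y \<and> W k i (sc (src k i)) t" if "i \<in> sl k" for i
    proof (cases "i = i0")
      case True
      then show ?thesis using z(2)[OF k i0(1) good[OF k i0], of y] by auto
    next
      case False
      then show ?thesis using \<mu>[OF that] y that by (intro exI[of _ "\<mu> i"]) auto
    qed
    with y show ?thesis by metis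
  qed
  then obtain y t where yt0: "\<And>k. k \<in> K \<Longrightarrow> y k \<in> M (Cla k) \<and> (\<forall>i\<in>sl k. t k i \<noteq> y k \<and> W k i (sc (src k i)) (t k i))"
    by metis
  then have yt: "\<And>k. k \<in> K \<Longrightarrow> y k \<in> M (Cla k)" "\<And>k i. k \<in> K \<Longrightarrow> i \<in> sl k \<Longrightarrow> t k i \<noteq> y k"
    "\<And>k i. k \<in> K \<Longrightarrow> i \<in> sl k \<Longrightarrow> W k i (sc (src k i)) (t k i)" by blast+
  define R where "R = (\<lambda>k i r a b. (\<forall>j<len k i. r j \<in> M (Path k i j)) \<and> r 0 \<noteq> sc (src k i) \<and> (\<forall>j. Suc j < len k i \<longrightarrow> r j \<noteq> r (Suc j))
      \<and> a \<in> M (Side k i False) \<and> b \<in> M (Side k i True) \<and> t k i \<in> M (Mer k i) \<and> t k i \<noteq> a \<and> t k i \<noteq> b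
      \<and> a \<noteq> r (len k i - 1) \<and> b \<noteq> r (len k i - 1))"
  have "\<exists>r a b. R k i r a b" if ki: "k \<in> K" "i \<in> sl k" for k i
  proof -
    have ne: "Ls k i \<noteq> []" "length (Ls k i) = len k i" "\<And>j. j < len k i \<Longrightarrow> Ls k i ! j = M (Path k i j)"
      using len[OF ki] by (auto simp: Ls_def)
    show ?thesis
      using yt(3)[OF ki] unfolding W_def
    proof (rule wextE, goal_cases)
      case (1 r a b)
      then have "R k i r a b" using ne by (simp add: R_def)
      then show ?case by blast
    qed
  qed
  then obtain r s1 s2 where "\<And>k i. k \<in> K \<Longrightarrow> i \<in> sl k \<Longrightarrow> R k i (r k i) (s1 k i) (s2 k i)" by metis
  then have r: "\<And>k i j. k \<in> K \<Longrightarrow> i \<in> sl k \<Longrightarrow> j < len k i \<Longrightarrow> r k i j \<in> M (Path k i j)"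
    "\<And>k i. k \<in> K \<Longrightarrow> i \<in> sl k \<Longrightarrow> r k i 0 \<noteq> sc (src k i)"
    "\<And>k i j. k \<in> K \<Longrightarrow> i \<in> sl k \<Longrightarrow> Suc j < len k i \<Longrightarrow> r k i j \<noteq> r k i (Suc j)"
    "\<And>k i. k \<in> K \<Longrightarrow> i \<in> sl k \<Longrightarrow> s1 k i \<in> M (Side k i False)"
    "\<And>k i. k \<in> K \<Longrightarrow> i \<in> sl k \<Longrightarrow> s2 k i \<in> M (Side k i True)"
    "\<And>k i. k \<in> K \<Longrightarrow> i \<in> sl k \<Longrightarrow> t k i \<in> M (Mer k i)"
    "\<And>k i. k \<in> K \<Longrightarrow> i \<in> sl k \<Longrightarrow> t k i \<noteq> s1 k i"
    "\<And>k i. k \<in> K \<Longrightarrow> i \<in> sl k \<Longrightarrow> t k i \<noteq> s2 k i"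
    "\<And>k i. k \<in> K \<Longrightarrow> i \<in> sl k \<Longrightarrow> s1 k i \<noteq> r k i (len k i - 1)"
    "\<And>k i. k \<in> K \<Longrightarrow> i \<in> sl k \<Longrightarrow> s2 k i \<noteq> r k i (len k i - 1)" by (simp_all add: R_def)
  define c where "c = (\<lambda>v. case v of Pos x \<Rightarrow> p x | Neg x \<Rightarrow> n x | Mid x \<Rightarrow> m x | Opp x \<Rightarrow> q x
    | Path k i j \<Rightarrow> r k i j | Side k i b \<Rightarrow> if b then s2 k i else s1 k i | Mer k i \<Rightarrow> t k i | Cla k \<Rightarrow> y k)"
  have tn: "c (term_node l) = sc l" for l by (auto simp: c_def term_node_def sc_def split: prod.split)
  have "c v \<in> M v" if "v \<in> nodes" for v
    using that by cases (use pn(1) r yt U_sub in \<open>auto simp: c_def ok_def\<close>)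
  moreover have "c u \<noteq> c v" if "(u, v) \<in> harc" for u v
    using that
  proof cases
    case (SrcPath k i)
    then show ?thesis using r(2)[of k i] by (simp add: tn) (simp add: c_def)
  next
    case (PosNeg x)
    then show ?thesis using pn(1)[of x] by (simp add: c_def ok_def)
  next
    case (PosMid x)
    then show ?thesis using pn(1)[of x] by (simp add: c_def ok_def)
  next
    case (NegMid x)
    then show ?thesis using pn(1)[of x] by (simp add: c_def ok_def)
  next
    case (NegOpp x)
    then show ?thesis using pn(1)[of x] U_sub by (auto simp: c_def ok_def)
  next
    case (MidOpp x)
    then show ?thesis using pn(1)[of x] U_sub by (auto simp: c_def ok_def)
  next
    case (PathPath k i j)
    then show ?thesis using r(3)[of k i j] by (simp add: c_def)
  next
    case (PathSide k i b)
    then show ?thesis using r(9,10)[of k i] by (cases b) (auto simp: c_def)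
  next
    case (SideMer k i b)
    then show ?thesis using r(7,8)[of k i] by (cases b) (auto simp: c_def)
  next
    case (MerCla k i)
    then show ?thesis using yt(2)[of k i] by (simp add: c_def)
  qed
  ultimately show ?thesis by (auto simp: hcolouring_def)
qed

definition forced :: "nat \<Rightarrow> nat" where
  "forced n = (if even n then 1 else 2)"

text \<open>Lists for which colour 3 of a literal is passed on along all wires.\<close>

fun lists :: "('x \<Rightarrow> bool) \<Rightarrow> ('x, 'k) node \<Rightarrow> nat set" where
  "lists a (Pos x) = (if x \<in> U then (if a x then {2, 4} else {1, 3}) else {1, 2, 3})"
| "lists a (Neg x) = (if x \<in> U then {1, 2} else {1, 2, 3})"
| "lists a (Mid x) = (if x \<in> U then {1, 4} else {1, 2})"
| "lists a (Opp x) = (if a x then {1, 3} else {2, 4})"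
| "lists a (Path k i n) = (if n = 0 then {1, 3} else {1, 2})"
| "lists a (Side k i b) = {forced (len k i - 1), if b then 4 else if i = 2 then 3 - forced (len k i - 1) else 3}"
| "lists a (Mer k i) = {4, if i = 2 then 3 - forced (len k i - 1) else 3, Suc i}"
| "lists a (Cla k) = Suc ` sl k"

lemma lists_size:
  assumes "v \<in> nodes"
  shows "lists a v \<subseteq> {1..4} \<and> card (lists a v) = hsize v"
  using assms
proof cases
  case (7 k i)
  then have "i < 3" using sl by blast
  then have "i = 0 \<or> i = 1 \<or> i = 2" by auto
  then show ?thesis using 7 by (auto simp: forced_def)
next
  case (8 k)
  then show ?thesis using sl[of k] by (auto simp: card_image)
qed (auto simp: forced_def)

theorem sound:
  assumes c: "hcolouring (lists a) c"
  shows "\<exists>val. (\<forall>x\<in>U. val x = a x) \<and> sat val"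
proof -
  have L: "c v \<in> lists a v" if "v \<in> nodes" for v using c that by (auto simp: hcolouring_def)
  have E: "c u \<noteq> c v" if "(u, v) \<in> harc" for u v using c that by (auto simp: hcolouring_def)
  define val where "val = (\<lambda>x. if x \<in> U then a x else c (Pos x) \<noteq> 3)"
  \<comment> \<open>In a square the four lists leave no colouring in which the terminal of the false
    literal avoids 3. In a triangle \<open>Mid\<close> has colour 1 or 2, so one of the terminals
    has colour 3, and \<open>val\<close> makes a literal true if its terminal does not have
    it.\<close>
  have bad: "c (term_node (x, b)) = 3" if x: "x \<in> X" and b: "val x \<noteq> b" for x b
  proof (cases "x \<in> U")
    case True
    have ls: "c (Pos x) \<in> lists a (Pos x)" "c (Neg x) \<in> lists a (Neg x)" "c (Mid x) \<in> lists a (Mid x)"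
      "c (Opp x) \<in> lists a (Opp x)" by (simp_all only: L nodes.intros x True)
    have es: "c (Pos x) \<noteq> c (Neg x)" "c (Pos x) \<noteq> c (Mid x)" "c (Neg x) \<noteq> c (Opp x)" "c (Mid x) \<noteq> c (Opp x)"
      using x True by (auto intro!: E harc.intros)
    show ?thesis
      using ls es True b by (cases b) (auto simp: term_node_def val_def split: if_splits)
  next
    case False
    have ls: "c (Pos x) \<in> lists a (Pos x)" "c (Neg x) \<in> lists a (Neg x)" "c (Mid x) \<in> lists a (Mid x)"
      by (simp_all only: L nodes.intros x)
    have es: "c (Pos x) \<noteq> c (Neg x)" "c (Pos x) \<noteq> c (Mid x)" "c (Neg x) \<noteq> c (Mid x)"
      using x False by (auto intro!: E harc.intros)
    show ?thesis
      using ls es False b by (cases b) (auto simp: term_node_def val_def split: if_splits)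
  qed
  have "\<exists>i\<in>sl k. val (fst (src k i)) = snd (src k i)" if k: "k \<in> K" for k
  proof (rule ccontr)
    assume *: "\<not> ?thesis"
    have "c (Cla k) \<noteq> Suc i" if i: "i \<in> sl k" for i
    proof -
      have "c (term_node (src k i)) = 3"
        using bad[of "fst (src k i)" "snd (src k i)"] src_X[OF k i] * i by simp
      \<comment> \<open>A source of colour 3 leaves only 1 in the first list; from there on the
        lists \<open>{1, 2}\<close> force an alternation.\<close>
      then have path: "c (Path k i n) = forced n" if "n < len k i" for n
        using that
      proof (induction n)
        case 0
        then show ?case using E[OF SrcPath[OF k i]] L[of "Path k i 0"] k i by (auto simp: forced_def nodes.intros)
      next
        case (Suc n)
        then show ?case using E[OF PathPath[OF k i Suc.prems(2)]] L[of "Path k i (Suc n)"] k i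
          by (auto simp: forced_def nodes.intros split: if_splits)
      qed
      have last: "c (Path k i (len k i - 1)) = forced (len k i - 1)"
        using len[OF k i] by (intro path) simp
      \<comment> \<open>The sides are forced to the two colours of \<open>Mer\<close> other than
        \<open>Suc i\<close>. In slot 2 the target \<open>Suc i\<close> is 3 itself, so the first
        side uses the colour in \<open>{1, 2}\<close> that the path does not end with.\<close>
      have "c (Side k i b) = (if b then 4 else if i = 2 then 3 - forced (len k i - 1) else 3)" for b
        using E[OF PathSide[OF k i, of b]] L[of "Side k i b"] k i
        by (auto simp: nodes.intros last[unfolded One_nat_def] forced_def split: if_splits)
      then have "c (Mer k i) = Suc i"
        using E[OF SideMer[OF k i, of False]] E[OF SideMer[OF k i, of True]] L[of "Mer k i"] k i
        by (auto simp: nodes.intros)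
      then show ?thesis using E[OF MerCla[OF k i]] by simp
    qed
    moreover have "c (Cla k) \<in> Suc ` sl k" using L[of "Cla k"] k by (auto simp: nodes.intros)
    ultimately show False by blast
  qed
  then show ?thesis by (intro exI[of _ val]) (auto simp: val_def sat_def)
qed

theorem network_correct:
  "(\<forall>M. (\<forall>v\<in>nodes. M v \<subseteq> {1..4} \<and> card (M v) = hsize v) \<longrightarrow> (\<exists>c. hcolouring M c))
    \<longleftrightarrow> (\<forall>a. \<exists>val. (\<forall>x\<in>U. val x = a x) \<and> sat val)"
proof (intro iffI allI impI)
  fix a assume "\<forall>M. (\<forall>v\<in>nodes. M v \<subseteq> {1..4} \<and> card (M v) = hsize v) \<longrightarrow> (\<exists>c. hcolouring M c)"
  then have "\<exists>c. hcolouring (lists a) c" using lists_size by blast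
  then show "\<exists>val. (\<forall>x\<in>U. val x = a x) \<and> sat val" using sound by blast
next
  fix M :: "('x, 'k) node \<Rightarrow> nat set"
  assume "\<forall>a. \<exists>val. (\<forall>x\<in>U. val x = a x) \<and> sat val"
    and "\<forall>v\<in>nodes. M v \<subseteq> {1..4} \<and> card (M v) = hsize v"
  then show "\<exists>c. hcolouring M c" using complete[of M] by blast
qed

end

section \<open>Helpers that forbid one colour but never two\<close>

section \<open>Simulating lists of size two\<close>

definition arc_graph :: "'a set \<Rightarrow> ('a \<times> 'a) set \<Rightarrow> 'a graph" where
  "arc_graph V R = (V, (\<lambda>(u, v). {u, v}) ` R)"

lemma arc_graph_sel [simp]: "verts (arc_graph V R) = V" "edges (arc_graph V R) = (\<lambda>(u, v). {u, v}) ` R"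
  by (simp_all add: arc_graph_def)

lemma arc_graph_edge: "{u, v} \<in> edges (arc_graph V R) \<longleftrightarrow> (u, v) \<in> R \<or> (v, u) \<in> R"
  by (auto simp: doubleton_eq_iff image_iff)

lemma proper_arc_graph:
  assumes "R \<subseteq> V \<times> V"
  shows "proper_coloring (arc_graph V R) c \<longleftrightarrow> (\<forall>(u, v)\<in>R. c u \<noteq> c v)"
  using assms by (fastforce simp: proper_coloring_def doubleton_eq_iff)

text \<open>The helper of a vertex consists of a vertex 1 adjacent to it (index 0) and of two copies
  2, 3, 4 and 5, 6, 7 of a triangle that has one vertex adjacent to 0 and two vertices adjacent to 1.\<close>

definition helper_arcs :: "(nat \<times> nat) set" where
  "helper_arcs = {(0, 1), (0, 2), (0, 5), (2, 3), (2, 4), (3, 4), (3, 1), (4, 1), (5, 6), (5, 7), (6, 7), (6, 1), (7, 1)}"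

text \<open>Points outside of \<open>D\<close> receive their seven extra vertices as isolated ones.
  The vertex set is thus a product, which makes its numbering arithmetical.\<close>

definition with_helpers :: "'v set \<Rightarrow> ('v \<times> 'v) set \<Rightarrow> 'v set \<Rightarrow> ('v \<times> nat) graph" where
  "with_helpers V A D = arc_graph (V \<times> {..<8})
     ((\<lambda>(u, v). ((u, 0), (v, 0))) ` A \<union> (\<lambda>(v, i, j). ((v, i), (v, j))) ` (D \<times> helper_arcs))"

lemma proper_with_helpers:
  assumes "A \<subseteq> V \<times> V" "D \<subseteq> V"
  shows "proper_coloring (with_helpers V A D) c \<longleftrightarrow>
    (\<forall>(u, v)\<in>A. c (u, 0) \<noteq> c (v, 0)) \<and> (\<forall>v\<in>D. \<forall>(i, j)\<in>helper_arcs. c (v, i) \<noteq> c (v, j))"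
proof -
  have "helper_arcs \<subseteq> {..<8} \<times> {..<8}" by (simp add: helper_arcs_def)
  then have "(\<lambda>(u, v). ((u, 0), (v, 0))) ` A \<union> (\<lambda>(v, i, j). ((v, i), (v, j))) ` (D \<times> helper_arcs)
    \<subseteq> (V \<times> {..<8}) \<times> (V \<times> {..<8})" using assms by fastforce
  from proper_arc_graph[OF this] show ?thesis
    unfolding with_helpers_def by (simp add: ball_Un split_beta) 
qed

text \<open>If there is no colouring, two different colours at two vertices of the triangle always
  exhaust the list of the third one; applied to each vertex in turn this makes the three lists
  coincide.\<close>

lemma triangle_lists:
  assumes "card X \<ge> 2" "card Y \<ge> 2" "card Z \<ge> 2"
    and no: "\<And>x y z. x \<in> X \<Longrightarrow> y \<in> Y \<Longrightarrow> z \<in> Z \<Longrightarrow> x \<noteq> y \<Longrightarrow> x \<noteq> z \<Longrightarrow> y = (z :: nat)"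
  shows "\<exists>p q. p \<noteq> q \<and> X = {p, q} \<and> Y = {p, q} \<and> Z = {p, q}"
proof -
  have ne: "X \<noteq> {}" "Y \<noteq> {}" "Z \<noteq> {}" using assms by auto
  obtain y where y: "y \<in> Y" using ne by blast
  obtain z where z: "z \<in> Z" "z \<noteq> y" using ex_neq1[of Z y] assms by auto
  have "X \<subseteq> {y, z}" using no y z by blast
  then have X: "X = {y, z}" using assms(1) z(2) by (intro card_seteq) auto
  obtain z' where z': "z' \<in> Z" "z' \<noteq> z" using ex_neq1[of Z z] assms by auto
  have "Y \<subseteq> {z, z'}" using no[of z] X z z' by blast
  then have "Y \<subseteq> {y, z}" using y z by blast
  then have Y: "Y = {y, z}" using assms(2) z(2) by (intro card_seteq) auto
  have "Z \<subseteq> {y, z}" using no[of y z] X Y z(2) by blast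
  then have "Z = {y, z}" using assms(3) z(2) by (intro card_seteq) auto
  then show ?thesis using X Y z(2) by blast
qed

text \<open>One triangle of a helper, where \<open>g\<close> is the colour of the helped vertex and
  \<open>h\<close> that of helper vertex 1.\<close>

definition tri_ext :: "nat set \<Rightarrow> nat set \<Rightarrow> nat set \<Rightarrow> nat \<Rightarrow> nat \<Rightarrow> bool" where
  "tri_ext B A C g h \<longleftrightarrow> (\<exists>b\<in>B. \<exists>a\<in>A. \<exists>c\<in>C. b \<noteq> g \<and> a \<noteq> h \<and> c \<noteq> h \<and> b \<noteq> a \<and> b \<noteq> c \<and> a \<noteq> c)"

lemma tri_ext_fails:
  assumes "card B = 3" "card A = 3" "card C = 3" "\<not> tri_ext B A C g h"
  shows "g \<in> B \<and> h \<in> A \<and> B - {g} = A - {h}"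
proof -
  have fin: "finite B" "finite A" "finite C" using assms by (auto intro: card_ge_0_finite)
  have "\<exists>p q. p \<noteq> q \<and> B - {g} = {p, q} \<and> A - {h} = {p, q} \<and> C - {h} = {p, q}"
  proof (rule triangle_lists)
    show "2 \<le> card (B - {g})" "2 \<le> card (A - {h})" "2 \<le> card (C - {h})"
      using assms fin by (auto simp: card_Diff_singleton_if)
    show "y = z" if "x \<in> B - {g}" "y \<in> A - {h}" "z \<in> C - {h}" "x \<noteq> y" "x \<noteq> z" for x y z
    proof (rule ccontr)
      assume "y \<noteq> z"
      then have "tri_ext B A C g h" unfolding tri_ext_def
        using that by (intro bexI[of _ x] bexI[of _ y] bexI[of _ z]) auto
      then show False using assms(4) by contradiction
    qed
  qed
  then obtain p q where pq: "p \<noteq> q" "B - {g} = {p, q}" "A - {h} = {p, q}" by blast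
  have "card (B - {g}) = 2" "card (A - {h}) = 2" unfolding pq using pq(1) by simp_all
  then have "g \<in> B" "h \<in> A" using assms(1,2) by (auto simp: card_Diff_singleton_if split: if_splits)
  then show ?thesis using pq by simp
qed

definition hext :: "(nat \<Rightarrow> nat set) \<Rightarrow> nat \<Rightarrow> bool" where
  "hext L g \<longleftrightarrow> (\<exists>c. c 0 = g \<and> (\<forall>i\<in>{1..<8}. c i \<in> L i) \<and> (\<forall>(i, j)\<in>helper_arcs. c i \<noteq> c j))"

text \<open>For fixed \<open>g\<close>, each triangle fails for at most one \<open>h\<close>. In the
  first triangle a failure with \<open>h \<noteq> g\<close> also determines \<open>g\<close>, as the
  only colour of \<open>L 2\<close> outside of \<open>L 3\<close>; this is \<open>r\<close>. For any
  other \<open>g\<close> the first triangle tolerates all \<open>h \<noteq> g\<close>, and of the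
  two or more colours left to vertex 1 the second triangle rejects at most one.\<close>

lemma helper_extends:
  assumes L: "\<And>i. i < 8 \<Longrightarrow> card (L i) = 3"
  shows "\<exists>r. \<forall>g. g \<noteq> r \<longrightarrow> hext L g"
proof -
  let ?T1 = "tri_ext (L 2) (L 3) (L 4)" and ?T2 = "tri_ext (L 5) (L 6) (L 7)"
  have fails1: "g \<in> L 2 \<and> h \<in> L 3 \<and> L 2 - {g} = L 3 - {h}" if "\<not> ?T1 g h" for g h
    using tri_ext_fails[OF _ _ _ that] L by simp
  have fails2: "g \<in> L 5 \<and> h \<in> L 6 \<and> L 5 - {g} = L 6 - {h}" if "\<not> ?T2 g h" for g h
    using tri_ext_fails[OF _ _ _ that] L by simp
  have u1: "h = h'" if "\<not> ?T1 g h" "\<not> ?T1 g h'" for g h h'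
    using fails1[OF that(1)] fails1[OF that(2)] by blast
  have u2: "h = h'" if "\<not> ?T2 g h" "\<not> ?T2 g h'" for g h h'
    using fails2[OF that(1)] fails2[OF that(2)] by blast
  have u: "g = g'" if "\<not> ?T1 g h" "h \<noteq> g" "\<not> ?T1 g' h'" "h' \<noteq> g'" for g h g' h'
    using fails1[OF that(1)] fails1[OF that(3)] that(2,4) by blast
  define r where "r = (SOME g. \<exists>h. h \<noteq> g \<and> \<not> ?T1 g h)"
  show ?thesis
  proof (rule exI[of _ r], intro allI impI)
    fix g assume "g \<noteq> r"
    then have T1: "?T1 g h" if "h \<noteq> g" for h
      unfolding r_def using u that by (metis (mono_tags, lifting) someI)
    obtain h where h: "h \<in> L 1" "h \<noteq> g" "?T2 g h"
    proof -
      obtain h where h: "h \<in> L 1" "h \<noteq> g" using ex_neq1[of "L 1" g] L by auto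
      obtain h' where h': "h' \<in> L 1" "h' \<noteq> g" "h' \<noteq> h" using ex_neq2[of "L 1" g h] L by auto
      show thesis using that[OF h] that[OF h'(1,2)] u2[of g h h'] h'(3) by blast
    qed
    obtain b1 a1 c1 where 1: "b1 \<in> L 2" "a1 \<in> L 3" "c1 \<in> L 4" "b1 \<noteq> g" "a1 \<noteq> h" "c1 \<noteq> h" "b1 \<noteq> a1" "b1 \<noteq> c1" "a1 \<noteq> c1"
      using T1[OF h(2)] by (auto simp: tri_ext_def)
    obtain b2 a2 c2 where 2: "b2 \<in> L 5" "a2 \<in> L 6" "c2 \<in> L 7" "b2 \<noteq> g" "a2 \<noteq> h" "c2 \<noteq> h" "b2 \<noteq> a2" "b2 \<noteq> c2" "a2 \<noteq> c2"
      using h(3) by (auto simp: tri_ext_def)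
    let ?c = "\<lambda>i. [g, h, b1, a1, c1, b2, a2, c2] ! i"
    have "\<forall>i\<in>{1..<8}. ?c i \<in> L i"
    proof
      fix i :: nat assume "i \<in> {1..<8}"
      then consider "i = 1" | "i = 2" | "i = 3" | "i = 4" | "i = 5" | "i = 6" | "i = 7" by fastforce
      then show "?c i \<in> L i" using h 1 2 by cases auto
    qed
    moreover have "\<forall>(i, j)\<in>helper_arcs. ?c i \<noteq> ?c j" using h 1 2 by (auto simp: helper_arcs_def)
    ultimately show "hext L g"
      unfolding hext_def by (intro exI[of _ ?c]) simp
  qed
qed

text \<open>Next to \<open>r\<close>, vertex 1 can only have \<open>q1\<close> or \<open>q2\<close>.
  The first triangle has just two colours left in the case of \<open>q1\<close>, the second one in
  the case of \<open>q2\<close>; so each copy excludes one of them.\<close>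

lemma helper_forces:
  assumes r: "r \<in> {1..4}"
  shows "\<exists>L. (\<forall>i. L i \<subseteq> {1..4} \<and> card (L i) = 3) \<and> \<not> hext L r"
proof -
  have "card ({1..4} - {r}) = 3" using r by simp
  then obtain q1 q2 q3 where "{1..4} - {r} = {q1, q2, q3}" "q1 \<noteq> q2" "q1 \<noteq> q3" "q2 \<noteq> q3"
    by (auto simp: card_3_iff)
  moreover have "{1..4} = insert r ({1..4} - {r})" "r \<notin> {1..4} - {r}" using r by blast+
  ultimately have q: "{1..4} = {r, q1, q2, q3}" "distinct [r, q1, q2, q3]" by (metis, force)
  \<comment> \<open>The entries are the missing colours of the vertices. The index is taken modulo 8
    because the claim is about all \<open>i\<close>.\<close>
  let ?L = "\<lambda>i. {1..4} - {[r, q3, q1, r, r, q2, r, r] ! (i mod 8)}"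
  have "?L i \<subseteq> {1..4} \<and> card (?L i) = 3" for i
  proof -
    have "[r, q3, q1, r, r, q2, r, r] ! (i mod 8) \<in> set [r, q3, q1, r, r, q2, r, r]"
      by (rule nth_mem) simp
    then have "[r, q3, q1, r, r, q2, r, r] ! (i mod 8) \<in> {1..4}" unfolding q(1) by auto
    then show ?thesis by (simp add: card_Diff_singleton)
  qed
  moreover have "c 0 \<noteq> r" if c: "\<forall>i\<in>{1..<8}. c i \<in> ?L i" and E: "\<forall>(i, j)\<in>helper_arcs. c i \<noteq> c j" for c
  proof
    assume 0: "c 0 = r"
    have cs: "c 1 \<in> {1..4} - {q3}" "c 2 \<in> {1..4} - {q1}" "c 3 \<in> {1..4} - {r}" "c 4 \<in> {1..4} - {r}"
      "c 5 \<in> {1..4} - {q2}" "c 6 \<in> {1..4} - {r}" "c 7 \<in> {1..4} - {r}"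
      using c[rule_format, of 1] c[rule_format, of 2] c[rule_format, of 3] c[rule_format, of 4]
        c[rule_format, of 5] c[rule_format, of 6] c[rule_format, of 7] by simp_all
    have ne: "c 0 \<noteq> c 1" "c 0 \<noteq> c 2" "c 0 \<noteq> c 5" "c 3 \<noteq> c 1" "c 4 \<noteq> c 1" "c 3 \<noteq> c 4" "c 2 \<noteq> c 3" "c 2 \<noteq> c 4"
      "c 6 \<noteq> c 1" "c 7 \<noteq> c 1" "c 6 \<noteq> c 7" "c 5 \<noteq> c 6" "c 5 \<noteq> c 7"
      using E unfolding helper_arcs_def by auto
    have "c 1 = q1 \<or> c 1 = q2" using cs(1) ne(1) 0 unfolding q(1) by auto
    then show False
    proof
      assume 1: "c 1 = q1"
      have "c 3 \<in> {q2, q3}" "c 4 \<in> {q2, q3}" "c 2 \<in> {q2, q3}"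
        using cs(2-4) ne 0 1 unfolding q(1) by auto
      then show False using ne(6-8) by auto
    next
      assume 1: "c 1 = q2"
      have "c 6 \<in> {q1, q3}" "c 7 \<in> {q1, q3}" "c 5 \<in> {q1, q3}"
        using cs(5-7) ne 0 1 unfolding q(1) by auto
      then show False using ne(11-13) by auto
    qed
  qed
  ultimately show ?thesis unfolding hext_def by (intro exI[of _ ?L]) blast
qed

text \<open>To pass from lists of size two to size three, a colour is added and the helper is made
  to forbid it. Conversely, the only colour that the helper may not tolerate is removed from a list
  of size three.\<close>

theorem choosable_with_helpers:
  fixes V :: "'v set"
  assumes A: "A \<subseteq> V \<times> V" and D: "D \<subseteq> V"
  shows "choosable 3 4 (with_helpers V A D) \<longleftrightarrow>
    (\<forall>M :: 'v \<Rightarrow> nat set. (\<forall>v\<in>V. M v \<subseteq> {1..4} \<and> card (M v) = (if v \<in> D then 2 else 3)) \<longrightarrow>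
      (\<exists>c. (\<forall>v\<in>V. c v \<in> M v) \<and> (\<forall>(u, v)\<in>A. c u \<noteq> c v)))"
proof (intro iffI allI impI)
  fix M :: "'v \<Rightarrow> nat set"
  assume ch: "choosable 3 4 (with_helpers V A D)" and M: "\<forall>v\<in>V. M v \<subseteq> {1..4} \<and> card (M v) = (if v \<in> D then 2 else 3)"
  have "\<forall>v\<in>D. \<exists>r. r \<in> {1..4} \<and> r \<notin> M v"
  proof
    fix v assume "v \<in> D"
    then have "card (M v) = 2" using M D by auto
    then have "finite (M v)" "card (M v) < card {1..4 :: nat}" by (auto intro: card_ge_0_finite)
    then show "\<exists>r. r \<in> {1..4} \<and> r \<notin> M v" using ex_notin_card by blast
  qed
  then obtain r where r: "\<And>v. v \<in> D \<Longrightarrow> r v \<in> {1..4} \<and> r v \<notin> M v" by metis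
  have "\<forall>v\<in>D. \<exists>L. (\<forall>i. L i \<subseteq> {1..4} \<and> card (L i) = 3) \<and> \<not> hext L (r v)"
    using r helper_forces by blast
  then obtain H where H: "\<And>v i. v \<in> D \<Longrightarrow> H v i \<subseteq> {1..4} \<and> card (H v i) = 3"
    "\<And>v. v \<in> D \<Longrightarrow> \<not> hext (H v) (r v)" by metis
  define L where "L = (\<lambda>(v, i). if v \<in> D then (if i = 0 then insert (r v) (M v) else H v i)
    else if i = (0 :: nat) then M v else {1..3})"
  have V: "verts (with_helpers V A D) = V \<times> {..<8}" by (simp add: with_helpers_def)
  have "L (v, i) \<subseteq> {1..4} \<and> card (L (v, i)) = 3" if v: "v \<in> V" for v i
  proof (cases "v \<in> D")
    case True
    then have "finite (M v)" "card (M v) = 2" "M v \<subseteq> {1..4}" using M v by (auto intro: card_ge_0_finite)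
    then show ?thesis using H(1)[OF True, of i] r[OF True] True by (simp add: L_def)
  next
    case False
    then show ?thesis using M v by (simp add: L_def)
  qed
  then have "\<forall>v\<in>verts (with_helpers V A D). L v \<subseteq> {1..4} \<and> card (L v) = 3" unfolding V by blast
  then obtain c where c: "\<forall>v\<in>verts (with_helpers V A D). c v \<in> L v" "proper_coloring (with_helpers V A D) c"
    using ch unfolding choosable_def by blast
  have p: "\<forall>(u, v)\<in>A. c (u, 0) \<noteq> c (v, 0)" "\<forall>v\<in>D. \<forall>(i, j)\<in>helper_arcs. c (v, i) \<noteq> c (v, j)"
    using c(2) proper_with_helpers[OF A D] by auto
  have "c (v, 0) \<in> M v" if v: "v \<in> V" for v
  proof (cases "v \<in> D")
    case True
    have "\<forall>i\<in>{1..<8}. c (v, i) \<in> H v i"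
    proof
      fix i :: nat assume "i \<in> {1..<8}"
      then show "c (v, i) \<in> H v i" using c(1)[unfolded V, rule_format, of "(v, i)"] True v by (auto simp: L_def)
    qed
    then have "hext (H v) (c (v, 0))"
      unfolding hext_def using p(2) True by (intro exI[of _ "\<lambda>i. c (v, i)"]) simp
    then have "c (v, 0) \<noteq> r v" using H(2)[OF True] by metis
    then show ?thesis using c(1)[unfolded V, rule_format, of "(v, 0)"] True v by (auto simp: L_def)
  next
    case False
    then show ?thesis using c(1)[unfolded V, rule_format, of "(v, 0)"] v by (auto simp: L_def)
  qed
  then show "\<exists>c. (\<forall>v\<in>V. c v \<in> M v) \<and> (\<forall>(u, v)\<in>A. c u \<noteq> c v)"
    using p(1) by (intro exI[of _ "\<lambda>v. c (v, 0)"]) auto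
next
  assume R: "\<forall>M :: 'v \<Rightarrow> nat set. (\<forall>v\<in>V. M v \<subseteq> {1..4} \<and> card (M v) = (if v \<in> D then 2 else 3)) \<longrightarrow>
      (\<exists>c. (\<forall>v\<in>V. c v \<in> M v) \<and> (\<forall>(u, v)\<in>A. c u \<noteq> c v))"
  show "choosable 3 4 (with_helpers V A D)"
    unfolding choosable_def
  proof (intro allI impI)
    fix L :: "'v \<times> nat \<Rightarrow> nat set"
    assume L0: "\<forall>v\<in>verts (with_helpers V A D). L v \<subseteq> {1..4} \<and> card (L v) = 3"
    have L: "L (v, i) \<subseteq> {1..4}" "card (L (v, i)) = 3" if "v \<in> V" "i < 8" for v i
      using L0 that by (auto simp: with_helpers_def)
    have "\<exists>r. \<forall>g. g \<noteq> r \<longrightarrow> hext (\<lambda>i. L (v, i)) g" if "v \<in> D" for v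
      by (rule helper_extends) (use L D that in auto)
    then obtain r where r: "\<And>v g. v \<in> D \<Longrightarrow> g \<noteq> r v \<Longrightarrow> hext (\<lambda>i. L (v, i)) g" by metis
    have "\<exists>M. M \<subseteq> L (v, 0) \<and> card M = (if v \<in> D then 2 else 3) \<and> (v \<in> D \<longrightarrow> r v \<notin> M)" if v: "v \<in> V" for v
    proof (cases "v \<in> D")
      case True
      have "finite (L (v, 0))" using L(2)[OF v, of 0] by (auto intro: card_ge_0_finite)
      then have "2 \<le> card (L (v, 0) - {r v})" using L(2)[OF v, of 0] by (simp add: card_Diff_singleton_if)
      then obtain M where "M \<subseteq> L (v, 0) - {r v}" "card M = 2" by (meson obtain_subset_with_card_n)
      then show ?thesis using True by (intro exI[of _ M]) auto
    next
      case False
      then show ?thesis using L(2)[OF v, of 0] by (intro exI[of _ "L (v, 0)"]) auto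
    qed
    then obtain M where M: "\<And>v. v \<in> V \<Longrightarrow> M v \<subseteq> L (v, 0)" "\<And>v. v \<in> V \<Longrightarrow> card (M v) = (if v \<in> D then 2 else 3)"
      "\<And>v. v \<in> V \<Longrightarrow> v \<in> D \<Longrightarrow> r v \<notin> M v" by metis
    have "\<forall>v\<in>V. M v \<subseteq> {1..4} \<and> card (M v) = (if v \<in> D then 2 else 3)" using M L(1) by fastforce
    from R[rule_format, OF this[rule_format]] obtain c where "(\<forall>v\<in>V. c v \<in> M v) \<and> (\<forall>(u, v)\<in>A. c u \<noteq> c v)" ..
    then have c: "\<And>v. v \<in> V \<Longrightarrow> c v \<in> M v" "\<forall>(u, v)\<in>A. c u \<noteq> c v" by simp_all
    have "\<forall>v\<in>D. \<exists>d. d 0 = c v \<and> (\<forall>i\<in>{1..<8}. d i \<in> L (v, i)) \<and> (\<forall>(i, j)\<in>helper_arcs. d i \<noteq> d j)"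
    proof
      fix v assume v: "v \<in> D"
      then have "v \<in> V" using D by blast
      then have "c v \<noteq> r v" using M(3)[of v] c(1)[of v] v by auto
      then have "hext (\<lambda>i. L (v, i)) (c v)" using r[OF v] by blast
      then show "\<exists>d. d 0 = c v \<and> (\<forall>i\<in>{1..<8}. d i \<in> L (v, i)) \<and> (\<forall>(i, j)\<in>helper_arcs. d i \<noteq> d j)"
        unfolding hext_def .
    qed
    then obtain d where d: "\<forall>v\<in>D. d v 0 = c v \<and> (\<forall>i\<in>{1..<8}. d v i \<in> L (v, i)) \<and> (\<forall>(i, j)\<in>helper_arcs. d v i \<noteq> d v j)"
      by (rule bchoice[THEN exE])
    define e where "e = (\<lambda>(v, i). if i = 0 then c v else if v \<in> D then d v i else (SOME g. g \<in> L (v, i)))"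
    have "e (v, i) \<in> L (v, i)" if "v \<in> V" "i < 8" for v i
    proof -
      have "L (v, i) \<noteq> {}" using L(2)[OF that] by auto
      then have "(SOME g. g \<in> L (v, i)) \<in> L (v, i)" by (simp add: some_in_eq)
      then show ?thesis using c(1)[OF that(1)] M(1)[OF that(1)] d that by (auto simp: e_def)
    qed
    moreover have ed: "e (v, i) = d v i" if "v \<in> D" for v i using that d by (auto simp: e_def)
    have "proper_coloring (with_helpers V A D) e"
      unfolding proper_with_helpers[OF A D]
    proof
      show "\<forall>(u, v)\<in>A. e (u, 0) \<noteq> e (v, 0)" using c(2) by (auto simp: e_def)
      show "\<forall>v\<in>D. \<forall>(i, j)\<in>helper_arcs. e (v, i) \<noteq> e (v, j)" using d by (simp add: ed)
    qed
    ultimately show "\<exists>c. (\<forall>v\<in>verts (with_helpers V A D). c v \<in> L v) \<and> proper_coloring (with_helpers V A D) c"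
      by (intro exI[of _ e]) (auto simp: with_helpers_def)
  qed
qed

section \<open>From clauses over literals to a grid of small clauses\<close>

section \<open>A planar formula\<close>

text \<open>Cell \<open>(i, j)\<close> has the variables 0 to 3 at its corners (clockwise from the north-west), 4 in its
  centre, and 5, 6 on its southern and eastern side. Variable 5 of cell \<open>(i, j)\<close> implies the literal
  of column \<open>j\<close>, and variable 6 of cell \<open>(i, j)\<close> implies that a literal of clause \<open>i - 1\<close> in one of
  the columns up to \<open>j\<close> is true. At most one of four corners has to be true; the corner NW, say,
  implies the variables on the northern and on the western side.\<close>

locale grid =
  fixes m N :: nat and on :: "nat \<Rightarrow> nat \<Rightarrow> bool" and univ :: "nat \<Rightarrow> bool"
  assumes N: "N \<ge> 1" and last_off: "\<not> on i (2 * N - 1)"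
begin

text \<open>The columns \<open>2 * j\<close> and \<open>2 * j + 1\<close> belong to a variable and
  to its negation; in row 0 their cells share variable 6, which stores the value. In the other rows
  the corners at the left and at the right border are missing, so that the chain of a clause ends
  there.\<close>

definition pv :: "nat \<Rightarrow> nat \<Rightarrow> nat \<Rightarrow> bool" where
  "pv i j v \<longleftrightarrow> i \<le> m \<and> j < 2 * N \<and>
    (if i = 0 then if even j then v \<in> {1, 3, 4, 5, 6} else v \<in> {0, 2, 4, 5}
     else v \<in> {4, 5} \<or> v \<in> {0, 3} \<and> 0 < j \<or> v \<in> {1, 2, 6} \<and> j < 2 * N - 1)"

text \<open>Clauses 0 and 1 together demand a true corner, split at the centre variable; the others
  are implications from corners. Clause 6 is dropped where the clause of the row contains the
  literal of the column: there NE is compatible with variable 6, and this is how a true literal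
  satisfies the clause.\<close>

definition pc :: "nat \<Rightarrow> nat \<Rightarrow> nat \<Rightarrow> bool" where
  "pc i j c \<longleftrightarrow> i \<le> m \<and> j < 2 * N \<and>
    (c \<in> {0, 1} \<or> c = 2 \<and> 0 < i \<and> pv i j 0 \<or> c = 3 \<and> 0 < i \<and> pv i j 1 \<or> c = 4 \<and> pv i j 0
     \<or> c = 5 \<and> 0 < i \<and> pv i j 3 \<or> c = 6 \<and> pv i j 1 \<and> (i = 0 \<or> \<not> on (i - 1) j) \<or> c = 7 \<and> 0 < i \<and> pv i j 2
     \<or> c = 8 \<and> pv i j 2 \<or> c = 9 \<and> pv i j 3)"

definition ps :: "nat \<Rightarrow> nat \<Rightarrow> nat \<Rightarrow> nat \<Rightarrow> bool" where
  "ps i j c s \<longleftrightarrow> (if c = 0 then s = 0 \<and> pv i j 0 \<or> s = 1 \<and> pv i j 1 \<or> s = 2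
     else if c = 1 then s = 0 \<or> s = 1 \<and> pv i j 2 \<or> s = 2 \<and> pv i j 3
     else s = 0 \<or> s = 1)"

definition gsrc :: "nat \<Rightarrow> nat \<Rightarrow> nat \<Rightarrow> nat \<Rightarrow> (nat \<times> nat \<times> nat) \<times> bool" where
  "gsrc i j c s = (if c = 0 then ((i, j, if s = 0 then 0 else if s = 1 then 1 else 4), True)
     else if c = 1 then (if s = 0 then ((i, j, 4), False) else ((i, j, if s = 1 then 2 else 3), True))
     else if s = 0 then ((i, j, if c \<in> {2, 4} then 0 else if c \<in> {3, 6} then 1 else if c \<in> {7, 8} then 2 else 3), False)
     else if c \<in> {2, 3} then ((i - 1, j, 5), True)
     else if c \<in> {4, 5} then ((i, j - 1, 6), True)
     else if c \<in> {6, 7} then ((i, j, 6), False) else ((i, j, 5), False))"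

definition gX :: "(nat \<times> nat \<times> nat) set" where "gX = {(i, j, v). pv i j v}"
definition gU :: "(nat \<times> nat \<times> nat) set" where
  "gU = {(i, j, v). i = 0 \<and> v = 6 \<and> j < 2 * N \<and> even j \<and> univ (j div 2)}"
definition gK :: "(nat \<times> nat \<times> nat) set" where "gK = {(i, j, c). pc i j c}"
definition gsl :: "nat \<times> nat \<times> nat \<Rightarrow> nat set" where "gsl = (\<lambda>(i, j, c). {s. ps i j c s})"
definition gs :: "nat \<times> nat \<times> nat \<Rightarrow> nat \<Rightarrow> (nat \<times> nat \<times> nat) \<times> bool" where
  "gs = (\<lambda>(i, j, c). gsrc i j c)"

lemma ps_less: "ps i j c s \<Longrightarrow> s < 3"
  by (auto simp: ps_def split: if_splits)

lemma card_gsl: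
  assumes "pc i j c"
  shows "card {s. ps i j c s} \<in> {2, 3}"
proof -
  have ij: "i \<le> m" "j < 2 * N" using assms by (auto simp: pc_def)
  consider "c = 0" | "c = 1" | "c \<ge> 2" by linarith
  then show ?thesis
  proof cases
    case 1
    have "pv i j 0 \<or> pv i j 1" using ij N by (cases "i = 0"; cases "j = 0") (auto simp: pv_def)
    moreover have "{s. ps i j c s} = {s. s = 0 \<and> pv i j 0} \<union> {s. s = 1 \<and> pv i j 1} \<union> {2}"
      using 1 by (auto simp: ps_def)
    ultimately show ?thesis by (cases "pv i j 0"; cases "pv i j 1") auto
  next
    case 2
    have "pv i j 2 \<or> pv i j 3" using ij N by (cases "i = 0"; cases "j = 0") (auto simp: pv_def)
    moreover have "{s. ps i j c s} = {s. s = 1 \<and> pv i j 2} \<union> {s. s = 2 \<and> pv i j 3} \<union> {0}"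
      using 2 by (auto simp: ps_def)
    ultimately show ?thesis by (cases "pv i j 2"; cases "pv i j 3") auto
  next
    case 3
    then have "{s. ps i j c s} = {0, 1}" by (auto simp: ps_def)
    then show ?thesis by simp
  qed
qed

lemma gsrc_present:
  assumes "pc i j c" "ps i j c s"
  shows "fst (gsrc i j c s) \<in> gX"
proof -
  have "c < 10" using assms by (auto simp: pc_def)
  then consider "c = 0" | "c = 1" | "c = 2" | "c = 3" | "c = 4" | "c = 5" | "c = 6" | "c = 7" | "c = 8" | "c = 9"
    by atomize_elim presburger
  then show ?thesis
    using assms by cases (auto simp: gX_def gsrc_def pc_def ps_def pv_def split: if_splits elim!: oddE)
qed

text \<open>A corner implies one horizontal and one vertical side, and a side is met by two corners
  on either hand. The universal variables lie in row 0, where the clauses 5 and 7 are absent, so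
  only one occurrence of each sign remains.\<close>

lemma gsrc_occ:
  "\<exists>w w'. {(k, s). k \<in> gK \<and> s \<in> gsl k \<and> gs k s = (x, b)} \<subseteq> {w, w'}
    \<and> (x \<in> gU \<longrightarrow> {(k, s). k \<in> gK \<and> s \<in> gsl k \<and> gs k s = (x, b)} \<subseteq> {w})"
proof -
  obtain i j v where x: "x = (i, j, v)" by (cases x)
  let ?S = "{(k, s). k \<in> gK \<and> s \<in> gsl k \<and> gs k s = (x, b)}"
  have S: "((i', j', c), s) \<in> ?S \<longleftrightarrow> pc i' j' c \<and> ps i' j' c s \<and> gsrc i' j' c s = ((i, j, v), b)" for i' j' c s
    by (auto simp: gK_def gsl_def gs_def x)
  have c10: "c < 10" if "pc i' j' c" for i' j' c using that by (auto simp: pc_def)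
  define w w' :: "(nat \<times> nat \<times> nat) \<times> nat" where "w = (if b then if v = 5 then ((i + 1, j, 2), 1) else if v = 6 then ((i, j + 1, 4), 1)
      else if v = 4 then ((i, j, 0), 2) else if v < 2 then ((i, j, 0), v) else ((i, j, 1), v - 1)
    else if v = 5 then ((i, j, 8), 1) else if v = 6 then ((i, j, 6), 1) else if v = 4 then ((i, j, 1), 0)
      else ((i, j, if v = 0 then 2 else if v = 1 then 3 else if v = 2 then 7 else 5), 0 :: nat))"
    and "w' = (if b then if v = 5 then ((i + 1, j, 3), 1) else ((i, j + 1, 5), 1)
    else if v = 5 then ((i, j, 9), 1) else if v = 6 then ((i, j, 7), 1)
      else ((i, j, if v = 0 then 4 else if v = 1 then 6 else if v = 2 then 8 else 9), 0 :: nat))"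
  have "y = w \<or> y = w' \<and> x \<notin> gU" if y: "y \<in> ?S" for y
  proof -
    obtain i' j' c s where yy: "y = ((i', j', c), s)" by (metis prod.exhaust)
    have *: "pc i' j' c" "ps i' j' c s" and g: "gsrc i' j' c s = ((i, j, v), b)" using y S unfolding yy by blast+
    have c: "c = 0 \<or> c = 1 \<or> c = 2 \<or> c = 3 \<or> c = 4 \<or> c = 5 \<or> c = 6 \<or> c = 7 \<or> c = 8 \<or> c = 9"
      using c10[OF *(1)] by presburger
    have s: "s = 0 \<or> s = 1 \<or> s = 2" using ps_less[OF *(2)] by presburger
    have pos: "c \<in> {2, 3, 5, 7} \<Longrightarrow> 0 < i'" "c \<in> {4, 5} \<Longrightarrow> 0 < j'" and s2: "c \<ge> 2 \<Longrightarrow> s < 2"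
      using * by (auto simp: pc_def ps_def pv_def split: if_splits intro: odd_pos)
    have E: "(i, j, v) = fst (gsrc i' j' c s)" "b = snd (gsrc i' j' c s)" by (simp_all add: g)
    have v: "v = snd (snd (fst (gsrc i' j' c s)))" and j: "j = fst (snd (fst (gsrc i' j' c s)))"
      and i: "i = fst (fst (gsrc i' j' c s))" by (simp_all add: g)
    show ?thesis
      using c s pos s2 unfolding yy w_def w'_def x gU_def i j v E(2)
      by (elim disjE) (simp_all add: gsrc_def)
  qed
  then show ?thesis by (intro exI[of _ w] exI[of _ w']) auto
qed

definition lit :: "(nat \<Rightarrow> bool) \<Rightarrow> nat \<Rightarrow> bool" where
  "lit w j \<longleftrightarrow> (if even j then w (j div 2) else \<not> w (j div 2))"

definition gsat :: "(nat \<times> nat \<times> nat \<Rightarrow> bool) \<Rightarrow> bool" where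
  "gsat val \<longleftrightarrow> (\<forall>i j c. pc i j c \<longrightarrow> (\<exists>s. ps i j c s \<and> val (fst (gsrc i j c s)) = snd (gsrc i j c s)))"

lemma gsat_cell:
  assumes "gsat val" "i \<le> m" "j < 2 * N"
  shows "(pv i j 0 \<and> val (i, j, 0)) \<or> (pv i j 1 \<and> val (i, j, 1)) \<or> val (i, j, 4)"
    and "\<not> val (i, j, 4) \<or> (pv i j 2 \<and> val (i, j, 2)) \<or> (pv i j 3 \<and> val (i, j, 3))"
    and "0 < i \<Longrightarrow> pv i j 0 \<Longrightarrow> val (i, j, 0) \<Longrightarrow> val (i - 1, j, 5)"
    and "0 < i \<Longrightarrow> pv i j 1 \<Longrightarrow> val (i, j, 1) \<Longrightarrow> val (i - 1, j, 5)"
    and "pv i j 0 \<Longrightarrow> val (i, j, 0) \<Longrightarrow> val (i, j - 1, 6)"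
    and "0 < i \<Longrightarrow> pv i j 3 \<Longrightarrow> val (i, j, 3) \<Longrightarrow> val (i, j - 1, 6)"
    and "pv i j 1 \<Longrightarrow> i = 0 \<or> \<not> on (i - 1) j \<Longrightarrow> val (i, j, 1) \<Longrightarrow> \<not> val (i, j, 6)"
    and "0 < i \<Longrightarrow> pv i j 2 \<Longrightarrow> val (i, j, 2) \<Longrightarrow> \<not> val (i, j, 6)"
    and "pv i j 2 \<Longrightarrow> val (i, j, 2) \<Longrightarrow> \<not> val (i, j, 5)"
    and "pv i j 3 \<Longrightarrow> val (i, j, 3) \<Longrightarrow> \<not> val (i, j, 5)"
proof -
  have S: "\<exists>s. ps i j c s \<and> val (fst (gsrc i j c s)) = snd (gsrc i j c s)" if "pc i j c" for c
    using assms(1) that by (auto simp: gsat_def)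
  have ij: "i \<le> m \<and> j < 2 * N" using assms by simp
  have pc: "pc i j 0" "pc i j 1" "0 < i \<Longrightarrow> pv i j 0 \<Longrightarrow> pc i j 2" "0 < i \<Longrightarrow> pv i j 1 \<Longrightarrow> pc i j 3"
    "pv i j 0 \<Longrightarrow> pc i j 4" "0 < i \<Longrightarrow> pv i j 3 \<Longrightarrow> pc i j 5"
    "pv i j 1 \<Longrightarrow> i = 0 \<or> \<not> on (i - 1) j \<Longrightarrow> pc i j 6" "0 < i \<Longrightarrow> pv i j 2 \<Longrightarrow> pc i j 7"
    "pv i j 2 \<Longrightarrow> pc i j 8" "pv i j 3 \<Longrightarrow> pc i j 9"
    using ij by (simp_all add: pc_def)
  show "(pv i j 0 \<and> val (i, j, 0)) \<or> (pv i j 1 \<and> val (i, j, 1)) \<or> val (i, j, 4)"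
    using S[OF pc(1)] by (auto simp: ps_def gsrc_def)
  show "\<not> val (i, j, 4) \<or> (pv i j 2 \<and> val (i, j, 2)) \<or> (pv i j 3 \<and> val (i, j, 3))"
    using S[OF pc(2)] by (auto simp: ps_def gsrc_def)
  show "0 < i \<Longrightarrow> pv i j 0 \<Longrightarrow> val (i, j, 0) \<Longrightarrow> val (i - 1, j, 5)"
    using S[OF pc(3)] by (auto simp: ps_def gsrc_def)
  show "0 < i \<Longrightarrow> pv i j 1 \<Longrightarrow> val (i, j, 1) \<Longrightarrow> val (i - 1, j, 5)"
    using S[OF pc(4)] by (auto simp: ps_def gsrc_def)
  show "pv i j 0 \<Longrightarrow> val (i, j, 0) \<Longrightarrow> val (i, j - 1, 6)"
    using S[OF pc(5)] by (auto simp: ps_def gsrc_def)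
  show "0 < i \<Longrightarrow> pv i j 3 \<Longrightarrow> val (i, j, 3) \<Longrightarrow> val (i, j - 1, 6)"
    using S[OF pc(6)] by (auto simp: ps_def gsrc_def)
  show "pv i j 1 \<Longrightarrow> i = 0 \<or> \<not> on (i - 1) j \<Longrightarrow> val (i, j, 1) \<Longrightarrow> \<not> val (i, j, 6)"
    using S[OF pc(7)] by (auto simp: ps_def gsrc_def)
  show "0 < i \<Longrightarrow> pv i j 2 \<Longrightarrow> val (i, j, 2) \<Longrightarrow> \<not> val (i, j, 6)"
    using S[OF pc(8)] by (auto simp: ps_def gsrc_def)
  show "pv i j 2 \<Longrightarrow> val (i, j, 2) \<Longrightarrow> \<not> val (i, j, 5)"
    using S[OF pc(9)] by (auto simp: ps_def gsrc_def)
  show "pv i j 3 \<Longrightarrow> val (i, j, 3) \<Longrightarrow> \<not> val (i, j, 5)"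
    using S[OF pc(10)] by (auto simp: ps_def gsrc_def)
qed

definition cnf :: "(nat \<Rightarrow> bool) \<Rightarrow> bool" where
  "cnf w \<longleftrightarrow> (\<forall>i<m. \<exists>j<2 * N. on i j \<and> lit w j)"

text \<open>A true southern side excludes the southern corners, so a northern one holds and passes
  the claim up to row 0, where the value of the literal is stored. In the row of a clause without a
  true literal, variable 6 would be true from the last column leftwards, until the cell at the left
  border has no admissible corner.\<close>

lemma gsat_cnf:
  assumes g: "gsat val"
  shows "cnf (\<lambda>j. \<not> val (0, 2 * j, 6))"
proof -
  let ?w = "\<lambda>j. \<not> val (0, 2 * j, 6)"
  have V: "lit ?w j" if "val (i, j, 5)" "i \<le> m" "j < 2 * N" for i j
    using that
  proof (induction i)
    case 0
    show ?case
    proof (cases "even j")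
      case True
      then have pv: "\<not> pv 0 j 0" "\<not> pv 0 j 2" "pv 0 j 1" "pv 0 j 3" using 0 by (auto simp: pv_def)
      have "\<not> val (0, j, 6)" using gsat_cell[OF g 0(2,3)] pv 0 by blast
      then show ?thesis using True by (simp add: lit_def)
    next
      case False
      then have pv: "\<not> pv 0 j 1" "\<not> pv 0 j 3" "pv 0 j 0" "pv 0 j 2" using 0 by (auto simp: pv_def)
      have "val (0, j - 1, 6)" using gsat_cell[OF g 0(2,3)] pv 0 by blast
      then show ?thesis using False by (auto simp: lit_def elim!: oddE)
    qed
  next
    case (Suc i)
    have "val (i, j, 5)" using gsat_cell[OF g Suc.prems(2,3)] Suc.prems(1) by (metis diff_Suc_1 zero_less_Suc)
    then show ?case using Suc by simp
  qed
  have "\<exists>j<2 * N. on i j \<and> lit ?w j" if i: "i < m" for i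
  proof (rule ccontr)
    assume no: "\<not> ?thesis"
    have step: "(pv i' j 0 \<or> pv i' j 3) \<and> val (i', j - 1, 6)"
      if "j < 2 * N" "j = 2 * N - 1 \<or> val (i', j, 6)" "i' = Suc i" for i' j
    proof -
      have i': "i' \<le> m" "0 < i'" "i' - 1 = i" "i \<le> m" using i that by auto
      have ne: "\<not> pv i' j 1 \<and> \<not> pv i' j 2" if "j = 2 * N - 1" using that i' by (auto simp: pv_def)
      have off: "\<not> (val (i, j, 5) \<and> on i j)" using V[of i j] no that i' by blast
      show ?thesis
        using gsat_cell[OF g i'(1) that(1)] that(2) ne off i'(2,3) by metis
    qed
    have "val (Suc i, 2 * N - 2 - k, 6)" if "k \<le> 2 * N - 2" for k
      using that
    proof (induction k)
      case 0
      then show ?case using step[of "2 * N - 1" "Suc i"] N by (simp add: numeral_2_eq_2)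
    next
      case (Suc k)
      then show ?case using step[of "2 * N - 2 - k" "Suc i"] by (simp add: numeral_2_eq_2)
    qed
    from this[of "2 * N - 2"] have "val (Suc i, 0, 6)" by simp
    then show False using step[of 0 "Suc i"] N by (auto simp: pv_def)
  qed
  then show ?thesis by (auto simp: cnf_def)
qed

lemma cnf_gsat:
  assumes w: "cnf w"
  shows "\<exists>val. gsat val \<and> (\<forall>j. val (0, 2 * j, 6) = (\<not> w j))"
proof -
  \<comment> \<open>\<open>L i j\<close> says that a column before \<open>j\<close> satisfies the
    clause of row \<open>i\<close>, the intended meaning of the western side. A true corner is found
    in the north or south according to \<open>lit w j\<close>, and in the west or east according to
    \<open>L\<close>.\<close>
  define L where "L = (\<lambda>i j. \<exists>j'<j. on (i - 1) j' \<and> lit w j')"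
  define val where "val = (\<lambda>(i, j, v). if v = 5 then lit w j
    else if v = 6 then (if i = 0 then \<not> w (j div 2) else L i (Suc j))
    else if v = (4 :: nat) then \<not> lit w j
    else if i = 0 then (if v < 2 then lit w j else \<not> lit w j)
    else if v = 0 then lit w j \<and> L i j
    else if v = 1 then lit w j \<and> (\<not> L i (Suc j) \<or> on (i - 1) j)
    else if v = 2 then \<not> lit w j \<and> \<not> L i (Suc j) else \<not> lit w j \<and> L i j)"
  have LS: "L i (Suc j) \<longleftrightarrow> L i j \<or> on (i - 1) j \<and> lit w j" for i j
    by (auto simp: L_def less_Suc_eq)
  have L0: "\<not> L i 0" for i by (simp add: L_def)
  \<comment> \<open>The last column is never \<open>on\<close>, so the clause is satisfied before
    it. In the last cell a western corner is therefore available.\<close>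
  have Llast: "L i (2 * N - 1)" if "0 < i" "i \<le> m" for i
  proof -
    have "i - 1 < m" using that by simp
    then obtain j where j: "j < 2 * N" "on (i - 1) j" "lit w j" using w unfolding cnf_def by blast
    then have "j \<noteq> 2 * N - 1" using last_off by metis
    then show ?thesis using j by (auto simp: L_def intro!: exI[of _ j])
  qed
  have "\<exists>s. ps i j c s \<and> val (fst (gsrc i j c s)) = snd (gsrc i j c s)" if pc: "pc i j c" for i j c
  proof -
    have ij: "i \<le> m" "j < 2 * N" using pc by (auto simp: pc_def)
    have two: "\<exists>s. ps i j c s \<and> val (fst (gsrc i j c s)) = snd (gsrc i j c s)"
      if "c \<ge> 2" "val (fst (gsrc i j c 0)) \<Longrightarrow> val (fst (gsrc i j c 1)) = snd (gsrc i j c 1)"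
    proof -
      have "ps i j c 0" "ps i j c 1" "snd (gsrc i j c 0) = False"
        using that(1) by (simp_all add: ps_def gsrc_def)
      then show ?thesis using that(2) by (cases "val (fst (gsrc i j c 0))") auto
    qed
    consider "c = 0" | "c = 1" | "c = 2" | "c = 3" | "c = 4" | "c = 5" | "c = 6" | "c = 7" | "c = 8" | "c = 9"
      using pc by (auto simp: pc_def)
    then show ?thesis
    proof cases
      case 1
      show ?thesis
      proof (cases "lit w j")
        case False
        then show ?thesis using 1 by (intro exI[of _ 2]) (simp add: ps_def gsrc_def val_def)
      next
        case True
        show ?thesis
        proof (cases "i = 0")
          case i0: True
          show ?thesis
            using 1 i0 True ij
            by (intro exI[of _ "if even j then 1 else 0"]) (simp add: ps_def gsrc_def val_def pv_def)
        next
          case i0: False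
          show ?thesis
          proof (cases "L i j")
            case Lj: True
            then have "pv i j 0" using L0[of i] ij i0 by (cases j) (auto simp: pv_def)
            then show ?thesis using 1 True Lj i0 by (intro exI[of _ 0]) (simp add: ps_def gsrc_def val_def)
          next
            case Lj: False
            then have "j \<noteq> 2 * N - 1" using Llast[of i] i0 ij by blast
            then have "pv i j 1" using ij i0 by (auto simp: pv_def)
            then show ?thesis using 1 True Lj i0 LS[of i j] by (intro exI[of _ 1]) (simp add: ps_def gsrc_def val_def)
          qed
        qed
      qed
    next
      case 2
      show ?thesis
      proof (cases "lit w j")
        case True
        then show ?thesis using 2 by (intro exI[of _ 0]) (simp add: ps_def gsrc_def val_def)
      next
        case False
        show ?thesis
        proof (cases "i = 0")
          case i0: True
          show ?thesis
            using 2 i0 False ij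
            by (intro exI[of _ "if even j then 2 else 1"]) (simp add: ps_def gsrc_def val_def pv_def)
        next
          case i0: False
          show ?thesis
          proof (cases "L i j")
            case Lj: True
            then have "pv i j 3" using L0[of i] ij i0 by (cases j) (auto simp: pv_def)
            then show ?thesis using 2 False Lj i0 by (intro exI[of _ 2]) (simp add: ps_def gsrc_def val_def)
          next
            case Lj: False
            then have "j \<noteq> 2 * N - 1" using Llast[of i] i0 ij by blast
            then have "pv i j 2" using ij i0 by (auto simp: pv_def)
            then show ?thesis using 2 False Lj i0 LS[of i j] by (intro exI[of _ 1]) (simp add: ps_def gsrc_def val_def)
          qed
        qed
      qed
    next
      case 5
      have "j > 0" using 5 pc by (auto simp: pc_def pv_def split: if_splits intro: odd_pos)
      moreover have "i = 0 \<Longrightarrow> odd j" using 5 pc by (auto simp: pc_def pv_def)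
      moreover have "(j - 1) div 2 = j div 2" if "odd j" using that by (auto elim!: oddE)
      ultimately show ?thesis
        using 5 by (intro two; cases "i = 0") (auto simp: gsrc_def val_def lit_def)
    next
      case 6
      have "j > 0" "i > 0" using 6 pc by (auto simp: pc_def pv_def)
      then show ?thesis using 6 by (intro two) (auto simp: gsrc_def val_def)
    next
      case 7
      have "i = 0 \<Longrightarrow> even j" using 7 pc by (auto simp: pc_def pv_def split: if_splits)
      then show ?thesis using 7 pc by (intro two) (auto simp: gsrc_def val_def lit_def pc_def)
    next
      case 3
      then show ?thesis using pc by (intro two) (auto simp: gsrc_def val_def pc_def split: if_splits)
    next
      case 4
      then show ?thesis using pc by (intro two) (auto simp: gsrc_def val_def pc_def split: if_splits)
    next
      case 8
      then show ?thesis using pc by (intro two) (auto simp: gsrc_def val_def pc_def split: if_splits)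
    next
      case 9
      then show ?thesis using pc by (intro two) (auto simp: gsrc_def val_def pc_def split: if_splits)
    next
      case 10
      then show ?thesis using pc by (intro two) (auto simp: gsrc_def val_def pc_def split: if_splits)
    qed
  qed
  then have "gsat val" by (simp add: gsat_def)
  moreover have "\<forall>j. val (0, 2 * j, 6) = (\<not> w j)" by (simp add: val_def)
  ultimately show ?thesis by blast
qed

text \<open>The shared variable 6 in row 0 carries the negated value, so the universal assignments
  on the two sides are negations of each other.\<close>

theorem grid_formula:
  "(\<forall>a. \<exists>val. (\<forall>x\<in>gU. val x = a x) \<and> gsat val) \<longleftrightarrow> (\<forall>a. \<exists>w. (\<forall>j<N. univ j \<longrightarrow> w j = a j) \<and> cnf w)"
proof (intro iffI allI)
  fix a :: "nat \<Rightarrow> bool"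
  assume "\<forall>a. \<exists>val. (\<forall>x\<in>gU. val x = a x) \<and> gsat val"
  then obtain val where val: "\<forall>x\<in>gU. val x = (\<not> a (fst (snd x) div 2))" "gsat val"
    by (drule_tac x = "\<lambda>x. \<not> a (fst (snd x) div 2)" in spec) blast
  have "val (0, 2 * j, 6) = (\<not> a j)" if "j < N" "univ j" for j
    using val(1)[rule_format, of "(0, 2 * j, 6)"] that by (simp add: gU_def)
  then show "\<exists>w. (\<forall>j<N. univ j \<longrightarrow> w j = a j) \<and> cnf w"
    using gsat_cnf[OF val(2)] by (intro exI[of _ "\<lambda>j. \<not> val (0, 2 * j, 6)"]) simp
next
  fix a :: "nat \<times> nat \<times> nat \<Rightarrow> bool"
  assume "\<forall>a. \<exists>w. (\<forall>j<N. univ j \<longrightarrow> w j = a j) \<and> cnf w"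
  then obtain w where w: "\<forall>j<N. univ j \<longrightarrow> w j = (\<not> a (0, 2 * j, 6))" "cnf w"
    by (drule_tac x = "\<lambda>j. \<not> a (0, 2 * j, 6)" in spec) blast
  obtain val where val: "gsat val" "\<And>j. val (0, 2 * j, 6) = (\<not> w j)" using cnf_gsat[OF w(2)] by blast
  have "val x = a x" if "x \<in> gU" for x
    using that w(1) val(2) by (auto simp: gU_def elim!: evenE)
  then show "\<exists>val. (\<forall>x\<in>gU. val x = a x) \<and> gsat val" using val(1) by blast
qed

end

section \<open>Lattice coordinates of the gadgets\<close>

section \<open>Placing the network on the grid\<close>

text \<open>Each cell gets a square of 26 by 26 grid points. The tables list the positions (row, column)
  of the nodes relative to a corner of the square: for the variables 0 to 6 those of \<open>Pos\<close>,
  \<open>Neg\<close>, \<open>Mid\<close>, and for the slots of the clauses 0 to 9 those of the path nodes, of the source and of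
  \<open>Mer\<close>. Some positions are outside of the square, but all are distinct modulo 26.\<close>

definition var_tab :: "((nat \<times> nat) \<times> (nat \<times> nat) \<times> (nat \<times> nat)) list" where
  "var_tab =
    [((9, 13), (9, 12), (8, 13)), ((9, 17), (8, 17), (9, 16)), ((20, 17), (20, 18), (21, 17)),
    ((20, 13), (21, 13), (20, 14)), ((14, 14), (15, 14), (14, 15)), ((26, 15), (25, 15), (26,
    14)), ((15, 26), (15, 25), (14, 26))]"

definition path_tab :: "(nat \<times> nat) list list list" where
  "path_tab =
    [[[(10, 13)], [(10, 17)], [(13, 14)]], [[(16, 14)], [(19, 17)], [(19, 13)]], [[(8, 12), (7,
    12)], [(1, 15), (2, 15), (2, 14), (3, 14)]], [[(7, 17)], [(0, 16), (1, 16), (2, 16), (3,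
    16), (3, 17)]], [[(9, 11), (9, 10)], [(15, 1), (15, 2), (15, 3), (15, 4), (15, 5), (15, 6),
    (14, 6), (13, 6), (12, 6), (11, 6)]], [[(21, 12), (21, 11), (21, 10), (20, 10)], [(16, 0),
    (16, 1), (16, 2), (16, 3), (16, 4), (16, 5), (16, 6), (17, 6), (18, 6)]], [[(8, 18), (8,
    19), (9, 19)], [(14, 25), (13, 25), (12, 25), (11, 25), (11, 24), (11, 23)]], [[(20, 19)],
    [(15, 24), (15, 23), (16, 23), (17, 23), (18, 23)]], [[(21, 18), (22, 18)], [(25, 16), (25,
    17)]], [[(22, 13)], [(25, 14)]]]"

definition src_tab :: "(nat \<times> nat) list list" where
  "src_tab =
    [[(9, 13), (9, 17), (14, 14)], [(15, 14), (20, 17), (20, 13)], [(9, 12), (0, 15)], [(8, 17),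
    (0, 15)], [(9, 12), (15, 0)], [(21, 13), (15, 0)], [(8, 17), (15, 25)], [(20, 18), (15,
    25)], [(20, 18), (25, 15)], [(21, 13), (25, 15)]]"

definition mer_tab :: "(nat \<times> nat) list list" where
  "mer_tab =
    [[(11, 14), (11, 16), (12, 15)], [(17, 15), (18, 16), (18, 14)], [(6, 13), (4, 13)], [(6,
    18), (4, 18)], [(10, 9), (10, 7)], [(19, 9), (19, 7)], [(10, 20), (10, 22)], [(19, 20), (19,
    22)], [(23, 19), (24, 18)], [(23, 12), (24, 13)]]"

definition cla_tab :: "(nat \<times> nat) list" where
  "cla_tab =
    [(11, 15), (18, 15), (5, 13), (5, 18), (10, 8), (19, 8), (10, 21), (19, 21), (24, 19), (24,
    12)]"

definition vpos :: "nat \<Rightarrow> nat \<times> nat" where "vpos v = fst (var_tab ! v)"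
definition vneg :: "nat \<Rightarrow> nat \<times> nat" where "vneg v = fst (snd (var_tab ! v))"
definition vmid :: "nat \<Rightarrow> nat \<times> nat" where "vmid v = snd (snd (var_tab ! v))"
definition wpath :: "nat \<Rightarrow> nat \<Rightarrow> (nat \<times> nat) list" where "wpath c s = path_tab ! c ! s"
definition wsrc :: "nat \<Rightarrow> nat \<Rightarrow> nat \<times> nat" where "wsrc c s = src_tab ! c ! s"
definition wmer :: "nat \<Rightarrow> nat \<Rightarrow> nat \<times> nat" where "wmer c s = mer_tab ! c ! s"
definition wcla :: "nat \<Rightarrow> nat \<times> nat" where "wcla c = cla_tab ! c"
text \<open>The sides are the two remaining corners of the unit square that has the end of the path
  and \<open>Mer\<close> at opposite corners.\<close>

definition wside :: "nat \<Rightarrow> nat \<Rightarrow> bool \<Rightarrow> nat \<times> nat" where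
  "wside c s b = (let q = last (wpath c s) in if b then (fst (wmer c s), snd q) else (fst q, snd (wmer c s)))"

text \<open>\<open>Opp\<close> takes the place of the first path node of the wire that starts at
  \<open>Neg\<close> of variable 6, namely clause 6, slot 1. The path of that wire then begins one
  entry later, which is accounted for by \<open>shift\<close>.\<close>

fun off :: "(nat, nat) node \<Rightarrow> nat \<times> nat" where
  "off (Pos v) = vpos v"
| "off (Neg v) = vneg v"
| "off (Mid v) = vmid v"
| "off (Opp v) = wpath 6 1 ! 0"
| "off (Path c s n) = wpath c s ! n"
| "off (Side c s b) = wside c s b"
| "off (Mer c s) = wmer c s"
| "off (Cla c) = wcla c"

definition slots :: "(nat \<times> nat) list" where
  "slots = [(0, 0), (0, 1), (0, 2), (1, 0), (1, 1), (1, 2), (2, 0), (2, 1), (3, 0), (3, 1), (4, 0), (4, 1),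
    (5, 0), (5, 1), (6, 0), (6, 1), (7, 0), (7, 1), (8, 0), (8, 1), (9, 0), (9, 1)]"

definition local_nodes :: "(nat, nat) node list" where
  "local_nodes = concat (map (\<lambda>v. [Pos v, Neg v, Mid v]) [0..<7]) @ map Cla [0, 1, 2, 3, 4, 5, 6, 7, 8, 9]
    @ concat (map (\<lambda>(c, s). map (Path c s) [0..<length (wpath c s)] @ [Side c s False, Side c s True, Mer c s]) slots)"

definition residue :: "(nat, nat) node \<Rightarrow> nat" where
  "residue l = (fst (off l) mod 26) * 26 + snd (off l) mod 26"

text \<open>Cells reach into their neighbours, so positions have to be compared across cells as
  well. Modulo 26 all cells are superimposed, and distinctness there excludes every
  collision.\<close>

lemma distinct_residues: "distinct (map residue local_nodes)"
proof -
  have "map residue local_nodes =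
    [247, 246, 221, 251, 225, 250, 537, 538, 563, 533, 559, 534, 378, 404, 379, 15, 665,
    14, 390, 415, 364, 301, 483, 143, 148, 268, 502, 281, 515, 643, 636, 273, 274, 299,
    300, 277, 276, 303, 302, 352, 353, 326, 327, 430, 431, 456, 457, 511, 510, 485, 484,
    507, 508, 481, 482, 220, 194, 195, 168, 169, 41, 67, 66, 92, 91, 118, 117, 199, 200,
    173, 174, 16, 42, 68, 94, 95, 96, 121, 122, 245, 244, 243, 270, 269, 391, 392, 393,
    394, 395, 396, 370, 344, 318, 292, 293, 266, 267, 558, 557, 556, 530, 529, 504, 503,
    416, 417, 418, 419, 420, 421, 422, 448, 474, 475, 500, 501, 226, 227, 253, 254, 279,
    280, 389, 363, 337, 311, 310, 309, 308, 283, 282, 539, 540, 513, 514, 414, 413, 439,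
    465, 491, 490, 517, 516, 564, 590, 591, 616, 617, 666, 667, 668, 641, 642, 585, 584,
    611, 610, 664, 663, 638, 637]"
    by (simp add: residue_def local_nodes_def slots_def var_tab_def path_tab_def mer_tab_def cla_tab_def
    vpos_def vneg_def vmid_def wpath_def wmer_def wcla_def wside_def Let_def upt_rec)
  moreover have "distinct \<dots>" by simp
  ultimately show ?thesis by simp
qed

definition ladj :: "nat \<times> nat \<Rightarrow> nat \<times> nat \<Rightarrow> bool" where
  "ladj p q \<longleftrightarrow> (fst p = fst q \<and> (snd q = snd p + 1 \<or> snd p = snd q + 1))
    \<or> (snd p = snd q \<and> (fst q = fst p + 1 \<or> fst p = fst q + 1))"

text \<open>Only one of the two diagonal directions is ever used. With the lattice edges it forms a
  planar triangulation.\<close>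

definition anti :: "nat \<times> nat \<Rightarrow> nat \<times> nat \<Rightarrow> bool" where
  "anti p q \<longleftrightarrow> (fst q = fst p + 1 \<and> snd p = snd q + 1) \<or> (fst p = fst q + 1 \<and> snd q = snd p + 1)"

definition wire_pairs :: "nat \<Rightarrow> nat \<Rightarrow> ((nat \<times> nat) \<times> (nat \<times> nat)) list" where
  "wire_pairs c s = (let p = wpath c s; m = wmer c s in (wsrc c s, p ! 0) # zip p (tl p)
    @ [(last p, wside c s False), (last p, wside c s True), (wside c s False, m), (wside c s True, m), (m, wcla c)])"

lemma tables_adjacent:
  "(\<forall>(c, s)\<in>set slots. \<forall>(p, q)\<in>set (wire_pairs c s). ladj p q) \<and>
   (\<forall>v\<in>set [0, 1, 2, 3, 4, 5, 6]. ladj (vpos v) (vneg v) \<and> ladj (vpos v) (vmid v) \<and> anti (vneg v) (vmid v)) \<and>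
   ladj (vneg 6) (wpath 6 1 ! 0) \<and> ladj (vmid 6) (wpath 6 1 ! 0) \<and>
   (\<forall>(c, s)\<in>set slots. wpath c s \<noteq> []) \<and> length (wpath 6 1) = 6"
  by (simp add: slots_def var_tab_def path_tab_def src_tab_def mer_tab_def cla_tab_def
    vpos_def vneg_def vmid_def wpath_def wsrc_def wmer_def wcla_def wside_def Let_def wire_pairs_def ladj_def anti_def)

context grid
begin

definition shift :: "nat \<Rightarrow> nat \<Rightarrow> nat \<Rightarrow> nat \<Rightarrow> nat" where
  "shift i j c s = of_bool (c = 6 \<and> s = 1 \<and> (i, j, 6) \<in> gU)"

definition glen :: "nat \<times> nat \<times> nat \<Rightarrow> nat \<Rightarrow> nat" where
  "glen = (\<lambda>(i, j, c) s. length (wpath c s) - shift i j c s)"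

lemma pv_less: "pv i j v \<Longrightarrow> v < 7"
  by (auto simp: pv_def split: if_splits)

lemma pc_less: "pc i j c \<Longrightarrow> c < 10"
  by (auto simp: pc_def)

lemma pc_slots: "pc i j c \<Longrightarrow> ps i j c s \<Longrightarrow> (c, s) \<in> set slots"
proof -
  assume *: "pc i j c" "ps i j c s"
  have "c = 0 \<or> c = 1 \<or> c = 2 \<or> c = 3 \<or> c = 4 \<or> c = 5 \<or> c = 6 \<or> c = 7 \<or> c = 8 \<or> c = 9"
    using pc_less[OF *(1)] by presburger
  then show ?thesis using *(2) by (elim disjE) (auto simp: ps_def slots_def)
qed

lemma wpath_ne: "(c, s) \<in> set slots \<Longrightarrow> wpath c s \<noteq> []"
  using tables_adjacent by blast

lemma glen_pos: "(c, s) \<in> set slots \<Longrightarrow> glen (i, j, c) s \<ge> 1"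
  using wpath_ne[of c s] tables_adjacent by (cases "wpath c s") (auto simp: glen_def shift_def)

end

sublocale grid \<subseteq> net: network gX gU gK gsl gs glen
proof
  show "gU \<subseteq> gX" by (auto simp: gU_def gX_def pv_def)
  fix k assume k: "k \<in> gK"
  obtain i j c where kk: "k = (i, j, c)" by (cases k)
  have pc: "pc i j c" using k by (simp add: kk gK_def)
  show "gsl k \<subseteq> {..<3} \<and> card (gsl k) \<in> {2, 3}"
    using card_gsl[OF pc] by (auto simp: kk gsl_def dest: ps_less)
  fix s assume "s \<in> gsl k"
  then have ps: "ps i j c s" by (simp add: kk gsl_def)
  show "fst (gs k s) \<in> gX" using gsrc_present[OF pc ps] by (simp add: gs_def kk)
  show "1 \<le> glen k s" unfolding kk by (rule glen_pos[OF pc_slots[OF pc ps]])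
next
  fix x b
  show "\<exists>w w'. {(k, i). k \<in> gK \<and> i \<in> gsl k \<and> gs k i = (x, b)} \<subseteq> {w, w'}" using gsrc_occ[of x b] by blast
  show "\<exists>w. {(k, i). k \<in> gK \<and> i \<in> gsl k \<and> gs k i = (x, b)} \<subseteq> {w}" if "x \<in> gU" using gsrc_occ[of x b] that by blast
qed

type_synonym gnode = "(nat \<times> nat \<times> nat, nat \<times> nat \<times> nat) node"

context grid
begin

lemma net_sat: "net.sat val = gsat val"
  unfolding net.sat_def gsat_def by (auto simp: gK_def gsl_def gs_def)

fun loc :: "gnode \<Rightarrow> (nat \<times> nat) \<times> (nat, nat) node" where
  "loc (Pos (i, j, v)) = ((i, j), Pos v)"
| "loc (Neg (i, j, v)) = ((i, j), Neg v)"
| "loc (Mid (i, j, v)) = ((i, j), Mid v)"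
| "loc (Opp (i, j, v)) = ((i, j), Path 6 1 0)"
| "loc (Path (i, j, c) s n) = ((i, j), Path c s (n + shift i j c s))"
| "loc (Side (i, j, c) s b) = ((i, j), Side c s b)"
| "loc (Mer (i, j, c) s) = ((i, j), Mer c s)"
| "loc (Cla (i, j, c)) = ((i, j), Cla c)"

definition padd :: "nat \<times> nat \<Rightarrow> nat \<times> nat \<Rightarrow> nat \<times> nat" where
  "padd q o' = (26 * fst q + fst o', 26 * snd q + snd o')"

definition place :: "gnode \<Rightarrow> nat \<times> nat" where
  "place u = padd (fst (loc u)) (off (snd (loc u)))"

lemma loc_local:
  assumes "u \<in> net.nodes"
  shows "snd (loc u) \<in> set local_nodes"
proof -
  have v7: "v \<in> {0, 1, 2, 3, 4, 5, 6}" if "(i, j, v) \<in> gX" for i j v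
    using that pv_less[of i j v] by (auto simp: gX_def)
  have c10: "c \<in> {0, 1, 2, 3, 4, 5, 6, 7, 8, 9}" if "(i, j, c) \<in> gK" for i j c
    using that pc_less[of i j c] by (auto simp: gK_def)
  have sl: "(c, s) \<in> set slots" if "(i, j, c) \<in> gK" "s \<in> gsl (i, j, c)" for i j c s
    using that pc_slots[of i j c s] by (simp add: gK_def gsl_def)
  have wire: "Path c s n \<in> set local_nodes \<and> Side c s b \<in> set local_nodes \<and> Mer c s \<in> set local_nodes"
    if "(c, s) \<in> set slots" "n < length (wpath c s)" for c s n b
  proof -
    let ?F = "\<lambda>(c, s). map (Path c s) [0..<length (wpath c s)] @ [Side c s False, Side c s True, Mer c s]"
    have "x \<in> set local_nodes" if "x \<in> set (?F (c, s))" for x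
    proof -
      have "x \<in> set (concat (map ?F slots))" using that \<open>(c, s) \<in> set slots\<close> by (simp only: set_concat set_map) blast
      then show ?thesis by (simp only: local_nodes_def set_append Un_iff simp_thms)
    qed
    then show ?thesis using that(2) by (cases b) simp_all
  qed
  have var: "Pos v \<in> set local_nodes \<and> Neg v \<in> set local_nodes \<and> Mid v \<in> set local_nodes"
    if "v \<in> {0, 1, 2, 3, 4, 5, 6}" for v
    using that unfolding local_nodes_def by auto
  show ?thesis using assms
  proof cases
    case (4 x)
    have "(6, 1) \<in> set slots" by (simp add: slots_def)
    then show ?thesis using 4 wire[of 6 1 0] wpath_ne[of 6 1] by (cases x) simp
  next
    case (5 k s n)
    obtain i j c where k: "k = (i, j, c)" by (cases k)
    show ?thesis using 5 wire[OF sl, of i j c s "n + shift i j c s"] by (simp add: k glen_def)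
  next
    case (6 k s b)
    obtain i j c where k: "k = (i, j, c)" by (cases k)
    have "(c, s) \<in> set slots" using 6 sl k by simp
    then show ?thesis using 6 wire[of c s 0 b] wpath_ne[of c s] by (simp add: k)
  next
    case (7 k s)
    obtain i j c where k: "k = (i, j, c)" by (cases k)
    have "(c, s) \<in> set slots" using 7 sl k by simp
    then show ?thesis using 7 wire[of c s 0] wpath_ne[of c s] by (simp add: k)
  next
    case (8 k)
    obtain i j c where k: "k = (i, j, c)" by (cases k)
    show ?thesis using 8 c10[of i j c] unfolding local_nodes_def k by auto
  next
    case (1 x)
    then show ?thesis using var v7 by (cases x) simp
  next
    case (2 x)
    then show ?thesis using var v7 by (cases x) simp
  next
    case (3 x)
    then show ?thesis using var v7 by (cases x) simp
  qed
qed

text \<open>\<open>Opp\<close> shares its local name with the start of a wire, but exactly in the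
  cells with \<open>Opp\<close> the path of this wire is moved on by \<open>shift\<close>.\<close>

lemma loc_inj: "inj_on loc net.nodes"
proof (rule inj_onI)
  fix u v assume u: "u \<in> net.nodes" and v: "v \<in> net.nodes" and eq: "loc u = loc v"
  have opp: "(i, j, w) \<in> gU" if "Opp (i, j, w) \<in> net.nodes" for i j w
    using that by cases
  have w6: "w = 6" if "(i, j, w) \<in> gU" for i j w using that by (simp add: gU_def)
  show "u = v"
    using u v eq by (cases u rule: loc.cases; cases v rule: loc.cases) (auto simp: shift_def dest!: opp dest: w6)
qed

lemma place_inj: "inj_on place net.nodes"
proof (rule inj_onI)
  fix u v assume u: "u \<in> net.nodes" and v: "v \<in> net.nodes" and eq: "place u = place v"
  obtain i j l where lu: "loc u = ((i, j), l)" by (metis prod.exhaust)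
  obtain i' j' l' where lv: "loc v = ((i', j'), l')" by (metis prod.exhaust)
  have e: "26 * i + fst (off l) = 26 * i' + fst (off l')" "26 * j + snd (off l) = 26 * j' + snd (off l')"
    using eq by (simp_all add: place_def padd_def lu lv)
  have "fst (off l) mod 26 = fst (off l') mod 26" "snd (off l) mod 26 = snd (off l') mod 26"
    using arg_cong[OF e(1), of "\<lambda>n. n mod 26"] arg_cong[OF e(2), of "\<lambda>n. n mod 26"] by simp_all
  then have "residue l = residue l'" by (simp add: residue_def)
  moreover have "l \<in> set local_nodes" "l' \<in> set local_nodes" using loc_local[OF u] loc_local[OF v] lu lv by simp_all
  ultimately have "l = l'" using distinct_residues by (auto simp: distinct_map inj_on_def)
  then have "loc u = loc v" using e by (simp add: lu lv)
  then show "u = v" using loc_inj u v by (auto dest: inj_onD)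
qed

text \<open>The edges once more, now as tabulated pairs of points with guards and without reference
  to nodes. In this form adjacency can be computed.\<close>

definition cell_pairs :: "nat \<Rightarrow> nat \<Rightarrow> ((nat \<times> nat) \<times> (nat \<times> nat)) set" where
  "cell_pairs i j = {(p, q). (\<exists>v\<in>set [0, 1, 2, 3, 4, 5, 6]. pv i j v \<and> ((p, q) = (vpos v, vneg v) \<or> (p, q) = (vpos v, vmid v)
      \<or> (i, j, v) \<notin> gU \<and> (p, q) = (vneg v, vmid v)))
    \<or> (i, j, 6) \<in> gU \<and> (p, q) = (vmid 6, wpath 6 1 ! 0)
    \<or> (\<exists>(c, s)\<in>set slots. pc i j c \<and> ps i j c s \<and> (p, q) \<in> set (wire_pairs c s))}"

definition arcs :: "((nat \<times> nat) \<times> (nat \<times> nat)) set" where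
  "arcs = {(padd (i, j) p, padd (i, j) q) |i j p q. i \<le> m \<and> j < 2 * N \<and> (p, q) \<in> cell_pairs i j}"

lemma in_zip_tl: "(a, b) \<in> set (zip p (tl p)) \<longleftrightarrow> (\<exists>n. Suc n < length p \<and> a = p ! n \<and> b = p ! Suc n)"
  by (cases p) (auto simp: set_zip)

lemma wire_pairs_iff:
  "pq \<in> set (wire_pairs c s) \<longleftrightarrow> pq = (wsrc c s, wpath c s ! 0)
    \<or> (\<exists>n. Suc n < length (wpath c s) \<and> pq = (wpath c s ! n, wpath c s ! Suc n))
    \<or> (\<exists>b. pq = (last (wpath c s), wside c s b)) \<or> (\<exists>b. pq = (wside c s b, wmer c s)) \<or> pq = (wmer c s, wcla c)"
proof -
  have ex: "(\<exists>b. P b) \<longleftrightarrow> P False \<or> P True" for P by (metis (full_types))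
  show ?thesis
    unfolding wire_pairs_def Let_def ex by (cases pq) (auto simp: in_zip_tl)
qed

lemma slot_cases:
  assumes "(c, s) \<in> set slots"
  shows "(c, s) = (0, 0) \<or> (c, s) = (0, 1) \<or> (c, s) = (0, 2) \<or> (c, s) = (1, 0) \<or> (c, s) = (1, 1) \<or> (c, s) = (1, 2)
    \<or> (c, s) = (2, 0) \<or> (c, s) = (2, 1) \<or> (c, s) = (3, 0) \<or> (c, s) = (3, 1) \<or> (c, s) = (4, 0) \<or> (c, s) = (4, 1)
    \<or> (c, s) = (5, 0) \<or> (c, s) = (5, 1) \<or> (c, s) = (6, 0) \<or> (c, s) = (6, 1) \<or> (c, s) = (7, 0) \<or> (c, s) = (7, 1)
    \<or> (c, s) = (8, 0) \<or> (c, s) = (8, 1) \<or> (c, s) = (9, 0) \<or> (c, s) = (9, 1)"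
  using assms by (simp add: slots_def)

text \<open>A source in the northern or western neighbour has coordinates that leave its own cell.
  Its coordinate 26 there is coordinate 0 here.\<close>

lemma src_off:
  assumes "pc i j c" "ps i j c s" "\<not> (c = 6 \<and> s = 1 \<and> (i, j, 6) \<in> gU)"
  shows "place (net.term_node (gsrc i j c s)) = padd (i, j) (wsrc c s)"
proof -
  have pos: "c \<in> {2, 3} \<Longrightarrow> 0 < i" "c \<in> {4, 5} \<Longrightarrow> 0 < j"
    using assms(1) by (auto simp: pc_def pv_def split: if_splits intro: odd_pos)
  have U: "(i, j, v) \<notin> gU" if "v \<noteq> 6" for v using that by (simp add: gU_def)
  have U': "i \<noteq> 0 \<Longrightarrow> (i, j, 6) \<notin> gU" by (simp add: gU_def)
  have i7: "c = 7 \<Longrightarrow> i \<noteq> 0" using assms(1) by (simp add: pc_def)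
  have up: "26 * (i - Suc 0) + 26 = 26 * i" if "0 < i" for i :: nat using that by (cases i) auto
  show ?thesis
    using slot_cases[OF pc_slots[OF assms(1,2)]] pos U U' i7 assms(3)
    by (elim disjE) (simp_all add: gsrc_def net.term_node_def place_def padd_def wsrc_def src_tab_def
      vpos_def vneg_def var_tab_def up)
qed

lemma last_wpath: "(c, s) \<in> set slots \<Longrightarrow> last (wpath c s) = wpath c s ! (length (wpath c s) - 1)"
  using wpath_ne by (simp add: last_conv_nth)

lemma wpath_6_1: "length (wpath 6 1) = 6" "(6, 1) \<in> set slots" "wsrc 6 1 = vneg 6"
  by (simp_all add: wpath_def path_tab_def slots_def wsrc_def src_tab_def vneg_def var_tab_def)

lemmas wpath_6_Suc = wpath_6_1[unfolded One_nat_def]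

lemma less7: "v < 7 \<Longrightarrow> v \<in> set [0, 1, 2, 3, 4, 5, 6 :: nat]"
  by auto

lemma gU_present: "(i, j, v) \<in> gU \<Longrightarrow> i = 0 \<and> v = 6 \<and> j < 2 * N \<and> pv i j 6 \<and> pc i j 6 \<and> ps i j 6 1"
  by (auto simp: gU_def pv_def pc_def ps_def)

lemma harc_arcs:
  assumes "(u, v) \<in> net.harc"
  shows "(place u, place v) \<in> arcs"
proof -
  have I: "(padd (i, j) p, padd (i, j) q) \<in> arcs" if "i \<le> m" "j < 2 * N" "(p, q) \<in> cell_pairs i j" for i j p q
    using that unfolding arcs_def by blast
  have V: "v \<in> set [0, 1, 2, 3, 4, 5, 6]" "i \<le> m" "j < 2 * N" if "pv i j v" for i j v
    using that less7[OF pv_less[OF that]] by (simp_all add: pv_def)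
  have W: "(padd (i, j) p, padd (i, j) q) \<in> arcs" if "pc i j c" "ps i j c s" "(p, q) \<in> set (wire_pairs c s)" for i j c s p q
  proof (rule I)
    show "i \<le> m" "j < 2 * N" using that(1) by (simp_all add: pc_def)
    show "(p, q) \<in> cell_pairs i j" using that pc_slots[OF that(1,2)] unfolding cell_pairs_def by blast
  qed
  have W1: "(padd (i, j) (wpath c s ! n), padd (i, j) (wpath c s ! Suc n)) \<in> arcs"
    if "pc i j c" "ps i j c s" "Suc n < length (wpath c s)" for i j c s n
    using that(3) by (intro W[OF that(1,2)]) (auto simp: wire_pairs_iff)
  have K: "pc i j c" "ps i j c s" if "(i, j, c) \<in> gK" "s \<in> gsl (i, j, c)" for i j c s
    using that by (simp_all add: gK_def gsl_def)
  have D: "place (Opp (i, j, 6)) = padd (i, j) (wpath 6 1 ! 0)" for i j by (simp add: place_def)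
  show ?thesis using assms
  proof cases
    case (PosNeg x)
    obtain i j w where x: "x = (i, j, w)" by (cases x)
    have pv: "pv i j w" using PosNeg x by (simp add: gX_def)
    have "(vpos w, vneg w) \<in> cell_pairs i j"
      unfolding cell_pairs_def using V(1)[OF pv] pv by blast
    from I[OF V(2,3)[OF pv] this] show ?thesis unfolding PosNeg x by (simp add: place_def)
  next
    case (PosMid x)
    obtain i j w where x: "x = (i, j, w)" by (cases x)
    have pv: "pv i j w" using PosMid x by (simp add: gX_def)
    have "(vpos w, vmid w) \<in> cell_pairs i j"
      unfolding cell_pairs_def using V(1)[OF pv] pv by blast
    from I[OF V(2,3)[OF pv] this] show ?thesis unfolding PosMid x by (simp add: place_def)
  next
    case (NegMid x)
    obtain i j w where x: "x = (i, j, w)" by (cases x)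
    have pv: "pv i j w" using NegMid x by (simp add: gX_def)
    have "(vneg w, vmid w) \<in> cell_pairs i j"
      unfolding cell_pairs_def using V(1)[OF pv] pv NegMid(4) x by blast
    from I[OF V(2,3)[OF pv] this] show ?thesis unfolding NegMid(1,2) x by (simp add: place_def)
  next
    case (NegOpp x)
    obtain i j w where x: "x = (i, j, w)" by (cases x)
    have U: "i = 0 \<and> w = 6 \<and> j < 2 * N \<and> pv i j 6 \<and> pc i j 6 \<and> ps i j 6 1" using NegOpp x gU_present[of i j w] by blast
    have "(padd (i, j) (vneg 6), padd (i, j) (wpath 6 1 ! 0)) \<in> arcs"
      using U by (intro W[of i j 6 1]) (auto simp: wire_pairs_iff wpath_6_Suc)
    then show ?thesis unfolding NegOpp x using U D by (simp add: place_def)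
  next
    case (MidOpp x)
    obtain i j w where x: "x = (i, j, w)" by (cases x)
    have U: "i = 0 \<and> w = 6 \<and> j < 2 * N \<and> pv i j 6 \<and> pc i j 6 \<and> ps i j 6 1" using MidOpp x gU_present[of i j w] by blast
    have "(padd (i, j) (vmid 6), padd (i, j) (wpath 6 1 ! 0)) \<in> arcs"
      using U MidOpp x by (intro I) (auto simp: cell_pairs_def)
    then show ?thesis unfolding MidOpp x using U D by (simp add: place_def)
  next
    case (SrcPath k s)
    obtain i j c where k: "k = (i, j, c)" by (cases k)
    have p: "pc i j c" "ps i j c s" using K SrcPath k by simp_all
    show ?thesis
    proof (cases "c = 6 \<and> s = 1 \<and> (i, j, 6) \<in> gU")
      case True
      then have "place u = padd (i, j) (wpath 6 1 ! 0)" "place v = padd (i, j) (wpath 6 1 ! Suc 0)"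
        using SrcPath k by (simp_all add: gs_def gsrc_def net.term_node_def place_def shift_def)
      then show ?thesis using W1[OF p, of 0] True by (simp add: wpath_6_Suc)
    next
      case False
      have "place u = padd (i, j) (wsrc c s)" unfolding SrcPath k gs_def using src_off[OF p False] by simp
      moreover have "place v = padd (i, j) (wpath c s ! 0)"
        unfolding SrcPath k using False by (auto simp: place_def shift_def)
      ultimately show ?thesis using W[OF p, of "wsrc c s" "wpath c s ! 0"] by (simp add: wire_pairs_iff)
    qed
  next
    case (PathPath k s n)
    obtain i j c where k: "k = (i, j, c)" by (cases k)
    have p: "pc i j c" "ps i j c s" using K PathPath k by simp_all
    show ?thesis unfolding PathPath k using W1[OF p, of "n + shift i j c s"] PathPath(5)
      by (simp add: place_def k glen_def)
  next
    case (PathSide k s b)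
    obtain i j c where k: "k = (i, j, c)" by (cases k)
    have p: "pc i j c" "ps i j c s" using K PathSide k by simp_all
    have "glen k s - 1 + shift i j c s = length (wpath c s) - 1"
      using glen_pos[OF pc_slots[OF p], of i j] by (simp add: k glen_def)
    then have "place u = padd (i, j) (last (wpath c s))"
      unfolding PathSide last_wpath[OF pc_slots[OF p]] by (simp add: k place_def)
    moreover have "place v = padd (i, j) (wside c s b)" unfolding PathSide k by (simp add: place_def)
    ultimately show ?thesis using W[OF p, of "last (wpath c s)" "wside c s b"] by (auto simp: wire_pairs_iff)
  next
    case (SideMer k s b)
    obtain i j c where k: "k = (i, j, c)" by (cases k)
    have p: "pc i j c" "ps i j c s" using K SideMer k by simp_all
    show ?thesis unfolding SideMer k using W[OF p, of "wside c s b" "wmer c s"]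
      by (auto simp: wire_pairs_iff place_def)
  next
    case (MerCla k s)
    obtain i j c where k: "k = (i, j, c)" by (cases k)
    have p: "pc i j c" "ps i j c s" using K MerCla k by simp_all
    show ?thesis unfolding MerCla k using W[OF p, of "wmer c s" "wcla c"]
      by (auto simp: wire_pairs_iff place_def)
  qed
qed

lemma arcs_harc:
  assumes "pq \<in> arcs"
  shows "\<exists>u v. (u, v) \<in> net.harc \<and> pq = (place u, place v)"
proof -
  obtain i j p q where pq: "pq = (padd (i, j) p, padd (i, j) q)" and ij: "i \<le> m" "j < 2 * N"
    and c: "(p, q) \<in> cell_pairs i j" using assms unfolding arcs_def by blast
  from c consider (v) v where "pv i j v" "(p, q) = (vpos v, vneg v) \<or> (p, q) = (vpos v, vmid v)
      \<or> (i, j, v) \<notin> gU \<and> (p, q) = (vneg v, vmid v)"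
    | (U) "(i, j, 6) \<in> gU" "(p, q) = (vmid 6, wpath 6 1 ! 0)"
    | (W) c s where "pc i j c" "ps i j c s" "(p, q) \<in> set (wire_pairs c s)"
    unfolding cell_pairs_def by blast
  then show ?thesis
  proof cases
    case v
    then have x: "(i, j, v) \<in> gX" by (simp add: gX_def)
    consider "(p, q) = (vpos v, vneg v)" | "(p, q) = (vpos v, vmid v)" | "(i, j, v) \<notin> gU" "(p, q) = (vneg v, vmid v)"
      using v(2) by blast
    then show ?thesis
    proof cases
      case 1
      then show ?thesis using net.PosNeg[OF x] by (intro exI[of _ "Pos (i, j, v)"] exI[of _ "Neg (i, j, v)"]) (simp add: pq place_def)
    next
      case 2
      then show ?thesis using net.PosMid[OF x] by (intro exI[of _ "Pos (i, j, v)"] exI[of _ "Mid (i, j, v)"]) (simp add: pq place_def)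
    next
      case 3
      then show ?thesis using net.NegMid[OF x] by (intro exI[of _ "Neg (i, j, v)"] exI[of _ "Mid (i, j, v)"]) (simp add: pq place_def)
    qed
  next
    case U
    then show ?thesis using net.MidOpp[OF U(1)]
      by (intro exI[of _ "Mid (i, j, 6)"] exI[of _ "Opp (i, j, 6)"]) (simp add: pq place_def)
  next
    case W
    have k: "(i, j, c) \<in> gK" "s \<in> gsl (i, j, c)" using W by (simp_all add: gK_def gsl_def)
    have sl: "(c, s) \<in> set slots" by (rule pc_slots[OF W(1,2)])
    have last: "place (Path (i, j, c) s (glen (i, j, c) s - 1)) = padd (i, j) (last (wpath c s))"
      unfolding last_wpath[OF sl] using glen_pos[OF sl, of i j] by (simp add: place_def glen_def)
    consider "(p, q) = (wsrc c s, wpath c s ! 0)"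
      | n where "Suc n < length (wpath c s)" "(p, q) = (wpath c s ! n, wpath c s ! Suc n)"
      | b where "(p, q) = (last (wpath c s), wside c s b)" | b where "(p, q) = (wside c s b, wmer c s)"
      | "(p, q) = (wmer c s, wcla c)"
      using W(3) unfolding wire_pairs_iff by blast
    then show ?thesis
    proof cases
      case 1
      show ?thesis
      proof (cases "c = 6 \<and> s = 1 \<and> (i, j, 6) \<in> gU")
        case True
        then show ?thesis using net.NegOpp[of "(i, j, 6)"] 1
          by (intro exI[of _ "Neg (i, j, 6)"] exI[of _ "Opp (i, j, 6)"]) (simp add: pq place_def wpath_6_Suc)
      next
        case False
        have "place (Path (i, j, c) s 0) = padd (i, j) (wpath c s ! 0)" using False by (auto simp: place_def shift_def)
        then show ?thesis using net.SrcPath[OF k] 1 src_off[OF W(1,2) False]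
          by (intro exI[of _ "net.term_node (gs (i, j, c) s)"] exI[of _ "Path (i, j, c) s 0"]) (simp add: pq gs_def)
      qed
    next
      case (2 n)
      show ?thesis
      proof (cases "c = 6 \<and> s = 1 \<and> (i, j, 6) \<in> gU")
        case True
        show ?thesis
        proof (cases n)
          case 0
          have "net.term_node (gs (i, j, c) s) = Opp (i, j, 6)"
            using True by (simp add: gs_def gsrc_def net.term_node_def)
          then show ?thesis using net.SrcPath[OF k] 2 0 True
            by (intro exI[of _ "Opp (i, j, 6)"] exI[of _ "Path (i, j, c) s 0"]) (simp add: pq place_def shift_def)
        next
          case (Suc n')
          then have "Suc n' < glen (i, j, c) s" using 2 True by (simp add: glen_def shift_def)
          then show ?thesis using net.PathPath[OF k] 2 Suc True
            by (intro exI[of _ "Path (i, j, c) s n'"] exI[of _ "Path (i, j, c) s (Suc n')"]) (simp add: pq place_def shift_def)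
        qed
      next
        case False
        then have sh: "shift i j c s = 0" by (auto simp: shift_def)
        then have "Suc n < glen (i, j, c) s" using 2 by (simp add: glen_def)
        then show ?thesis using net.PathPath[OF k] 2 sh
          by (intro exI[of _ "Path (i, j, c) s n"] exI[of _ "Path (i, j, c) s (Suc n)"]) (simp add: pq place_def)
      qed
    next
      case (3 b)
      then show ?thesis using net.PathSide[OF k, of b] last
        by (intro exI[of _ "Path (i, j, c) s (glen (i, j, c) s - 1)"] exI[of _ "Side (i, j, c) s b"])
          (simp add: pq, simp add: place_def)
    next
      case (4 b)
      then show ?thesis using net.SideMer[OF k, of b]
        by (intro exI[of _ "Side (i, j, c) s b"] exI[of _ "Mer (i, j, c) s"]) (simp add: pq place_def)
    next
      case 5
      then show ?thesis using net.MerCla[OF k]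
        by (intro exI[of _ "Mer (i, j, c) s"] exI[of _ "Cla (i, j, c)"]) (simp add: pq place_def)
    qed
  qed
qed

definition cell_twos :: "nat \<Rightarrow> nat \<Rightarrow> (nat \<times> nat) set" where
  "cell_twos i j = {p. (\<exists>v\<in>set [0, 1, 2, 3, 4, 5, 6]. pv i j v \<and> p = vmid v)
    \<or> (i, j, 6) \<in> gU \<and> (p = vpos 6 \<or> p = vneg 6)
    \<or> (\<exists>(c, s)\<in>set slots. pc i j c \<and> ps i j c s \<and> (p \<in> set (wpath c s) \<or> p = wside c s False \<or> p = wside c s True))
    \<or> (\<exists>c\<in>set [0, 1, 2, 3, 4, 5, 6, 7, 8, 9]. pc i j c \<and> \<not> (ps i j c 0 \<and> ps i j c 1 \<and> ps i j c 2) \<and> p = wcla c)}"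

definition twos :: "(nat \<times> nat) set" where
  "twos = {padd (i, j) p |i j p. i \<le> m \<and> j < 2 * N \<and> p \<in> cell_twos i j}"

lemma card_gsl_2: "pc i j c \<Longrightarrow> card (gsl (i, j, c)) = 2 \<longleftrightarrow> \<not> (ps i j c 0 \<and> ps i j c 1 \<and> ps i j c 2)"
proof -
  assume pc: "pc i j c"
  have sub: "gsl (i, j, c) \<subseteq> {0, 1, 2}"
  proof
    fix s assume "s \<in> gsl (i, j, c)"
    then have "s < 3" by (auto simp: gsl_def dest: ps_less)
    then show "s \<in> {0, 1, 2}" by auto
  qed
  have "card (gsl (i, j, c)) = 3 \<longleftrightarrow> gsl (i, j, c) = {0, 1, 2}"
    using card_subset_eq[OF _ sub] by auto
  also have "\<dots> \<longleftrightarrow> ps i j c 0 \<and> ps i j c 1 \<and> ps i j c 2"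
    using sub unfolding gsl_def by blast
  finally have "card (gsl (i, j, c)) = 3 \<longleftrightarrow> ps i j c 0 \<and> ps i j c 1 \<and> ps i j c 2" .
  moreover have "card (gsl (i, j, c)) \<in> {2, 3}" using card_gsl[OF pc] by (simp add: gsl_def)
  ultimately show ?thesis by force
qed

lemma twos_eq: "place ` {u \<in> net.nodes. net.hsize u = 2} = twos"
proof (intro set_eqI iffI)
  fix p assume "p \<in> place ` {u \<in> net.nodes. net.hsize u = 2}"
  then obtain u where u: "u \<in> net.nodes" "net.hsize u = 2" "p = place u" by blast
  have I: "padd (i, j) q \<in> twos" if "i \<le> m" "j < 2 * N" "q \<in> cell_twos i j" for i j q
    using that unfolding twos_def by blast
  have V: "v \<in> set [0, 1, 2, 3, 4, 5, 6]" "i \<le> m" "j < 2 * N" if "pv i j v" for i j v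
    using that less7[OF pv_less[OF that]] by (simp_all add: pv_def)
  have W: "padd (i, j) q \<in> twos" if "pc i j c" "ps i j c s"
    "q \<in> set (wpath c s) \<or> (\<exists>b. q = wside c s b)" for i j c s q
  proof (rule I)
    show "i \<le> m" "j < 2 * N" using that(1) by (simp_all add: pc_def)
    have "q \<in> set (wpath c s) \<or> q = wside c s False \<or> q = wside c s True" using that(3) by (metis (full_types))
    then show "q \<in> cell_twos i j" using that(1,2) pc_slots[OF that(1,2)] unfolding cell_twos_def by blast
  qed
  have K: "pc i j c" "ps i j c s" if "(i, j, c) \<in> gK" "s \<in> gsl (i, j, c)" for i j c s
    using that by (simp_all add: gK_def gsl_def)
  show "p \<in> twos" using u(1)
  proof cases
    case (1 x)
    obtain i j v where x: "x = (i, j, v)" by (cases x)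
    have U: "(i, j, v) \<in> gU" using u(2) 1 x by (simp split: if_splits)
    note g = gU_present[OF U]
    show ?thesis unfolding u(3) 1 x using I[of i j "vpos 6"] U g V(2,3)[of i j 6]
      by (simp add: place_def cell_twos_def)
  next
    case (2 x)
    obtain i j v where x: "x = (i, j, v)" by (cases x)
    have U: "(i, j, v) \<in> gU" using u(2) 2 x by (simp split: if_splits)
    note g = gU_present[OF U]
    show ?thesis unfolding u(3) 2 x using I[of i j "vneg 6"] U g V(2,3)[of i j 6]
      by (simp add: place_def cell_twos_def)
  next
    case (3 x)
    obtain i j v where x: "x = (i, j, v)" by (cases x)
    have pv: "pv i j v" using 3 x by (simp add: gX_def)
    have "vmid v \<in> cell_twos i j" unfolding cell_twos_def using pv V(1)[OF pv] by blast
    then show ?thesis unfolding u(3) 3 x using I[OF V(2,3)[OF pv]] by (simp add: place_def)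
  next
    case (4 x)
    obtain i j v where x: "x = (i, j, v)" by (cases x)
    have g: "pc i j 6 \<and> ps i j 6 1" using gU_present 4 x by blast
    show ?thesis unfolding u(3) 4 x using W[of i j 6 1 "wpath 6 1 ! 0"] g by (simp add: place_def wpath_6_1 wpath_6_Suc)
  next
    case (5 k s n)
    obtain i j c where k: "k = (i, j, c)" by (cases k)
    have p: "pc i j c" "ps i j c s" using K 5 k by simp_all
    have "n + shift i j c s < length (wpath c s)" using 5(4) by (simp add: k glen_def)
    then show ?thesis unfolding u(3) 5 k using W[OF p] by (simp add: place_def)
  next
    case (6 k s b)
    obtain i j c where k: "k = (i, j, c)" by (cases k)
    have p: "pc i j c" "ps i j c s" using K 6 k by simp_all
    show ?thesis unfolding u(3) 6 k using W[OF p, of "wside c s b"] by (auto simp: place_def)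
  next
    case (7 k s)
    then show ?thesis using u(2) by simp
  next
    case (8 k)
    obtain i j c where k: "k = (i, j, c)" by (cases k)
    have pc: "pc i j c" using 8 k by (simp add: gK_def)
    have "c \<in> set [0, 1, 2, 3, 4, 5, 6, 7, 8, 9]" using pc_less[OF pc] by auto
    moreover have "\<not> (ps i j c 0 \<and> ps i j c 1 \<and> ps i j c 2)" using u(2) 8 k card_gsl_2[OF pc] by simp
    ultimately have "wcla c \<in> cell_twos i j" unfolding cell_twos_def using pc by blast
    then show ?thesis unfolding u(3) 8 k using I[of i j "wcla c"] pc by (simp add: place_def pc_def)
  qed
next
  fix p assume "p \<in> twos"
  then obtain i j q where p: "p = padd (i, j) q" and ij: "i \<le> m" "j < 2 * N" and q: "q \<in> cell_twos i j"
    unfolding twos_def by blast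
  have I: "p \<in> place ` {u \<in> net.nodes. net.hsize u = 2}" if "u \<in> net.nodes" "net.hsize u = 2" "p = place u" for u
    using that by blast
  from q consider (v) v where "pv i j v" "q = vmid v"
    | (U) "(i, j, 6) \<in> gU" "q = vpos 6 \<or> q = vneg 6"
    | (W) c s where "pc i j c" "ps i j c s" "q \<in> set (wpath c s)"
    | (S) c s b where "pc i j c" "ps i j c s" "q = wside c s b"
    | (C) c where "pc i j c" "\<not> (ps i j c 0 \<and> ps i j c 1 \<and> ps i j c 2)" "q = wcla c"
    unfolding cell_twos_def by blast
  then show "p \<in> place ` {u \<in> net.nodes. net.hsize u = 2}"
  proof cases
    case v
    have "(i, j, v) \<in> gX" using v by (simp add: gX_def)
    then show ?thesis using v by (intro I[of "Mid (i, j, v)"]) (simp_all add: p place_def net.nodes.intros)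
  next
    case U
    have x: "(i, j, 6) \<in> gX" using gU_present[OF U(1)] unfolding gX_def by blast
    from U(2) show ?thesis
    proof
      assume "q = vpos 6"
      then show ?thesis using x U(1) by (intro I[of "Pos (i, j, 6)"]) (simp_all add: p place_def net.nodes.intros)
    next
      assume "q = vneg 6"
      then show ?thesis using x U(1) by (intro I[of "Neg (i, j, 6)"]) (simp_all add: p place_def net.nodes.intros)
    qed
  next
    case W
    have k: "(i, j, c) \<in> gK" "s \<in> gsl (i, j, c)" using W by (simp_all add: gK_def gsl_def)
    obtain n where n: "n < length (wpath c s)" "q = wpath c s ! n" using W(3) by (auto simp: in_set_conv_nth)
    show ?thesis
    proof (cases "n < shift i j c s")
      case True
      then have "c = 6" "s = 1" "(i, j, 6) \<in> gU" "n = 0" by (auto simp: shift_def of_bool_def split: if_splits)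
      then show ?thesis using n by (intro I[of "Opp (i, j, 6)"]) (simp_all add: p place_def net.nodes.intros)
    next
      case False
      then have "n - shift i j c s < glen (i, j, c) s" using n by (simp add: glen_def)
      then show ?thesis using False n k
        by (intro I[of "Path (i, j, c) s (n - shift i j c s)"]) (simp_all add: p place_def net.nodes.intros)
    qed
  next
    case S
    have k: "(i, j, c) \<in> gK" "s \<in> gsl (i, j, c)" using S by (simp_all add: gK_def gsl_def)
    then show ?thesis using S by (intro I[of "Side (i, j, c) s b"]) (simp_all add: p place_def net.nodes.intros)
  next
    case C
    have k: "(i, j, c) \<in> gK" using C by (simp add: gK_def)
    then show ?thesis using C card_gsl_2[OF C(1)] by (intro I[of "Cla (i, j, c)"]) (simp_all add: p place_def net.nodes.intros)
  qed
qed

end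

section \<open>Planarity, odd holes and degrees of lattice graphs with helpers\<close>

section \<open>Lattice graphs with helpers\<close>

lemma planar_straight:
  fixes pos :: "'a \<Rightarrow> real \<times> real"
  assumes inj: "inj_on pos (verts G)"
    and edge: "\<And>e. e \<in> edges G \<Longrightarrow> \<exists>u\<in>verts G. \<exists>v\<in>verts G. u \<noteq> v \<and> e = {u, v}"
    and vertex: "\<And>u v w. {u, v} \<in> edges G \<Longrightarrow> w \<in> verts G \<Longrightarrow> pos w \<in> closed_segment (pos u) (pos v) \<Longrightarrow> w = u \<or> w = v"
    and cross: "\<And>u v u' v' x. {u, v} \<in> edges G \<Longrightarrow> {u', v'} \<in> edges G \<Longrightarrow> {u, v} \<noteq> {u', v'} \<Longrightarrow>
      x \<in> closed_segment (pos u) (pos v) \<Longrightarrow> x \<in> closed_segment (pos u') (pos v') \<Longrightarrow>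
      \<exists>w\<in>{u, v} \<inter> {u', v'}. x = pos w"
  shows "planar G"
proof -
  have "\<exists>g. \<forall>e\<in>edges G. \<exists>u\<in>verts G. \<exists>v\<in>verts G. u \<noteq> v \<and> e = {u, v} \<and> g e = linepath (pos u) (pos v)"
    using edge by (intro bchoice) metis
  then obtain g where g: "\<And>e. e \<in> edges G \<Longrightarrow>
      \<exists>u\<in>verts G. \<exists>v\<in>verts G. u \<noteq> v \<and> e = {u, v} \<and> g e = linepath (pos u) (pos v)" by blast
  show ?thesis unfolding planar_def
  proof (intro exI[of _ pos] exI[of _ g] conjI ballI impI)
    fix e assume e: "e \<in> edges G"
    obtain u v where uv: "u \<in> verts G" "v \<in> verts G" "u \<noteq> v" "e = {u, v}" "g e = linepath (pos u) (pos v)"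
      using g[OF e] by blast
    have "pos u \<noteq> pos v" using inj uv by (auto dest: inj_onD)
    then show "arc (g e)" unfolding uv(5) by simp
    show "{pathstart (g e), pathfinish (g e)} = pos ` e" unfolding uv(5) by (simp add: uv(4))
    have euv: "{u, v} \<in> edges G" using e uv(4) by simp
    have "closed_segment (pos u) (pos v) \<inter> pos ` verts G \<subseteq> {pos u, pos v}" using vertex[OF euv] by blast
    then show "path_image (g e) \<inter> pos ` verts G = pos ` e"
      unfolding uv(5) path_image_linepath unfolding uv(4) using uv(1,2) by auto
    fix e' assume e': "e' \<in> edges G" "e \<noteq> e'"
    obtain u' v' where uv': "u' \<in> verts G" "v' \<in> verts G" "e' = {u', v'}" "g e' = linepath (pos u') (pos v')"
      using g[OF e'(1)] by blast
    show "path_image (g e) \<inter> path_image (g e') = pos ` (e \<inter> e')"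
    proof
      have "{u', v'} \<in> edges G" "{u, v} \<noteq> {u', v'}" using e' uv(4) uv'(3) by simp_all
      note c = cross[OF euv this]
      show "path_image (g e) \<inter> path_image (g e') \<subseteq> pos ` (e \<inter> e')"
        unfolding uv(5) uv'(4) path_image_linepath unfolding uv(4) uv'(3) by (rule subsetI) (metis IntD1 IntD2 c image_eqI)
      show "pos ` (e \<inter> e') \<subseteq> path_image (g e) \<inter> path_image (g e')"
        unfolding uv(5) uv'(4) using uv(4) uv'(3) by auto
    qed
  qed (fact inj)
qed

text \<open>Index 0 is a lattice point, 1 to 7 form its helper, 8 and 9 are the next lattice points
  in its row and in its column. The helper lies inside the triangle of these three; the side length
  14 gives room for integer coordinates.\<close>

definition drawing :: "(int \<times> int) list" where
  "drawing = [(0, 0), (6, 6), (6, 2), (7, 4), (8, 4), (2, 6), (2, 7), (1, 8), (0, 14), (14, 0)]"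

definition local_arcs :: "(nat \<times> nat) list" where
  "local_arcs = [(0, 8), (0, 9), (8, 9), (0, 1), (0, 2), (0, 5), (2, 3), (2, 4), (3, 4), (3, 1), (4, 1), (5, 6), (5, 7), (6, 7), (6, 1), (7, 1)]"

text \<open>The orientation determinant: its sign tells on which side of the line through
  \<open>p\<close> and \<open>q\<close> the point \<open>x\<close> lies.\<close>

definition cross :: "int \<times> int \<Rightarrow> int \<times> int \<Rightarrow> int \<times> int \<Rightarrow> int" where
  "cross p q x = (fst q - fst p) * (snd x - snd p) - (snd q - snd p) * (fst x - fst p)"

text \<open>General position with respect to whole lines, not only to the segments: arcs that touch
  the line of another arc with an end must share this end.\<close>

lemma drawing_vertex:
  "\<forall>(a, b)\<in>set local_arcs. \<forall>k\<in>set [0..<10]. k \<noteq> a \<and> k \<noteq> b \<longrightarrow> cross (drawing ! a) (drawing ! b) (drawing ! k) \<noteq> 0"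
  by code_simp

text \<open>Of two arcs, one stays in a closed half plane of the line through the other. With the
  general position this leaves only common ends.\<close>

lemma drawing_edges:
  "\<forall>(a, b)\<in>set local_arcs. \<forall>(c, d)\<in>set local_arcs.
     cross (drawing ! a) (drawing ! b) (drawing ! c) * cross (drawing ! a) (drawing ! b) (drawing ! d) \<ge> 0 \<or>
     cross (drawing ! c) (drawing ! d) (drawing ! a) * cross (drawing ! c) (drawing ! d) (drawing ! b) \<ge> 0"
  by code_simp

lemma local_arcs_less: "(a, b) \<in> set local_arcs \<Longrightarrow> a < 10 \<and> b < 10 \<and> a \<noteq> b"
  by (auto simp: local_arcs_def)

definition rpt :: "int \<times> int \<Rightarrow> real \<times> real" where
  "rpt p = (of_int (fst p), of_int (snd p))"

definition rcross :: "real \<times> real \<Rightarrow> real \<times> real \<Rightarrow> real \<times> real \<Rightarrow> real" where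
  "rcross p q x = (fst q - fst p) * (snd x - snd p) - (snd q - snd p) * (fst x - fst p)"

lemma rcross_rpt: "rcross (rpt p) (rpt q) (rpt x) = of_int (cross p q x)"
  by (simp add: rcross_def rpt_def cross_def)

lemma rcross_segment: "rcross p q ((1 - t) *\<^sub>R x + t *\<^sub>R y) = (1 - t) * rcross p q x + t * rcross p q y"
  by (simp add: rcross_def algebra_simps)

lemma rcross_self [simp]: "rcross p q p = 0" "rcross p q q = 0"
  by (simp_all add: rcross_def)

lemma rcross_on_segment:
  assumes "x \<in> closed_segment p q"
  shows "rcross p q x = 0"
  using assms by (auto simp: in_segment rcross_segment)

abbreviation lpt :: "nat \<Rightarrow> real \<times> real" where
  "lpt k \<equiv> rpt (drawing ! k)"

lemma local_vertex:
  assumes "(a, b) \<in> set local_arcs" "k < 10" "lpt k \<in> closed_segment (lpt a) (lpt b)"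
  shows "k = a \<or> k = b"
proof -
  have "cross (drawing ! a) (drawing ! b) (drawing ! k) = 0"
    using rcross_on_segment[OF assms(3)] by (simp add: rcross_rpt)
  then show ?thesis using drawing_vertex assms(1,2) by fastforce
qed

text \<open>At a common point, a convex combination of the two orientation values is zero. As the
  values do not have opposite signs, the point is an end of the first arc and lies on the line of
  the second one, so it is an end of that arc too.\<close>

lemma local_edges_aux:
  assumes ab: "(a, b) \<in> set local_arcs" and cd: "(c, d) \<in> set local_arcs" and ne: "{a, b} \<noteq> {c, d}"
    and x: "x \<in> closed_segment (lpt a) (lpt b)" "x \<in> closed_segment (lpt c) (lpt d)"
    and sg: "cross (drawing ! c) (drawing ! d) (drawing ! a) * cross (drawing ! c) (drawing ! d) (drawing ! b) \<ge> 0"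
  shows "\<exists>k\<in>{a, b} \<inter> {c, d}. x = lpt k"
proof -
  let ?A = "rcross (lpt c) (lpt d) (lpt a)" and ?B = "rcross (lpt c) (lpt d) (lpt b)"
  obtain t where t: "0 \<le> t" "t \<le> 1" "x = (1 - t) *\<^sub>R lpt a + t *\<^sub>R lpt b"
    using x(1) by (auto simp: in_segment)
  have z: "(1 - t) * ?A + t * ?B = 0"
    using rcross_on_segment[OF x(2)] unfolding t(3) rcross_segment .
  have s: "?A * ?B \<ge> 0" using sg unfolding rcross_rpt of_int_mult[symmetric] by (simp only: of_int_0_le_iff)
  have A: "?A = 0 \<Longrightarrow> a \<in> {c, d}" and B: "?B = 0 \<Longrightarrow> b \<in> {c, d}"
    using drawing_vertex cd local_arcs_less[OF ab] unfolding rcross_rpt by fastforce+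
  have ab': "a \<noteq> b" "c \<noteq> d" using local_arcs_less ab cd by blast+
  have "t = 0 \<or> t = 1 \<or> ?A = 0 \<and> ?B = 0"
  proof (rule ccontr)
    assume *: "\<not> ?thesis"
    then have "0 < t" "0 < 1 - t" using t by auto
    then consider "?A > 0 \<or> ?B > 0" "?A \<ge> 0" "?B \<ge> 0" | "?A < 0 \<or> ?B < 0" "?A \<le> 0" "?B \<le> 0"
      using s * by (fastforce simp: zero_le_mult_iff)
    then show False
    proof cases
      case 1
      then have "0 \<le> (1 - t) * ?A" "0 \<le> t * ?B" "0 < (1 - t) * ?A \<or> 0 < t * ?B"
        using \<open>0 < t\<close> \<open>0 < 1 - t\<close> by (auto simp: zero_less_mult_iff)
      then show False using z by linarith
    next
      case 2
      then have "(1 - t) * ?A \<le> 0" "t * ?B \<le> 0" "(1 - t) * ?A < 0 \<or> t * ?B < 0"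
        using \<open>0 < t\<close> \<open>0 < 1 - t\<close> by (auto simp: mult_less_0_iff mult_le_0_iff)
      then show False using z by linarith
    qed
  qed
  moreover have "\<not> (?A = 0 \<and> ?B = 0)" using A B ne ab' by blast
  ultimately consider "t = 0" | "t = 1" by blast
  then show ?thesis
  proof cases
    case 1
    then show ?thesis using z A t(3) by auto
  next
    case 2
    then show ?thesis using z B t(3) by auto
  qed
qed

lemma local_edges:
  assumes "(a, b) \<in> set local_arcs" "(c, d) \<in> set local_arcs" "{a, b} \<noteq> {c, d}"
    "x \<in> closed_segment (lpt a) (lpt b)" "x \<in> closed_segment (lpt c) (lpt d)"
  shows "\<exists>k\<in>{a, b} \<inter> {c, d}. x = lpt k"
proof -
  consider "cross (drawing ! c) (drawing ! d) (drawing ! a) * cross (drawing ! c) (drawing ! d) (drawing ! b) \<ge> 0"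
    | "cross (drawing ! a) (drawing ! b) (drawing ! c) * cross (drawing ! a) (drawing ! b) (drawing ! d) \<ge> 0"
    using drawing_edges assms(1,2) by fast
  then show ?thesis
  proof cases
    case 1
    then show ?thesis using local_edges_aux assms by blast
  next
    case 2
    then show ?thesis using local_edges_aux[of c d a b x] assms by (metis Int_commute)
  qed
qed


definition lattice_pos :: "(nat \<times> nat) \<times> nat \<Rightarrow> real \<times> real" where
  "lattice_pos w = (14 * of_nat (fst (fst w)), 14 * of_nat (snd (fst w))) + lpt (snd w)"

definition lvert :: "nat \<times> nat \<Rightarrow> nat \<Rightarrow> (nat \<times> nat) \<times> nat" where
  "lvert p k = (if k = 8 then ((fst p, snd p + 1), 0) else if k = 9 then ((fst p + 1, snd p), 0) else (p, k))"

lemma lattice_pos_lvert: "lattice_pos (lvert p k) = (14 * of_nat (fst p), 14 * of_nat (snd p)) + lpt k"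
  by (simp add: lattice_pos_def lvert_def rpt_def drawing_def)

definition tri :: "(real \<times> real) set" where
  "tri = {y. 0 \<le> fst y \<and> 0 \<le> snd y \<and> fst y + snd y \<le> 14}"

lemma lpt_tri: "k < 10 \<Longrightarrow> lpt k \<in> tri"
proof -
  have "\<forall>k\<in>set [0..<10]. 0 \<le> fst (drawing ! k) \<and> 0 \<le> snd (drawing ! k) \<and> fst (drawing ! k) + snd (drawing ! k) \<le> 14"
    by code_simp
  moreover assume "k < 10"
  ultimately have "0 \<le> fst (drawing ! k)" "0 \<le> snd (drawing ! k)" "fst (drawing ! k) + snd (drawing ! k) \<le> 14" by simp_all
  then show ?thesis by (simp add: tri_def rpt_def)
qed

lemma convex_tri: "convex tri"
proof -
  have "tri = {y. (1, 0) \<bullet> y \<ge> 0} \<inter> {y. (0, 1) \<bullet> y \<ge> 0} \<inter> {y. (1, 1) \<bullet> y \<le> 14}"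
    by (auto simp: tri_def inner_prod_def)
  then show ?thesis using convex_Int convex_halfspace_ge convex_halfspace_le by metis
qed

lemma segment_tri:
  assumes "(a, b) \<in> set local_arcs"
  shows "closed_segment (lpt a) (lpt b) \<subseteq> tri"
  using local_arcs_less[OF assms] lpt_tri convex_tri by (simp add: closed_segment_subset)

text \<open>A lattice point owns only one of the two halves of its unit square, and these halves
  touch in lattice points only. Crossings thus have to be excluded inside a single triangle, a
  finite computation.\<close>

lemma tri_meet:
  assumes "y \<in> tri" "z \<in> tri" "p \<noteq> q"
    and eq: "(14 * of_nat (fst p), 14 * of_nat (snd p)) + y = (14 * of_nat (fst q), 14 * of_nat (snd q)) + z"
  shows "\<exists>k\<in>{0, 8, 9}. y = lpt k"
proof -
  define d where "d = int (fst q) - int (fst p)"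
  define e where "e = int (snd q) - int (snd p)"
  have y: "fst y = 14 * of_int d + fst z" "snd y = 14 * of_int e + snd z"
    using eq by (cases y; cases z; simp add: d_def e_def)+
  have de: "d \<noteq> 0 \<or> e \<noteq> 0" using \<open>p \<noteq> q\<close> by (auto simp: d_def e_def prod_eq_iff)
  have b: "0 \<le> fst y" "0 \<le> snd y" "fst y + snd y \<le> 14" "0 \<le> fst z" "0 \<le> snd z" "fst z + snd z \<le> 14"
    using assms(1,2) by (simp_all add: tri_def)
  have le1: "(14 :: real) * of_int n \<ge> 14" if "n \<ge> 1" for n :: int using that by simp
  have le2: "(14 :: real) * of_int n \<le> -14" if "n \<le> -1" for n :: int
  proof -
    have "(of_int n :: real) \<le> of_int (-1)" using that by (simp only: of_int_le_iff)
    then show ?thesis by simp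
  qed
  have "\<exists>m n. fst y = 14 * of_int m \<and> snd y = 14 * of_int n"
  proof -
    \<comment> \<open>A shift by one side length in either coordinate uses up the whole triangle, so
      one of the two points has to be a corner.\<close>
    consider "d \<le> -1" | "e \<le> -1" | "d \<ge> 1" | "e \<ge> 1" using de by linarith
    then show ?thesis
    proof cases
      case 1
      then have "fst z = 14" "snd z = 0" using le2[of d] y b by linarith+
      then show ?thesis using y by (intro exI[of _ "d + 1"] exI[of _ e]) simp
    next
      case 2
      then have "fst z = 0" "snd z = 14" using le2[of e] y b by linarith+
      then show ?thesis using y by (intro exI[of _ d] exI[of _ "e + 1"]) simp
    next
      case 3
      then have "fst y = 14" "snd y = 0" using le1[of d] y b by linarith+
      then show ?thesis by (intro exI[of _ 1] exI[of _ 0]) simp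
    next
      case 4
      then have "fst y = 0" "snd y = 14" using le1[of e] y b by linarith+
      then show ?thesis by (intro exI[of _ 0] exI[of _ 1]) simp
    qed
  qed
  then obtain m n where mn: "fst y = 14 * of_int m" "snd y = 14 * of_int n" by blast
  have "(0 :: real) \<le> of_int m" "(0 :: real) \<le> of_int n" "of_int (m + n) \<le> (1 :: real)"
    using b unfolding mn by auto
  then have "m \<ge> 0" "n \<ge> 0" "m + n \<le> 1" by linarith+
  then have "(m, n) = (0, 0) \<or> (m, n) = (0, 1) \<or> (m, n) = (1, 0)" by auto
  then show ?thesis using mn by (cases y) (auto simp: rpt_def drawing_def)
qed

lemma drawing_distinct: "distinct drawing"
  by (simp add: drawing_def)

lemma lpt_inj: "k < 10 \<Longrightarrow> l < 10 \<Longrightarrow> lpt k = lpt l \<Longrightarrow> k = l"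
  using drawing_distinct nth_eq_iff_index_eq[of drawing k l] by (auto simp: rpt_def prod_eq_iff drawing_def)

lemma lattice_pos_inj:
  assumes "snd u < 8" "snd v < 8" "lattice_pos u = lattice_pos v"
  shows "u = v"
proof -
  obtain p k q l where uv: "u = (p, k)" "v = (q, l)" by (metis surj_pair)
  have eq: "(14 * of_nat (fst p), 14 * of_nat (snd p)) + lpt k = (14 * of_nat (fst q), 14 * of_nat (snd q)) + lpt l"
    using assms(3) by (simp add: lattice_pos_def uv)
  show ?thesis
  proof (cases "p = q")
    case True
    then have "lpt k = lpt l" using eq by simp
    then show ?thesis using lpt_inj[of k l] assms uv True by simp
  next
    case False
    have "k < 8" "l < 8" using assms uv by simp_all
    then obtain k' l' where "k' \<in> {0, 8, 9}" "lpt k = lpt k'" "l' \<in> {0, 8, 9}" "lpt l = lpt l'"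
      using tri_meet[OF _ _ False eq] tri_meet[OF _ _ False[symmetric] eq[symmetric]] lpt_tri[of k] lpt_tri[of l] by force
    then have "k = 0" "l = 0" using lpt_inj[of k k'] lpt_inj[of l l'] \<open>k < 8\<close> \<open>l < 8\<close> by auto
    then have "p = q" using eq by (simp add: prod_eq_iff)
    then show ?thesis using False by simp
  qed
qed

lemma lvert_less: "k < 10 \<Longrightarrow> snd (lvert p k) < 8"
  by (simp add: lvert_def)

lemma helper_arcs_local: "helper_arcs \<subseteq> set local_arcs"
  by (auto simp: helper_arcs_def local_arcs_def)

text \<open>An edge to a smaller neighbour is attributed to that neighbour, and a diagonal is the
  hypotenuse in the triangle of a third lattice point.\<close>

lemma with_helpers_local:
  assumes A: "\<forall>(p, q)\<in>A. ladj p q \<or> anti p q" and e: "e \<in> edges (with_helpers V A D)"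
  shows "\<exists>p a b. (a, b) \<in> set local_arcs \<and> e = {lvert p a, lvert p b}"
proof -
  from e consider (A) p q where "(p, q) \<in> A" "e = {(p, 0), (q, 0)}"
    | (H) p i j where "(i, j) \<in> helper_arcs" "e = {(p, i), (p, j)}"
    by (auto simp: with_helpers_def)
  then show ?thesis
  proof cases
    case A
    obtain r c r' c' where pq: "p = (r, c)" "q = (r', c')" by (metis surj_pair)
    have "ladj p q \<or> anti p q" using A assms(1) by blast
    then consider "r' = r" "c' = c + 1" | "r' = r" "c = c' + 1" | "c = c'" "r' = r + 1" | "c = c'" "r = r' + 1"
      | "r' = r + 1" "c = c' + 1" | "r = r' + 1" "c' = c + 1"
      by (auto simp: ladj_def anti_def pq)
    then show ?thesis
    proof cases
      case 1
      then show ?thesis unfolding A(2) pq by (intro exI[of _ "(r, c)"] exI[of _ 0] exI[of _ 8]) (simp add: lvert_def local_arcs_def)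
    next
      case 2
      then show ?thesis unfolding A(2) pq by (intro exI[of _ "(r, c')"] exI[of _ 0] exI[of _ 8]) (auto simp add: lvert_def local_arcs_def)
    next
      case 3
      then show ?thesis unfolding A(2) pq by (intro exI[of _ "(r, c)"] exI[of _ 0] exI[of _ 9]) (simp add: lvert_def local_arcs_def)
    next
      case 4
      then show ?thesis unfolding A(2) pq by (intro exI[of _ "(r', c)"] exI[of _ 0] exI[of _ 9]) (auto simp add: lvert_def local_arcs_def)
    next
      case 5
      then show ?thesis unfolding A(2) pq by (intro exI[of _ "(r, c')"] exI[of _ 8] exI[of _ 9]) (simp add: lvert_def local_arcs_def)
    next
      case 6
      then show ?thesis unfolding A(2) pq by (intro exI[of _ "(r', c)"] exI[of _ 8] exI[of _ 9]) (auto simp add: lvert_def local_arcs_def)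
    qed
  next
    case H
    have "i < 8" "j < 8" using H(1) by (auto simp: helper_arcs_def)
    then show ?thesis unfolding H(2)
      using helper_arcs_local H(1) by (intro exI[of _ p] exI[of _ i] exI[of _ j]) (auto simp: lvert_def)
  qed
qed

lemma planar_with_helpers:
  assumes A: "\<forall>(p, q)\<in>A. ladj p q \<or> anti p q" and AV: "A \<subseteq> V \<times> V" and DV: "D \<subseteq> V"
  shows "planar (with_helpers V A D)"
proof (rule planar_straight[of lattice_pos])
  let ?G = "with_helpers V A D"
  have vG: "snd w < 8" if "w \<in> verts ?G" for w using that by (auto simp: with_helpers_def)
  show "inj_on lattice_pos (verts ?G)"
    using lattice_pos_inj vG by (intro inj_onI) blast
  show "\<exists>u\<in>verts ?G. \<exists>v\<in>verts ?G. u \<noteq> v \<and> e = {u, v}" if "e \<in> edges ?G" for e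
  proof -
    from that consider (A) p q where "(p, q) \<in> A" "e = {(p, 0), (q, 0)}"
      | (H) p i j where "p \<in> D" "(i, j) \<in> helper_arcs" "e = {(p, i), (p, j)}"
      by (auto simp: with_helpers_def)
    then show ?thesis
    proof cases
      case A
      have "p \<noteq> q" using assms(1) A(1) by (force simp: ladj_def anti_def)
      have "(p, 0) \<in> verts ?G" "(q, 0) \<in> verts ?G" using A AV by (auto simp: with_helpers_def)
      then show ?thesis using A(2) \<open>p \<noteq> q\<close> by blast
    next
      case H
      have "i < 8" "j < 8" "i \<noteq> j" using H(2) by (auto simp: helper_arcs_def)
      then show ?thesis using H DV by (auto simp: with_helpers_def)
    qed
  qed
  have local: "\<exists>p a b. (a, b) \<in> set local_arcs \<and> {u, v} = {lvert p a, lvert p b} \<and>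
      closed_segment (lattice_pos u) (lattice_pos v)
        = (+) (14 * of_nat (fst p), 14 * of_nat (snd p)) ` closed_segment (lpt a) (lpt b)"
    if in_edges: "{u, v} \<in> edges ?G" for u v
  proof -
    obtain p a b where *: "(a, b) \<in> set local_arcs" "{u, v} = {lvert p a, lvert p b}"
      using with_helpers_local[OF A in_edges] by blast
    have "closed_segment (lattice_pos u) (lattice_pos v) = closed_segment (lattice_pos (lvert p a)) (lattice_pos (lvert p b))"
      using *(2) by (metis closed_segment_commute doubleton_eq_iff)
    then show ?thesis using * unfolding lattice_pos_lvert closed_segment_translation by blast
  qed
  show "w = u \<or> w = v"
    if uv: "{u, v} \<in> edges ?G" and w: "w \<in> verts ?G" "lattice_pos w \<in> closed_segment (lattice_pos u) (lattice_pos v)" for u v w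
  proof -
    obtain p a b where ab: "(a, b) \<in> set local_arcs" "{u, v} = {lvert p a, lvert p b}" and
      cs: "closed_segment (lattice_pos u) (lattice_pos v)
        = (+) (14 * of_nat (fst p), 14 * of_nat (snd p)) ` closed_segment (lpt a) (lpt b)" using local[OF uv] by blast
    obtain y where y: "y \<in> closed_segment (lpt a) (lpt b)" "lattice_pos w = (14 * of_nat (fst p), 14 * of_nat (snd p)) + y"
      using w(2) unfolding cs by blast
    obtain q k where wq: "w = (q, k)" by (cases w)
    have k: "k < 8" using vG[OF w(1)] wq by simp
    have eq: "(14 * of_nat (fst p), 14 * of_nat (snd p)) + y = (14 * of_nat (fst q), 14 * of_nat (snd q)) + lpt k"
      using y(2) by (simp add: lattice_pos_def wq)
    have "\<exists>l<10. y = lpt l"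
    proof (cases "p = q")
      case True
      then show ?thesis using eq k by (intro exI[of _ k]) simp
    next
      case False
      have "\<exists>k\<in>{0, 8, 9}. y = lpt k" using tri_meet[OF _ lpt_tri False eq] segment_tri[OF ab(1)] y(1) k by auto
      then show ?thesis by (elim bexE) (auto intro: exI[of _ 0] exI[of _ 8] exI[of _ 9])
    qed
    then obtain l where l: "l < 10" "y = lpt l" by blast
    have "l = a \<or> l = b" using local_vertex[OF ab(1) l(1)] y(1) l(2) by blast
    moreover have "w = lvert p l"
      using lattice_pos_inj[OF vG[OF w(1)] lvert_less[OF l(1)], of p] y(2) unfolding lattice_pos_lvert l(2) by blast
    ultimately show ?thesis using ab(2) by blast
  qed
  show "\<exists>w\<in>{u, v} \<inter> {u', v'}. x = lattice_pos w"
    if uv: "{u, v} \<in> edges ?G" and uv': "{u', v'} \<in> edges ?G" and ne: "{u, v} \<noteq> {u', v'}"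
      and x: "x \<in> closed_segment (lattice_pos u) (lattice_pos v)" and x': "x \<in> closed_segment (lattice_pos u') (lattice_pos v')"
    for u v u' v' x
  proof -
    obtain p a b where ab: "(a, b) \<in> set local_arcs" "{u, v} = {lvert p a, lvert p b}" and
      cs: "closed_segment (lattice_pos u) (lattice_pos v)
        = (+) (14 * of_nat (fst p), 14 * of_nat (snd p)) ` closed_segment (lpt a) (lpt b)" using local[OF uv] by blast
    obtain q c d where cd: "(c, d) \<in> set local_arcs" "{u', v'} = {lvert q c, lvert q d}" and
      cs': "closed_segment (lattice_pos u') (lattice_pos v')
        = (+) (14 * of_nat (fst q), 14 * of_nat (snd q)) ` closed_segment (lpt c) (lpt d)" using local[OF uv'] by blast
    obtain y where y: "y \<in> closed_segment (lpt a) (lpt b)" "x = (14 * of_nat (fst p), 14 * of_nat (snd p)) + y"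
      using x unfolding cs by blast
    obtain z where z: "z \<in> closed_segment (lpt c) (lpt d)" "x = (14 * of_nat (fst q), 14 * of_nat (snd q)) + z"
      using x' unfolding cs' by blast
    show ?thesis
    proof (cases "p = q")
      case True
      then have "y = z" using y z by simp
      moreover have "{a, b} \<noteq> {c, d}" using ne ab(2) cd(2) True by (auto simp: doubleton_eq_iff)
      ultimately obtain k where "k \<in> {a, b} \<inter> {c, d}" "y = lpt k" using local_edges[OF ab(1) cd(1), of y] y z by blast
      then show ?thesis unfolding ab(2) cd(2) using True y(2)
        by (intro bexI[of _ "lvert p k"]) (auto simp: lattice_pos_lvert)
    next
      case False
      have eq: "(14 * of_nat (fst p), 14 * of_nat (snd p)) + y = (14 * of_nat (fst q), 14 * of_nat (snd q)) + z"
        using y z by simp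
      have t: "y \<in> tri" "z \<in> tri" using segment_tri ab cd y z by blast+
      obtain k where k: "k < 10" "y = lpt k" using tri_meet[OF t False eq] by (auto intro: that[of 0] that[of 8] that[of 9])
      obtain l where l: "l < 10" "z = lpt l" using tri_meet[OF t(2,1) False[symmetric] eq[symmetric]] by (auto intro: that[of 0] that[of 8] that[of 9])
      have "k = a \<or> k = b" using local_vertex[OF ab(1) k(1)] y(1) k(2) by blast
      moreover have "l = c \<or> l = d" using local_vertex[OF cd(1) l(1)] z(1) l(2) by blast
      moreover have "lvert p k = lvert q l"
        using lattice_pos_inj[OF lvert_less[OF k(1)] lvert_less[OF l(1)]] eq unfolding lattice_pos_lvert k(2) l(2) by blast
      ultimately have "lvert p k \<in> {u, v} \<inter> {u', v'}" unfolding ab(2) cd(2) by auto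
      then show ?thesis using y(2) unfolding k(2) lattice_pos_lvert[symmetric] by blast
    qed
  qed
qed

lemma with_helpers_verts: "verts (with_helpers V A D) = V \<times> {..<8}"
  by (simp add: with_helpers_def)

lemma with_helpers_edge:
  "{(p, i), (q, j)} \<in> edges (with_helpers V A D) \<longleftrightarrow>
     i = 0 \<and> j = 0 \<and> ((p, q) \<in> A \<or> (q, p) \<in> A) \<or>
     p = q \<and> p \<in> D \<and> ((i, j) \<in> helper_arcs \<or> (j, i) \<in> helper_arcs)"
proof -
  have key: "((p, i), (q, j)) \<in> (\<lambda>(u, v). ((u, 0), (v, 0))) ` A \<union> (\<lambda>(v, i, j). ((v, i), (v, j))) ` (D \<times> helper_arcs)
    \<longleftrightarrow> i = 0 \<and> j = 0 \<and> (p, q) \<in> A \<or> p = q \<and> p \<in> D \<and> (i, j) \<in> helper_arcs" (is "?L \<longleftrightarrow> ?R") for p q i j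
  proof
    assume ?L
    then show ?R by (elim UnE imageE) auto
  next
    assume ?R
    then show ?L
    proof (elim disjE conjE)
      assume "(p, q) \<in> A" "i = 0" "j = 0"
      then show ?L by (intro UnI1 image_eqI[of _ _ "(p, q)"]) simp_all
    next
      assume "p \<in> D" "(i, j) \<in> helper_arcs" "p = q"
      then show ?L by (intro UnI2 image_eqI[of _ _ "(p, i, j)"]) simp_all
    qed
  qed
  show ?thesis unfolding with_helpers_def arc_graph_edge key by auto
qed

lemma colorable_with_helpers:
  fixes g :: "'v \<Rightarrow> nat"
  assumes AV: "A \<subseteq> V \<times> V" "D \<subseteq> V"
    and g: "\<forall>p\<in>V. g p \<in> {1..3}" "\<forall>(p, q)\<in>A. g p \<noteq> g q"
  shows "colorable 3 (with_helpers V A D)"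
proof -
  have three: "x = 1 \<or> x = 2 \<or> x = 3" if "x \<in> {1..3}" for x :: nat
    using that unfolding atLeastAtMost_iff by linarith
  have g123: "g p = 1 \<or> g p = 2 \<or> g p = 3" if "p \<in> V" for p
    using three g(1) that by blast
  define o1 o2 :: "nat \<Rightarrow> nat" where "o1 = (\<lambda>x. if x = 1 then 2 else 1)" "o2 = (\<lambda>x. if x = 3 then 2 else 3)"
  \<comment> \<open>Vertices 1, 2 and 5 are pairwise non-adjacent and share one colour different
    from \<open>x\<close>; the rest of each triangle takes \<open>x\<close> and the remaining
    colour.\<close>
  define c where "c = (\<lambda>(p, k). let x = g p in [x, o1 x, o1 x, x, o2 x, o1 x, x, o2 x] ! k)"
  have "c w \<in> {1..3}" if "w \<in> V \<times> {..<8}" for w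
  proof -
    obtain p k where w: "w = (p, k)" by (cases w)
    have "p \<in> V" "k < 8" using that w by simp_all
    have "k \<in> set [0, 1, 2, 3, 4, 5, 6, 7]" using \<open>k < 8\<close> by auto
    moreover have "g p = 1 \<or> g p = 2 \<or> g p = 3" using g123 \<open>p \<in> V\<close> by blast
    ultimately show ?thesis unfolding w c_def o1_o2_def by (elim disjE) (auto simp: Let_def)
  qed
  moreover have "proper_coloring (with_helpers V A D) c"
    unfolding proper_with_helpers[OF AV]
  proof (intro conjI)
    show "\<forall>(u, v)\<in>A. c (u, 0) \<noteq> c (v, 0)" using g(2) by (simp add: c_def)
    show "\<forall>v\<in>D. \<forall>(i, j)\<in>helper_arcs. c (v, i) \<noteq> c (v, j)"
    proof
      fix v assume "v \<in> D"
      then have "g v = 1 \<or> g v = 2 \<or> g v = 3" using AV g123 by blast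
      then show "\<forall>(i, j)\<in>helper_arcs. c (v, i) \<noteq> c (v, j)"
        unfolding c_def o1_o2_def by (elim disjE) (simp_all add: helper_arcs_def Let_def)
    qed
  qed
  ultimately show ?thesis unfolding colorable_def with_helpers_verts by blast
qed

text \<open>Five consecutive vertices with \<open>u\<close> in the middle. The outer two are
  adjacent if the length is 5, therefore nothing is claimed about this pair.\<close>

lemma cycle_window:
  assumes cyc: "induced_cycle G vs" and len: "length vs \<ge> 5" and u: "u \<in> set vs"
  shows "\<exists>y z w w'. {y, z, w, w'} \<subseteq> set vs \<and> y \<noteq> z \<and> {u, y} \<in> edges G \<and> {u, z} \<in> edges G \<and> {y, z} \<notin> edges G
    \<and> {y, w} \<in> edges G \<and> w \<noteq> u \<and> {w, u} \<notin> edges G \<and> {w, z} \<notin> edges G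
    \<and> {z, w'} \<in> edges G \<and> w' \<noteq> u \<and> {w', u} \<notin> edges G \<and> {w', y} \<notin> edges G"
proof -
  let ?n = "length vs"
  obtain i where i: "i < ?n" "u = vs ! i" using u by (auto simp: in_set_conv_nth)
  define x where "x k = vs ! ((i + k) mod ?n)" for k
  have n0: "?n > 0" using len by linarith
  have C: "{vs ! a, vs ! b} \<in> edges G \<longleftrightarrow> b = (a + 1) mod ?n \<or> a = (b + 1) mod ?n" if "a < ?n" "b < ?n" for a b
    using cyc that unfolding induced_cycle_def by blast
  have adj: "{x a, x b} \<in> edges G \<longleftrightarrow> (b = (a + 1) mod ?n \<or> a = (b + 1) mod ?n)" if "a < ?n" "b < ?n" for a b
  proof -
    have "{x a, x b} \<in> edges G \<longleftrightarrow> (i + b) mod ?n = ((i + a) mod ?n + 1) mod ?n \<or> (i + a) mod ?n = ((i + b) mod ?n + 1) mod ?n"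
      unfolding x_def by (rule C[OF mod_less_divisor[OF n0] mod_less_divisor[OF n0]])
    moreover have shift: "(i + p) mod ?n = ((i + q) mod ?n + 1) mod ?n \<longleftrightarrow> p = (q + 1) mod ?n" if "p < ?n" for p q
    proof -
      have "(i + p) mod ?n = ((i + q) mod ?n + 1) mod ?n \<longleftrightarrow> (i + p) mod ?n = (i + (q + 1)) mod ?n"
        by (simp only: mod_add_left_eq add.assoc)
      also have "\<dots> \<longleftrightarrow> p mod ?n = (q + 1) mod ?n" unfolding nat_mod_eq_iff by simp
      also have "\<dots> \<longleftrightarrow> p = (q + 1) mod ?n" using that by simp
      finally show ?thesis .
    qed
    ultimately show ?thesis by (simp only: shift[OF that(1)] shift[OF that(2)])
  qed
  have inj: "x a \<noteq> x b" if "a < ?n" "b < ?n" "a \<noteq> b" for a b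
  proof -
    have "(i + a) mod ?n \<noteq> (i + b) mod ?n"
    proof
      assume "(i + a) mod ?n = (i + b) mod ?n"
      then have "a mod ?n = b mod ?n" unfolding nat_mod_eq_iff by simp
      then show False using that by simp
    qed
    then show ?thesis using cyc n0 unfolding x_def induced_cycle_def by (simp add: nth_eq_iff_index_eq)
  qed
  have mem: "x k \<in> set vs" for k using n0 by (simp add: x_def)
  have u0: "u = x 0" using i by (simp add: x_def)
  obtain m where m: "?n = m + 5" using len by (metis add.commute le_Suc_ex)
  have [simp]: "(5 + m) mod (m + 5) = 0" by (simp add: add.commute)
  show ?thesis unfolding u0
    by (rule exI[of _ "x 1"], rule exI[of _ "x (m + 4)"], rule exI[of _ "x 2"], rule exI[of _ "x (m + 3)"], intro conjI)
      (simp_all add: mem adj inj m)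
qed


definition hadj :: "nat \<Rightarrow> nat \<Rightarrow> bool" where
  "hadj i j \<longleftrightarrow> (i, j) \<in> helper_arcs \<or> (j, i) \<in> helper_arcs"

lemma hadj_simps:
  "hadj 0 j \<longleftrightarrow> j = 1 \<or> j = 2 \<or> j = 5"
  "hadj (Suc 0) j \<longleftrightarrow> j = 0 \<or> j = 3 \<or> j = 4 \<or> j = 6 \<or> j = 7"
  "hadj 2 j \<longleftrightarrow> j = 0 \<or> j = 3 \<or> j = 4"
  "hadj 3 j \<longleftrightarrow> j = 1 \<or> j = 2 \<or> j = 4"
  "hadj 4 j \<longleftrightarrow> j = 1 \<or> j = 2 \<or> j = 3"
  "hadj 5 j \<longleftrightarrow> j = 0 \<or> j = 6 \<or> j = 7"
  "hadj 6 j \<longleftrightarrow> j = 1 \<or> j = 5 \<or> j = 7"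
  "hadj 7 j \<longleftrightarrow> j = 1 \<or> j = 5 \<or> j = 6"
  unfolding hadj_def helper_arcs_def by auto

lemma helper_edge:
  assumes "{(p, k), y} \<in> edges (with_helpers V A D)" "k \<noteq> 0"
  shows "\<exists>j. y = (p, j) \<and> hadj k j \<and> p \<in> D"
  using assms by (cases y) (auto simp: with_helpers_edge hadj_def)

lemma helper_edgeI:
  "p \<in> D \<Longrightarrow> hadj i j \<Longrightarrow> {(p, i), (p, j)} \<in> edges (with_helpers V A D)"
  by (simp add: with_helpers_edge hadj_def)

text \<open>Of a hole only this local property of its vertex set is used to keep helpers off
  it.\<close>

context
  fixes V A D S
  assumes win: "\<And>u. u \<in> S \<Longrightarrow> \<exists>y z w w'. {y, z, w, w'} \<subseteq> S \<and> y \<noteq> z \<and> {u, y} \<in> edges (with_helpers V A D) \<and>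
      {u, z} \<in> edges (with_helpers V A D) \<and> {y, z} \<notin> edges (with_helpers V A D)
    \<and> {y, w} \<in> edges (with_helpers V A D) \<and> w \<noteq> u \<and> {w, u} \<notin> edges (with_helpers V A D) \<and> {w, z} \<notin> edges (with_helpers V A D)
    \<and> {z, w'} \<in> edges (with_helpers V A D) \<and> w' \<noteq> u \<and> {w', u} \<notin> edges (with_helpers V A D) \<and> {w', y} \<notin> edges (with_helpers V A D)"
begin

text \<open>The only non-adjacent neighbours of such a vertex are 1 and the vertex 2 or 5 of its
  triangle. Beyond the latter the cycle could only go on to the third vertex of the triangle, which
  is adjacent to the given vertex, or to index 0, which is adjacent to 1.\<close>

lemma outer_not_on_cycle:
  assumes k: "k \<in> {3, 4, 6, 7}"
  shows "(p, k) \<notin> S"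
proof
  assume "(p, k) \<in> S"
  from win[OF this] obtain y z w w' where y: "{(p, k), y} \<in> edges (with_helpers V A D)"
    and z: "{(p, k), z} \<in> edges (with_helpers V A D)" and yz: "{y, z} \<notin> edges (with_helpers V A D)" "y \<noteq> z"
    and w: "{y, w} \<in> edges (with_helpers V A D)" "w \<noteq> (p, k)" "{w, (p, k)} \<notin> edges (with_helpers V A D)" "{w, z} \<notin> edges (with_helpers V A D)"
    and w': "{z, w'} \<in> edges (with_helpers V A D)" "w' \<noteq> (p, k)" "{w', (p, k)} \<notin> edges (with_helpers V A D)" "{w', y} \<notin> edges (with_helpers V A D)"
    by blast
  have k0: "k \<noteq> 0" using k by auto
  obtain jy where jy: "y = (p, jy)" "hadj k jy" "p \<in> D" using helper_edge[OF y k0] by blast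
  obtain jz where jz: "z = (p, jz)" "hadj k jz" using helper_edge[OF z k0] by blast
  have nyz: "\<not> hadj jy jz" "jy \<noteq> jz" using yz helper_edgeI[OF jy(3)] unfolding jy(1) jz(1) by blast+
  have no: False if x: "{(p, b), x} \<in> edges (with_helpers V A D)" "x \<noteq> (p, k)" "{x, (p, k)} \<notin> edges (with_helpers V A D)"
      "{x, (p, 1)} \<notin> edges (with_helpers V A D)" "b \<noteq> 0" "b \<noteq> 1" "hadj k b" for x b
  proof -
    obtain j where j: "x = (p, j)" "hadj b j" using helper_edge[OF x(1,5)] by blast
    have "\<not> hadj j k" "\<not> hadj j 1" "j \<noteq> k" using x helper_edgeI[OF jy(3)] unfolding j(1) by blast+
    then show False using k x(5-7) j(2) by (auto simp: hadj_simps)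
  qed
  from k jy(2) jz(2) nyz consider "jz = 1" "jy \<noteq> 0" "jy \<noteq> 1" | "jy = 1" "jz \<noteq> 0" "jz \<noteq> 1"
    by (auto simp: hadj_simps)
  then show False
  proof cases
    case 1
    show False by (rule no[of jy w]) (use w 1 jy jz in auto)
  next
    case 2
    show False by (rule no[of jz w']) (use w' 2 jy jz in auto)
  qed
qed

text \<open>Once the outer vertices are excluded, the vertices 1, 2 and 5 have index 0 as their only
  possible neighbour on the cycle, whereas a cycle requires two.\<close>

lemma helper_not_on_cycle:
  assumes "(p, k) \<in> S" "k < 8"
  shows "k = 0"
proof (rule ccontr)
  assume k0: "k \<noteq> 0"
  have two: "\<exists>y z. y \<in> S \<and> z \<in> S \<and> y \<noteq> z \<and> {(q, i), y} \<in> edges (with_helpers V A D) \<and> {(q, i), z} \<in> edges (with_helpers V A D)"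
    if "(q, i) \<in> S" for q i using win[OF that] by blast
  have one: False if i: "(q, i) \<in> S" "i \<noteq> 0" and "\<And>j. hadj i j \<Longrightarrow> (q, j) \<in> S \<Longrightarrow> j = 0" for q i
  proof -
    obtain y z where yz: "y \<in> S" "z \<in> S" "y \<noteq> z" "{(q, i), y} \<in> edges (with_helpers V A D)" "{(q, i), z} \<in> edges (with_helpers V A D)"
      using two[OF i(1)] by blast
    obtain a b where "y = (q, a)" "hadj i a" "z = (q, b)" "hadj i b"
      using helper_edge[OF yz(4) i(2)] helper_edge[OF yz(5) i(2)] by blast
    then show False using that(3) yz(1-3) by blast
  qed
  note out = outer_not_on_cycle
  have k: "k = 1 \<or> k = 2 \<or> k = 5 \<or> k \<in> {3, 4, 6, 7}" using assms(2) k0 by auto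
  then have "k = 1 \<or> k = 2 \<or> k = 5" using out[of k p] assms(1) by blast
  then show False using one[OF assms(1) k0] out[of 3 p] out[of 4 p] out[of 6 p] out[of 7 p]
    by (elim disjE) (auto simp: hadj_simps)
qed

end

text \<open>An exceptional arc ends in a vertex \<open>q\<close> whose neighbours outside of its
  helper are two adjacent vertices, so \<open>q\<close> is on no induced cycle of length five or
  more. Every other arc changes the parity of the sum of the coordinates.\<close>

lemma odd_hole_free_with_helpers:
  assumes AV: "A \<subseteq> V \<times> V" "D \<subseteq> V"
    and A: "\<forall>(p, q)\<in>A. ladj p q \<or>
      (\<exists>s. ((p, s) \<in> A \<or> (s, p) \<in> A) \<and> (\<forall>x. (x, q) \<in> A \<or> (q, x) \<in> A \<longrightarrow> x = p \<or> x = s))"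
  shows "odd_hole_free (with_helpers V A D)"
  unfolding odd_hole_free_def
proof
  let ?E = "edges (with_helpers V A D)"
  assume "\<exists>vs i. i \<ge> 2 \<and> length vs = 2 * i + 1 \<and> induced_cycle (with_helpers V A D) vs"
  then obtain vs i where i: "i \<ge> 2" "length vs = 2 * i + 1" and cyc: "induced_cycle (with_helpers V A D) vs" by blast
  have len: "length vs \<ge> 5" using i by simp
  have main: "snd u = 0" if "u \<in> set vs" for u
  proof -
    have "u \<in> V \<times> {..<8}" using cyc that unfolding induced_cycle_def with_helpers_verts by blast
    then have "snd u < 8" by auto
    moreover have "(fst u, snd u) \<in> set vs" using that by simp
    moreover have "k = 0" if "(p, k) \<in> set vs" "k < 8" for p k
      by (rule helper_not_on_cycle[OF _ that]) (rule cycle_window[OF cyc len])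
    ultimately show ?thesis by blast
  qed
  have lat: "{(p, 0), (q, 0)} \<in> ?E \<longleftrightarrow> (p, q) \<in> A \<or> (q, p) \<in> A" for p q
    by (simp add: with_helpers_edge helper_arcs_def)
  have A': "ladj p q \<or> (\<exists>s. ((p, s) \<in> A \<or> (s, p) \<in> A) \<and> (\<forall>x. (x, q) \<in> A \<or> (q, x) \<in> A \<longrightarrow> x = p \<or> x = s))"
    if "(p, q) \<in> A" for p q using bspec[OF A that] by (simp only: prod.case)
  have step: "ladj (fst u) (fst v)" if u: "u \<in> set vs" and v: "v \<in> set vs" and e: "{u, v} \<in> ?E" for u v
  proof -
    obtain p q where uv: "u = (p, 0)" "v = (q, 0)" using main[OF u] main[OF v] by (cases u; cases v) simp
    have no: False if v: "(q, 0) \<in> set vs" and s: "(p, s) \<in> A \<or> (s, p) \<in> A"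
      and x: "\<forall>x. (x, q) \<in> A \<or> (q, x) \<in> A \<longrightarrow> x = p \<or> x = s" for p q s
    proof -
      obtain y z where yz: "y \<in> set vs" "z \<in> set vs" "y \<noteq> z" "{(q, 0), y} \<in> ?E" "{(q, 0), z} \<in> ?E" "{y, z} \<notin> ?E"
        using cycle_window[OF cyc len v] by blast
      obtain y' z' where yz': "y = (y', 0)" "z = (z', 0)" using main[OF yz(1)] main[OF yz(2)] by (cases y; cases z) simp
      have "y' = p \<or> y' = s" using x[rule_format, of y'] yz(4) unfolding yz'(1) lat by blast
      moreover have "z' = p \<or> z' = s" using x[rule_format, of z'] yz(5) unfolding yz'(2) lat by blast
      ultimately have "(y', z') = (p, s) \<or> (y', z') = (s, p)" using yz(3) yz' by auto
      then show False using yz(6) s unfolding yz' lat by auto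
    qed
    have "(p, q) \<in> A \<or> (q, p) \<in> A" using e unfolding uv lat .
    then show ?thesis
    proof
      assume "(p, q) \<in> A"
      from A'[OF this] show ?thesis using no[of q p] v unfolding uv fst_conv by blast
    next
      assume "(q, p) \<in> A"
      from A'[OF this] have "ladj q p" using no[of p q] u unfolding uv by blast
      then show ?thesis unfolding uv by (auto simp: ladj_def)
    qed
  qed
  let ?n = "length vs"
  define f where "f k = (fst (fst (vs ! k)) + snd (fst (vs ! k)))" for k
  have flip: "even (f a) \<longleftrightarrow> odd (f b)" if "a < ?n" "b < ?n" "b = (a + 1) mod ?n" for a b
  proof -
    have "{vs ! a, vs ! b} \<in> ?E" using cyc that unfolding induced_cycle_def by blast
    then have "ladj (fst (vs ! a)) (fst (vs ! b))" using step that by simp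
    then show ?thesis unfolding f_def ladj_def by auto
  qed
  have "even (f k) \<longleftrightarrow> (even (f 0) \<longleftrightarrow> even k)" if "k < ?n" for k
    using that
  proof (induction k)
    case (Suc k)
    have "even (f k) \<longleftrightarrow> odd (f (Suc k))" by (rule flip) (use Suc.prems in simp_all)
    moreover have "even (f k) \<longleftrightarrow> (even (f 0) \<longleftrightarrow> even k)" by (rule Suc.IH) (use Suc.prems in simp)
    ultimately show ?case unfolding even_Suc by blast
  qed simp
  \<comment> \<open>The last vertex has the even index \<open>2 * i\<close> and hence the parity of
    vertex 0, to which it is adjacent.\<close>
  from this[of "2 * i"] have "even (f (2 * i)) \<longleftrightarrow> even (f 0)" using i by simp
  moreover have "even (f (2 * i)) \<longleftrightarrow> odd (f 0)" using flip[of "2 * i" 0] i by simp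
  ultimately show False by blast
qed

lemma vertex_degree_card:
  assumes "\<And>e. e \<in> edges G \<Longrightarrow> card e = 2"
  shows "vertex_degree G v = card {u. {v, u} \<in> edges G}"
proof -
  have "bij_betw (\<lambda>u. {v, u}) {u. {v, u} \<in> edges G} {e \<in> edges G. v \<in> e}"
  proof (intro bij_betwI')
    show "({v, x} = {v, y}) = (x = y)" if "x \<in> {u. {v, u} \<in> edges G}" "y \<in> {u. {v, u} \<in> edges G}" for x y
      by (auto simp: doubleton_eq_iff)
    show "\<exists>u\<in>{u. {v, u} \<in> edges G}. e = {v, u}" if "e \<in> {e \<in> edges G. v \<in> e}" for e
    proof -
      have "card e = 2" "v \<in> e" using assms that by blast+
      then obtain u where "e = {v, u}" unfolding card_2_iff by blast
      then show ?thesis using that by auto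
    qed
  qed auto
  then show ?thesis unfolding vertex_degree_def by (simp add: bij_betw_same_card)
qed

text \<open>A helped point has at most three network neighbours and three helper neighbours, those
  of index 1, 2 and 5. A point without helper has six neighbours at most for geometric reasons: four
  along the lattice and two along the diagonal.\<close>

lemma max_degree_with_helpers:
  assumes AV: "A \<subseteq> V \<times> V" "D \<subseteq> V" "finite V"
    and A: "\<forall>(p, q)\<in>A. ladj p q \<or> anti p q"
    and D: "\<forall>p\<in>D. card {q. (p, q) \<in> A \<or> (q, p) \<in> A} \<le> 3" "p0 \<in> D" "card {q. (p0, q) \<in> A \<or> (q, p0) \<in> A} = 3"
  shows "max_degree (with_helpers V A D) = 6"
proof -
  let ?G = "with_helpers V A D"
  define nb where "nb p = {q. (p, q) \<in> A \<or> (q, p) \<in> A}" for p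
  have e2: "card e = 2" if "e \<in> edges ?G" for e
  proof -
    from that consider (A) p q where "(p, q) \<in> A" "e = {(p, 0), (q, 0)}"
      | (H) p i j where "(i, j) \<in> helper_arcs" "e = {(p, i), (p, j)}"
      by (auto simp: with_helpers_def)
    then show ?thesis
    proof cases
      case A
      then have "p \<noteq> q" using assms(4) by (force simp: ladj_def anti_def)
      then show ?thesis unfolding A by (simp add: card_2_iff)
    next
      case H
      then have "i \<noteq> j" by (auto simp: helper_arcs_def)
      then show ?thesis unfolding H by simp
    qed
  qed
  have deg: "vertex_degree ?G v = card {u. {v, u} \<in> edges ?G}" for v
    by (rule vertex_degree_card) (rule e2)
  have fin: "finite (nb p)" for p
    using AV by (intro finite_subset[OF _ AV(3)]) (auto simp: nb_def)
  have nb6: "card (nb p) \<le> 6" for p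
  proof -
    obtain r c where p: "p = (r, c)" by (cases p)
    have "nb p \<subseteq> set [(r, c + 1), (r, c - 1), (r + 1, c), (r - 1, c), (r + 1, c - 1), (r - 1, c + 1)]" (is "_ \<subseteq> set ?l")
    proof
      fix q assume "q \<in> nb p"
      then have "ladj p q \<or> anti p q \<or> ladj q p \<or> anti q p" using A by (auto simp: nb_def)
      then show "q \<in> set ?l" by (cases q) (auto simp: ladj_def anti_def p)
    qed
    then have "card (nb p) \<le> card (set ?l)" by (intro card_mono) simp_all
    also have "\<dots> \<le> length ?l" by (rule card_length)
    finally show ?thesis by simp
  qed
  have main: "vertex_degree ?G (p, 0) = card (nb p) + (if p \<in> D then 3 else 0)" for p
  proof -
    have "{u. {(p, 0), u} \<in> edges ?G} = (\<lambda>q. (q, 0)) ` nb p \<union> (if p \<in> D then (\<lambda>j. (p, j)) ` {1, 2, 5} else {})"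
      by (auto simp: with_helpers_edge nb_def helper_arcs_def)
    moreover have "card ((\<lambda>q. (q, 0 :: nat)) ` nb p \<union> (\<lambda>j. (p, j)) ` {1, 2, 5}) = card (nb p) + 3"
      by (subst card_Un_disjoint) (auto simp: fin card_image inj_on_def)
    moreover have "card ((\<lambda>q. (q, 0 :: nat)) ` nb p) = card (nb p)" by (simp add: card_image inj_on_def)
    ultimately show ?thesis unfolding deg by simp
  qed
  have helper: "vertex_degree ?G (p, k) \<le> 5" if "k \<in> set [1, 2, 3, 4, 5, 6, 7]" for p k
  proof -
    have "{u. {(p, k), u} \<in> edges ?G} \<subseteq> (\<lambda>j. (p, j)) ` {j. hadj k j}"
      using helper_edge[of p k] that by fastforce
    moreover have "finite {j. hadj k j} \<and> card {j. hadj k j} \<le> 5"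
    proof -
      have "{j. hadj k j} \<subseteq> set (if k = 1 then [0, 3, 4, 6, 7] else if k = 2 then [0, 3, 4] else if k = 3 then [1, 2, 4]
          else if k = 4 then [1, 2, 3] else if k = 5 then [0, 6, 7] else if k = 6 then [1, 5, 7] else [1, 5, 6])" (is "_ \<subseteq> set ?l")
        using that by (auto simp: hadj_simps)
      then have "finite {j. hadj k j} \<and> card {j. hadj k j} \<le> card (set ?l)"
        using finite_subset card_mono List.finite_set by metis
      moreover have "card (set ?l) \<le> length ?l" by (rule card_length)
      moreover have "length ?l \<le> 5" by simp
      ultimately show ?thesis by linarith
    qed
    ultimately show ?thesis unfolding deg
      by (meson card_image_le card_mono finite_imageI le_trans)
  qed
  have "vertex_degree ?G w \<le> 6" if "w \<in> verts ?G" for w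
  proof -
    obtain p k where w: "w = (p, k)" by (cases w)
    have k: "k < 8" using that by (simp add: w with_helpers_verts)
    show ?thesis
    proof (cases "k = 0")
      case True
      then show ?thesis unfolding w using main[of p] nb6[of p] D(1) by (auto simp: nb_def)
    next
      case False
      then have "k \<in> set [1, 2, 3, 4, 5, 6, 7]" using k by auto
      then show ?thesis unfolding w using helper[of k p] by linarith
    qed
  qed
  moreover have "vertex_degree ?G (p0, 0) = 6" using main[of p0] D by (simp add: nb_def)
  moreover have "(p0, 0) \<in> verts ?G" using D AV by (auto simp: with_helpers_verts)
  moreover have "finite (verts ?G)" using AV by (simp add: with_helpers_verts)
  ultimately show ?thesis unfolding max_degree_def by (intro Max_eqI) (auto intro: image_eqI)
qed

context network
begin

lemma harc_nodes: "(u, v) \<in> harc \<Longrightarrow> u \<in> nodes \<and> v \<in> nodes"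
proof (induction u v rule: harc.induct)
  case (SrcPath k i)
  have "term_node (src k i) \<in> nodes"
    using src_X[OF SrcPath] by (cases "src k i") (auto simp: term_node_def intro: nodes.intros)
  moreover have "0 < len k i" using len[OF SrcPath] by simp
  ultimately show ?case using SrcPath by (simp add: nodes.intros)
next
  case (PathSide k i b)
  have "len k i - 1 < len k i" using len[OF PathSide] by simp
  then show ?case using PathSide by (simp add: nodes.intros)
qed (use U_sub in \<open>auto intro: nodes.intros\<close>)

definition nbs :: "('x, 'k) node \<Rightarrow> ('x, 'k) node set" where
  "nbs u = {w. (u, w) \<in> harc \<or> (w, u) \<in> harc}"

lemma term_node_eq: 
  "term_node s = Pos x \<longleftrightarrow> s = (x, True)"
  "x \<in> U \<Longrightarrow> term_node s \<noteq> Neg x"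
  "term_node s = Opp x \<longleftrightarrow> s = (x, False) \<and> x \<in> U"
  "term_node s \<noteq> Mid x" "term_node s \<noteq> Path k i n" "term_node s \<noteq> Side k i b" "term_node s \<noteq> Mer k i" "term_node s \<noteq> Cla k"
  by (auto simp: term_node_def split: prod.splits if_splits)

lemma term_node_eq2:
  "Pos x = term_node s \<longleftrightarrow> s = (x, True)"
  "x \<in> U \<Longrightarrow> Neg x \<noteq> term_node s"
  "Opp x = term_node s \<longleftrightarrow> s = (x, False) \<and> x \<in> U"
  "Mid x \<noteq> term_node s" "Path k i n \<noteq> term_node s" "Side k i b \<noteq> term_node s" "Mer k i \<noteq> term_node s" "Cla k \<noteq> term_node s"
  using term_node_eq by metis+

lemma nbs_Mid: "x \<notin> U \<Longrightarrow> nbs (Mid x) \<subseteq> {Pos x, Neg x}"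
  by (auto simp: nbs_def elim!: harc.cases simp: term_node_eq term_node_eq2)

lemma wires_path:
  assumes "x \<in> U"
  shows "\<exists>w. {Path k i 0 |k i. k \<in> K \<and> i \<in> sl k \<and> src k i = (x, b)} \<subseteq> {w :: ('x, 'k) node}"
proof -
  obtain w where w: "{(k, i). k \<in> K \<and> i \<in> sl k \<and> src k i = (x, b)} \<subseteq> {w}" using occ1[OF assms] by blast
  have "{Path k i 0 |k i. k \<in> K \<and> i \<in> sl k \<and> src k i = (x, b)} \<subseteq> {Path (fst w) (snd w) 0}" using w by fastforce
  then show ?thesis by blast
qed

text \<open>A terminal of a square has two neighbours in the square and one wire, as universal
  literals occur once. Terminals of triangles may have two wires, but their lists have size three
  and they carry no helper.\<close>

lemma nbs_two:
  assumes u: "u \<in> nodes" "hsize u = 2"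
  shows "\<exists>a b c. nbs u \<subseteq> {a, b, c}"
  using u(1)
proof cases
  case (1 x)
  then have x: "x \<in> U" using u by (simp split: if_splits)
  obtain w :: "('x, 'k) node" where w: "{Path k i 0 |k i. k \<in> K \<and> i \<in> sl k \<and> src k i = (x, True)} \<subseteq> {w}" using wires_path[OF x] by blast
  have "nbs u \<subseteq> {Neg x, Mid x} \<union> {Path k i 0 |k i. k \<in> K \<and> i \<in> sl k \<and> src k i = (x, True)}"
    unfolding 1 nbs_def by (auto elim!: harc.cases simp: term_node_eq term_node_eq2)
  then have "nbs u \<subseteq> {Neg x, Mid x, w}" using w by blast
  then show ?thesis by (intro exI)
next
  case (2 x)
  then have x: "x \<in> U" using u by (simp split: if_splits)
  have "nbs u \<subseteq> {Pos x, Opp x}" using x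
    unfolding 2 nbs_def by (auto elim!: harc.cases simp: term_node_eq term_node_eq2)
  then show ?thesis by blast
next
  case (3 x)
  show ?thesis
  proof (cases "x \<in> U")
    case True
    then have "nbs u \<subseteq> {Pos x, Opp x}"
      unfolding 3 nbs_def by (auto elim!: harc.cases simp: term_node_eq term_node_eq2)
    then show ?thesis by blast
  next
    case False
    then show ?thesis using nbs_Mid 3 by blast
  qed
next
  case (4 x)
  obtain w :: "('x, 'k) node" where w: "{Path k i 0 |k i. k \<in> K \<and> i \<in> sl k \<and> src k i = (x, False)} \<subseteq> {w}" using wires_path[OF 4(2)] by blast
  have "nbs u \<subseteq> {Neg x, Mid x} \<union> {Path k i 0 |k i. k \<in> K \<and> i \<in> sl k \<and> src k i = (x, False)}"
    unfolding 4 nbs_def by (auto elim!: harc.cases simp: term_node_eq term_node_eq2)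
  then have "nbs u \<subseteq> {Neg x, Mid x, w}" using w by blast
  then show ?thesis by (intro exI)
next
  case (5 k i n)
  have "w \<in> {if n = 0 then term_node (src k i) else Path k i (n - 1)} \<union> (if Suc n < len k i then {Path k i (Suc n)} else {Side k i True, Side k i False})"
    if "(u, w) \<in> harc \<or> (w, u) \<in> harc" for w
    using that
  proof
    assume "(u, w) \<in> harc"
    then show ?thesis unfolding 5
    proof cases
      case (PathSide b)
      then show ?thesis by (cases b) simp_all
    qed (simp_all add: term_node_eq2)
  next
    assume "(w, u) \<in> harc"
    then show ?thesis unfolding 5 by cases simp_all
  qed
  then have *: "nbs u \<subseteq> {if n = 0 then term_node (src k i) else Path k i (n - 1)} \<union> (if Suc n < len k i then {Path k i (Suc n)} else {Side k i True, Side k i False})" (is "_ \<subseteq> {?p} \<union> _")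
    unfolding nbs_def by blast
  show ?thesis
  proof (cases "Suc n < len k i")
    case True
    then have "nbs u \<subseteq> {?p, Path k i (Suc n), Path k i (Suc n)}" using * by (simp split del: if_split add: insert_commute)
    then show ?thesis by (intro exI)
  next
    case False
    then have "nbs u \<subseteq> {?p, Side k i True, Side k i False}" using * by (simp split del: if_split add: insert_commute)
    then show ?thesis by (intro exI)
  qed
next
  case (6 k i b)
  have "nbs u \<subseteq> {Path k i (len k i - 1), Mer k i}"
    unfolding 6 nbs_def by (auto elim!: harc.cases simp: term_node_eq term_node_eq2)
  then show ?thesis by blast
next
  case (7 k i)
  then show ?thesis using u by simp
next
  case (8 k)
  have "nbs u \<subseteq> Mer k ` sl k"
    unfolding 8 nbs_def by (auto elim!: harc.cases simp: term_node_eq term_node_eq2)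
  moreover obtain a b where "sl k = {a, b}" using u 8 by (auto simp: card_2_iff)
  ultimately show ?thesis by blast
qed

text \<open>Three neighbours plus a helper give a vertex of degree six, so the maximum is attained
  whatever the formula is.\<close>

lemma nbs_path_end:
  assumes k: "k \<in> K" "i \<in> sl k"
  shows "\<exists>a. nbs (Path k i (len k i - 1)) = {a, Side k i True, Side k i False} \<and> a \<noteq> Side k i True \<and> a \<noteq> Side k i False"
proof -
  let ?n = "len k i - 1"
  have l: "len k i \<ge> 1" using len[OF k] .
  have S: "(Path k i ?n, Side k i b) \<in> harc" for b using PathSide[OF k] by simp
  show ?thesis
  proof (cases "?n = 0")
    case True
    have "(term_node (src k i), Path k i ?n) \<in> harc" unfolding True by (rule SrcPath[OF k])
    then have "nbs (Path k i ?n) = {term_node (src k i), Side k i True, Side k i False}"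
      using S l unfolding nbs_def
      by (auto elim!: harc.cases simp: term_node_eq term_node_eq2 True)
    then show ?thesis using term_node_eq(6) by blast
  next
    case False
    have "(Path k i (?n - 1), Path k i (Suc (?n - 1))) \<in> harc" by (rule PathPath[OF k]) (use False in simp)
    moreover have "Suc (?n - 1) = ?n" using False by simp
    ultimately have "(Path k i (?n - 1), Path k i ?n) \<in> harc" by (simp only:)
    then have "nbs (Path k i ?n) = {Path k i (?n - 1), Side k i True, Side k i False}"
      using S l unfolding nbs_def
      by (auto elim!: harc.cases simp: term_node_eq term_node_eq2 False)
    then show ?thesis by blast
  qed
qed

lemma not_Mid_Mid: "(Mid x, Mid y) \<notin> harc"
  by (auto elim!: harc.cases)

end


section \<open>The lattice graph of a formula and its graph class\<close>

context grid
begin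

text \<open>Lattice points that carry no node become isolated vertices; this keeps the numbering of
  the vertices simple. The additional 26 rows and columns leave room for the nodes that stick out of
  the last cells.\<close>

definition lattice :: "(nat \<times> nat) set" where
  "lattice = {..<26 * (m + 2)} \<times> {..<26 * (2 * N + 1)}"

lemma off_less: "l \<in> set local_nodes \<Longrightarrow> fst (off l) < 52 \<and> snd (off l) < 52"
proof -
  have "\<forall>l\<in>set local_nodes. fst (off l) < 52 \<and> snd (off l) < 52"
    by code_simp
  then show "l \<in> set local_nodes \<Longrightarrow> ?thesis" by blast
qed

lemma loc_cell:
  assumes "u \<in> net.nodes"
  shows "fst (fst (loc u)) \<le> m \<and> snd (fst (loc u)) < 2 * N"
proof -
  have X: "i \<le> m \<and> j < 2 * N" if "(i, j, v) \<in> gX" for i j v using that by (simp add: gX_def pv_def)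
  have K: "i \<le> m \<and> j < 2 * N" if "(i, j, c) \<in> gK" for i j c using that by (simp add: gK_def pc_def)
  have U: "i \<le> m \<and> j < 2 * N" if "(i, j, c) \<in> gU" for i j c using that by (simp add: gU_def)
  show ?thesis using assms
    by (cases u rule: loc.cases) (auto elim!: net.nodes.cases dest: X K U)
qed

lemma place_lattice: "u \<in> net.nodes \<Longrightarrow> place u \<in> lattice"
  using loc_cell[of u] off_less[OF loc_local[of u]]
  by (auto simp: place_def padd_def lattice_def)

lemma arcs_lattice: "arcs \<subseteq> lattice \<times> lattice"
proof
  fix pq assume "pq \<in> arcs"
  then obtain u v where "(u, v) \<in> net.harc" "pq = (place u, place v)" using arcs_harc by blast
  then show "pq \<in> lattice \<times> lattice" using net.harc_nodes place_lattice by blast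
qed

lemma twos_lattice: "twos \<subseteq> lattice"
  unfolding twos_eq[symmetric] using place_lattice by blast

lemma place_arc_iff:
  assumes "u \<in> net.nodes" "v \<in> net.nodes"
  shows "(place u, place v) \<in> arcs \<longleftrightarrow> (u, v) \<in> net.harc"
proof
  assume "(place u, place v) \<in> arcs"
  then obtain u' v' where *: "(u', v') \<in> net.harc" "place u = place u'" "place v = place v'" using arcs_harc by blast
  then have "u = u'" "v = v'" using inj_onD[OF place_inj] assms net.harc_nodes by blast+
  then show "(u, v) \<in> net.harc" using *(1) by simp
qed (rule harc_arcs)

lemma place_two_iff:
  assumes "u \<in> net.nodes"
  shows "place u \<in> twos \<longleftrightarrow> net.hsize u = 2"
  unfolding twos_eq[symmetric] using assms inj_onD[OF place_inj] by blast

lemma place_nbs: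
  assumes u: "u \<in> net.nodes"
  shows "{q. (place u, q) \<in> arcs \<or> (q, place u) \<in> arcs} = place ` net.nbs u"
proof
  show "{q. (place u, q) \<in> arcs \<or> (q, place u) \<in> arcs} \<subseteq> place ` net.nbs u"
  proof
    fix q assume "q \<in> {q. (place u, q) \<in> arcs \<or> (q, place u) \<in> arcs}"
    then obtain a b where ab: "(a, b) \<in> net.harc" "(place u, q) = (place a, place b) \<or> (q, place u) = (place a, place b)"
      using arcs_harc by blast
    note n = net.harc_nodes[OF ab(1)]
    from ab(2) show "q \<in> place ` net.nbs u"
    proof
      assume *: "(place u, q) = (place a, place b)"
      then have "u = a" using inj_onD[OF place_inj] u n by blast
      then show ?thesis using * ab(1) by (auto simp: net.nbs_def)
    next
      assume *: "(q, place u) = (place a, place b)"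
      then have "u = b" using inj_onD[OF place_inj] u n by blast
      then show ?thesis using * ab(1) by (auto simp: net.nbs_def)
    qed
  qed
  show "place ` net.nbs u \<subseteq> {q. (place u, q) \<in> arcs \<or> (q, place u) \<in> arcs}"
    using harc_arcs by (auto simp: net.nbs_def)
qed

lemma ladj_padd: "ladj (padd ij p) (padd ij q) \<longleftrightarrow> ladj p q" "anti (padd ij p) (padd ij q) \<longleftrightarrow> anti p q"
  by (auto simp: ladj_def anti_def padd_def)

lemma arc_cases:
  assumes "(p, q) \<in> arcs"
  shows "ladj p q \<or> (\<exists>x. x \<in> gX \<and> x \<notin> gU \<and> p = place (Neg x) \<and> q = place (Mid x) \<and> anti p q)"
proof -
  obtain i j a b where ab: "p = padd (i, j) a" "q = padd (i, j) b" "(a, b) \<in> cell_pairs i j"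
    using assms unfolding arcs_def by blast
  note t = tables_adjacent
  from ab(3) consider (v) v where "v \<in> set [0, 1, 2, 3, 4, 5, 6]" "(a, b) = (vpos v, vneg v) \<or> (a, b) = (vpos v, vmid v)"
    | (m) v where "v \<in> set [0, 1, 2, 3, 4, 5, 6]" "pv i j v" "(i, j, v) \<notin> gU" "(a, b) = (vneg v, vmid v)"
    | (o) "(a, b) = (vmid 6, wpath 6 1 ! 0)"
    | (w) c s where "(c, s) \<in> set slots" "(a, b) \<in> set (wire_pairs c s)"
    unfolding cell_pairs_def by blast
  then show ?thesis
  proof cases
    case v
    then have "ladj a b" using t by auto
    then show ?thesis by (simp add: ab ladj_padd)
  next
    case m
    have "anti a b" using t m by blast
    moreover have "(i, j, v) \<in> gX" using m by (simp add: gX_def)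
    moreover have "p = place (Neg (i, j, v))" "q = place (Mid (i, j, v))" using m by (simp_all add: ab place_def)
    ultimately show ?thesis using m ladj_padd(2) unfolding ab(1,2) by blast
  next
    case o
    then have "ladj a b" using t by simp
    then show ?thesis by (simp add: ab ladj_padd)
  next
    case w
    then have "ladj a b" using t by blast
    then show ?thesis by (simp add: ab ladj_padd)
  qed
qed

definition lgraph :: "((nat \<times> nat) \<times> nat) graph" where
  "lgraph = with_helpers lattice arcs twos"

lemma Neg_Mid_nodes: "x \<in> gX \<Longrightarrow> Neg x \<in> net.nodes" "x \<in> gX \<Longrightarrow> Mid x \<in> net.nodes" "x \<in> gX \<Longrightarrow> Pos x \<in> net.nodes"
  by (rule net.nodes.intros; assumption)+

lemma planar_lgraph: "planar lgraph"
  unfolding lgraph_def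
  by (rule planar_with_helpers[OF _ arcs_lattice twos_lattice]) (use arc_cases in blast)

lemma odd_hole_free_lgraph: "odd_hole_free lgraph"
  unfolding lgraph_def
proof (rule odd_hole_free_with_helpers[OF arcs_lattice twos_lattice], intro ballI, clarify)
  fix r c r' c' assume a: "((r, c), (r', c')) \<in> arcs" and no: "\<nexists>s. (((r, c), s) \<in> arcs \<or> (s, (r, c)) \<in> arcs)
     \<and> (\<forall>x. (x, (r', c')) \<in> arcs \<or> ((r', c'), x) \<in> arcs \<longrightarrow> x = (r, c) \<or> x = s)"
  show "ladj (r, c) (r', c')"
  proof (rule ccontr)
    assume "\<not> ?thesis"
    then obtain x where x: "x \<in> gX" "x \<notin> gU" "(r, c) = place (Neg x)" "(r', c') = place (Mid x)"
      using arc_cases[OF a] by blast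
    have "(place (Pos x), (r, c)) \<in> arcs" unfolding x(3) by (rule harc_arcs[OF net.PosNeg[OF x(1)]])
    moreover have "y = (r, c) \<or> y = place (Pos x)" if "(y, (r', c')) \<in> arcs \<or> ((r', c'), y) \<in> arcs" for y
    proof -
      have "y \<in> place ` net.nbs (Mid x)" using place_nbs[OF Neg_Mid_nodes(2)[OF x(1)]] that unfolding x(4) by blast
      then show ?thesis using net.nbs_Mid[OF x(2)] unfolding x(3) by blast
    qed
    ultimately show False using no by blast
  qed
qed

text \<open>Parity gives a proper colouring except on the diagonals. Each diagonal ends in a
  \<open>Mid\<close>, and these are pairwise non-adjacent, so all of them can take the third
  colour.\<close>

lemma colorable_lgraph: "colorable 3 lgraph"
proof -
  define mids where "mids = (\<lambda>x. place (Mid x)) ` gX"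
  define g :: "nat \<times> nat \<Rightarrow> nat" where "g p = (if p \<in> mids then 3 else if even (fst p + snd p) then 1 else 2)" for p
  have "g p \<in> {1..3}" for p by (simp add: g_def)
  moreover have "g p \<noteq> g q" if pq: "(p, q) \<in> arcs" for p q
  proof -
    consider "p \<in> mids" "q \<in> mids" | "p \<in> mids" "q \<notin> mids" | "p \<notin> mids" "q \<in> mids" | "p \<notin> mids" "q \<notin> mids" by blast
    then show ?thesis
    proof cases
      case 1
      then obtain x y where "x \<in> gX" "y \<in> gX" "p = place (Mid x)" "q = place (Mid y)" by (auto simp: mids_def)
      then have "(Mid x, Mid y) \<in> net.harc" using place_arc_iff[OF Neg_Mid_nodes(2) Neg_Mid_nodes(2)] pq by blast
      then show ?thesis using net.not_Mid_Mid by blast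
    next
      case 2
      then show ?thesis by (simp add: g_def)
    next
      case 3
      then show ?thesis by (simp add: g_def)
    next
      case 4
      have "ladj p q" using arc_cases[OF pq] 4(2) unfolding mids_def by blast
      then have "even (fst p + snd p) \<longleftrightarrow> odd (fst q + snd q)" by (auto simp: ladj_def)
      then show ?thesis using 4 by (simp add: g_def)
    qed
  qed
  ultimately show ?thesis unfolding lgraph_def
    by (intro colorable_with_helpers[OF arcs_lattice twos_lattice, of g]) auto
qed

lemma max_degree_lgraph: "max_degree lgraph = 6"
proof -
  have pc: "pc 0 0 0" "ps 0 0 0 2" using N by (simp_all add: pc_def ps_def)
  then have k: "(0, 0, 0) \<in> gK" "2 \<in> gsl (0, 0, 0)" by (auto simp: gK_def gsl_def)
  let ?u = "Path (0, 0, 0) 2 (glen (0, 0, 0) 2 - 1) :: gnode"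
  have l: "1 \<le> glen (0, 0, 0) 2" using net.len[OF k] .
  have u: "?u \<in> net.nodes" using l by (intro net.nodes.intros k) linarith
  have inj: "inj_on place (net.nbs w)" for w
    by (rule inj_on_subset[OF place_inj]) (use net.harc_nodes in \<open>auto simp: net.nbs_def\<close>)
  show ?thesis unfolding lgraph_def
  proof (rule max_degree_with_helpers[OF arcs_lattice twos_lattice, of "place ?u"])
    show "finite lattice" by (simp add: lattice_def)
    show "\<forall>(p, q)\<in>arcs. ladj p q \<or> anti p q" using arc_cases by blast
    show "\<forall>p\<in>twos. card {q. (p, q) \<in> arcs \<or> (q, p) \<in> arcs} \<le> 3"
    proof
      fix p assume "p \<in> twos"
      then obtain w where w: "w \<in> net.nodes" "net.hsize w = 2" "p = place w" unfolding twos_eq[symmetric] by blast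
      obtain a b c where "net.nbs w \<subseteq> {a, b, c}" using net.nbs_two[OF w(1,2)] by blast
      then have "place ` net.nbs w \<subseteq> set [place a, place b, place c]" by auto
      then have "card (place ` net.nbs w) \<le> card (set [place a, place b, place c])" by (intro card_mono) simp_all
      also have "\<dots> \<le> length [place a, place b, place c]" by (rule card_length)
      finally show "card {q. (p, q) \<in> arcs \<or> (q, p) \<in> arcs} \<le> 3" unfolding w(3) place_nbs[OF w(1)] by simp
    qed
    show "place ?u \<in> twos" unfolding place_two_iff[OF u] by simp
    obtain a where a: "net.nbs ?u = {a, Side (0, 0, 0) 2 True, Side (0, 0, 0) 2 False}"
        "a \<noteq> Side (0, 0, 0) 2 True" "a \<noteq> Side (0, 0, 0) 2 False" using net.nbs_path_end[OF k] by blast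
    have "card (net.nbs ?u) = 3" unfolding a(1) using a(2,3) by simp
    then show "card {q. (place ?u, q) \<in> arcs \<or> (q, place ?u) \<in> arcs} = 3"
      unfolding place_nbs[OF u] card_image[OF inj] .
  qed
qed

theorem choosable_lgraph:
  "choosable 3 4 lgraph \<longleftrightarrow> (\<forall>a. \<exists>w. (\<forall>j<N. univ j \<longrightarrow> w j = a j) \<and> cnf w)"
proof -
  define size where "size p = (if p \<in> twos then 2 else 3 :: nat)" for p
  define g where "g = inv_into net.nodes place"
  have g: "g (place u) = u" if "u \<in> net.nodes" for u using inv_into_f_f[OF place_inj that] by (simp add: g_def)
  have gn: "g p \<in> net.nodes \<and> place (g p) = p" if "p \<in> place ` net.nodes" for p using that g by auto
  have hs: "size (place u) = net.hsize u" if u: "u \<in> net.nodes" for u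
  proof -
    have "net.hsize u \<in> {2, 3}"
      using u by cases (use net.sl in auto)
    then show ?thesis unfolding size_def place_two_iff[OF u] by auto
  qed
  have "choosable 3 4 lgraph \<longleftrightarrow> (\<forall>M :: nat \<times> nat \<Rightarrow> nat set. (\<forall>v\<in>lattice. M v \<subseteq> {1..4} \<and> card (M v) = size v) \<longrightarrow>
      (\<exists>c. (\<forall>v\<in>lattice. c v \<in> M v) \<and> (\<forall>(u, v)\<in>arcs. c u \<noteq> c v)))"
    unfolding lgraph_def size_def by (rule choosable_with_helpers[OF arcs_lattice twos_lattice])
  also have "\<dots> \<longleftrightarrow> (\<forall>M. (\<forall>v\<in>net.nodes. M v \<subseteq> {1..4} \<and> card (M v) = net.hsize v) \<longrightarrow> (\<exists>c. net.hcolouring M c))" (is "?L \<longleftrightarrow> ?R")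
  proof
    assume L: ?L
    show ?R
    proof (intro allI impI)
      fix M :: "gnode \<Rightarrow> nat set" assume M: "\<forall>v\<in>net.nodes. M v \<subseteq> {1..4} \<and> card (M v) = net.hsize v"
      define M' where "M' p = (if p \<in> place ` net.nodes then M (g p) else {1..3})" for p
      have "M' v \<subseteq> {1..4} \<and> card (M' v) = size v" for v
      proof (cases "v \<in> place ` net.nodes")
        case True
        note n = gn[OF True]
        have "M' v = M (g v)" using True by (simp add: M'_def)
        then show ?thesis using M[rule_format, of "g v"] hs[of "g v"] n by simp
      next
        case False
        then have "v \<notin> twos" unfolding twos_eq[symmetric] by blast
        then show ?thesis using False by (simp add: M'_def size_def)
      qed
      then obtain c where c: "\<forall>v\<in>lattice. c v \<in> M' v" "\<forall>(u, v)\<in>arcs. c u \<noteq> c v" using L by blast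
      have "net.hcolouring M (\<lambda>u. c (place u))"
        unfolding net.hcolouring_def
      proof (intro conjI ballI)
        fix u assume u: "u \<in> net.nodes"
        then show "c (place u) \<in> M u" using bspec[OF c(1) place_lattice[OF u]] g by (simp add: M'_def)
      next
        fix uv assume "uv \<in> net.harc"
        then show "case uv of (u, v) \<Rightarrow> c (place u) \<noteq> c (place v)" using c(2) harc_arcs by (cases uv) blast
      qed
      then show "\<exists>c. net.hcolouring M c" by blast
    qed
  next
    assume R: ?R
    show ?L
    proof (intro allI impI)
      fix M :: "nat \<times> nat \<Rightarrow> nat set" assume M: "\<forall>v\<in>lattice. M v \<subseteq> {1..4} \<and> card (M v) = size v"
      have "\<forall>v\<in>net.nodes. M (place v) \<subseteq> {1..4} \<and> card (M (place v)) = net.hsize v" using M place_lattice hs by metis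
      then obtain c where c: "net.hcolouring (\<lambda>v. M (place v)) c" using R[rule_format, of "\<lambda>v. M (place v)"] by blast
      define c' where "c' p = (if p \<in> place ` net.nodes then c (g p) else (SOME x. x \<in> M p))" for p
      have "c' v \<in> M v" if v: "v \<in> lattice" for v
      proof (cases "v \<in> place ` net.nodes")
        case True
        then show ?thesis using c gn[OF True] unfolding net.hcolouring_def c'_def by auto
      next
        case False
        have "card (M v) = size v" using M v by blast
        then have "card (M v) \<noteq> 0" by (simp add: size_def)
        then have "\<exists>x. x \<in> M v" by (metis card.empty ex_in_conv)
        then have "(SOME x. x \<in> M v) \<in> M v" by (rule someI_ex)
        then show ?thesis using False by (simp add: c'_def)
      qed
      moreover have "c' p \<noteq> c' q" if "(p, q) \<in> arcs" for p q
      proof -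
        obtain u v where uv: "(u, v) \<in> net.harc" "p = place u" "q = place v" using arcs_harc[OF \<open>(p, q) \<in> arcs\<close>] by blast
        have n: "u \<in> net.nodes" "v \<in> net.nodes" using net.harc_nodes[OF uv(1)] by simp_all
        have "c u \<noteq> c v" using c uv(1) unfolding net.hcolouring_def by blast
        then show ?thesis using n g by (simp add: uv c'_def)
      qed
      ultimately show "\<exists>c. (\<forall>v\<in>lattice. c v \<in> M v) \<and> (\<forall>(u, v)\<in>arcs. c u \<noteq> c v)" by blast
    qed
  qed
  also have "\<dots> \<longleftrightarrow> (\<forall>a. \<exists>val. (\<forall>x\<in>gU. val x = a x) \<and> gsat val)"
    unfolding net.network_correct net_sat ..
  also have "\<dots> \<longleftrightarrow> (\<forall>a. \<exists>w. (\<forall>j<N. univ j \<longrightarrow> w j = a j) \<and> cnf w)" by (rule grid_formula)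
  finally show ?thesis .
qed

end

section \<open>Invariance of graph properties under injective renaming\<close>

section \<open>Renaming vertices\<close>

definition rename_graph :: "('a \<Rightarrow> 'b) \<Rightarrow> 'a graph \<Rightarrow> 'b graph" where
  "rename_graph f G = (f ` verts G, (`) f ` edges G)"

locale renaming =
  fixes f :: "'a \<Rightarrow> 'b" and G :: "'a graph"
  assumes inj: "inj_on f (verts G)" and edges_sub: "e \<in> edges G \<Longrightarrow> e \<subseteq> verts G"
begin

abbreviation H where "H \<equiv> rename_graph f G"

definition g where "g = inv_into (verts G) f"

lemma vH: "verts H = f ` verts G" and eH: "edges H = (`) f ` edges G"
  by (simp_all add: rename_graph_def)

lemma gf [simp]: "v \<in> verts G \<Longrightarrow> g (f v) = v"
  using inj by (simp add: g_def)

lemma fg [simp]: "v \<in> verts H \<Longrightarrow> f (g v) = v"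
  and g_in [simp]: "v \<in> verts H \<Longrightarrow> g v \<in> verts G"
  by (auto simp: vH)

lemma g_image: "X \<subseteq> verts G \<Longrightarrow> g ` f ` X = X"
proof -
  assume X: "X \<subseteq> verts G"
  have "g (f x) = x" if "x \<in> X" for x using that X by auto
  then show ?thesis by (simp add: image_image)
qed

lemma g_edge: "e \<in> edges H \<Longrightarrow> g ` e \<in> edges G \<and> e = f ` g ` e"
proof -
  assume "e \<in> edges H"
  then obtain e' where e': "e' \<in> edges G" "e = f ` e'" unfolding eH by blast
  then have "g ` e = e'" using g_image[OF edges_sub] by simp
  then show ?thesis using e' by simp
qed

lemma edge_iff:
  assumes "u \<in> verts G" "v \<in> verts G"
  shows "{f u, f v} \<in> edges H \<longleftrightarrow> {u, v} \<in> edges G"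
proof
  assume "{f u, f v} \<in> edges H"
  then have "g ` {f u, f v} \<in> edges G" using g_edge by blast
  then show "{u, v} \<in> edges G" using assms by simp
next
  assume "{u, v} \<in> edges G"
  then have "f ` {u, v} \<in> edges H" unfolding eH by blast
  then show "{f u, f v} \<in> edges H" by simp
qed

lemma proper_iff: "proper_coloring H c \<longleftrightarrow> proper_coloring G (\<lambda>v. c (f v))"
  unfolding proper_coloring_def vH using edge_iff by auto

lemma colorable_rename: "colorable k G \<Longrightarrow> colorable k H"
proof -
  assume "colorable k G"
  then obtain c where c: "\<forall>v\<in>verts G. c v \<in> {1..k}" "proper_coloring G c" unfolding colorable_def by blast
  have "proper_coloring G (\<lambda>v. c (g (f v)))" using c(2) unfolding proper_coloring_def by simp
  then have "proper_coloring H (\<lambda>v. c (g v))" unfolding proper_iff .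
  moreover have "\<forall>v\<in>verts H. c (g v) \<in> {1..k}" using c(1) g_in by blast
  ultimately show ?thesis unfolding colorable_def by (intro exI[of _ "\<lambda>v. c (g v)"] conjI)
qed

lemma choosable_rename: "choosable l k H \<longleftrightarrow> choosable l k G"
proof
  assume H: "choosable l k H"
  show "choosable l k G" unfolding choosable_def
  proof (intro allI impI)
    fix L :: "'a \<Rightarrow> nat set" assume L: "\<forall>v\<in>verts G. L v \<subseteq> {1..k} \<and> card (L v) = l"
    then have "\<forall>v\<in>verts H. L (g v) \<subseteq> {1..k} \<and> card (L (g v)) = l" using g_in by blast
    then obtain c where c: "\<forall>v\<in>verts H. c v \<in> L (g v)" "proper_coloring H c"
      using H[unfolded choosable_def, rule_format, of "\<lambda>v. L (g v)"] by blast
    have "c (f v) \<in> L v" if "v \<in> verts G" for v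
      using bspec[OF c(1), of "f v"] that by (simp add: vH)
    then show "\<exists>c. (\<forall>v\<in>verts G. c v \<in> L v) \<and> proper_coloring G c"
      using c(2) unfolding proper_iff by (intro exI[of _ "\<lambda>v. c (f v)"]) simp
  qed
next
  assume G: "choosable l k G"
  show "choosable l k H" unfolding choosable_def
  proof (intro allI impI)
    fix L :: "'b \<Rightarrow> nat set" assume L: "\<forall>v\<in>verts H. L v \<subseteq> {1..k} \<and> card (L v) = l"
    then have "\<forall>v\<in>verts G. L (f v) \<subseteq> {1..k} \<and> card (L (f v)) = l" by (simp add: vH)
    then obtain c where c: "\<forall>v\<in>verts G. c v \<in> L (f v)" "proper_coloring G c"
      using G[unfolded choosable_def, rule_format, of "\<lambda>v. L (f v)"] by blast
    have "proper_coloring G (\<lambda>v. c (g (f v)))" using c(2) unfolding proper_coloring_def by simp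
    then have "proper_coloring H (\<lambda>v. c (g v))" unfolding proper_iff .
    moreover have "c (g v) \<in> L v" if "v \<in> verts H" for v
      using bspec[OF c(1) g_in[OF that]] that by simp
    ultimately show "\<exists>c. (\<forall>v\<in>verts H. c v \<in> L v) \<and> proper_coloring H c"
      by (intro exI[of _ "\<lambda>v. c (g v)"]) simp
  qed
qed

lemma odd_hole_free_rename:
  assumes "odd_hole_free G"
  shows "odd_hole_free H"
  unfolding odd_hole_free_def
proof
  assume "\<exists>vs i. 2 \<le> i \<and> length vs = 2 * i + 1 \<and> induced_cycle H vs"
  then obtain vs i where i: "2 \<le> i" "length vs = 2 * i + 1" and c: "induced_cycle H vs" by blast
  have s: "set vs \<subseteq> verts H" using c by (simp add: induced_cycle_def)
  have inj_g: "inj_on g (verts H)" by (metis fg inj_onI)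
  have "{map g vs ! a, map g vs ! b} \<in> edges G \<longleftrightarrow> {vs ! a, vs ! b} \<in> edges H" if "a < length vs" "b < length vs" for a b
  proof -
    have "vs ! a \<in> verts H" "vs ! b \<in> verts H" using s that by (auto dest: nth_mem)
    then show ?thesis using edge_iff[of "g (vs ! a)" "g (vs ! b)"] that by simp
  qed
  moreover have "distinct (map g vs)" using c s inj_g by (auto simp: distinct_map induced_cycle_def intro: inj_on_subset)
  moreover have "set (map g vs) \<subseteq> verts G" using s g_in by auto
  ultimately have "induced_cycle G (map g vs)" using c unfolding induced_cycle_def by simp
  then show False using assms i unfolding odd_hole_free_def by (metis length_map)
qed

lemma planar_rename:
  assumes "planar G"
  shows "planar H"
proof -
  obtain pos :: "'a \<Rightarrow> real \<times> real" and \<gamma> where pos: "inj_on pos (verts G)"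
    and e: "\<forall>e\<in>edges G. arc (\<gamma> e) \<and> {pathstart (\<gamma> e), pathfinish (\<gamma> e)} = pos ` e \<and> path_image (\<gamma> e) \<inter> pos ` verts G = pos ` e"
    and ee: "\<forall>e\<in>edges G. \<forall>e'\<in>edges G. e \<noteq> e' \<longrightarrow> path_image (\<gamma> e) \<inter> path_image (\<gamma> e') = pos ` (e \<inter> e')"
    using assms unfolding planar_def by blast
  have gH: "g ` verts H = verts G" unfolding vH by (rule g_image) simp
  have inj_g: "inj_on g (verts H)" by (metis fg inj_onI)
  show ?thesis unfolding planar_def
  proof (intro exI[of _ "\<lambda>v. pos (g v)"] exI[of _ "\<lambda>e. \<gamma> (g ` e)"] conjI ballI impI)
    show "inj_on (\<lambda>v. pos (g v)) (verts H)" using pos inj_g gH by (auto simp: inj_on_def)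
    fix a assume a: "a \<in> edges H"
    then have a': "g ` a \<in> edges G" using g_edge by blast
    have pa: "(\<lambda>v. pos (g v)) ` X = pos ` g ` X" for X by (simp add: image_image)
    show "arc (\<gamma> (g ` a))" using bspec[OF e a'] by blast
    show "{pathstart (\<gamma> (g ` a)), pathfinish (\<gamma> (g ` a))} = (\<lambda>v. pos (g v)) ` a" using bspec[OF e a'] unfolding pa by blast
    show "path_image (\<gamma> (g ` a)) \<inter> (\<lambda>v. pos (g v)) ` verts H = (\<lambda>v. pos (g v)) ` a" using bspec[OF e a'] unfolding pa gH by blast
    fix b assume b: "b \<in> edges H" "a \<noteq> b"
    then have b': "g ` b \<in> edges G" "g ` a \<noteq> g ` b" using g_edge[OF a] g_edge[OF b(1)] by metis+
    have "a \<subseteq> verts H" "b \<subseteq> verts H" using a b edges_sub by (auto simp: eH vH)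
    then have "g ` (a \<inter> b) = g ` a \<inter> g ` b" using inj_on_image_Int[OF inj_g] by blast
    then show "path_image (\<gamma> (g ` a)) \<inter> path_image (\<gamma> (g ` b)) = (\<lambda>v. pos (g v)) ` (a \<inter> b)"
      using bspec[OF bspec[OF ee a'] b'(1)] b'(2) unfolding pa by simp
  qed
qed

lemma vertex_degree_rename:
  assumes v: "v \<in> verts G"
  shows "vertex_degree H (f v) = vertex_degree G v"
proof -
  have inj_e: "inj_on ((`) f) (edges G)" using g_image edges_sub by (metis inj_onI)
  have "{e \<in> edges H. f v \<in> e} = (`) f ` {e \<in> edges G. v \<in> e}"
  proof -
    have "f v \<in> f ` e \<longleftrightarrow> v \<in> e" if "e \<in> edges G" for e
      using inj_on_image_mem_iff[OF inj v edges_sub[OF that]] .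
    then show ?thesis unfolding eH by auto
  qed
  then show ?thesis unfolding vertex_degree_def by (simp add: card_image inj_on_subset[OF inj_e])
qed

lemma max_degree_rename: "max_degree H = max_degree G"
  unfolding max_degree_def vH image_image using vertex_degree_rename by (simp cong: image_cong)

end

context grid
begin

definition width :: nat where "width = 26 * (2 * N + 1)"

definition vertex_id :: "(nat \<times> nat) \<times> nat \<Rightarrow> nat" where
  "vertex_id = (\<lambda>((r, c), k). (r * width + c) * 8 + k)"

definition order :: nat where "order = 26 * (m + 2) * width * 8"

lemma vertex_id_bij: "bij_betw vertex_id (verts lgraph) {..<order}"
proof -
  have w: "width > 0" by (simp add: width_def)
  let ?h = "\<lambda>n. ((n div 8 div width, n div 8 mod width), n mod 8)"
  have "(r * width + c) * 8 + k < order" if "r < 26 * (m + 2)" "c < width" "k < 8" for r c k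
  proof -
    have "Suc r * width \<le> 26 * (m + 2) * width" using that by (intro mult_le_mono1) simp
    then have "r * width + c < 26 * (m + 2) * width" using that by simp
    then have "Suc (r * width + c) * 8 \<le> 26 * (m + 2) * width * 8" by (intro mult_le_mono1) simp
    then show ?thesis unfolding order_def using that(3) by simp
  qed
  moreover have "n div 8 div width < 26 * (m + 2)" if "n < order" for n
  proof -
    have "n < 26 * (m + 2) * (width * 8)" using that by (simp only: order_def mult.assoc)
    then have "n div (width * 8) < 26 * (m + 2)" by (rule less_mult_imp_div_less)
    then show ?thesis by (simp only: div_mult2_eq mult.commute[of width])
  qed
  moreover have "(a * 8 + k) div 8 = a" "(a * 8 + k) mod 8 = k" if "k < 8" for a k :: nat using that by simp_all
  moreover have "(r * width + c) div width = r" "(r * width + c) mod width = c" if "c < width" for r c using that by simp_all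
  moreover have "(n div 8 div width * width + n div 8 mod width) * 8 + n mod 8 = n" for n by (simp only: div_mult_mod_eq)
  moreover have "n div 8 mod width < width" for n using w by simp
  moreover have "verts lgraph = ({..<26 * (m + 2)} \<times> {..<width}) \<times> {..<8}"
    by (simp only: lgraph_def with_helpers_verts lattice_def width_def)
  ultimately show ?thesis
    by (intro bij_betw_byWitness[of _ ?h]) (auto simp del: distrib_right_numeral distrib_left_numeral simp: vertex_id_def)
qed

definition ngraph :: "nat graph" where
  "ngraph = rename_graph vertex_id lgraph"

lemma lgraph_edge: "e \<in> edges lgraph \<Longrightarrow> e \<subseteq> verts lgraph \<and> card e = 2"
proof -
  assume "e \<in> edges lgraph"
  then consider (A) p q where "(p, q) \<in> arcs" "e = {(p, 0), (q, 0)}"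
    | (H) p i j where "p \<in> twos" "(i, j) \<in> helper_arcs" "e = {(p, i), (p, j)}"
    by (auto simp: lgraph_def with_helpers_def)
  then show ?thesis
  proof cases
    case A
    have "p \<noteq> q" using arc_cases[OF A(1)] by (auto simp: ladj_def anti_def)
    moreover have "p \<in> lattice \<and> q \<in> lattice" using A(1) arcs_lattice by blast
    ultimately show ?thesis unfolding A(2) by (simp add: lgraph_def with_helpers_verts)
  next
    case H
    have "i < 8" "j < 8" "i \<noteq> j" using H(2) by (auto simp: helper_arcs_def)
    moreover have "p \<in> lattice" using H(1) twos_lattice by blast
    ultimately show ?thesis unfolding H(3) by (simp add: lgraph_def with_helpers_verts)
  qed
qed

end

sublocale grid \<subseteq> ren: renaming vertex_id lgraph
  using vertex_id_bij lgraph_edge by unfold_locales (auto simp: bij_betw_def)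

context grid
begin

lemma verts_ngraph: "verts ngraph = {..<order}"
  using vertex_id_bij by (simp add: ngraph_def ren.vH bij_betw_def)

lemma ngraph_input: "ngraph \<in> input_graphs"
proof -
  have "e \<subseteq> verts ngraph \<and> card e = 2" if e: "e \<in> edges ngraph" for e
  proof -
    obtain e' where e': "e' \<in> edges lgraph" "e = vertex_id ` e'" using e unfolding ngraph_def ren.eH by blast
    have "inj_on vertex_id e'" using lgraph_edge[OF e'(1)] inj_on_subset[OF ren.inj] by blast
    then show ?thesis using lgraph_edge[OF e'(1)] by (auto simp: e'(2) card_image ngraph_def ren.vH)
  qed
  then show ?thesis unfolding input_graphs_def simple_graph_def using verts_ngraph by auto
qed

lemma ngraph_class: "colorable 3 ngraph \<and> odd_hole_free ngraph \<and> planar ngraph \<and> max_degree ngraph = 6"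
  unfolding ngraph_def ren.max_degree_rename
  using ren.colorable_rename colorable_lgraph ren.odd_hole_free_rename odd_hole_free_lgraph
    ren.planar_rename planar_lgraph max_degree_lgraph by blast

lemma choosable_ngraph: "choosable 3 4 ngraph \<longleftrightarrow> (\<forall>a. \<exists>w. (\<forall>j<N. univ j \<longrightarrow> w j = a j) \<and> cnf w)"
  unfolding ngraph_def ren.choosable_rename by (rule choosable_lgraph)

text \<open>Adjacency by bounded quantifiers over cells and by finite tables, as the calculus of
  computable predicates requires.\<close>

lemma ngraph_edge:
  "{a, b} \<in> edges ngraph \<longleftrightarrow> (\<exists>i\<le>m. \<exists>j<2 * N.
     (\<exists>(p, q)\<in>cell_pairs i j. {a, b} = {vertex_id (padd (i, j) p, 0), vertex_id (padd (i, j) q, 0)}) \<or>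
     (\<exists>p\<in>cell_twos i j. \<exists>(k, l)\<in>helper_arcs. {a, b} = {vertex_id (padd (i, j) p, k), vertex_id (padd (i, j) p, l)}))"
    (is "_ \<longleftrightarrow> ?R")
proof
  assume "{a, b} \<in> edges ngraph"
  then obtain e where e: "e \<in> edges lgraph" "{a, b} = vertex_id ` e" unfolding ngraph_def ren.eH by blast
  from e(1) consider (A) p q where "(p, q) \<in> arcs" "e = {(p, 0), (q, 0)}"
    | (H) p i j where "p \<in> twos" "(i, j) \<in> helper_arcs" "e = {(p, i), (p, j)}"
    by (auto simp: lgraph_def with_helpers_def)
  then show ?R
  proof cases
    case A
    then show ?thesis using e(2) unfolding arcs_def by fastforce
  next
    case H
    then show ?thesis using e(2) unfolding twos_def by fastforce
  qed
next
  assume ?R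
  then obtain i j where ij: "i \<le> m" "j < 2 * N" and
    *: "(\<exists>(p, q)\<in>cell_pairs i j. {a, b} = {vertex_id (padd (i, j) p, 0), vertex_id (padd (i, j) q, 0)}) \<or>
     (\<exists>p\<in>cell_twos i j. \<exists>(k, l)\<in>helper_arcs. {a, b} = {vertex_id (padd (i, j) p, k), vertex_id (padd (i, j) p, l)})" by blast
  have "\<exists>u v. {u, v} \<in> edges lgraph \<and> {a, b} = vertex_id ` {u, v}"
    using *
  proof
    assume "\<exists>(p, q)\<in>cell_pairs i j. {a, b} = {vertex_id (padd (i, j) p, 0), vertex_id (padd (i, j) q, 0)}"
    then obtain p q where pq: "(p, q) \<in> cell_pairs i j" "{a, b} = {vertex_id (padd (i, j) p, 0), vertex_id (padd (i, j) q, 0)}" by blast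
    have "(padd (i, j) p, padd (i, j) q) \<in> arcs" using pq(1) ij unfolding arcs_def by blast
    then have "{(padd (i, j) p, 0), (padd (i, j) q, 0)} \<in> edges lgraph" by (simp add: lgraph_def with_helpers_edge)
    then show ?thesis using pq(2) by (metis image_empty image_insert)
  next
    assume "\<exists>p\<in>cell_twos i j. \<exists>(k, l)\<in>helper_arcs. {a, b} = {vertex_id (padd (i, j) p, k), vertex_id (padd (i, j) p, l)}"
    then obtain p k l where pq: "p \<in> cell_twos i j" "(k, l) \<in> helper_arcs" "{a, b} = {vertex_id (padd (i, j) p, k), vertex_id (padd (i, j) p, l)}" by blast
    have "padd (i, j) p \<in> twos" using pq(1) ij unfolding twos_def by blast
    then have "{(padd (i, j) p, k), (padd (i, j) p, l)} \<in> edges lgraph" using pq(2) by (simp add: lgraph_def with_helpers_edge)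
    then show ?thesis using pq(3) by (metis image_empty image_insert)
  qed
  then obtain u v where "{u, v} \<in> edges lgraph" "{a, b} = vertex_id ` {u, v}" by blast
  then show "{a, b} \<in> edges ngraph" unfolding ngraph_def ren.eH by (simp only: imageI)
qed

end

section \<open>Computability of the adjacency matrix\<close>

section \<open>Computing the reduction graph\<close>

text \<open>Substitution is expressed by a quantifier that is bounded by the substituted term
  itself.\<close>

lemma ppred_subst1:
  assumes "ppred (\<lambda>x v. P x (v 0))" "pexp a"
  shows "ppred (\<lambda>x v. P x (a x v))"
proof -
  have eq: "P x (a x v) \<longleftrightarrow> (\<exists>i\<le>a x v. i = a x v \<and> P x i)" for x v by auto
  show ?thesis unfolding eq
    by (intro ppred_bex_le ppred_conj ppred_eq pexp_var pexp_shift[OF assms(2)] assms)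
qed

lemma ppred_subst2:
  assumes "ppred (\<lambda>x v. P x (v 0) (v 1))" "pexp a" "pexp b"
  shows "ppred (\<lambda>x v. P x (a x v) (b x v))"
proof -
  have eq: "P x (a x v) (b x v) \<longleftrightarrow> (\<exists>j\<le>b x v. j = b x v \<and> (\<exists>i\<le>a x v. i = a x v \<and> P x i j))" for x v by auto
  have 1: "ppred (\<lambda>x v. P x (v 0) (v (Suc 0)))" using assms(1) by simp
  show ?thesis unfolding eq
    by (intro ppred_bex_le ppred_conj ppred_eq pexp_var pexp_shift[OF assms(2)]
      pexp_shift[OF pexp_shift[OF assms(2)]] pexp_shift[OF assms(3)] assms(2,3) 1)
qed

lemma ppred_even [pexp_intros]: "pexp a \<Longrightarrow> ppred (\<lambda>x v. even (a x v))"
  unfolding even_iff_mod_2_eq_zero by (intro ppred_eq pexp_mod pexp_const)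

lemma ppred_if_const: "(c \<Longrightarrow> ppred P) \<Longrightarrow> (\<not> c \<Longrightarrow> ppred Q) \<Longrightarrow> ppred (\<lambda>x v. if c then P x v else Q x v)"
  by (cases c) simp_all

lemma upt_square: "[0..<n * n] = concat (map (\<lambda>i. map (\<lambda>j. i * n + j) [0..<n]) [0..<n])"
proof -
  have "[0..<k * n] = concat (map (\<lambda>i. map (\<lambda>j. i * n + j) [0..<n]) [0..<k])" for k
  proof (induction k)
    case (Suc k)
    have "[0..<Suc k * n] = [0..<k * n] @ [k * n..<k * n + n]"
      using upt_add_eq_append[of 0 "k * n" n] by (simp add: add.commute)
    also have "[k * n..<k * n + n] = map (\<lambda>j. k * n + j) [0..<n]"
      using map_add_upt[of "k * n" n] by (simp add: add.commute)
    finally show ?case using Suc by simp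
  qed simp
  then show ?thesis .
qed

lemma encode_map:
  assumes "verts G = {..<n}"
  shows "encode G = map (\<lambda>t. {t div n, t mod n} \<in> edges G) [0..<n * n]"
proof -
  have "map (\<lambda>t. {t div n, t mod n} \<in> edges G) [0..<n * n]
    = concat (map (\<lambda>i. map (\<lambda>j. {(i * n + j) div n, (i * n + j) mod n} \<in> edges G) [0..<n]) [0..<n])"
    by (simp only: upt_square map_concat map_map o_def)
  also have "\<dots> = encode G"
    unfolding encode_def Let_def assms card_lessThan
    by (intro arg_cong[where f = concat] map_cong refl) simp
  finally show ?thesis ..
qed

context grid
begin

text \<open>Set membership becomes a finite disjunction over the tables. The equivalence is proved
  for arbitrary sets and functions first, so that the concrete tables remain folded.\<close>

lemma bex_cell_pairs:
  "(\<exists>(p, q)\<in>cell_pairs i j. Q p q) \<longleftrightarrow>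
    (\<exists>v\<in>set [0, 1, 2, 3, 4, 5, 6]. pv i j v \<and> (Q (vpos v) (vneg v) \<or> Q (vpos v) (vmid v)
      \<or> (i, j, v) \<notin> gU \<and> Q (vneg v) (vmid v))) \<or>
    (i, j, 6) \<in> gU \<and> Q (vmid 6) (wpath 6 1 ! 0) \<or>
    (\<exists>y\<in>set slots. pc i j (fst y) \<and> ps i j (fst y) (snd y) \<and> (\<exists>z\<in>set (wire_pairs (fst y) (snd y)). Q (fst z) (snd z)))"
proof -
  have "(\<exists>(p, q)\<in>{(p, q). (\<exists>v\<in>S. P v \<and> ((p, q) = (f v, g v) \<or> (p, q) = (f v, h v) \<or> U v \<and> (p, q) = (g v, h v)))
      \<or> c \<and> (p, q) = (d, e) \<or> (\<exists>(k, s)\<in>T. R k \<and> R' k s \<and> (p, q) \<in> W k s)}. Q p q) \<longleftrightarrow>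
    (\<exists>v\<in>S. P v \<and> (Q (f v) (g v) \<or> Q (f v) (h v) \<or> U v \<and> Q (g v) (h v))) \<or> c \<and> Q d e \<or>
    (\<exists>y\<in>T. R (fst y) \<and> R' (fst y) (snd y) \<and> (\<exists>z\<in>W (fst y) (snd y). Q (fst z) (snd z)))" (is "?L \<longleftrightarrow> ?R")
    for S :: "'s set" and P U f g h c d e R R' and T :: "('t \<times> 'u) set" and W
  proof -
    have W_eq: "(\<exists>z\<in>X. Q (fst z) (snd z)) \<longleftrightarrow> (\<exists>p q. (p, q) \<in> X \<and> Q p q)" for X by force
    have "?L \<longleftrightarrow> (\<exists>p q. ((\<exists>v\<in>S. P v \<and> (p = f v \<and> q = g v \<or> p = f v \<and> q = h v \<or> U v \<and> p = g v \<and> q = h v))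
      \<or> c \<and> p = d \<and> q = e \<or> (\<exists>y\<in>T. R (fst y) \<and> R' (fst y) (snd y) \<and> (p, q) \<in> W (fst y) (snd y))) \<and> Q p q)"
      by (simp add: split_beta)
    also have "\<dots> \<longleftrightarrow> ?R" unfolding W_eq by blast
    finally show ?thesis .
  qed
  then show ?thesis unfolding cell_pairs_def .
qed

lemma bex_cell_twos:
  "(\<exists>p\<in>cell_twos i j. Q p) \<longleftrightarrow>
    (\<exists>v\<in>set [0, 1, 2, 3, 4, 5, 6]. pv i j v \<and> Q (vmid v)) \<or>
    (i, j, 6) \<in> gU \<and> (Q (vpos 6) \<or> Q (vneg 6)) \<or>
    (\<exists>y\<in>set slots. pc i j (fst y) \<and> ps i j (fst y) (snd y) \<and>
      ((\<exists>p\<in>set (wpath (fst y) (snd y)). Q p) \<or> Q (wside (fst y) (snd y) False) \<or> Q (wside (fst y) (snd y) True))) \<or>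
    (\<exists>c\<in>set [0, 1, 2, 3, 4, 5, 6, 7, 8, 9]. pc i j c \<and> \<not> (ps i j c 0 \<and> ps i j c 1 \<and> ps i j c 2) \<and> Q (wcla c))"
proof -
  have "(\<exists>p\<in>{p. (\<exists>v\<in>S. P v \<and> p = h v) \<or> c \<and> (p = d \<or> p = e)
      \<or> (\<exists>(k, s)\<in>T. R k \<and> R' k s \<and> (p \<in> W k s \<or> p = w1 k s \<or> p = w2 k s)) \<or> (\<exists>k\<in>S'. K k \<and> K' k \<and> p = C k)}. Q p) \<longleftrightarrow>
    (\<exists>v\<in>S. P v \<and> Q (h v)) \<or> c \<and> (Q d \<or> Q e) \<or>
    (\<exists>y\<in>T. R (fst y) \<and> R' (fst y) (snd y) \<and> ((\<exists>p\<in>W (fst y) (snd y). Q p) \<or> Q (w1 (fst y) (snd y)) \<or> Q (w2 (fst y) (snd y)))) \<or>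
    (\<exists>k\<in>S'. K k \<and> K' k \<and> Q (C k))"
    for S :: "'s set" and S' :: "'r set" and P h c d e R R' and T :: "('t \<times> 'u) set" and W w1 w2 K K' C
    unfolding split_beta by blast
  then show ?thesis unfolding cell_twos_def .
qed

end

lemma helper_arcs_list:
  "helper_arcs = set [(0, 1), (0, 2), (0, 5), (2, 3), (2, 4), (3, 4), (3, 1), (4, 1), (5, 6), (5, 7), (6, 7), (6, 1), (7, 1)]"
  by (simp add: helper_arcs_def)

context
  fixes m N :: "bool list \<Rightarrow> nat" and on :: "bool list \<Rightarrow> nat \<Rightarrow> nat \<Rightarrow> bool" and univ :: "bool list \<Rightarrow> nat \<Rightarrow> bool"
  assumes g: "\<And>x. grid (N x) (on x)"
    and m: "pexp (\<lambda>x v. m x)" and N: "pexp (\<lambda>x v. N x)"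
    and on: "ppred (\<lambda>x v. on x (v 0) (v 1))" and univ: "ppred (\<lambda>x v. univ x (v 0))"
begin

lemmas sub_on = ppred_subst2[OF on] and sub_univ = ppred_subst1[OF univ]

lemma pv: "pexp a \<Longrightarrow> pexp b \<Longrightarrow> ppred (\<lambda>x v. grid.pv (m x) (N x) (a x v) (b x v) c)"
  unfolding grid.pv_def[OF g] by (intro pexp_intros m N)

lemma pc: "pexp a \<Longrightarrow> pexp b \<Longrightarrow> ppred (\<lambda>x v. grid.pc (m x) (N x) (on x) (a x v) (b x v) c)"
  unfolding grid.pc_def[OF g] by (intro pexp_intros m N pv sub_on)

lemma ps: "pexp a \<Longrightarrow> pexp b \<Longrightarrow> ppred (\<lambda>x v. grid.ps (m x) (N x) (a x v) (b x v) c s)"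
  unfolding grid.ps_def[OF g] by (intro ppred_if_const pexp_intros m N pv)

lemma gU: "pexp a \<Longrightarrow> pexp b \<Longrightarrow> ppred (\<lambda>x v. (a x v, b x v, c) \<in> grid.gU (N x) (univ x))"
  unfolding grid.gU_def[OF g] mem_Collect_eq prod.case by (intro pexp_intros m N sub_univ)

lemma vertex: "pexp a \<Longrightarrow> pexp b \<Longrightarrow> pexp (\<lambda>x v. grid.vertex_id (N x) (grid.padd (a x v, b x v) p, k))"
  unfolding grid.vertex_id_def[OF g] grid.padd_def[OF g] grid.width_def[OF g] prod.case fst_conv snd_conv
  by (intro pexp_intros N)

lemma order: "pexp (\<lambda>x v. grid.order (m x) (N x))"
  unfolding grid.order_def[OF g] grid.width_def[OF g] by (intro pexp_intros m N)

lemma doubleton: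
  assumes "pexp a" "pexp b" "pexp c" "pexp d"
  shows "ppred (\<lambda>x v. {a x v, b x v} = {c x v, d x v})"
  unfolding doubleton_eq_iff by (intro pexp_intros assms)

theorem polytime_ngraph: "polytime (\<lambda>x. encode (grid.ngraph (m x) (N x) (on x) (univ x)))"
proof -
  let ?n = "\<lambda>x. grid.order (m x) (N x)"
  have "ppred (\<lambda>x v. {v 0 div ?n x, v 0 mod ?n x} \<in> edges (grid.ngraph (m x) (N x) (on x) (univ x)))"
    unfolding grid.ngraph_edge[OF g] grid.bex_cell_pairs[OF g] grid.bex_cell_twos[OF g] helper_arcs_list split_beta
    by (intro ppred_bex_le ppred_bex ppred_disj ppred_conj ppred_not ppred_list_ex pv pc ps gU doubleton vertex
      pexp_div pexp_mod order pexp_mult pexp_var pexp_const m N)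
  moreover have "pexp (\<lambda>x v. ?n x * ?n x)" by (intro pexp_mult order)
  ultimately show ?thesis
    using polytime_bits by (simp add: encode_map[OF grid.verts_ngraph[OF g]])
qed

end

section \<open>Arithmetically defined families of clauses\<close>

section \<open>Schemas of clauses\<close>

text \<open>A schema has three bounded parameters and stands for a clause for each choice of parameters
  that satisfies its guard; its literals consist of a sign and of an atom with two bounded arguments.\<close>

type_synonym param_nat = "bool list \<Rightarrow> nat \<Rightarrow> nat \<Rightarrow> nat \<Rightarrow> nat"
type_synonym 'k literal = "bool \<times> 'k \<times> param_nat \<times> param_nat"
type_synonym 'k schema = "(bool list \<Rightarrow> nat \<Rightarrow> nat \<Rightarrow> nat \<Rightarrow> bool) \<times> 'k literal list"

definition schema_sat :: "(bool list \<Rightarrow> nat) \<Rightarrow> 'k schema list \<Rightarrow> bool list \<Rightarrow> ('k \<Rightarrow> nat \<Rightarrow> nat \<Rightarrow> bool) \<Rightarrow> bool" where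
  "schema_sat B F x tr \<longleftrightarrow> (\<forall>(\<phi>, ls)\<in>set F. \<forall>c<B x. \<forall>d<B x. \<forall>e<B x. \<phi> x c d e \<longrightarrow>
     (\<exists>(s, \<kappa>, f, g)\<in>set ls. tr \<kappa> (f x c d e) (g x c d e) = s))"

definition schema_bounded :: "(bool list \<Rightarrow> nat) \<Rightarrow> 'k schema \<Rightarrow> bool" where
  "schema_bounded B = (\<lambda>(\<phi>, ls). \<forall>x c d e. c < B x \<longrightarrow> d < B x \<longrightarrow> e < B x \<longrightarrow> \<phi> x c d e \<longrightarrow>
     (\<forall>(s, \<kappa>, f, g)\<in>set ls. f x c d e < B x \<and> g x c d e < B x))"

definition schema_expr :: "'k schema \<Rightarrow> bool" where
  "schema_expr = (\<lambda>(\<phi>, ls). ppred (\<lambda>x v. \<phi> x (v 2) (v 1) (v 0)) \<and>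
     (\<forall>(s, \<kappa>, f, g)\<in>set ls. pexp (\<lambda>x v. f x (v 2) (v 1) (v 0)) \<and> pexp (\<lambda>x v. g x (v 2) (v 1) (v 0))))"

locale schemas =
  fixes B :: "bool list \<Rightarrow> nat" and F :: "'k :: countable schema list" and Us :: "'k list"
  assumes B: "pexp (\<lambda>x v. B x)" and B_pos: "B x \<ge> 1"
    and bounded: "\<And>S. S \<in> set F \<Longrightarrow> schema_bounded B S" and expr: "\<And>S. S \<in> set F \<Longrightarrow> schema_expr S"
begin

definition kinds :: nat where
  "kinds = Suc (Max (insert 0 (to_nat ` (set Us \<union> (\<Union>S\<in>set F. (\<lambda>l. fst (snd l)) ` set (snd S))))))"

lemma kinds_Us: "\<kappa> \<in> set Us \<Longrightarrow> to_nat \<kappa> < kinds"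
  unfolding kinds_def less_Suc_eq_le by (intro Max_ge) auto

lemma kinds_F: "(\<phi>, ls) \<in> set F \<Longrightarrow> (s, \<kappa>, f, g) \<in> set ls \<Longrightarrow> to_nat \<kappa> < kinds"
  unfolding kinds_def less_Suc_eq_le by (intro Max_ge) force+

definition idx :: "bool list \<Rightarrow> 'k \<Rightarrow> nat \<Rightarrow> nat \<Rightarrow> nat" where
  "idx x \<kappa> a b = (to_nat \<kappa> * B x + a) * B x + b"

text \<open>The additional variable leaves the last column without occurrences, as the locale
  \<open>grid\<close> demands.\<close>

definition sN :: "bool list \<Rightarrow> nat" where "sN x = kinds * B x * B x + 1"
definition sm :: "bool list \<Rightarrow> nat" where "sm x = length F * B x * B x * B x"

text \<open>Column \<open>2 * k\<close> is the positive and \<open>2 * k + 1\<close> the negative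
  literal of variable \<open>k\<close>. An instance whose guard is false gets both literals of
  variable 0 and is thus a tautology.\<close>

definition son :: "bool list \<Rightarrow> nat \<Rightarrow> nat \<Rightarrow> bool" where
  "son x i j \<longleftrightarrow> (\<exists>h\<in>set [0..<length F]. \<exists>c<B x. \<exists>d<B x. \<exists>e<B x. i = ((h * B x + c) * B x + d) * B x + e \<and>
     (if fst (F ! h) x c d e then
        \<exists>l\<in>set (snd (F ! h)). j = 2 * idx x (fst (snd l)) (fst (snd (snd l)) x c d e) (snd (snd (snd l)) x c d e) + (if fst l then 0 else 1)
      else j < 2))"

definition suniv :: "bool list \<Rightarrow> nat \<Rightarrow> bool" where
  "suniv x j \<longleftrightarrow> (\<exists>\<kappa>\<in>set Us. \<exists>a<B x. \<exists>b<B x. j = idx x \<kappa> a b)"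

lemma digits_less: "h < (n :: nat) \<Longrightarrow> a < b \<Longrightarrow> h * b + a < n * b"
  using mult_le_mono1[of "Suc h" n b] by simp

lemma digits_unique: "a < b \<Longrightarrow> a' < b \<Longrightarrow> h * b + a = h' * b + a' \<longleftrightarrow> h = h' \<and> a = (a' :: nat)"
proof -
  assume "a < b" "a' < b"
  then have "(h * b + a) div b = h" "(h * b + a) mod b = a" "(h' * b + a') div b = h'" "(h' * b + a') mod b = a'" by simp_all
  then show ?thesis by metis
qed

lemma idx_less: "to_nat \<kappa> < kinds \<Longrightarrow> a < B x \<Longrightarrow> b < B x \<Longrightarrow> idx x \<kappa> a b < kinds * B x * B x"
  unfolding idx_def by (intro digits_less)

lemma idx_decode:
  assumes "a < B x" "b < B x"
  shows "from_nat (idx x \<kappa> a b div B x div B x) = \<kappa>" "idx x \<kappa> a b div B x mod B x = a" "idx x \<kappa> a b mod B x = b"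
proof -
  have "idx x \<kappa> a b div B x = to_nat \<kappa> * B x + a" using assms by (simp add: idx_def)
  then show "from_nat (idx x \<kappa> a b div B x div B x) = \<kappa>" "idx x \<kappa> a b div B x mod B x = a" using assms by simp_all
  show "idx x \<kappa> a b mod B x = b" using assms by (simp add: idx_def)
qed

lemma boundedD:
  assumes "(\<phi>, ls) \<in> set F" "(s, \<kappa>, f, g) \<in> set ls" "c < B x" "d < B x" "e < B x" "\<phi> x c d e"
  shows "f x c d e < B x \<and> g x c d e < B x"
proof -
  have "\<forall>(s, \<kappa>, f, g)\<in>set ls. f x c d e < B x \<and> g x c d e < B x"
    using bounded[OF assms(1)] assms(3-) unfolding schema_bounded_def prod.case by blast
  from bspec[OF this assms(2)] show ?thesis by simp
qed

lemma lit_bounds: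
  assumes "h < length F" "c < B x" "d < B x" "e < B x" "fst (F ! h) x c d e" "l \<in> set (snd (F ! h))"
  shows "fst (snd (snd l)) x c d e < B x" "snd (snd (snd l)) x c d e < B x" "to_nat (fst (snd l)) < kinds"
proof -
  obtain \<phi> ls where F: "F ! h = (\<phi>, ls)" by (cases "F ! h")
  have S: "(\<phi>, ls) \<in> set F" using nth_mem[OF assms(1)] F by simp
  obtain s \<kappa> f g where l: "l = (s, \<kappa>, f, g)" by (metis prod.exhaust)
  have "(s, \<kappa>, f, g) \<in> set ls" using assms(6) F l by simp
  then show "fst (snd (snd l)) x c d e < B x" "snd (snd (snd l)) x c d e < B x" "to_nat (fst (snd l)) < kinds"
    using boundedD[OF S] kinds_F[OF S] assms(2-5) unfolding F l by simp_all
qed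

lemma son_range: "son x i j \<Longrightarrow> j < 2 * sN x - 1"
proof -
  assume "son x i j"
  then obtain h c d e where h: "h < length F" "c < B x" "d < B x" "e < B x" and
    j: "if fst (F ! h) x c d e then
        \<exists>l\<in>set (snd (F ! h)). j = 2 * idx x (fst (snd l)) (fst (snd (snd l)) x c d e) (snd (snd (snd l)) x c d e) + (if fst l then 0 else 1)
      else j < 2" unfolding son_def by auto
  have N: "sN x \<ge> 2" using B_pos[of x] by (simp add: sN_def kinds_def)
  show ?thesis
  proof (cases "fst (F ! h) x c d e")
    case True
    then obtain l where l: "l \<in> set (snd (F ! h))" and
      j: "j = 2 * idx x (fst (snd l)) (fst (snd (snd l)) x c d e) (snd (snd (snd l)) x c d e) + (if fst l then 0 else 1)"
      using j by auto
    have "idx x (fst (snd l)) (fst (snd (snd l)) x c d e) (snd (snd (snd l)) x c d e) < kinds * B x * B x"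
      using lit_bounds[OF h True l] by (intro idx_less)
    then show ?thesis using j by (simp add: sN_def split: if_splits)
  next
    case False
    then show ?thesis using j N by simp
  qed
qed

lemma grid: "grid (sN x) (son x)"
proof
  show "1 \<le> sN x" by (simp add: sN_def)
  show "\<not> son x i (2 * sN x - 1)" for i using son_range by blast
qed

lemma polytime: "polytime (\<lambda>x. encode (grid.ngraph (sm x) (sN x) (son x) (suniv x)))"
proof (rule polytime_ngraph[OF grid])
  have idx: "pexp (\<lambda>x v. idx x \<kappa> (a x v) (b x v))" if "pexp a" "pexp b" for \<kappa> a b
    unfolding idx_def by (intro pexp_intros B that)
  show "pexp (\<lambda>x v. sm x)" "pexp (\<lambda>x v. sN x)"
    unfolding sm_def sN_def by (intro pexp_intros B)+
  show "ppred (\<lambda>x v. suniv x (v 0))"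
    unfolding suniv_def by (intro pexp_intros B idx)
  have fst: "ppred (\<lambda>x v. fst (F ! h) x (v (Suc (Suc 0))) (v (Suc 0)) (v 0))" if "h \<in> set [0..<length F]" for h
    using expr[of "F ! h"] that by (simp add: schema_expr_def split_beta numeral_2_eq_2)
  have lit: "pexp (\<lambda>x v. fst (snd (snd l)) x (v (Suc (Suc 0))) (v (Suc 0)) (v 0)) \<and> pexp (\<lambda>x v. snd (snd (snd l)) x (v (Suc (Suc 0))) (v (Suc 0)) (v 0))"
    if "h \<in> set [0..<length F]" "l \<in> set (snd (F ! h))" for h l
    using expr[of "F ! h"] that by (auto simp: schema_expr_def split_beta numeral_2_eq_2)
  show "ppred (\<lambda>x v. son x (v 0) (v 1))"
    unfolding son_def
    by (intro ppred_list_ex ppred_bex ppred_conj ppred_if ppred_eq ppred_less pexp_add pexp_mult pexp_var pexp_const B fst idx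
        lit[THEN conjunct1] lit[THEN conjunct2] pexp_if ppred_const)
qed

lemma cnf_iff:
  "grid.cnf (sm x) (sN x) (son x) w \<longleftrightarrow> schema_sat B F x (\<lambda>\<kappa> a b. w (idx x \<kappa> a b))"
proof -
  have lit: "grid.lit w j \<longleftrightarrow> (if even j then w (j div 2) else \<not> w (j div 2))" for j
    by (rule grid.lit_def[OF grid])
  have ex: "(\<exists>j<2 * sN x. (if \<phi> then \<exists>l\<in>S. j = 2 * k l + (if s l then 0 else 1) else j < 2) \<and> grid.lit w j)
      \<longleftrightarrow> (\<phi> \<longrightarrow> (\<exists>l\<in>S. w (k l) = s l))"
    if "\<And>l. \<phi> \<Longrightarrow> l \<in> S \<Longrightarrow> 2 * k l + 1 < 2 * sN x" for \<phi> and S :: "'k literal set" and k s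
  proof (cases \<phi>)
    case True
    have "(\<exists>l\<in>S. w (k l) = s l) \<longleftrightarrow> (\<exists>l\<in>S. 2 * k l + (if s l then 0 else 1) < 2 * sN x \<and> grid.lit w (2 * k l + (if s l then 0 else 1)))"
    proof (intro bex_cong refl)
      fix l assume "l \<in> S"
      from that[OF True this] show "w (k l) = s l \<longleftrightarrow>
          2 * k l + (if s l then 0 else 1) < 2 * sN x \<and> grid.lit w (2 * k l + (if s l then 0 else 1))"
        unfolding lit by (cases "s l") simp_all
    qed
    also have "\<dots> \<longleftrightarrow> (\<exists>j<2 * sN x. (\<exists>l\<in>S. j = 2 * k l + (if s l then 0 else 1)) \<and> grid.lit w j)" by blast
    finally show ?thesis using True by simp
  next
    case False
    have "sN x \<ge> 2" using B_pos[of x] by (simp add: sN_def kinds_def)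
    then have "(0 < 2 * sN x \<and> grid.lit w 0) \<or> (1 < 2 * sN x \<and> grid.lit w 1)" unfolding lit by simp
    then have "\<exists>j<2 * sN x. j < 2 \<and> grid.lit w j"
    proof
      assume "0 < 2 * sN x \<and> grid.lit w 0"
      then show ?thesis by (intro exI[of _ 0]) simp
    next
      assume "1 < 2 * sN x \<and> grid.lit w 1"
      then show ?thesis by (intro exI[of _ 1]) simp
    qed
    then show ?thesis using False by simp
  qed
  have "grid.cnf (sm x) (sN x) (son x) w \<longleftrightarrow> (\<forall>i<sm x. \<exists>j<2 * sN x. son x i j \<and> grid.lit w j)"
    by (rule grid.cnf_def[OF grid])
  also have "\<dots> \<longleftrightarrow> (\<forall>h<length F. \<forall>c<B x. \<forall>d<B x. \<forall>e<B x. \<exists>j<2 * sN x. son x (((h * B x + c) * B x + d) * B x + e) j \<and> grid.lit w j)" (is "?L \<longleftrightarrow> ?R")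
  proof
    assume ?L
    show ?R
    proof (intro allI impI)
      fix h c d e assume "h < length F" "c < B x" "d < B x" "e < B x"
      then have "((h * B x + c) * B x + d) * B x + e < sm x" unfolding sm_def by (intro digits_less)
      then show "\<exists>j<2 * sN x. son x (((h * B x + c) * B x + d) * B x + e) j \<and> grid.lit w j"
        by (rule \<open>?L\<close>[rule_format])
    qed
  next
    assume R: ?R
    show ?L
    proof (intro allI impI)
      fix i assume i: "i < sm x"
      have b: "B x > 0" using B_pos[of x] by simp
      let ?h = "i div B x div B x div B x" and ?c = "i div B x div B x mod B x" and ?d = "i div B x mod B x" and ?e = "i mod B x"
      have "i = ((?h * B x + ?c) * B x + ?d) * B x + ?e" by (simp only: div_mult_mod_eq)
      moreover have "?h < length F" using i unfolding sm_def by (intro less_mult_imp_div_less)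
      moreover have "?c < B x" "?d < B x" "?e < B x" using b by simp_all
      ultimately show "\<exists>j<2 * sN x. son x i j \<and> grid.lit w j" using R[rule_format, of ?h ?c ?d ?e] by simp
    qed
  qed
  also have "\<dots> \<longleftrightarrow> (\<forall>h<length F. \<forall>c<B x. \<forall>d<B x. \<forall>e<B x. fst (F ! h) x c d e \<longrightarrow>
      (\<exists>l\<in>set (snd (F ! h)). w (idx x (fst (snd l)) (fst (snd (snd l)) x c d e) (snd (snd (snd l)) x c d e)) = fst l))"
  proof (intro all_cong)
    fix h c d e assume h: "h < length F" "c < B x" "d < B x" "e < B x"
    have son: "son x (((h * B x + c) * B x + d) * B x + e) j \<longleftrightarrow> (if fst (F ! h) x c d e then
        \<exists>l\<in>set (snd (F ! h)). j = 2 * idx x (fst (snd l)) (fst (snd (snd l)) x c d e) (snd (snd (snd l)) x c d e) + (if fst l then 0 else 1)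
      else j < 2)" for j
    proof -
      have uniq: "((h * B x + c) * B x + d) * B x + e = ((h' * B x + c') * B x + d') * B x + e' \<longleftrightarrow> h = h' \<and> c = c' \<and> d = d' \<and> e = e'"
        if "c' < B x" "d' < B x" "e' < B x" for h' c' d' e'
        using h that by (simp add: digits_unique)
      have "(\<exists>h'\<in>set [0..<length F]. \<exists>c'<B x. \<exists>d'<B x. \<exists>e'<B x.
          ((h * B x + c) * B x + d) * B x + e = ((h' * B x + c') * B x + d') * B x + e' \<and> X h' c' d' e') \<longleftrightarrow> X h c d e" (is "?A \<longleftrightarrow> _") for X
      proof
        assume ?A
        then obtain h' c' d' e' where "c' < B x" "d' < B x" "e' < B x" "X h' c' d' e'"
            "((h * B x + c) * B x + d) * B x + e = ((h' * B x + c') * B x + d') * B x + e'"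
          by (elim bexE exE conjE) rule
        then show "X h c d e" using uniq by simp
      next
        assume "X h c d e"
        moreover have "h \<in> set [0..<length F]" using h by simp
        ultimately show ?A using h(2-4)
          by (intro bexI[of _ h] exI[of _ c] conjI exI[of _ d] exI[of _ e]) simp_all
      qed
      then show ?thesis unfolding son_def .
    qed
    show "(\<exists>j<2 * sN x. son x (((h * B x + c) * B x + d) * B x + e) j \<and> grid.lit w j) \<longleftrightarrow>
      (fst (F ! h) x c d e \<longrightarrow>
      (\<exists>l\<in>set (snd (F ! h)). w (idx x (fst (snd l)) (fst (snd (snd l)) x c d e) (snd (snd (snd l)) x c d e)) = fst l))"
      unfolding son
    proof (rule ex)
      fix l assume "fst (F ! h) x c d e" "l \<in> set (snd (F ! h))"
      then have "idx x (fst (snd l)) (fst (snd (snd l)) x c d e) (snd (snd (snd l)) x c d e) < kinds * B x * B x"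
        using lit_bounds[OF h] by (intro idx_less)
      then show "2 * idx x (fst (snd l)) (fst (snd (snd l)) x c d e) (snd (snd (snd l)) x c d e) + 1 < 2 * sN x"
        by (simp add: sN_def)
    qed
  qed
  also have "\<dots> \<longleftrightarrow> schema_sat B F x (\<lambda>\<kappa> a b. w (idx x \<kappa> a b))"
    unfolding schema_sat_def split_beta all_set_conv_all_nth ..
  finally show ?thesis .
qed

definition valid :: "bool list \<Rightarrow> bool" where
  "valid x \<longleftrightarrow> (\<forall>\<alpha>. \<exists>tr. (\<forall>\<kappa>\<in>set Us. \<forall>a<B x. \<forall>b<B x. tr \<kappa> a b = \<alpha> \<kappa> a b) \<and> schema_sat B F x tr)"

lemma schema_sat_cong:
  assumes "\<And>\<kappa> a b. a < B x \<Longrightarrow> b < B x \<Longrightarrow> tr \<kappa> a b = tr' \<kappa> a b" "schema_sat B F x tr"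
  shows "schema_sat B F x tr'"
  unfolding schema_sat_def
proof (intro ballI, clarify)
  fix \<phi> ls c d e assume S: "(\<phi>, ls) \<in> set F" and c: "c < B x" "d < B x" "e < B x" "\<phi> x c d e"
  have "\<exists>(s, \<kappa>, f, g)\<in>set ls. tr \<kappa> (f x c d e) (g x c d e) = s"
    using bspec[OF assms(2)[unfolded schema_sat_def] S] c by simp
  then obtain l where l: "l \<in> set ls" "case l of (s, \<kappa>, f, g) \<Rightarrow> tr \<kappa> (f x c d e) (g x c d e) = s" by (rule bexE)
  obtain s \<kappa> f g where l': "l = (s, \<kappa>, f, g)" by (cases l)
  have "f x c d e < B x \<and> g x c d e < B x" using boundedD[OF S _ c] l(1) unfolding l' by blast
  then show "\<exists>(s, \<kappa>, f, g)\<in>set ls. tr' \<kappa> (f x c d e) (g x c d e) = s"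
    using l assms(1) unfolding l' by (intro bexI[of _ "(s, \<kappa>, f, g)"]) simp_all
qed

lemma valid_iff:
  "valid x \<longleftrightarrow> (\<forall>a. \<exists>w. (\<forall>j<sN x. suniv x j \<longrightarrow> w j = a j) \<and> grid.cnf (sm x) (sN x) (son x) w)"
proof
  assume v: "valid x"
  show "\<forall>a. \<exists>w. (\<forall>j<sN x. suniv x j \<longrightarrow> w j = a j) \<and> grid.cnf (sm x) (sN x) (son x) w"
  proof
    fix a :: "nat \<Rightarrow> bool"
    obtain tr where tr: "\<forall>\<kappa>\<in>set Us. \<forall>c<B x. \<forall>d<B x. tr \<kappa> c d = a (idx x \<kappa> c d)" "schema_sat B F x tr"
      using v[unfolded valid_def, rule_format, of "\<lambda>\<kappa> c d. a (idx x \<kappa> c d)"] by blast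
    define w where "w j = tr (from_nat (j div B x div B x)) (j div B x mod B x) (j mod B x)" for j
    have w: "w (idx x \<kappa> c d) = tr \<kappa> c d" if "c < B x" "d < B x" for \<kappa> c d
      unfolding w_def idx_decode[OF that] ..
    have "w j = a j" if "suniv x j" for j using that w tr(1) unfolding suniv_def by auto
    moreover have "grid.cnf (sm x) (sN x) (son x) w"
      unfolding cnf_iff by (rule schema_sat_cong[OF _ tr(2)]) (simp add: w)
    ultimately show "\<exists>w. (\<forall>j<sN x. suniv x j \<longrightarrow> w j = a j) \<and> grid.cnf (sm x) (sN x) (son x) w" by blast
  qed
next
  assume R: "\<forall>a. \<exists>w. (\<forall>j<sN x. suniv x j \<longrightarrow> w j = a j) \<and> grid.cnf (sm x) (sN x) (son x) w"
  show "valid x" unfolding valid_def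
  proof
    fix \<alpha> :: "'k \<Rightarrow> nat \<Rightarrow> nat \<Rightarrow> bool"
    define a where "a j = \<alpha> (from_nat (j div B x div B x)) (j div B x mod B x) (j mod B x)" for j
    obtain w where w: "\<forall>j<sN x. suniv x j \<longrightarrow> w j = a j" "grid.cnf (sm x) (sN x) (son x) w" using R by blast
    have "w (idx x \<kappa> c d) = \<alpha> \<kappa> c d" if "\<kappa> \<in> set Us" "c < B x" "d < B x" for \<kappa> c d
    proof -
      have "suniv x (idx x \<kappa> c d)" using that unfolding suniv_def by blast
      moreover have "idx x \<kappa> c d < sN x" using idx_less[OF kinds_Us[OF that(1)] that(2,3)] by (simp add: sN_def)
      ultimately have "w (idx x \<kappa> c d) = a (idx x \<kappa> c d)" using w(1) by blast
      then show ?thesis unfolding a_def idx_decode[OF that(2,3)] .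
    qed
    then show "\<exists>tr. (\<forall>\<kappa>\<in>set Us. \<forall>a<B x. \<forall>b<B x. tr \<kappa> a b = \<alpha> \<kappa> a b) \<and> schema_sat B F x tr"
      using w(2) unfolding cnf_iff by (intro exI[of _ "\<lambda>\<kappa> a b. w (idx x \<kappa> a b)"]) simp
  qed
qed

theorem reduction:
  "\<exists>f. polytime f \<and> (\<forall>x. f x \<in> graph_lang (\<lambda>G. colorable 3 G \<and> odd_hole_free G \<and> planar G \<and> max_degree G = 6)
     \<and> (valid x \<longleftrightarrow> f x \<in> CH 3 4))"
proof (intro exI conjI allI)
  show "polytime (\<lambda>x. encode (grid.ngraph (sm x) (sN x) (son x) (suniv x)))" by (rule polytime)
  fix x
  let ?G = "grid.ngraph (sm x) (sN x) (son x) (suniv x)"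
  have G: "?G \<in> input_graphs" by (rule grid.ngraph_input[OF grid])
  show "encode ?G \<in> graph_lang (\<lambda>G. colorable 3 G \<and> odd_hole_free G \<and> planar G \<and> max_degree G = 6)"
    unfolding graph_lang_def using G grid.ngraph_class[OF grid] by blast
  have "encode ?G \<in> CH 3 4 \<longleftrightarrow> choosable 3 4 ?G"
    unfolding CH_def graph_lang_def using G inj_onD[OF encode_inj] by blast
  then show "valid x \<longleftrightarrow> encode ?G \<in> CH 3 4"
    unfolding valid_iff grid.choosable_ngraph[OF grid] by simp
qed

end

section \<open>Cook's encoding for a verifier with two witnesses\<close>

section \<open>Runs of Turing machines as clauses\<close>

lemma pexp_Suc [pexp_intros]: "pexp a \<Longrightarrow> pexp (\<lambda>x v. Suc (a x v))"
  unfolding Suc_eq_plus1 by (intro pexp_intros)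

text \<open>With a time and a position as arguments, \<open>KS\<close>, \<open>KH\<close>,
  \<open>KQ\<close> and \<open>KR\<close> stand for a tape symbol, a head, the state and the symbol
  read by a head. \<open>KA\<close> and \<open>KB\<close> are the presence and the value of a bit of
  a witness, the outer one for \<open>True\<close>.\<close>

datatype kind = KS nat nat | KH nat | KQ nat | KR nat nat | KA bool | KB bool | KL bool | KC bool

instance kind :: countable
  by countable_datatype

locale cook =
  fixes M :: tm and p q :: "nat poly" and R :: "bool list set"
  assumes wf: "wf_tm M" and comp: "computes_within M y [y \<in> R] (poly q (length y))"
begin

abbreviation nt where "nt \<equiv> num_tapes M"

text \<open>The halting state gets an idle step, so that all runs can be described up to the same
  time.\<close>

definition step :: "nat \<Rightarrow> nat list \<Rightarrow> nat \<times> (nat \<times> dir) list" where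
  "step s rs = (if s < num_states M then delta M s rs else (s, map (\<lambda>r. (r, Stay)) rs))"

lemma step_wf:
  assumes "s \<le> num_states M" "length rs = nt" "\<forall>r\<in>set rs. r < num_syms M"
  shows "fst (step s rs) \<le> num_states M" "length (snd (step s rs)) = nt" "\<forall>a\<in>set (snd (step s rs)). fst a < num_syms M"
proof -
  have *: "case step s rs of (q', acts) \<Rightarrow> q' \<le> num_states M \<and> length acts = nt \<and> (\<forall>(w, d)\<in>set acts. w < num_syms M)"
  proof (cases "s < num_states M")
    case True
    then show ?thesis using wf assms unfolding wf_tm_def step_def by simp
  next
    case False
    then show ?thesis using assms unfolding step_def by auto
  qed
  then show "fst (step s rs) \<le> num_states M" "length (snd (step s rs)) = nt" "\<forall>a\<in>set (snd (step s rs)). fst a < num_syms M"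
    by (auto split: prod.splits)
qed

lemma nt_pos: "nt \<ge> 1" and num_syms_ge: "num_syms M \<ge> 3"
  using wf by (simp_all add: wf_tm_def)

definition conf :: "bool list \<Rightarrow> nat \<Rightarrow> config" where "conf y t = (tm_step M ^^ t) (init_config M y)"
definition st :: "bool list \<Rightarrow> nat \<Rightarrow> nat" where "st y t = fst (conf y t)"
definition hd :: "bool list \<Rightarrow> nat \<Rightarrow> nat \<Rightarrow> int" where "hd y t \<tau> = fst (snd (conf y t) ! \<tau>)"
definition tp :: "bool list \<Rightarrow> nat \<Rightarrow> nat \<Rightarrow> tape" where "tp y t \<tau> = snd (snd (conf y t) ! \<tau>)"
definition reads :: "bool list \<Rightarrow> nat \<Rightarrow> nat list" where "reads y t = map (\<lambda>\<tau>. tp y t \<tau> (hd y t \<tau>)) [0..<nt]"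

lemma tm_step_eq:
  assumes "length ts = nt"
  shows "tm_step M (s, ts) = (case step s (map (\<lambda>(h, t). t h) ts) of (q', acts) \<Rightarrow>
          (q', map2 (\<lambda>(w, d) (h, t). (move d h, t(h := w))) acts ts))"
proof (cases "s < num_states M")
  case False
  have "map2 (\<lambda>(w, d) (h, t). (move d h, t(h := w))) (map (\<lambda>r. (r, Stay)) (map (\<lambda>(h, t). t h) ts)) ts = ts"
    by (rule nth_equalityI) (auto simp: split_beta)
  then show ?thesis using False by (simp add: tm_step_def step_def)
qed (simp add: tm_step_def step_def)

lemma conf_run:
  "length (snd (conf y t)) = nt \<and> st y t \<le> num_states M \<and> (\<forall>\<tau><nt. \<forall>i. tp y t \<tau> i < num_syms M)"
proof (induction t)
  case 0
  have "tape_of z i < num_syms M" for z i using num_syms_ge by (simp add: tape_of_def)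
  then have "tp y 0 \<tau> i < num_syms M" if "\<tau> < nt" for \<tau> i
    using that by (cases \<tau>) (simp_all add: tp_def conf_def init_config_def)
  then show ?case using nt_pos by (simp add: conf_def st_def init_config_def)
next
  case (Suc t)
  define ts where "ts = snd (conf y t)"
  have c: "conf y t = (st y t, ts)" by (simp add: st_def ts_def)
  have len: "length ts = nt" using Suc by (simp add: ts_def)
  have rd: "map (\<lambda>(h, t). t h) ts = reads y t"
    by (rule nth_equalityI) (simp_all add: reads_def len tp_def hd_def ts_def[symmetric] split_beta)
  obtain q' acts where a: "step (st y t) (reads y t) = (q', acts)" by (cases "step (st y t) (reads y t)")
  have rs: "length (reads y t) = nt" "\<forall>r\<in>set (reads y t). r < num_syms M" using Suc by (auto simp: reads_def)
  have sw: "q' \<le> num_states M" "length acts = nt" "\<forall>a\<in>set acts. fst a < num_syms M"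
    using step_wf[of "st y t" "reads y t"] Suc rs unfolding a by simp_all
  have conf: "conf y (Suc t) = (q', map2 (\<lambda>(w, d) (h, t). (move d h, t(h := w))) acts ts)"
    using tm_step_eq[OF len, of "st y t"] unfolding rd a by (simp add: conf_def) (simp add: conf_def[symmetric] c)
  have "tp y (Suc t) \<tau> i < num_syms M" if "\<tau> < nt" for \<tau> i
  proof -
    have "fst (acts ! \<tau>) < num_syms M" using sw that by simp
    moreover have "snd (ts ! \<tau>) i < num_syms M" using Suc that by (simp add: tp_def ts_def)
    ultimately show ?thesis using that sw(2) len by (simp add: tp_def conf split_beta)
  qed
  then show ?case using sw len by (simp add: conf st_def)
qed

lemma reads_wf: "length (reads y t) = nt" "\<forall>r\<in>set (reads y t). r < num_syms M"
  using conf_run by (auto simp: reads_def)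

lemma run_step:
  shows "st y (Suc t) = fst (step (st y t) (reads y t))"
    and "\<tau> < nt \<Longrightarrow> hd y (Suc t) \<tau> = move (snd (snd (step (st y t) (reads y t)) ! \<tau>)) (hd y t \<tau>)"
    and "\<tau> < nt \<Longrightarrow> tp y (Suc t) \<tau> = (tp y t \<tau>)(hd y t \<tau> := fst (snd (step (st y t) (reads y t)) ! \<tau>))"
proof -
  define ts where "ts = snd (conf y t)"
  have c: "conf y t = (st y t, ts)" by (simp add: st_def ts_def)
  have len: "length ts = nt" using conf_run by (simp add: ts_def)
  have rd: "map (\<lambda>(h, t). t h) ts = reads y t"
    by (rule nth_equalityI) (simp_all add: reads_def len tp_def hd_def ts_def[symmetric] split_beta)
  obtain q' acts where a: "step (st y t) (reads y t) = (q', acts)" by (cases "step (st y t) (reads y t)")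
  have l: "length acts = nt" using step_wf(2)[of "st y t" "reads y t"] reads_wf conf_run unfolding a by simp
  have conf: "conf y (Suc t) = (q', map2 (\<lambda>(w, d) (h, t). (move d h, t(h := w))) acts ts)"
    using tm_step_eq[OF len, of "st y t"] unfolding rd a by (simp add: conf_def) (simp add: conf_def[symmetric] c)
  show "st y (Suc t) = fst (step (st y t) (reads y t))" by (simp add: st_def[of y "Suc t"] conf a)
  show "hd y (Suc t) \<tau> = move (snd (snd (step (st y t) (reads y t)) ! \<tau>)) (hd y t \<tau>)" if "\<tau> < nt"
    using that len l by (simp add: hd_def conf a split_beta ts_def[symmetric])
  show "tp y (Suc t) \<tau> = (tp y t \<tau>)(hd y t \<tau> := fst (snd (step (st y t) (reads y t)) ! \<tau>))" if "\<tau> < nt"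
    using that len l by (simp add: hd_def tp_def conf a split_beta ts_def[symmetric])
qed

lemma run_init: "st y 0 = 0" "\<tau> < nt \<Longrightarrow> hd y 0 \<tau> = 0" "tp y 0 0 = tape_of y" "\<tau> < nt \<Longrightarrow> \<tau> \<noteq> 0 \<Longrightarrow> tp y 0 \<tau> = (\<lambda>_. 0)"
proof -
  show "hd y 0 \<tau> = 0" if "\<tau> < nt" using that by (cases \<tau>) (simp_all add: hd_def conf_def init_config_def)
  show "tp y 0 \<tau> = (\<lambda>_. 0)" if "\<tau> < nt" "\<tau> \<noteq> 0"
    using that by (cases \<tau>) (simp_all add: tp_def conf_def init_config_def tape_of_def fun_eq_iff)
qed (simp_all add: st_def tp_def conf_def init_config_def)

lemma head_bound: "\<tau> < nt \<Longrightarrow> \<bar>hd y t \<tau>\<bar> \<le> int t"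
proof (induction t)
  case (Suc t)
  have "\<bar>move d h\<bar> \<le> \<bar>h\<bar> + 1" for d h by (cases d) auto
  from this[of "snd (snd (step (st y t) (reads y t)) ! \<tau>)" "hd y t \<tau>"]
  show ?case unfolding run_step(2)[OF Suc.prems] using Suc.IH[OF Suc.prems] by simp
qed (simp add: run_init)

lemma run_final:
  assumes "poly q (length y) \<le> t"
  shows "tp y t (nt - 1) 0 = (if y \<in> R then 2 else 1)"
proof -
  let ?t = "poly q (length y)"
  have halt: "st y ?t = num_states M" and last: "snd (last (snd (conf y ?t))) = tape_of [y \<in> R]"
    using comp[of y] by (auto simp: computes_within_def st_def conf_def split: prod.splits)
  have stay: "conf y (?t + d) = conf y ?t" for d
  proof (induction d)
    case (Suc d)
    have "conf y (?t + Suc d) = tm_step M (conf y (?t + d))" by (simp add: conf_def)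
    also have "\<dots> = conf y ?t" unfolding Suc using halt by (cases "conf y ?t") (simp add: st_def tm_step_def)
    finally show ?case .
  qed simp
  have "conf y t = conf y ?t" using stay[of "t - ?t"] assms by simp
  moreover have "snd (conf y ?t) \<noteq> []" using conf_run[of y ?t] nt_pos by auto
  ultimately have "tp y t (nt - 1) = tape_of [y \<in> R]" using last conf_run[of y ?t] by (simp add: tp_def last_conv_nth)
  then show ?thesis by (simp add: tape_of_def)
qed


definition P :: "bool list \<Rightarrow> nat" where "P x = poly p (length x)"
text \<open>The argument of \<open>q\<close> bounds the length
  \<open>2 * length x + 2 + (2 * length u + 2 + length v)\<close> of the doubly paired
  input.\<close>

definition T :: "bool list \<Rightarrow> nat" where "T x = poly q (2 * length x + 4 + 3 * P x)"
definition B :: "bool list \<Rightarrow> nat" where "B x = 2 * T x + P x + 2"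

text \<open>Positions on the tapes are shifted by \<open>T x\<close>. The input on the first tape is determined by \<open>x\<close>,
  the lengths \<open>c\<close> and \<open>d\<close> of the two witnesses and their bits.\<close>

definition fixed :: "nat \<Rightarrow> bool list \<Rightarrow> nat \<Rightarrow> nat \<Rightarrow> nat \<Rightarrow> bool" where
  "fixed \<sigma> x c d e \<longleftrightarrow> (let n = length x; t = T x in
     if \<sigma> = 0 then e < t \<or> t + 2 * n + 4 + 2 * c + d \<le> e
     else if \<sigma> = 1 then t \<le> e \<and> e < t + 2 * n \<and> \<not> bit_at x ((e - t) div 2) \<or> e = t + 2 * n \<or> e = t + 2 * n + 2 + 2 * c
     else t \<le> e \<and> e < t + 2 * n \<and> bit_at x ((e - t) div 2) \<or> e = t + 2 * n + 1 \<or> e = t + 2 * n + 3 + 2 * c)"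

definition bsym :: "bool \<Rightarrow> nat" where "bsym b = (if b then 2 else 1)"

abbreviation (input) zero :: param_nat where "zero \<equiv> \<lambda>x c d e. 0"
abbreviation (input) par1 :: param_nat where "par1 \<equiv> \<lambda>x c d e. c"
abbreviation (input) par2 :: param_nat where "par2 \<equiv> \<lambda>x c d e. d"
abbreviation (input) par3 :: param_nat where "par3 \<equiv> \<lambda>x c d e. e"
abbreviation (input) next1 :: param_nat where "next1 \<equiv> \<lambda>x c d e. c + 1"

definition init_state :: "kind schema" where
  "init_state = (\<lambda>x c d e. c = 0 \<and> d = 0 \<and> e = 0, [(True, KQ 0, zero, zero)])"

definition init_head :: "nat \<Rightarrow> kind schema" where
  "init_head \<tau> = (\<lambda>x c d e. c = 0 \<and> d = 0 \<and> e = 0, [(True, KH \<tau>, zero, \<lambda>x c d e. T x)])"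

definition init_blank :: "nat \<Rightarrow> kind schema" where
  "init_blank \<tau> = (\<lambda>x c d e. c \<le> 2 * T x \<and> d = 0 \<and> e = 0, [(True, KS \<tau> 0, zero, par1)])"

definition init_fixed :: "nat \<Rightarrow> kind schema" where
  "init_fixed \<sigma> = (\<lambda>x c d e. c \<le> P x \<and> d \<le> P x \<and> e \<le> 2 * T x \<and> fixed \<sigma> x c d e,
      [(False, KL True, par1, zero), (False, KL False, par2, zero), (True, KS 0 \<sigma>, zero, par3)])"

text \<open>As the first component of the inner \<open>pair\<close>, the outer witness has each of
  its bits written twice.\<close>

definition init_outer :: "bool \<Rightarrow> kind schema" where
  "init_outer b = (\<lambda>x c d e. c \<le> P x \<and> d < c \<and> e \<le> 2 * T x \<and>
        (e = T x + 2 * length x + 2 + 2 * d \<or> e = T x + 2 * length x + 3 + 2 * d),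
      [(False, KL True, par1, zero), (\<not> b, KB True, par2, zero), (True, KS 0 (bsym b), zero, par3)])"

definition init_inner :: "bool \<Rightarrow> kind schema" where
  "init_inner b = (\<lambda>x c d e. c \<le> P x \<and> d \<le> P x \<and> e < d \<and> T x + 2 * length x + 4 + 2 * c + e \<le> 2 * T x,
      [(False, KL True, par1, zero), (False, KL False, par2, zero), (\<not> b, KB False, par3, zero),
       (True, KS 0 (bsym b), zero, \<lambda>x c d e. T x + 2 * length x + 4 + 2 * c + e)])"

text \<open>\<open>KC z c\<close> says that \<open>KA z\<close> holds below \<open>c\<close>, and \<open>KL z c\<close> that the witness \<open>z\<close> has length \<open>c\<close>.\<close>

definition length_start :: "bool \<Rightarrow> kind schema" where
  "length_start z = (\<lambda>x c d e. c = 0 \<and> d = 0 \<and> e = 0, [(True, KC z, zero, zero)])"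

definition length_next :: "bool \<Rightarrow> kind schema" where
  "length_next z = (\<lambda>x c d e. c < P x \<and> d = 0 \<and> e = 0,
      [(False, KC z, par1, zero), (False, KA z, par1, zero), (True, KC z, next1, zero)])"

definition length_stop :: "bool \<Rightarrow> kind schema" where
  "length_stop z = (\<lambda>x c d e. c < P x \<and> d = 0 \<and> e = 0,
      [(False, KC z, par1, zero), (True, KA z, par1, zero), (True, KL z, par1, zero)])"

definition length_max :: "bool \<Rightarrow> kind schema" where
  "length_max z = (\<lambda>x c d e. c = P x \<and> d = 0 \<and> e = 0, [(False, KC z, par1, zero), (True, KL z, par1, zero)])"

definition read_sym :: "nat \<Rightarrow> nat \<Rightarrow> kind schema" where
  "read_sym \<tau> \<sigma> = (\<lambda>x c d e. c < T x \<and> d \<le> 2 * T x \<and> e = 0,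
      [(False, KH \<tau>, par1, par2), (False, KS \<tau> \<sigma>, par1, par2), (True, KR \<tau> \<sigma>, par1, zero)])"

definition keep_sym :: "nat \<Rightarrow> nat \<Rightarrow> kind schema" where
  "keep_sym \<tau> \<sigma> = (\<lambda>x c d e. c < T x \<and> d \<le> 2 * T x \<and> e \<le> 2 * T x \<and> d \<noteq> e,
      [(False, KH \<tau>, par1, par2), (False, KS \<tau> \<sigma>, par1, par3), (True, KS \<tau> \<sigma>, next1, par3)])"

definition read_lits :: "nat \<Rightarrow> nat list \<Rightarrow> kind literal list" where
  "read_lits s rs = (False, KQ s, par1, zero) # map (\<lambda>\<tau>. (False, KR \<tau> (rs ! \<tau>), par1, zero)) [0..<nt]"

fun shifted :: "dir \<Rightarrow> nat \<Rightarrow> nat" where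
  "shifted MoveL h = h - 1"
| "shifted Stay h = h"
| "shifted MoveR h = h + 1"

definition new_state :: "nat \<Rightarrow> nat list \<Rightarrow> kind schema" where
  "new_state s rs = (\<lambda>x c d e. c < T x \<and> d = 0 \<and> e = 0, read_lits s rs @ [(True, KQ (fst (step s rs)), next1, zero)])"

definition write_sym :: "nat \<Rightarrow> nat list \<Rightarrow> nat \<Rightarrow> kind schema" where
  "write_sym s rs \<tau> = (\<lambda>x c d e. c < T x \<and> d \<le> 2 * T x \<and> e = 0,
      read_lits s rs @ [(False, KH \<tau>, par1, par2), (True, KS \<tau> (fst (snd (step s rs) ! \<tau>)), next1, par2)])"

definition move_head :: "nat \<Rightarrow> nat list \<Rightarrow> nat \<Rightarrow> kind schema" where
  "move_head s rs \<tau> = (\<lambda>x c d e. c < T x \<and> d \<le> 2 * T x \<and> e = 0,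
      read_lits s rs @ [(False, KH \<tau>, par1, par2), (True, KH \<tau>, next1, \<lambda>x c d e. shifted (snd (snd (step s rs) ! \<tau>)) d)])"

text \<open>Cell 0 of the last tape is position \<open>T x\<close> after the shift, and symbol 1
  there is the answer \<open>False\<close>.\<close>

definition reject :: "kind schema" where
  "reject = (\<lambda>x c d e. c = T x \<and> d = 0 \<and> e = 0, [(False, KS (nt - 1) 1, par1, par1)])"

definition init_schemas :: "kind schema list" where
  "init_schemas = [init_state] @ map init_head [0..<nt] @ map init_blank [1..<nt] @ map init_fixed [0..<3] @
    map init_outer [False, True] @ map init_inner [False, True]"

definition length_schemas :: "kind schema list" where
  "length_schemas = concat (map (\<lambda>z. [length_start z, length_next z, length_stop z, length_max z]) [False, True])"

definition step_schemas :: "nat \<Rightarrow> nat list \<Rightarrow> kind schema list" where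
  "step_schemas s rs = new_state s rs # map (write_sym s rs) [0..<nt] @ map (move_head s rs) [0..<nt]"

definition tape_schemas :: "kind schema list" where
  "tape_schemas = concat (map (\<lambda>\<tau>. map (read_sym \<tau>) [0..<num_syms M] @ map (keep_sym \<tau>) [0..<num_syms M]) [0..<nt])"

definition all_schemas :: "kind schema list" where
  "all_schemas = init_schemas @ length_schemas @ tape_schemas @
    concat (map (\<lambda>s. concat (map (step_schemas s) (List.n_lists nt [0..<num_syms M]))) [0..<Suc (num_states M)]) @ [reject]"

lemmas schema_defs = init_state_def init_head_def init_blank_def init_fixed_def init_outer_def init_inner_def
  length_start_def length_next_def length_stop_def length_max_def read_sym_def keep_sym_def read_lits_def
  new_state_def write_sym_def move_head_def reject_def

lemma pexp_PT [pexp_intros]: "pexp (\<lambda>x v. P x)" "pexp (\<lambda>x v. T x)" "pexp (\<lambda>x v. B x)"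
  unfolding P_def T_def B_def by (intro pexp_intros)+

lemma expr_shifted: "pexp a \<Longrightarrow> pexp (\<lambda>x v. shifted m (a x v))"
  by (cases m) (simp_all, (intro pexp_intros; assumption)+)

lemma expr_fixed: "ppred (\<lambda>x v. fixed \<sigma> x (v 2) (v (Suc 0)) (v 0))"
  unfolding fixed_def Let_def by (intro ppred_if_const pexp_intros)

lemma expr_Cons: "schema_expr (\<phi>, ls) \<longleftrightarrow> ppred (\<lambda>x v. \<phi> x (v 2) (v 1) (v 0)) \<and>
     (\<forall>l\<in>set ls. pexp (\<lambda>x v. fst (snd (snd l)) x (v 2) (v 1) (v 0)) \<and> pexp (\<lambda>x v. snd (snd (snd l)) x (v 2) (v 1) (v 0)))"
  by (auto simp: schema_expr_def)

lemma bounded_Cons: "schema_bounded b (\<phi>, ls) \<longleftrightarrow> (\<forall>x c d e. c < b x \<longrightarrow> d < b x \<longrightarrow> e < b x \<longrightarrow> \<phi> x c d e \<longrightarrow>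
     (\<forall>l\<in>set ls. fst (snd (snd l)) x c d e < b x \<and> snd (snd (snd l)) x c d e < b x))"
  by (simp add: schema_bounded_def split_beta)

lemma all_schemas_cases:
  assumes "S \<in> set all_schemas"
  obtains "S \<in> set init_schemas" | "S \<in> set length_schemas" | "S \<in> set tape_schemas"
    | s rs where "S \<in> set (step_schemas s rs)" | "S = reject"
  using assms unfolding all_schemas_def by auto

lemma expr_all: "S \<in> set all_schemas \<Longrightarrow> schema_expr S"
proof (erule all_schemas_cases)
  show "S \<in> set init_schemas \<Longrightarrow> schema_expr S"
    by (auto simp: init_schemas_def schema_defs expr_Cons simp del: upt_rec_numeral intro!: pexp_intros expr_fixed)
  show "S \<in> set length_schemas \<Longrightarrow> schema_expr S"
    by (auto simp: length_schemas_def schema_defs expr_Cons intro!: pexp_intros)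
  show "S \<in> set tape_schemas \<Longrightarrow> schema_expr S"
    by (auto simp: tape_schemas_def schema_defs expr_Cons intro!: pexp_intros)
  show "S \<in> set (step_schemas s rs) \<Longrightarrow> schema_expr S" for s rs
    by (auto simp: step_schemas_def schema_defs expr_Cons intro!: pexp_intros expr_shifted)
  show "S = reject \<Longrightarrow> schema_expr S"
    by (auto simp: schema_defs expr_Cons intro!: pexp_intros)
qed

lemma shifted_le: "shifted m d \<le> d + 1"
  by (cases m) auto

lemma shifted_less: "d \<le> 2 * T x \<Longrightarrow> shifted m d < B x"
  using shifted_le[of m d] by (simp add: B_def)

lemma bounded_all: "S \<in> set all_schemas \<Longrightarrow> schema_bounded B S"
proof (erule all_schemas_cases)
  show "S \<in> set init_schemas \<Longrightarrow> schema_bounded B S"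
    by (auto simp: init_schemas_def schema_defs bounded_Cons B_def simp del: upt_rec_numeral)
  show "S \<in> set length_schemas \<Longrightarrow> schema_bounded B S"
    by (auto simp: length_schemas_def schema_defs bounded_Cons B_def)
  show "S \<in> set tape_schemas \<Longrightarrow> schema_bounded B S"
    by (auto simp: tape_schemas_def schema_defs bounded_Cons B_def)
  show "S \<in> set (step_schemas s rs) \<Longrightarrow> schema_bounded B S" for s rs
    by (auto simp: step_schemas_def schema_defs bounded_Cons shifted_less) (auto simp: B_def)
  show "S = reject \<Longrightarrow> schema_bounded B S"
    by (auto simp: schema_defs bounded_Cons B_def)
qed

end

sublocale cook \<subseteq> sch: schemas B all_schemas "[KA True, KB True]"
  by unfold_locales (simp_all add: pexp_PT bounded_all expr_all, simp add: B_def)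

lemma pair_length: "length (pair x z) = 2 * length x + 2 + length z"
  by (simp add: pair_def length_concat o_def sum_list_triv)

lemma pair_nth:
  "i < length (pair x z) \<Longrightarrow> pair x z ! i = (if i < 2 * length x then x ! (i div 2) else if i = 2 * length x then False
     else if i = 2 * length x + 1 then True else z ! (i - (2 * length x + 2)))"
proof (induction x arbitrary: i)
  case Nil
  then show ?case by (auto simp: pair_def nth_Cons split: nat.split)
next
  case (Cons a x)
  have p: "pair (a # x) z = a # a # pair x z" by (simp add: pair_def)
  consider "i = 0" | "i = 1" | j where "i = Suc (Suc j)" by (metis One_nat_def not0_implies_Suc)
  then show ?case
  proof cases
    case 3
    then have "j < length (pair x z)" using Cons.prems by (simp add: p)
    from Cons.IH[OF this] show ?thesis by (auto simp: p 3)
  qed (simp_all add: p)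
qed

context cook
begin

definition input :: "bool list \<Rightarrow> bool list \<Rightarrow> bool list \<Rightarrow> bool list" where
  "input x u v = pair x (pair u v)"

lemma input_nth:
  "r < 2 * length x \<Longrightarrow> input x u v ! r = x ! (r div 2)"
  "input x u v ! (2 * length x) = False"
  "input x u v ! (2 * length x + 1) = True"
  "r < 2 * length u \<Longrightarrow> input x u v ! (2 * length x + 2 + r) = u ! (r div 2)"
  "input x u v ! (2 * length x + 2 + 2 * length u) = False"
  "input x u v ! (2 * length x + 3 + 2 * length u) = True"
  "k < length v \<Longrightarrow> input x u v ! (2 * length x + 4 + 2 * length u + k) = v ! k"
proof -
  have tail: "input x u v ! (2 * length x + 2 + r) = pair u v ! r" if "r < length (pair u v)" for r
    using pair_nth[of "2 * length x + 2 + r" x "pair u v"] that by (simp add: input_def pair_length)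
  show "r < 2 * length x \<Longrightarrow> input x u v ! r = x ! (r div 2)" "input x u v ! (2 * length x) = False"
    "input x u v ! (2 * length x + 1) = True"
    using pair_nth[of _ x "pair u v"] by (simp_all add: input_def pair_length)
  show "r < 2 * length u \<Longrightarrow> input x u v ! (2 * length x + 2 + r) = u ! (r div 2)"
    "input x u v ! (2 * length x + 2 + 2 * length u) = False"
    using tail pair_nth[of _ u v] by (simp_all add: pair_length)
  show "input x u v ! (2 * length x + 3 + 2 * length u) = True"
  proof -
    have eq: "2 * length x + 3 + 2 * length u = 2 * length x + 2 + (2 * length u + 1)" by simp
    have "pair u v ! (2 * length u + 1) = True" using pair_nth[of "2 * length u + 1" u v] by (simp add: pair_length)
    moreover have "input x u v ! (2 * length x + 2 + (2 * length u + 1)) = pair u v ! (2 * length u + 1)"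
      by (rule tail) (simp add: pair_length)
    ultimately show ?thesis unfolding eq by (simp only:)
  qed
  show "k < length v \<Longrightarrow> input x u v ! (2 * length x + 4 + 2 * length u + k) = v ! k"
  proof -
    have eq: "2 * length x + 4 + 2 * length u + k = 2 * length x + 2 + (2 * length u + 2 + k)" by simp
    assume k: "k < length v"
    have "pair u v ! (2 * length u + 2 + k) = v ! k" using pair_nth[of "2 * length u + 2 + k" u v] k by (simp add: pair_length)
    moreover have "input x u v ! (2 * length x + 2 + (2 * length u + 2 + k)) = pair u v ! (2 * length u + 2 + k)"
      by (rule tail) (simp add: pair_length k)
    ultimately show ?thesis unfolding eq by (simp only:)
  qed
qed

definition cell :: "bool list \<Rightarrow> bool list \<Rightarrow> bool list \<Rightarrow> nat \<Rightarrow> nat" where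
  "cell x u v e = tape_of (input x u v) (int e - int (T x))"

lemma cell_regions:
  "e < T x \<Longrightarrow> cell x u v e = 0"
  "r < 2 * length x \<Longrightarrow> cell x u v (T x + r) = bsym (x ! (r div 2))"
  "cell x u v (T x + 2 * length x) = 1"
  "cell x u v (T x + 2 * length x + 1) = 2"
  "r < 2 * length u \<Longrightarrow> cell x u v (T x + 2 * length x + 2 + r) = bsym (u ! (r div 2))"
  "cell x u v (T x + 2 * length x + 2 + 2 * length u) = 1"
  "cell x u v (T x + 2 * length x + 3 + 2 * length u) = 2"
  "k < length v \<Longrightarrow> cell x u v (T x + 2 * length x + 4 + 2 * length u + k) = bsym (v ! k)"
  "T x + 2 * length x + 4 + 2 * length u + length v \<le> e \<Longrightarrow> cell x u v e = 0"
proof -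
  have len: "length (input x u v) = 2 * length x + 4 + 2 * length u + length v" by (simp add: input_def pair_length)
  have c: "cell x u v (T x + r) = bsym (input x u v ! r)" if "r < 2 * length x + 4 + 2 * length u + length v" for r
    using that by (simp add: cell_def tape_of_def len bsym_def)
  show "e < T x \<Longrightarrow> cell x u v e = 0" by (simp add: cell_def tape_of_def)
  show "T x + 2 * length x + 4 + 2 * length u + length v \<le> e \<Longrightarrow> cell x u v e = 0"
    by (simp add: cell_def tape_of_def len nat_diff_distrib)
  note n = input_nth
  show "r < 2 * length x \<Longrightarrow> cell x u v (T x + r) = bsym (x ! (r div 2))" using c[of r] n(1) by simp
  show "cell x u v (T x + 2 * length x) = 1" using c[of "2 * length x"] n(2) by (simp add: bsym_def)
  show "cell x u v (T x + 2 * length x + 1) = 2" using c[of "2 * length x + 1"] n(3) by (simp add: bsym_def)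
  show "r < 2 * length u \<Longrightarrow> cell x u v (T x + 2 * length x + 2 + r) = bsym (u ! (r div 2))"
    using c[of "2 * length x + 2 + r"] n(4)[of r] by (simp add: add.assoc)
  show "cell x u v (T x + 2 * length x + 2 + 2 * length u) = 1"
    using c[of "2 * length x + 2 + 2 * length u"] n(5) by (simp add: bsym_def add.assoc)
  show "cell x u v (T x + 2 * length x + 3 + 2 * length u) = 2"
    using c[of "2 * length x + 3 + 2 * length u"] n(6) by (simp add: bsym_def add.assoc)
  show "k < length v \<Longrightarrow> cell x u v (T x + 2 * length x + 4 + 2 * length u + k) = bsym (v ! k)"
    using c[of "2 * length x + 4 + 2 * length u + k"] n(7)[of k] by (simp add: add.assoc)
qed

lemma fixed_cell:
  assumes "fixed \<sigma> x (length u) (length v) e" "\<sigma> < 3"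
  shows "cell x u v e = \<sigma>"
proof -
  have x: "cell x u v e = bsym (bit_at x ((e - T x) div 2))" if "T x \<le> e" "e < T x + 2 * length x"
  proof -
    have "e - T x < 2 * length x" "T x + (e - T x) = e" using that by linarith+
    moreover from this have "(e - T x) div 2 < length x" by linarith
    ultimately show ?thesis using cell_regions(2)[of "e - T x" x u v] by (simp add: bit_at_def)
  qed
  consider "\<sigma> = 0" | "\<sigma> = 1" | "\<sigma> = 2" using assms(2) by linarith
  then show ?thesis
  proof cases
    case 1
    then show ?thesis using assms(1) cell_regions(1,9)[where e = e] unfolding fixed_def Let_def by auto
  next
    case 2
    then consider "T x \<le> e" "e < T x + 2 * length x" "\<not> bit_at x ((e - T x) div 2)" | "e = T x + 2 * length x"
      | "e = T x + 2 * length x + 2 + 2 * length u"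
      using assms(1) unfolding fixed_def Let_def by (auto split: if_splits)
    then show ?thesis
    proof cases
      case 1
      then show ?thesis using x 2 by (simp add: bsym_def)
    qed (simp_all only: cell_regions 2)
  next
    case 3
    then consider "T x \<le> e" "e < T x + 2 * length x" "bit_at x ((e - T x) div 2)" | "e = T x + 2 * length x + 1"
      | "e = T x + 2 * length x + 3 + 2 * length u"
      using assms(1) unfolding fixed_def Let_def by (auto split: if_splits)
    then show ?thesis
    proof cases
      case 1
      then show ?thesis using x 3 by (simp add: bsym_def)
    qed (simp_all only: cell_regions 3)
  qed
qed

lemma cell_cases:
  obtains (F) "cell x u v e < 3" "fixed (cell x u v e) x (length u) (length v) e"
    | (U) k where "k < length u" "e = T x + 2 * length x + 2 + 2 * k \<or> e = T x + 2 * length x + 3 + 2 * k" "cell x u v e = bsym (u ! k)"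
    | (V) k where "k < length v" "e = T x + 2 * length x + 4 + 2 * length u + k" "cell x u v e = bsym (v ! k)"
proof -
  let ?n = "length x" and ?c = "length u" and ?d = "length v"
  have "e < T x \<or> T x \<le> e \<and> e < T x + 2 * ?n \<or> e = T x + 2 * ?n \<or> e = T x + 2 * ?n + 1
      \<or> T x + 2 * ?n + 2 \<le> e \<and> e < T x + 2 * ?n + 2 + 2 * ?c \<or> e = T x + 2 * ?n + 2 + 2 * ?c \<or> e = T x + 2 * ?n + 3 + 2 * ?c
      \<or> T x + 2 * ?n + 4 + 2 * ?c \<le> e \<and> e < T x + 2 * ?n + 4 + 2 * ?c + ?d \<or> T x + 2 * ?n + 4 + 2 * ?c + ?d \<le> e"
    by linarith
  then consider "e < T x" | "T x \<le> e" "e < T x + 2 * ?n" | "e = T x + 2 * ?n" | "e = T x + 2 * ?n + 1"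
    | "T x + 2 * ?n + 2 \<le> e" "e < T x + 2 * ?n + 2 + 2 * ?c" | "e = T x + 2 * ?n + 2 + 2 * ?c" | "e = T x + 2 * ?n + 3 + 2 * ?c"
    | "T x + 2 * ?n + 4 + 2 * ?c \<le> e" "e < T x + 2 * ?n + 4 + 2 * ?c + ?d" | "T x + 2 * ?n + 4 + 2 * ?c + ?d \<le> e"
    by (elim disjE conjE)
  then show thesis
  proof cases
    case 1
    then show thesis using F cell_regions(1)[OF 1] by (simp add: fixed_def)
  next
    case 2
    define r where "r = e - T x"
    have r: "e = T x + r" "r < 2 * ?n" using 2 by (simp_all add: r_def)
    then have "r div 2 < ?n" by linarith
    then show thesis using F cell_regions(2)[OF r(2), of u v] r
      by (cases "x ! (r div 2)") (simp_all add: fixed_def Let_def bsym_def bit_at_def)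
  next
    case 3
    then show thesis using F cell_regions(3)[of x u v] by (simp add: fixed_def Let_def)
  next
    case 4
    then show thesis using F cell_regions(4)[of x u v] by (simp add: fixed_def Let_def)
  next
    case 5
    define r where "r = e - (T x + 2 * ?n + 2)"
    have r: "e = T x + 2 * ?n + 2 + r" "r < 2 * ?c" using 5 by (simp_all add: r_def)
    have "e = T x + 2 * ?n + 2 + 2 * (r div 2) \<or> e = T x + 2 * ?n + 3 + 2 * (r div 2)" using r by linarith
    moreover have "r div 2 < ?c" using r by linarith
    ultimately show thesis using U[of "r div 2"] cell_regions(5)[OF r(2), of x v] unfolding r(1)[symmetric] by blast
  next
    case 6
    then show thesis using F cell_regions(6)[of x u v] by (simp add: fixed_def Let_def)
  next
    case 7
    then show thesis using F cell_regions(7)[of x u v] by (simp add: fixed_def Let_def)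
  next
    case 8
    define k where "k = e - (T x + 2 * ?n + 4 + 2 * ?c)"
    have k: "e = T x + 2 * ?n + 4 + 2 * ?c + k" "k < ?d" using 8 by (simp_all add: k_def)
    then show thesis using V[of k] cell_regions(8)[OF k(2), of x u] by simp
  next
    case 9
    then show thesis using F cell_regions(9)[OF 9] by (simp add: fixed_def)
  qed
qed

definition holds :: "bool list \<Rightarrow> (kind \<Rightarrow> nat \<Rightarrow> nat \<Rightarrow> bool) \<Rightarrow> kind schema \<Rightarrow> bool" where
  "holds x tr = (\<lambda>(\<phi>, ls). \<forall>c<B x. \<forall>d<B x. \<forall>e<B x. \<phi> x c d e \<longrightarrow>
     (\<exists>l\<in>set ls. tr (fst (snd l)) (fst (snd (snd l)) x c d e) (snd (snd (snd l)) x c d e) = fst l))"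

lemma schema_sat_holds: "schema_sat B F x tr \<longleftrightarrow> (\<forall>S\<in>set F. holds x tr S)"
  unfolding schema_sat_def holds_def split_beta ..

lemma holds_iff:
  assumes "\<And>c d e. \<phi> x c d e \<Longrightarrow> c < B x \<and> d < B x \<and> e < B x"
  shows "holds x tr (\<phi>, ls) \<longleftrightarrow> (\<forall>c d e. \<phi> x c d e \<longrightarrow>
     (\<exists>l\<in>set ls. tr (fst (snd l)) (fst (snd (snd l)) x c d e) (snd (snd (snd l)) x c d e) = fst l))"
  unfolding holds_def prod.case using assms by blast

lemma holds_simps:
  "holds x tr init_state \<longleftrightarrow> tr (KQ 0) 0 0"
  "holds x tr (init_head \<tau>) \<longleftrightarrow> tr (KH \<tau>) 0 (T x)"
  "holds x tr (init_blank \<tau>) \<longleftrightarrow> (\<forall>e\<le>2 * T x. tr (KS \<tau> 0) 0 e)"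
  "holds x tr (init_fixed \<sigma>) \<longleftrightarrow> (\<forall>c d e. c \<le> P x \<and> d \<le> P x \<and> e \<le> 2 * T x \<and> fixed \<sigma> x c d e \<longrightarrow>
     tr (KL True) c 0 \<longrightarrow> tr (KL False) d 0 \<longrightarrow> tr (KS 0 \<sigma>) 0 e)"
  "holds x tr (init_outer b) \<longleftrightarrow> (\<forall>c d e. c \<le> P x \<and> d < c \<and> e \<le> 2 * T x \<and>
       (e = T x + 2 * length x + 2 + 2 * d \<or> e = T x + 2 * length x + 3 + 2 * d) \<longrightarrow>
     tr (KL True) c 0 \<longrightarrow> tr (KB True) d 0 = b \<longrightarrow> tr (KS 0 (bsym b)) 0 e)"
  "holds x tr (init_inner b) \<longleftrightarrow> (\<forall>c d e. c \<le> P x \<and> d \<le> P x \<and> e < d \<and> T x + 2 * length x + 4 + 2 * c + e \<le> 2 * T x \<longrightarrow>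
     tr (KL True) c 0 \<longrightarrow> tr (KL False) d 0 \<longrightarrow> tr (KB False) e 0 = b \<longrightarrow>
     tr (KS 0 (bsym b)) 0 (T x + 2 * length x + 4 + 2 * c + e))"
  "holds x tr (length_start z) \<longleftrightarrow> tr (KC z) 0 0"
  "holds x tr (length_next z) \<longleftrightarrow> (\<forall>c<P x. tr (KC z) c 0 \<longrightarrow> tr (KA z) c 0 \<longrightarrow> tr (KC z) (c + 1) 0)"
  "holds x tr (length_stop z) \<longleftrightarrow> (\<forall>c<P x. tr (KC z) c 0 \<longrightarrow> \<not> tr (KA z) c 0 \<longrightarrow> tr (KL z) c 0)"
  "holds x tr (length_max z) \<longleftrightarrow> (tr (KC z) (P x) 0 \<longrightarrow> tr (KL z) (P x) 0)"
  "holds x tr (read_sym \<tau> \<sigma>) \<longleftrightarrow> (\<forall>t d. t < T x \<and> d \<le> 2 * T x \<longrightarrow> tr (KH \<tau>) t d \<longrightarrow> tr (KS \<tau> \<sigma>) t d \<longrightarrow> tr (KR \<tau> \<sigma>) t 0)"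
  "holds x tr (keep_sym \<tau> \<sigma>) \<longleftrightarrow> (\<forall>t d e. t < T x \<and> d \<le> 2 * T x \<and> e \<le> 2 * T x \<and> d \<noteq> e \<longrightarrow>
     tr (KH \<tau>) t d \<longrightarrow> tr (KS \<tau> \<sigma>) t e \<longrightarrow> tr (KS \<tau> \<sigma>) (t + 1) e)"
  "holds x tr reject \<longleftrightarrow> \<not> tr (KS (nt - 1) 1) (T x) (T x)"
  unfolding init_state_def init_head_def init_blank_def init_fixed_def init_outer_def init_inner_def
    length_start_def length_next_def length_stop_def length_max_def read_sym_def keep_sym_def reject_def
  by (subst holds_iff; auto simp: B_def)+

lemma holds_step_simps:
  "holds x tr (new_state s rs) \<longleftrightarrow> (\<forall>t<T x. tr (KQ s) t 0 \<longrightarrow> (\<forall>\<tau><nt. tr (KR \<tau> (rs ! \<tau>)) t 0) \<longrightarrow>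
     tr (KQ (fst (step s rs))) (t + 1) 0)"
  "holds x tr (write_sym s rs \<tau>) \<longleftrightarrow> (\<forall>t d. t < T x \<and> d \<le> 2 * T x \<longrightarrow> tr (KQ s) t 0 \<longrightarrow> (\<forall>\<tau><nt. tr (KR \<tau> (rs ! \<tau>)) t 0) \<longrightarrow>
     tr (KH \<tau>) t d \<longrightarrow> tr (KS \<tau> (fst (snd (step s rs) ! \<tau>))) (t + 1) d)"
  "holds x tr (move_head s rs \<tau>) \<longleftrightarrow> (\<forall>t d. t < T x \<and> d \<le> 2 * T x \<longrightarrow> tr (KQ s) t 0 \<longrightarrow> (\<forall>\<tau><nt. tr (KR \<tau> (rs ! \<tau>)) t 0) \<longrightarrow>
     tr (KH \<tau>) t d \<longrightarrow> tr (KH \<tau>) (t + 1) (shifted (snd (snd (step s rs) ! \<tau>)) d))"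
proof -
  have all: "(\<exists>\<tau>\<in>{0..<nt}. \<not> X \<tau>) \<longleftrightarrow> \<not> (\<forall>\<tau><nt. X \<tau>)" for X by auto
  have lits: "(\<exists>l\<in>set (read_lits s rs @ ls). tr (fst (snd l)) (fst (snd (snd l)) x c d e) (snd (snd (snd l)) x c d e) = fst l) \<longleftrightarrow>
    (tr (KQ s) c 0 \<longrightarrow> (\<forall>\<tau><nt. tr (KR \<tau> (rs ! \<tau>)) c 0) \<longrightarrow>
      (\<exists>l\<in>set ls. tr (fst (snd l)) (fst (snd (snd l)) x c d e) (snd (snd (snd l)) x c d e) = fst l))" for ls c d e
    by (simp add: read_lits_def bex_Un all) blast
  show "holds x tr (new_state s rs) \<longleftrightarrow> (\<forall>t<T x. tr (KQ s) t 0 \<longrightarrow> (\<forall>\<tau><nt. tr (KR \<tau> (rs ! \<tau>)) t 0) \<longrightarrow>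
     tr (KQ (fst (step s rs))) (t + 1) 0)"
    unfolding new_state_def by (subst holds_iff, force simp: B_def, simp only: lits, simp)
  show "holds x tr (write_sym s rs \<tau>) \<longleftrightarrow> (\<forall>t d. t < T x \<and> d \<le> 2 * T x \<longrightarrow> tr (KQ s) t 0 \<longrightarrow> (\<forall>\<tau><nt. tr (KR \<tau> (rs ! \<tau>)) t 0) \<longrightarrow>
     tr (KH \<tau>) t d \<longrightarrow> tr (KS \<tau> (fst (snd (step s rs) ! \<tau>))) (t + 1) d)"
    unfolding write_sym_def by (subst holds_iff, force simp: B_def, simp only: lits, auto)
  show "holds x tr (move_head s rs \<tau>) \<longleftrightarrow> (\<forall>t d. t < T x \<and> d \<le> 2 * T x \<longrightarrow> tr (KQ s) t 0 \<longrightarrow> (\<forall>\<tau><nt. tr (KR \<tau> (rs ! \<tau>)) t 0) \<longrightarrow>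
     tr (KH \<tau>) t d \<longrightarrow> tr (KH \<tau>) (t + 1) (shifted (snd (snd (step s rs) ! \<tau>)) d))"
    unfolding move_head_def by (subst holds_iff, force simp: B_def, simp only: lits, auto)
qed

lemma sat_all:
  "schema_sat B all_schemas x tr \<longleftrightarrow> (\<forall>S\<in>set init_schemas. holds x tr S) \<and> (\<forall>S\<in>set length_schemas. holds x tr S) \<and>
    (\<forall>S\<in>set tape_schemas. holds x tr S) \<and> (\<forall>s\<le>num_states M. \<forall>rs. length rs = nt \<and> set rs \<subseteq> {..<num_syms M} \<longrightarrow>
      (\<forall>S\<in>set (step_schemas s rs). holds x tr S)) \<and> holds x tr reject"
proof -
  have "set (List.n_lists nt [0..<num_syms M]) = {rs. length rs = nt \<and> set rs \<subseteq> {..<num_syms M}}"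
    by (auto simp: set_n_lists)
  then show ?thesis unfolding schema_sat_holds all_schemas_def by (auto simp: less_Suc_eq_le simp del: upt_Suc)
qed

text \<open>Any values of the atoms \<open>KA z\<close> describe a length, that of their longest
  true initial segment up to \<open>P x\<close>. For the outer witness these atoms are universal, so
  clauses may not demand that they form a segment.\<close>

lemma length_chain:
  assumes h: "\<forall>S\<in>set length_schemas. holds x tr S"
  shows "tr (KL z) (LEAST l. l = P x \<or> \<not> tr (KA z) l 0) 0"
proof -
  let ?L = "LEAST l. l = P x \<or> \<not> tr (KA z) l 0"
  have "S \<in> set length_schemas" if "S \<in> {length_start z, length_next z, length_stop z, length_max z}" for S
    using that by (cases z) (auto simp: length_schemas_def)
  then have hz: "holds x tr (length_start z)" "holds x tr (length_next z)" "holds x tr (length_stop z)" "holds x tr (length_max z)"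
    using h by blast+
  have L: "?L = P x \<or> \<not> tr (KA z) ?L 0" by (rule LeastI[of _ "P x"]) simp
  have LP: "?L \<le> P x" by (rule Least_le) simp
  have "tr (KC z) l 0" if "l \<le> ?L" for l
    using that
  proof (induction l)
    case 0
    then show ?case using hz(1) by (simp add: holds_simps)
  next
    case (Suc l)
    then have l: "l < ?L" by simp
    then have "tr (KA z) l 0" using not_less_Least by blast
    moreover have "l < P x" using l LP by linarith
    moreover have "tr (KC z) l 0" using Suc l by simp
    ultimately show ?case using hz(2) by (simp add: holds_simps)
  qed
  then have C: "tr (KC z) ?L 0" by simp
  show ?thesis
  proof (cases "?L = P x")
    case True
    then show ?thesis using C hz(4) by (simp add: holds_simps)
  next
    case False
    then have "?L < P x" "\<not> tr (KA z) ?L 0" using LP L by linarith+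
    then show ?thesis using C hz(3) by (simp add: holds_simps)
  qed
qed

lemma input_time: "length u \<le> P x \<Longrightarrow> length v \<le> P x \<Longrightarrow> poly q (length (input x u v)) \<le> T x"
  unfolding T_def by (intro poly_nat_mono) (simp add: input_def pair_length)

lemma shifted_move: "1 \<le> d \<Longrightarrow> int (shifted m d) - k = move m (int d - k)"
  by (cases m) auto


lemma step_schemas_holds:
  "(\<forall>S\<in>set (step_schemas s rs). holds x tr S) \<longleftrightarrow> holds x tr (new_state s rs) \<and>
    (\<forall>\<tau><nt. holds x tr (write_sym s rs \<tau>)) \<and> (\<forall>\<tau><nt. holds x tr (move_head s rs \<tau>))"
  by (auto simp: step_schemas_def)

lemma tape_schemas_holds:
  "(\<forall>S\<in>set tape_schemas. holds x tr S) \<longleftrightarrow> (\<forall>\<tau><nt. \<forall>\<sigma><num_syms M. holds x tr (read_sym \<tau> \<sigma>) \<and> holds x tr (keep_sym \<tau> \<sigma>))"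
  by (auto simp: tape_schemas_def)

lemma init_schemas_holds:
  "(\<forall>S\<in>set init_schemas. holds x tr S) \<longleftrightarrow> holds x tr init_state \<and> (\<forall>\<tau><nt. holds x tr (init_head \<tau>)) \<and>
    (\<forall>\<tau>. 1 \<le> \<tau> \<and> \<tau> < nt \<longrightarrow> holds x tr (init_blank \<tau>)) \<and> (\<forall>\<sigma><3. holds x tr (init_fixed \<sigma>)) \<and>
    (\<forall>b. holds x tr (init_outer b)) \<and> (\<forall>b. holds x tr (init_inner b))"
  by (auto simp: init_schemas_def all_bool_eq simp del: upt_rec_numeral)

lemma length_schemas_holds:
  "(\<forall>S\<in>set length_schemas. holds x tr S) \<longleftrightarrow> (\<forall>z. holds x tr (length_start z) \<and> holds x tr (length_next z) \<and>
    holds x tr (length_stop z) \<and> holds x tr (length_max z))"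
  by (auto simp: length_schemas_def all_bool_eq)

lemma reads_nth: "\<tau> < nt \<Longrightarrow> reads y t ! \<tau> = tp y t \<tau> (hd y t \<tau>)"
  by (simp add: reads_def)

lemma tp_less: "\<tau> < nt \<Longrightarrow> tp y t \<tau> i < num_syms M"
  using conf_run by blast

text \<open>The inner witness is read off from the assignment, and induction over time shows that
  the assignment contains the run on the resulting input. There \<open>reject\<close> excludes a
  negative answer.\<close>

theorem sat_accepts:
  assumes sat: "schema_sat B all_schemas x tr"
    and u: "length u \<le> P x" and u_len: "\<And>k. k \<le> P x \<Longrightarrow> tr (KA True) k 0 \<longleftrightarrow> k < length u"
    and u_bits: "\<And>k. k < length u \<Longrightarrow> tr (KB True) k 0 \<longleftrightarrow> u ! k"
  shows "\<exists>v. length v \<le> P x \<and> input x u v \<in> R"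
proof -
  define l where "l = (LEAST l. l = P x \<or> \<not> tr (KA False) l 0)"
  define v where "v = map (\<lambda>k. tr (KB False) k 0) [0..<l]"
  have lv: "length v = l" by (simp add: v_def)
  have lP: "l \<le> P x" unfolding l_def by (rule Least_le) simp
  note sat = sat[unfolded sat_all]
  have KLv: "tr (KL False) (length v) 0" unfolding lv l_def by (rule length_chain) (use sat in blast)
  have "(LEAST l. l = P x \<or> \<not> tr (KA True) l 0) = length u"
  proof (rule Least_equality)
    show "length u = P x \<or> \<not> tr (KA True) (length u) 0" using u_len[OF u] by simp
    show "length u \<le> k" if "k = P x \<or> \<not> tr (KA True) k 0" for k
      using that u u_len[of k] by (cases "k \<le> P x") auto
  qed
  then have KLu: "tr (KL True) (length u) 0" using length_chain[of x tr True] sat by simp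
  define y where "y = input x u v"
  define pos where "pos h = nat (h + int (T x))" for h
  have pos: "int (pos (hd y t \<tau>)) - int (T x) = hd y t \<tau>" "pos (hd y t \<tau>) \<le> 2 * T x"
    if "t \<le> T x" "\<tau> < nt" for t \<tau>
    using head_bound[OF that(2), of y t] that(1) by (auto simp: pos_def)
  have init: "holds x tr init_state" "\<forall>\<tau><nt. holds x tr (init_head \<tau>)" "\<forall>\<tau>. 1 \<le> \<tau> \<and> \<tau> < nt \<longrightarrow> holds x tr (init_blank \<tau>)"
    "\<forall>\<sigma><3. holds x tr (init_fixed \<sigma>)" "\<forall>b. holds x tr (init_outer b)" "\<forall>b. holds x tr (init_inner b)"
    using sat unfolding init_schemas_holds by blast+
  have run: "tr (KQ (st y t)) t 0 \<and> (\<forall>\<tau><nt. tr (KH \<tau>) t (pos (hd y t \<tau>))) \<and>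
      (\<forall>\<tau><nt. \<forall>e\<le>2 * T x. tr (KS \<tau> (tp y t \<tau> (int e - int (T x)))) t e)" if "t \<le> T x" for t
    using that
  proof (induction t)
    case 0
    have "tr (KS 0 (cell x u v e)) 0 e" if e: "e \<le> 2 * T x" for e
    proof (cases x u v e rule: cell_cases)
      case F
      then show ?thesis using init(4) u lP lv KLu KLv e unfolding holds_simps by blast
    next
      case (U k)
      have "tr (KS 0 (bsym (tr (KB True) k 0))) 0 e"
        using init(5) U(1,2) u KLu e unfolding holds_simps by blast
      then show ?thesis using U(3) u_bits[OF U(1)] by simp
    next
      case (V k)
      have "tr (KS 0 (bsym (tr (KB False) k 0))) 0 (T x + 2 * length x + 4 + 2 * length u + k)"
        using init(6) V(1,2) u lP lv KLu KLv e unfolding holds_simps by blast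
      moreover have "v ! k = tr (KB False) k 0" using V(1) by (simp add: v_def)
      ultimately show ?thesis using V(2,3) by simp
    qed
    then have "tr (KS 0 (tp y 0 0 (int e - int (T x)))) 0 e" if "e \<le> 2 * T x" for e
      using that by (simp add: run_init cell_def y_def)
    moreover have "tr (KS \<tau> (tp y 0 \<tau> (int e - int (T x)))) 0 e" if "e \<le> 2 * T x" "\<tau> < nt" "\<tau> \<noteq> 0" for e \<tau>
    proof -
      have "1 \<le> \<tau>" using that by simp
      then show ?thesis using init(3) that by (simp add: run_init holds_simps)
    qed
    moreover have "tr (KH \<tau>) 0 (pos (hd y 0 \<tau>))" if "\<tau> < nt" for \<tau>
      using init(2) that by (simp add: run_init pos_def holds_simps)
    moreover have "tr (KQ (st y 0)) 0 0" using init(1) by (simp add: run_init holds_simps)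
    ultimately show ?case by metis
  next
    case (Suc t)
    then have t: "t < T x" and Q: "tr (KQ (st y t)) t 0" and H: "\<And>\<tau>. \<tau> < nt \<Longrightarrow> tr (KH \<tau>) t (pos (hd y t \<tau>))"
      and S: "\<And>\<tau> e. \<tau> < nt \<Longrightarrow> e \<le> 2 * T x \<Longrightarrow> tr (KS \<tau> (tp y t \<tau> (int e - int (T x)))) t e" by simp_all
    note pt = pos[of t, OF less_imp_le[OF t]]
    have tape: "holds x tr (read_sym \<tau> \<sigma>)" "holds x tr (keep_sym \<tau> \<sigma>)" if "\<tau> < nt" "\<sigma> < num_syms M" for \<tau> \<sigma>
      using sat that unfolding tape_schemas_holds by blast+
    have Rd: "tr (KR \<tau> (reads y t ! \<tau>)) t 0" if \<tau>: "\<tau> < nt" for \<tau>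
    proof -
      have "tr (KS \<tau> (tp y t \<tau> (hd y t \<tau>))) t (pos (hd y t \<tau>))" using S[OF \<tau> pt(2)[OF \<tau>]] unfolding pt(1)[OF \<tau>] .
      then show ?thesis using tape(1)[OF \<tau> tp_less[OF \<tau>, of y t "hd y t \<tau>"]] H[OF \<tau>] t pt(2)[OF \<tau>]
        unfolding holds_simps reads_nth[OF \<tau>] by blast
    qed
    have steps: "holds x tr (new_state (st y t) (reads y t))"
      "\<And>\<tau>. \<tau> < nt \<Longrightarrow> holds x tr (write_sym (st y t) (reads y t) \<tau>)"
      "\<And>\<tau>. \<tau> < nt \<Longrightarrow> holds x tr (move_head (st y t) (reads y t) \<tau>)"
    proof -
      have "\<forall>S\<in>set (step_schemas (st y t) (reads y t)). holds x tr S"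
      proof -
        have "length (reads y t) = nt \<and> set (reads y t) \<subseteq> {..<num_syms M}" using reads_wf[of y t] by auto
        moreover have "st y t \<le> num_states M" using conf_run[of y t] by blast
        ultimately show ?thesis using sat by blast
      qed
      then show "holds x tr (new_state (st y t) (reads y t))"
        "\<And>\<tau>. \<tau> < nt \<Longrightarrow> holds x tr (write_sym (st y t) (reads y t) \<tau>)"
        "\<And>\<tau>. \<tau> < nt \<Longrightarrow> holds x tr (move_head (st y t) (reads y t) \<tau>)"
        unfolding step_schemas_holds by blast+
    qed
    have "tr (KQ (st y (Suc t))) (Suc t) 0"
      using steps(1) t Q Rd by (simp add: holds_step_simps run_step(1))
    moreover have "tr (KH \<tau>) (Suc t) (pos (hd y (Suc t) \<tau>))" if \<tau>: "\<tau> < nt" for \<tau>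
    proof -
      let ?m = "snd (snd (step (st y t) (reads y t)) ! \<tau>)" and ?d = "pos (hd y t \<tau>)"
      have "tr (KH \<tau>) (t + 1) (shifted ?m ?d)"
        using steps(3)[OF \<tau>] t Q Rd H[OF \<tau>] pt(2)[OF \<tau>] by (simp add: holds_step_simps)
      \<comment> \<open>A head starts at position \<open>T x\<close> and has moved fewer than
        \<open>T x\<close> times, so the subtraction in \<open>shifted\<close> is not cut off at
        zero.\<close>
      moreover have "1 \<le> ?d" using head_bound[OF \<tau>, of y t] t by (simp add: pos_def)
      then have "int (shifted ?m ?d) - int (T x) = hd y (Suc t) \<tau>"
        unfolding run_step(2)[OF \<tau>] using pt(1)[OF \<tau>] by (simp add: shifted_move)
      then have "shifted ?m ?d = pos (hd y (Suc t) \<tau>)" by (simp add: pos_def)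
      ultimately show ?thesis by simp
    qed
    moreover have "tr (KS \<tau> (tp y (Suc t) \<tau> (int e - int (T x)))) (Suc t) e" if \<tau>: "\<tau> < nt" and e: "e \<le> 2 * T x" for \<tau> e
    proof (cases "e = pos (hd y t \<tau>)")
      case True
      have "tr (KS \<tau> (fst (snd (step (st y t) (reads y t)) ! \<tau>))) (t + 1) e"
        using steps(2)[OF \<tau>] t Q Rd H[OF \<tau>] pt(2)[OF \<tau>] True by (simp add: holds_step_simps)
      then show ?thesis using True pt(1)[OF \<tau>] by (simp add: run_step(3)[OF \<tau>])
    next
      case False
      have "int e - int (T x) \<noteq> hd y t \<tau>" using False pt(1)[OF \<tau>] by auto
      moreover have "tr (KS \<tau> (tp y t \<tau> (int e - int (T x)))) (t + 1) e"
        using tape(2)[OF \<tau> tp_less[OF \<tau>, of y t "int e - int (T x)"]] H[OF \<tau>] S[OF \<tau> e] t pt(2)[OF \<tau>] e False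
        unfolding holds_simps by blast
      ultimately show ?thesis by (simp add: run_step(3)[OF \<tau>])
    qed
    ultimately show ?case by blast
  qed
  have "tp y (T x) (nt - 1) 0 = (if y \<in> R then 2 else 1)"
    by (rule run_final) (use input_time u lP lv in \<open>simp add: y_def\<close>)
  moreover have "tr (KS (nt - 1) (tp y (T x) (nt - 1) 0)) (T x) (T x)"
  proof -
    have "nt - 1 < nt" using nt_pos by simp
    then have "\<forall>e\<le>2 * T x. tr (KS (nt - 1) (tp y (T x) (nt - 1) (int e - int (T x)))) (T x) e" using run[of "T x"] by blast
    from this[rule_format, of "T x"] show ?thesis by simp
  qed
  moreover have "\<not> tr (KS (nt - 1) 1) (T x) (T x)" using sat by (simp add: holds_simps)
  ultimately have "y \<in> R" by (metis (full_types))
  then show ?thesis using lv lP y_def by auto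
qed


text \<open>The universal atoms keep their prescribed values, and the outer witness is the word that
  they decode to. All other atoms are interpreted truthfully by this word, the inner witness and the
  run.\<close>

lemma accepts_sat:
  assumes u: "u = map (\<lambda>k. \<alpha> (KB True) k 0) [0..<(LEAST l. l = P x \<or> \<not> \<alpha> (KA True) l 0)]"
    and v: "length v \<le> P x" "input x u v \<in> R"
  shows "\<exists>tr. (\<forall>\<kappa>\<in>set [KA True, KB True]. \<forall>a<B x. \<forall>b<B x. tr \<kappa> a b = \<alpha> \<kappa> a b) \<and> schema_sat B all_schemas x tr"
proof -
  define y where "y = input x u v"
  define A where "A z k = (if z then \<alpha> (KA True) k 0 else k < length v)" for z k
  define tr where "tr \<kappa> a b = (case \<kappa> of
      KS \<tau> \<sigma> \<Rightarrow> tp y a \<tau> (int b - int (T x)) = \<sigma> | KH \<tau> \<Rightarrow> int b - int (T x) = hd y a \<tau> | KQ s \<Rightarrow> st y a = s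
    | KR \<tau> \<sigma> \<Rightarrow> tp y a \<tau> (hd y a \<tau>) = \<sigma> | KA z \<Rightarrow> if z then \<alpha> (KA True) a b else a < length v
    | KB z \<Rightarrow> if z then \<alpha> (KB True) a b else a < length v \<and> v ! a
    | KL z \<Rightarrow> a = (if z then length u else length v) | KC z \<Rightarrow> (\<forall>k<a. A z k))" for \<kappa> a b
  have tr: "tr (KS \<tau> \<sigma>) a b \<longleftrightarrow> tp y a \<tau> (int b - int (T x)) = \<sigma>" "tr (KH \<tau>) a b \<longleftrightarrow> int b - int (T x) = hd y a \<tau>"
    "tr (KQ s) a b \<longleftrightarrow> st y a = s" "tr (KR \<tau> \<sigma>) a b \<longleftrightarrow> tp y a \<tau> (hd y a \<tau>) = \<sigma>" "tr (KA z) a 0 \<longleftrightarrow> A z a"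
    "tr (KB True) a b \<longleftrightarrow> \<alpha> (KB True) a b" "tr (KB False) a b \<longleftrightarrow> a < length v \<and> v ! a"
    "tr (KL True) a b \<longleftrightarrow> a = length u" "tr (KL False) a b \<longleftrightarrow> a = length v" "tr (KC z) a b \<longleftrightarrow> (\<forall>k<a. A z k)" for a b \<tau> \<sigma> s z
    by (simp_all add: tr_def A_def)
  have lu: "length u = (LEAST l. l = P x \<or> \<not> A True l)" by (simp add: u A_def)
  have lv: "length v = (LEAST l. l = P x \<or> \<not> A False l)"
    by (rule Least_equality[symmetric]) (use v in \<open>auto simp: A_def\<close>)
  have KL: "tr (KL z) a b \<longleftrightarrow> a = (LEAST l. l = P x \<or> \<not> A z l)" for z a b
    using lu lv by (cases z) (simp_all add: tr)
  have uP: "length u \<le> P x" unfolding lu by (rule Least_le) simp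
  have acc: "tp y (T x) (nt - 1) 0 = 2"
    using run_final[of y "T x"] input_time[OF uP v(1)] v(2) by (simp add: y_def)
  have init: "\<forall>S\<in>set init_schemas. holds x tr S"
    unfolding init_schemas_holds
  proof (intro conjI allI impI)
    show "holds x tr init_state" by (simp add: holds_simps tr run_init)
    show "holds x tr (init_head \<tau>)" if "\<tau> < nt" for \<tau> using that by (simp add: holds_simps tr run_init)
    show "holds x tr (init_blank \<tau>)" if "1 \<le> \<tau> \<and> \<tau> < nt" for \<tau> using that by (simp add: holds_simps tr run_init)
    show "holds x tr (init_fixed \<sigma>)" if "\<sigma> < 3" for \<sigma>
      unfolding holds_simps tr run_init y_def cell_def[symmetric] using fixed_cell[OF _ that] by blast
    show "holds x tr (init_outer b)" for b
      unfolding holds_simps tr run_init y_def cell_def[symmetric]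
    proof (intro allI impI)
      fix c d e assume *: "c \<le> P x \<and> d < c \<and> e \<le> 2 * T x \<and>
        (e = T x + 2 * length x + 2 + 2 * d \<or> e = T x + 2 * length x + 3 + 2 * d)" "c = length u" "\<alpha> (KB True) d 0 = b"
      then have d: "d < length u" by simp
      then have "u ! d = b" using *(3) by (subst u) (simp add: u)
      then show "cell x u v e = bsym b"
        using * d cell_regions(5)[of "2 * d" u x v] cell_regions(5)[of "2 * d + 1" u x v]
        by (auto simp: numeral_3_eq_3 add.assoc)
    qed
    show "holds x tr (init_inner b)" for b
      unfolding holds_simps tr run_init y_def cell_def[symmetric] using cell_regions(8) by fastforce
  qed
  have length: "\<forall>S\<in>set length_schemas. holds x tr S"
    unfolding length_schemas_holds
  proof (intro allI conjI)
    fix z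
    show "holds x tr (length_start z)" by (simp add: holds_simps tr)
    show "holds x tr (length_next z)" by (auto simp: holds_simps tr less_Suc_eq)
    show "holds x tr (length_stop z)"
      unfolding holds_simps KL tr
    proof (intro allI impI)
      fix c assume "c < P x" "\<forall>k<c. A z k" "\<not> A z c"
      then show "c = (LEAST l. l = P x \<or> \<not> A z l)"
        by (intro Least_equality[symmetric]) (auto simp: not_less[symmetric])
    qed
    show "holds x tr (length_max z)"
      unfolding holds_simps KL tr by (auto intro!: Least_equality[symmetric] simp: not_less[symmetric])
  qed
  have tape: "\<forall>S\<in>set tape_schemas. holds x tr S"
    unfolding tape_schemas_holds holds_simps tr by (auto simp: run_step(3))
  have step: "\<forall>S\<in>set (step_schemas s rs). holds x tr S" if "length rs = nt" for s rs
  proof -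
    have rs: "rs = reads y t" if "\<forall>\<tau><nt. tp y t \<tau> (hd y t \<tau>) = rs ! \<tau>" for t
      using that \<open>length rs = nt\<close> reads_wf(1)[of y t] by (intro nth_equalityI) (auto simp: reads_nth)
    have "holds x tr (new_state s rs)"
      unfolding holds_step_simps tr by (auto dest!: rs simp: run_step(1))
    moreover have "holds x tr (write_sym s rs \<tau>)" if "\<tau> < nt" for \<tau>
      unfolding holds_step_simps tr using that by (auto dest!: rs simp: run_step(3))
    moreover have "holds x tr (move_head s rs \<tau>)" if \<tau>: "\<tau> < nt" for \<tau>
      unfolding holds_step_simps tr
    proof (intro allI impI)
      fix t d assume *: "t < T x \<and> d \<le> 2 * T x" "st y t = s" "\<forall>\<tau><nt. tp y t \<tau> (hd y t \<tau>) = rs ! \<tau>"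
        "int d - int (T x) = hd y t \<tau>"
      have "1 \<le> d" using head_bound[OF \<tau>, of y t] * by linarith
      then show "int (shifted (snd (snd (step s rs) ! \<tau>)) d) - int (T x) = hd y (t + 1) \<tau>"
        using * rs[OF *(3)] by (simp add: shifted_move run_step(2)[OF \<tau>])
    qed
    ultimately show ?thesis unfolding step_schemas_holds by blast
  qed
  have "holds x tr reject" using acc by (simp add: holds_simps tr)
  then have "schema_sat B all_schemas x tr" unfolding sat_all using init length tape step by blast
  moreover have "tr \<kappa> a b = \<alpha> \<kappa> a b" if "\<kappa> \<in> set [KA True, KB True]" for \<kappa> a b
    using that by (auto simp: tr_def)
  ultimately show ?thesis by blast
qed

theorem valid_accepts:
  "sch.valid x \<longleftrightarrow> (\<forall>u. length u \<le> P x \<longrightarrow> (\<exists>v. length v \<le> P x \<and> pair x (pair u v) \<in> R))"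
proof
  assume valid: "sch.valid x"
  show "\<forall>u. length u \<le> P x \<longrightarrow> (\<exists>v. length v \<le> P x \<and> pair x (pair u v) \<in> R)"
  proof (intro allI impI)
    fix u :: "bool list" assume u: "length u \<le> P x"
    define \<alpha> :: "kind \<Rightarrow> nat \<Rightarrow> nat \<Rightarrow> bool" where
      "\<alpha> \<kappa> a b = (if \<kappa> = KA True then a < length u else a < length u \<and> u ! a)" for \<kappa> a b
    obtain tr where tr: "\<forall>\<kappa>\<in>set [KA True, KB True]. \<forall>a<B x. \<forall>b<B x. tr \<kappa> a b = \<alpha> \<kappa> a b" "schema_sat B all_schemas x tr"
      using valid unfolding sch.valid_def by blast
    have PB: "k < B x" if "k \<le> P x" for k using that by (simp add: B_def)
    show "\<exists>v. length v \<le> P x \<and> pair x (pair u v) \<in> R"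
      unfolding input_def[symmetric]
    proof (rule sat_accepts[OF tr(2) u])
      show "tr (KA True) k 0 \<longleftrightarrow> k < length u" if "k \<le> P x" for k
        using tr(1) PB[OF that] PB[of 0] by (simp add: \<alpha>_def)
      show "tr (KB True) k 0 \<longleftrightarrow> u ! k" if "k < length u" for k
        using tr(1) PB[of k] PB[of 0] that u by (simp add: \<alpha>_def)
    qed
  qed
next
  assume R: "\<forall>u. length u \<le> P x \<longrightarrow> (\<exists>v. length v \<le> P x \<and> pair x (pair u v) \<in> R)"
  show "sch.valid x" unfolding sch.valid_def
  proof
    fix \<alpha> :: "kind \<Rightarrow> nat \<Rightarrow> nat \<Rightarrow> bool"
    define u where "u = map (\<lambda>k. \<alpha> (KB True) k 0) [0..<(LEAST l. l = P x \<or> \<not> \<alpha> (KA True) l 0)]"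
    have "length u \<le> P x" unfolding u_def by (simp add: Least_le)
    then obtain v where "length v \<le> P x" "input x u v \<in> R" using R unfolding input_def by blast
    then show "\<exists>tr. (\<forall>\<kappa>\<in>set [KA True, KB True]. \<forall>a<B x. \<forall>b<B x. tr \<kappa> a b = \<alpha> \<kappa> a b) \<and> schema_sat B all_schemas x tr"
      by (intro accepts_sat[of u \<alpha> x v] u_def)
  qed
qed

end

theorem Pi2p_reduction:
  assumes "A \<in> Pi2p"
  shows "\<exists>f. polytime f \<and> (\<forall>x. f x \<in> graph_lang (\<lambda>G. colorable 3 G \<and> odd_hole_free G \<and> planar G \<and> max_degree G = 6)
     \<and> (x \<in> A \<longleftrightarrow> f x \<in> CH 3 4))"
proof -
  obtain R p where R: "R \<in> class_P" and A: "\<And>x. x \<in> A \<longleftrightarrow> (\<forall>u. length u \<le> poly p (length x) \<longrightarrow>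
        (\<exists>v. length v \<le> poly p (length x) \<and> pair x (pair u v) \<in> R))" using assms unfolding Pi2p_def by blast
  obtain M q where "wf_tm M" "\<And>y. computes_within M y [y \<in> R] (poly q (length y))"
    using R unfolding class_P_def polytime_def by blast
  then interpret cook M p q R by unfold_locales
  show ?thesis using sch.reduction unfolding valid_accepts A P_def .
qed

section \<open>A polynomial-time checker for list colourings\<close>

section \<open>Membership\<close>

text \<open>\<open>pair\<close> doubles the bits of its first component, so the first pair of
  unequal bits marks its end.\<close>

definition marks_end :: "(nat \<Rightarrow> bool) \<Rightarrow> nat \<Rightarrow> bool" where
  "marks_end f a \<longleftrightarrow> (\<forall>k<a. f (2 * k) = f (2 * k + 1)) \<and> \<not> f (2 * a) \<and> f (2 * a + 1)"

lemma bit_at_pair: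
  "k < length x \<Longrightarrow> bit_at (pair x z) (2 * k) = x ! k" "k < length x \<Longrightarrow> bit_at (pair x z) (2 * k + 1) = x ! k"
  "bit_at (pair x z) (2 * length x) = False" "bit_at (pair x z) (2 * length x + 1) = True"
  "bit_at (pair x z) (2 * length x + 2 + r) = bit_at z r"
  using pair_nth[of _ x z] by (auto simp: bit_at_def pair_length)

lemma marks_end_pair: "marks_end (bit_at (pair x z)) a \<longleftrightarrow> a = length x"
proof
  assume m: "marks_end (bit_at (pair x z)) a"
  show "a = length x"
  proof (rule linorder_cases[of a "length x"])
    assume "a < length x"
    then show ?thesis using m bit_at_pair(1,2)[of a x z] by (simp add: marks_end_def)
  next
    assume "a > length x"
    then have "bit_at (pair x z) (2 * length x) = bit_at (pair x z) (2 * length x + 1)" using m unfolding marks_end_def by blast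
    then show ?thesis unfolding bit_at_pair by simp
  qed
qed (use bit_at_pair in \<open>simp add: marks_end_def\<close>)

text \<open>Every two bits are a colour, and bits beyond the end count as zeros. So every word,
  however short, describes a legal list of missing colours.\<close>

definition code :: "(nat \<Rightarrow> bool) \<Rightarrow> nat \<Rightarrow> nat" where
  "code f i = 1 + 2 * of_bool (f (2 * i)) + of_bool (f (2 * i + 1))"

lemma code_range: "code f i \<in> {1..4}"
  by (simp add: code_def)

lemma code_decode: "c i \<in> {1..4} \<Longrightarrow> code (\<lambda>t. if even t then c (t div 2) \<ge> 3 else even (c (t div 2))) i = (c i :: nat)"
proof -
  assume "c i \<in> {1..4}"
  then have "c i = 1 \<or> c i = 2 \<or> c i = 3 \<or> c i = 4" by auto
  then show ?thesis by (auto simp: code_def)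
qed

lemma code_cong: "f (2 * i) = g (2 * i) \<Longrightarrow> f (2 * i + 1) = g (2 * i + 1) \<Longrightarrow> code f i = code g i"
  by (simp add: code_def)

definition colours_ok :: "(nat \<Rightarrow> bool) \<Rightarrow> nat \<Rightarrow> (nat \<Rightarrow> bool) \<Rightarrow> (nat \<Rightarrow> bool) \<Rightarrow> bool" where
  "colours_ok adj n f g \<longleftrightarrow> (\<forall>i<n. code g i \<noteq> code f i) \<and> (\<forall>i<n. \<forall>j<n. adj (i * n + j) \<longrightarrow> code g i \<noteq> code g j)"

text \<open>The first witness is the list of the missing colours, the second is a colouring.\<close>

definition checker :: "bool list set" where
  "checker = {w. \<exists>a\<le>length w. marks_end (\<lambda>r. bit_at w r) a \<and> (\<exists>b\<le>length w. marks_end (\<lambda>r. bit_at w (2 * a + 2 + r)) b \<and>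
     (\<exists>n\<le>length w. n * n = a \<and> colours_ok (\<lambda>t. bit_at w (2 * t)) n
       (\<lambda>t. t < b \<and> bit_at w (2 * a + 2 + 2 * t)) (\<lambda>t. bit_at w (2 * a + 2 + (2 * b + 2 + t)))))}"

lemma checker_P: "checker \<in> class_P"
  unfolding checker_def mem_Collect_eq marks_end_def colours_ok_def code_def
  by (intro class_PI) (unfold mem_Collect_eq, intro pexp_intros ppredD)

text \<open>The bits of the outer witness are found at even offsets of a doubled block, and the
  guard \<open>t < b\<close> cuts them off at its end as \<open>bit_at\<close> does. The inner
  witness extends to the end of the word, where \<open>bit_at\<close> is false by itself.\<close>

lemma checker_pair:
  assumes "length x = n * n"
  shows "pair x (pair u v) \<in> checker \<longleftrightarrow> colours_ok (bit_at x) n (bit_at u) (bit_at v)"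
proof -
  let ?w = "pair x (pair u v)"
  have len: "length x \<le> length ?w" "length u \<le> length ?w" "n \<le> length ?w"
  proof -
    show "length x \<le> length ?w" "length u \<le> length ?w" by (simp_all add: pair_length)
    have "n \<le> n * n" by simp
    then show "n \<le> length ?w" unfolding pair_length assms by linarith
  qed
  have bu: "(\<lambda>t. t < length u \<and> bit_at ?w (2 * length x + 2 + 2 * t)) = bit_at u"
  proof
    fix t
    have "bit_at ?w (2 * length x + 2 + 2 * t) = bit_at (pair u v) (2 * t)" by (rule bit_at_pair(5))
    then show "(t < length u \<and> bit_at ?w (2 * length x + 2 + 2 * t)) = bit_at u t"
      using bit_at_pair(1)[of t u v] by (auto simp: bit_at_def[of u])
  qed
  have bv: "(\<lambda>t. bit_at ?w (2 * length x + 2 + (2 * length u + 2 + t))) = bit_at v"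
    unfolding bit_at_pair(5) ..
  have bx: "colours_ok (\<lambda>t. bit_at ?w (2 * t)) n f g \<longleftrightarrow> colours_ok (bit_at x) n f g" for f g
  proof -
    have "bit_at ?w (2 * (i * n + j)) = bit_at x (i * n + j)" if "i < n" "j < n" for i j
    proof -
      have "i * n + j < n * n" using that mult_le_mono1[of "Suc i" n n] by simp
      then show ?thesis using bit_at_pair(1)[of "i * n + j" x "pair u v"] assms by (simp add: bit_at_def[of x])
    qed
    then show ?thesis unfolding colours_ok_def by blast
  qed
  have m1: "marks_end (\<lambda>r. bit_at ?w r) a \<longleftrightarrow> a = length x" for a by (rule marks_end_pair)
  have m2: "marks_end (\<lambda>r. bit_at ?w (2 * length x + 2 + r)) b \<longleftrightarrow> b = length u" for b
    unfolding bit_at_pair(5) by (rule marks_end_pair)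
  have sq: "k * k = n * n \<longleftrightarrow> k = n" for k :: nat by (metis power2_eq_square power2_eq_iff_nonneg zero_le)
  have "?w \<in> checker \<longleftrightarrow> (\<exists>b\<le>length ?w. marks_end (\<lambda>r. bit_at ?w (2 * length x + 2 + r)) b \<and>
     (\<exists>k\<le>length ?w. k * k = length x \<and> colours_ok (\<lambda>t. bit_at ?w (2 * t)) k
       (\<lambda>t. t < b \<and> bit_at ?w (2 * length x + 2 + 2 * t)) (\<lambda>t. bit_at ?w (2 * length x + 2 + (2 * b + 2 + t)))))"
    unfolding checker_def mem_Collect_eq m1 using len(1) by blast
  also have "\<dots> \<longleftrightarrow> (\<exists>k\<le>length ?w. k * k = length x \<and> colours_ok (\<lambda>t. bit_at ?w (2 * t)) k (bit_at u) (bit_at v))"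
    unfolding m2 using len(2) bu bv by auto
  also have "\<dots> \<longleftrightarrow> colours_ok (bit_at x) n (bit_at u) (bit_at v)"
    unfolding assms sq using len(3) bx by blast
  finally show ?thesis .
qed

definition choosable_inputs :: "bool list set" where
  "choosable_inputs = {x. \<forall>u. length u \<le> 2 * length x \<longrightarrow> (\<exists>v. length v \<le> 2 * length x \<and> pair x (pair u v) \<in> checker)}"

lemma choosable_inputs_Pi2p: "choosable_inputs \<in> Pi2p"
  unfolding Pi2p_def choosable_inputs_def
  by (intro CollectI bexI[OF _ checker_P] exI[of _ "[:0, 2:]"]) (simp add: mult.commute)

lemma choosable_inputs_encode:
  assumes G: "G \<in> input_graphs"
  shows "encode G \<in> choosable_inputs \<longleftrightarrow> choosable 3 4 G"
proof -
  obtain n where n: "verts G = {..<n}" using G by (auto simp: input_graphs_def)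
  let ?x = "encode G"
  have len: "length ?x = n * n" using encode_length[of G] n by simp
  have adj: "bit_at ?x (i * n + j) \<longleftrightarrow> {i, j} \<in> edges G" if "i < n" "j < n" for i j
  proof -
    have "i * n + j < n * n" using that mult_le_mono1[of "Suc i" n n] by simp
    then show ?thesis using that unfolding bit_at_def len by (simp add: encode_map[OF n])
  qed
  have ok: "colours_ok (bit_at ?x) n f g \<longleftrightarrow> (\<forall>i<n. code g i \<noteq> code f i) \<and> proper_coloring G (code g)" for f g
    unfolding colours_ok_def proper_coloring_def n using adj by auto
  have mem: "?x \<in> choosable_inputs \<longleftrightarrow> (\<forall>u. length u \<le> 2 * (n * n) \<longrightarrow> (\<exists>v. length v \<le> 2 * (n * n) \<and>
      (\<forall>i<n. code (bit_at v) i \<noteq> code (bit_at u) i) \<and> proper_coloring G (code (bit_at v))))"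
    unfolding choosable_inputs_def mem_Collect_eq checker_pair[OF len] ok len ..
  define word where "word c = map (\<lambda>t. if even t then c (t div 2) \<ge> 3 else even (c (t div 2))) [0..<2 * n]" for c :: "nat \<Rightarrow> nat"
  have word: "code (bit_at (word c)) i = c i" if "i < n" "c i \<in> {1..4}" for c i
  proof -
    have "code (bit_at (word c)) i = code (\<lambda>t. if even t then c (t div 2) \<ge> 3 else even (c (t div 2))) i"
      using that(1) by (intro code_cong) (simp_all add: bit_at_def word_def)
    then show ?thesis using code_decode[of c i] that(2) by (simp only:)
  qed
  \<comment> \<open>Two bits per vertex fit into twice the input length because
    \<open>n \<le> n * n\<close>.\<close>
  have word_len: "length (word c) \<le> 2 * (n * n)" for c by (simp add: word_def)
  show ?thesis
  proof
    assume x: "?x \<in> choosable_inputs"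
    show "choosable 3 4 G" unfolding choosable_def
    proof (intro allI impI)
      fix L :: "nat \<Rightarrow> nat set" assume L: "\<forall>v\<in>verts G. L v \<subseteq> {1..4} \<and> card (L v) = 3"
      have "\<exists>a. a \<in> {1..4} \<and> L i = {1..4} - {a}" if "i < n" for i
      proof -
        have Li: "L i \<subseteq> {1..4}" "card (L i) = 3" using L that n by auto
        then have "card ({1..4} - L i) = 1" by (simp add: card_Diff_subset finite_subset[OF Li(1)])
        then obtain a where "{1..4} - L i = {a}" by (auto simp: card_1_singleton_iff)
        then show ?thesis using Li(1) by (intro exI[of _ a]) blast
      qed
      then obtain mis where mis: "\<And>i. i < n \<Longrightarrow> mis i \<in> {1..4} \<and> L i = {1..4} - {mis i}" by metis
      obtain v where v: "\<forall>i<n. code (bit_at v) i \<noteq> code (bit_at (word mis)) i" "proper_coloring G (code (bit_at v))"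
        using x[unfolded mem] word_len by blast
      have "code (bit_at v) i \<in> L i" if "i < n" for i
      proof -
        have "code (bit_at (word mis)) i = mis i" using word mis that by blast
        then have "code (bit_at v) i \<noteq> mis i" using v(1) that by metis
        then show ?thesis using mis[OF that] code_range[of "bit_at v" i] by blast
      qed
      then show "\<exists>c. (\<forall>v\<in>verts G. c v \<in> L v) \<and> proper_coloring G c" using v(2) n by auto
    qed
  next
    assume c: "choosable 3 4 G"
    show "?x \<in> choosable_inputs" unfolding mem
    proof (intro allI impI)
      fix u :: "bool list"
      define L where "L i = {1..4} - {code (bit_at u) i}" for i
      have "L i \<subseteq> {1..4} \<and> card (L i) = 3" for i
        using code_range[of "bit_at u" i] by (auto simp: L_def)
      then obtain c where c: "\<forall>v\<in>verts G. c v \<in> L v" "proper_coloring G c" using c unfolding choosable_def by blast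
      have ci: "c i \<in> {1..4} \<and> c i \<noteq> code (bit_at u) i" if "i < n" for i using c(1) that n by (auto simp: L_def)
      then have w: "code (bit_at (word c)) i = c i" if "i < n" for i using word that by blast
      have "\<forall>i<n. code (bit_at (word c)) i \<noteq> code (bit_at u) i" using ci w by simp
      moreover have "proper_coloring G (code (bit_at (word c)))" using c(2) w n by (simp add: proper_coloring_def)
      ultimately show "\<exists>v. length v \<le> 2 * (n * n) \<and> (\<forall>i<n. code (bit_at v) i \<noteq> code (bit_at u) i) \<and> proper_coloring G (code (bit_at v))"
        using word_len by blast
    qed
  qed
qed

theorem theorem4p4:
  "Pi2p_complete_in
     (graph_lang (\<lambda>G. colorable 3 G \<and> odd_hole_free G \<and> planar G \<and> max_degree G = 6))
     (CH 3 4)"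
proof -
  let ?C = "graph_lang (\<lambda>G. colorable 3 G \<and> odd_hole_free G \<and> planar G \<and> max_degree G = 6)"
  have "encode G \<in> CH 3 4 \<longleftrightarrow> choosable 3 4 G" if "G \<in> input_graphs" for G
    unfolding CH_def graph_lang_def using that inj_onD[OF encode_inj] by blast
  then have "x \<in> choosable_inputs \<longleftrightarrow> x \<in> CH 3 4" if "x \<in> ?C" for x
    using that choosable_inputs_encode unfolding graph_lang_def by blast
  then have "choosable_inputs \<inter> ?C = CH 3 4 \<inter> ?C" by blast
  then show ?thesis
    unfolding Pi2p_complete_in_def using choosable_inputs_Pi2p Pi2p_reduction by blast
qed

end
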